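(* Let $q\in W_1^p[0,1]$ be complex valued for some integer $p\ge1$, with $\int_0^1q(x)\,dx=0$, and suppose that $q^{(s)}(0)\ne q^{(s)}(1)$ for some integer $0\le s\le p-1$. Then a normal system of eigen- and associated functions of the operator $L_0$ forms a Riesz basis in $L_2[0,1]$.
   Context: $W_1^p[0,1]$ is the Sobolev space of functions whose derivatives up to order $p-1$ are absolutely continuous and whose $p$-th derivative is in $L_1[0,1]$. $L_0$ is the operator $L_0y=-y''+q(x)y$ in $L_2[0,1]$ with boundary conditions $y(1)=y(0)$, $y'(1)=y'(0)$ (domain: $y,y'$ absolutely continuous, $-y''+qy\in L_2$, boundary conditions satisfied). Standing convention: all eigenvalues of $L_0$ have algebraic multiplicity at most $2$ (this is automatic for all but finitely many eigenvalues). A normal system of eigen- and associated functions of $L_0$ consists of: for each simple eigenvalue, one eigenfunction of $L_2$-norm $1$; for each eigenvalue of geometric multiplicity $2$, two orthonormal eigenfunctions; for each eigenvalue $\lambda$ of algebraic multiplicity $2$ and geometric multiplicity $1$, an eigenfunction $\varphi$ with $\|\varphi\|=1$ and the associated function $\psi$ with $(L_0-\lambda)\psi=\varphi$ and $\psi\perp\varphi$. A Riesz basis is the image of an orthonormal basis under a bounded and boundedly invertible operator. *)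

theory Defs
  imports "HOL-Analysis.Analysis" "HOL-Library.Extended_Nat"
begin

section \<open>The Hilbert space of square integrable functions on the unit interval\<close>

text \<open>
  Elements of the space are represented by functions \<^typ>\<open>real \<Rightarrow> complex\<close>; equality of elements is
  equality almost everywhere on \<open>[0,1]\<close>, and values outside \<open>[0,1]\<close> never matter.
\<close>

abbreviation \<mu> :: "real measure"
  where "\<mu> \<equiv> lebesgue_on {0..1}"

definition L2 :: "(real \<Rightarrow> complex) set"
  where "L2 = {f \<in> borel_measurable \<mu>. integrable \<mu> (\<lambda>x. (cmod (f x))\<^sup>2)}"

definition L2_inner :: "(real \<Rightarrow> complex) \<Rightarrow> (real \<Rightarrow> complex) \<Rightarrow> complex"
  where "L2_inner f g = (LINT x|\<mu>. f x * cnj (g x))"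

definition L2_norm :: "(real \<Rightarrow> complex) \<Rightarrow> real"
  where "L2_norm f = sqrt (LINT x|\<mu>. (cmod (f x))\<^sup>2)"

definition L2_orthonormal_basis :: "'i set \<Rightarrow> ('i \<Rightarrow> real \<Rightarrow> complex) \<Rightarrow> bool"
  where "L2_orthonormal_basis I e \<longleftrightarrow>
    (\<forall>i\<in>I. e i \<in> L2) \<and>
    (\<forall>i\<in>I. \<forall>j\<in>I. L2_inner (e i) (e j) = (if i = j then 1 else 0)) \<and>
    (\<forall>f\<in>L2. \<forall>\<epsilon>>0. \<exists>F c. finite F \<and> F \<subseteq> I \<and> L2_norm (\<lambda>x. f x - (\<Sum>i\<in>F. c i * e i x)) < \<epsilon>)"

text \<open>
  Linearity and boundedness together imply that the operator respects almost everywhere equality.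
\<close>

definition L2_bounded_linear :: "((real \<Rightarrow> complex) \<Rightarrow> (real \<Rightarrow> complex)) \<Rightarrow> bool"
  where "L2_bounded_linear T \<longleftrightarrow>
    (\<forall>f\<in>L2. T f \<in> L2) \<and>
    (\<forall>f\<in>L2. \<forall>g\<in>L2. \<forall>a b. AE x in \<mu>. T (\<lambda>t. a * f t + b * g t) x = a * T f x + b * T g x) \<and>
    (\<exists>C. \<forall>f\<in>L2. L2_norm (T f) \<le> C * L2_norm f)"

definition L2_boundedly_invertible :: "((real \<Rightarrow> complex) \<Rightarrow> (real \<Rightarrow> complex)) \<Rightarrow> bool"
  where "L2_boundedly_invertible T \<longleftrightarrow>
    (\<exists>S. L2_bounded_linear S \<and>
      (\<forall>f\<in>L2. (AE x in \<mu>. S (T f) x = f x) \<and> (AE x in \<mu>. T (S f) x = f x)))"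

definition L2_Riesz_basis :: "'i set \<Rightarrow> ('i \<Rightarrow> real \<Rightarrow> complex) \<Rightarrow> bool"
  where "L2_Riesz_basis I u \<longleftrightarrow>
    (\<forall>i\<in>I. u i \<in> L2) \<and>
    (\<exists>e T. L2_orthonormal_basis I e \<and> L2_bounded_linear T \<and> L2_boundedly_invertible T \<and>
      (\<forall>i\<in>I. AE x in \<mu>. u i x = T (e i) x))"

text \<open>The dimension of a subspace modulo almost everywhere equality.\<close>

definition L2_independent :: "nat \<Rightarrow> (nat \<Rightarrow> real \<Rightarrow> complex) \<Rightarrow> bool"
  where "L2_independent n f \<longleftrightarrow>
    (\<forall>c. (AE x in \<mu>. (\<Sum>i<n. c i * f i x) = 0) \<longrightarrow> (\<forall>i<n. c i = 0))"

definition L2_dim :: "(real \<Rightarrow> complex) set \<Rightarrow> enat"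
  where "L2_dim V = Sup {enat n |n. \<exists>f. (\<forall>i<n. f i \<in> V) \<and> L2_independent n f}"


section \<open>Absolute continuity and Sobolev spaces on the unit interval\<close>

text \<open>
  The intervals of a division may be degenerate, and \<open>t\<close> is their union, which need not be
  connected: \<open>d\<close> is an arbitrary finite family of non-overlapping closed subintervals of \<open>[0,1]\<close>.
\<close>

definition abs_cont :: "(real \<Rightarrow> complex) \<Rightarrow> bool"
  where "abs_cont f \<longleftrightarrow>
    (\<forall>\<epsilon>>0. \<exists>\<delta>>0. \<forall>d t. d division_of t \<and> t \<subseteq> {0..1} \<and> (\<Sum>k\<in>d. Sup k - Inf k) < \<delta> \<longrightarrow>
      (\<Sum>k\<in>d. cmod (f (Sup k) - f (Inf k))) < \<epsilon>)"

text \<open>The derivative on \<open>[0,1]\<close>, one-sided at the end points.\<close>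

definition deriv01 :: "(real \<Rightarrow> complex) \<Rightarrow> real \<Rightarrow> complex"
  where "deriv01 f x = vector_derivative f (at x within {0..1})"

text \<open>The derivatives up to order \<open>p - 1\<close> exist everywhere on \<open>[0,1]\<close> and are absolutely continuous.\<close>

definition derivs_abs_cont :: "nat \<Rightarrow> (real \<Rightarrow> complex) \<Rightarrow> bool"
  where "derivs_abs_cont p f \<longleftrightarrow>
    (\<forall>s. Suc s < p \<longrightarrow> (\<forall>x\<in>{0..1}. (deriv01 ^^ s) f differentiable (at x within {0..1}))) \<and>
    (\<forall>s<p. abs_cont ((deriv01 ^^ s) f))"

text \<open>
  The derivative of order \<open>p\<close> only exists almost everywhere (by absolute continuity of the
  preceding one); the arbitrary values of \<^const>\<open>deriv01\<close> on the exceptional null set are harmless.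
\<close>

definition sobolev_W1 :: "nat \<Rightarrow> (real \<Rightarrow> complex) \<Rightarrow> bool"
  where "sobolev_W1 p f \<longleftrightarrow> derivs_abs_cont p f \<and> integrable \<mu> ((deriv01 ^^ p) f)"


section \<open>The periodic Sturm--Liouville operator\<close>

definition SL_op :: "(real \<Rightarrow> complex) \<Rightarrow> (real \<Rightarrow> complex) \<Rightarrow> real \<Rightarrow> complex"
  where "SL_op q y x = - deriv01 (deriv01 y) x + q x * y x"

definition SL_domain :: "(real \<Rightarrow> complex) \<Rightarrow> (real \<Rightarrow> complex) set"
  where "SL_domain q = {y. derivs_abs_cont 2 y \<and> SL_op q y \<in> L2 \<and>
    y 1 = y 0 \<and> deriv01 y 1 = deriv01 y 0}"

text \<open>\<open>SL_shift_maps q \<zeta> y z\<close> states that \<open>y\<close> is in the domain and \<open>(L\<^sub>0 - \<zeta>) y = z\<close>.\<close>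

definition SL_shift_maps :: "(real \<Rightarrow> complex) \<Rightarrow> complex \<Rightarrow> (real \<Rightarrow> complex) \<Rightarrow> (real \<Rightarrow> complex) \<Rightarrow> bool"
  where "SL_shift_maps q \<zeta> y z \<longleftrightarrow> y \<in> SL_domain q \<and> (AE x in \<mu>. SL_op q y x - \<zeta> * y x = z x)"

definition SL_eigenspace :: "(real \<Rightarrow> complex) \<Rightarrow> complex \<Rightarrow> (real \<Rightarrow> complex) set"
  where "SL_eigenspace q \<zeta> = {y. SL_shift_maps q \<zeta> y (\<lambda>x. 0)}"

definition SL_eigenvalue :: "(real \<Rightarrow> complex) \<Rightarrow> complex \<Rightarrow> bool"
  where "SL_eigenvalue q \<zeta> \<longleftrightarrow> (\<exists>y\<in>SL_eigenspace q \<zeta>. \<not> (AE x in \<mu>. y x = 0))"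

text \<open>
  The kernel of \<open>(L\<^sub>0 - \<zeta>)\<^sup>n\<close>. As \<open>(L\<^sub>0 - \<zeta>) y\<close> is only determined almost everywhere, membership in
  the domain of the next power is required of some representative \<open>z\<close>.
\<close>

primrec SL_kernel_power :: "(real \<Rightarrow> complex) \<Rightarrow> complex \<Rightarrow> nat \<Rightarrow> (real \<Rightarrow> complex) set"
  where
    "SL_kernel_power q \<zeta> 0 = {y \<in> L2. AE x in \<mu>. y x = 0}"
  | "SL_kernel_power q \<zeta> (Suc n) = {y. \<exists>z\<in>SL_kernel_power q \<zeta> n. SL_shift_maps q \<zeta> y z}"

definition SL_geom_mult :: "(real \<Rightarrow> complex) \<Rightarrow> complex \<Rightarrow> enat"
  where "SL_geom_mult q \<zeta> = L2_dim (SL_eigenspace q \<zeta>)"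

definition SL_alg_mult :: "(real \<Rightarrow> complex) \<Rightarrow> complex \<Rightarrow> enat"
  where "SL_alg_mult q \<zeta> = L2_dim (\<Union>n. SL_kernel_power q \<zeta> n)"

text \<open>
  A normal system is a family indexed by pairs \<open>(\<zeta>, j)\<close> with \<open>\<zeta>\<close> an eigenvalue and \<open>j\<close> below its
  algebraic multiplicity; in the presence of an associated function, \<open>j = 0\<close> is the eigenfunction
  and \<open>j = 1\<close> the associated function. The definition is meant for operators all of whose
  eigenvalues have algebraic multiplicity at most 2.
\<close>

definition SL_index :: "(real \<Rightarrow> complex) \<Rightarrow> (complex \<times> nat) set"
  where "SL_index q = {(\<zeta>, j). SL_eigenvalue q \<zeta> \<and> enat j < SL_alg_mult q \<zeta>}"

definition SL_normal_system :: "(real \<Rightarrow> complex) \<Rightarrow> (complex \<times> nat \<Rightarrow> real \<Rightarrow> complex) \<Rightarrow> bool"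
  where "SL_normal_system q u \<longleftrightarrow>
    (\<forall>\<zeta>. SL_eigenvalue q \<zeta> \<longrightarrow>
      (SL_alg_mult q \<zeta> = 1 \<longrightarrow>
        u (\<zeta>, 0) \<in> SL_eigenspace q \<zeta> \<and> L2_norm (u (\<zeta>, 0)) = 1) \<and>
      (SL_geom_mult q \<zeta> = 2 \<longrightarrow>
        u (\<zeta>, 0) \<in> SL_eigenspace q \<zeta> \<and> L2_norm (u (\<zeta>, 0)) = 1 \<and>
        u (\<zeta>, 1) \<in> SL_eigenspace q \<zeta> \<and> L2_norm (u (\<zeta>, 1)) = 1 \<and>
        L2_inner (u (\<zeta>, 0)) (u (\<zeta>, 1)) = 0) \<and>
      (SL_alg_mult q \<zeta> = 2 \<and> SL_geom_mult q \<zeta> = 1 \<longrightarrow>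
        u (\<zeta>, 0) \<in> SL_eigenspace q \<zeta> \<and> L2_norm (u (\<zeta>, 0)) = 1 \<and>
        SL_shift_maps q \<zeta> (u (\<zeta>, 1)) (u (\<zeta>, 0)) \<and>
        L2_inner (u (\<zeta>, 1)) (u (\<zeta>, 0)) = 0))"

end

theory Submission
  imports Defs "HOL-Analysis.Analysis" "HOL-Computational_Algebra.Fundamental_Theorem_Algebra"
    "HOL-Library.Function_Algebras"
begin

text \<open>
  In the basis of exponentials the operator is the sum of the diagonal matrix with entries
  \<open>4 \<pi>\<^sup>2 k\<^sup>2\<close> and the matrix of Fourier coefficients \<open>q(k - l)\<close>. For large \<open>N\<close> a fixed point argument
  produces a matrix \<open>U\<close> close to the identity that intertwines this matrix with a block diagonal one,
  whose blocks are indexed by \<open>{-N..N}\<close> and by the pairs \<open>{n, -n}\<close> with \<open>n > N\<close>. The columns of \<open>U\<close> are the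
  Fourier coefficients of functions \<open>g n\<close> that form a Riesz basis by the Paley--Wiener criterion, and the root
  functions of the operator correspond to the generalised eigenvectors of the blocks.

  The off-diagonal entries of the block \<open>{n, -n}\<close> are asymptotic to the Fourier coefficients \<open>q(2n)\<close> and
  \<open>q(-2n)\<close>. If \<open>s\<close> is minimal with \<open>q\<^sup>(\<^sup>s\<^sup>)(0) \<noteq> q\<^sup>(\<^sup>s\<^sup>)(1)\<close>, then integration by parts and the Riemann--Lebesgue
  lemma show that both are asymptotic in modulus to one and the same multiple of \<open>1 / n\<^sup>s\<^sup>+\<^sup>1\<close>.
  The operator is symmetric for the pairing \<open>\<integral>f g\<close>, and therefore the two diagonal entries differ by
  much less. So for large \<open>n\<close> the block has two different eigenvalues and its normalised eigenvectors
  have a determinant bounded away from zero: the normal system arises from \<open>g\<close> by a block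
  diagonal matrix that is bounded with bounded inverse.
\<close>

section \<open>Absolutely continuous functions\<close>

text \<open>Smallness of the perturbation alone would not be enough: the off-diagonal entries of the
  block {n, -n} are themselves only of order \<open>1 / n\<close> to the power
  \<open>r = s + 1\<close>. The correction to the Fourier coefficient must share this decay and
  carry a small factor besides. Hence the fixed point is sought in a norm with submultiplicative
  weights, and the small factor comes from sums of inverse gaps, of order \<open>1 / sqrt N\<close>.

  A root function is not known in advance to be a finite combination of the \<open>g n\<close>. Its
  moments against them in the bilinear pairing obey the transposed block equations, which replaces
  resolvents and spectral projections: Gershgorin discs annihilate the moments in all blocks but
  one, and completeness of \<open>g\<close> does the rest.

  The operator acts on absolutely continuous derivatives, so integration by parts rests on almost
  everywhere differentiability, obtained from Vitali coverings, and on the fundamental theorem for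
  such functions.

  The central block may be arbitrarily degenerate, but it is finite; uniform estimates are required
  in the tail only.\<close>

lemma vitali_finite_cover:
  fixes K :: "real set set"
  assumes K: "\<And>k. k \<in> K \<Longrightarrow> k \<subseteq> T \<and> (\<exists>u v. u < v \<and> k = {u..v})"
    and S: "\<And>x d. x \<in> S \<Longrightarrow> 0 < d \<Longrightarrow> \<exists>k\<in>K. x \<in> k \<and> Sup k - Inf k < d"
    and T: "T \<in> lmeasurable" and e: "e > 0"
  obtains F R where "finite F" "F \<subseteq> K" "pairwise disjnt F" "R \<in> lmeasurable" "measure lebesgue R < e"
    "S - \<Union>F \<subseteq> R"
proof -
  \<comment> \<open>Intervals are recoded as closed balls, the form in which Vitali's covering
    theorem is applied.\<close>
  define c where "c k = (Inf k + Sup k) / 2" for k :: "real set"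
  define r where "r k = (Sup k - Inf k) / 2" for k :: "real set"
  have ball: "cball (c k) (r k) = k" and rpos: "0 < r k" if "k \<in> K" for k
    using K[OF that] by (auto simp: c_def r_def cball_eq_atLeastAtMost field_simps)
  obtain C where C: "countable C" "C \<subseteq> K"
    "pairwise (\<lambda>i j. disjnt (cball (c i) (r i)) (cball (c j) (r j))) C"
    "negligible (S - (\<Union>i\<in>C. cball (c i) (r i)))"
  proof (rule Vitali_covering_theorem_cballs[of K r S c])
    fix x d :: real assume "x \<in> S" "0 < d"
    from S[OF this] obtain k where "k \<in> K" "x \<in> k" "Sup k - Inf k < d" by blast
    moreover from this ball[of k] rpos[of k] have "r k < d" by (auto simp: r_def)
    ultimately show "\<exists>i. i \<in> K \<and> x \<in> cball (c i) (r i) \<and> r i < d" using ball by blast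
  qed (use rpos in auto)
  have UC: "(\<Union>i\<in>C. cball (c i) (r i)) = \<Union>C" using ball C(2) by auto
  have meas: "k \<in> lmeasurable" if "k \<in> K" for k using K[OF that] by auto
  have bd: "measure lebesgue (\<Union>k\<in>F. k) \<le> measure lebesgue T" if "finite F" "F \<subseteq> C" for F
    using that C(2) K T meas by (intro measure_mono_fmeasurable) (auto intro!: fmeasurableD fmeasurable.finite_UN)
  have UCm: "\<Union>C \<in> lmeasurable"
    using fmeasurable_UN_bound[OF C(1), of "\<lambda>k. k" lebesgue "measure lebesgue T"] bd meas C(2) by auto
  \<comment> \<open>The measure of the countable union is the supremum over its finite subfamilies,
    so some finite \<open>F\<close> loses less than \<open>e\<close>; the loss, together with the
    null set left by the covering, becomes \<open>R\<close>.\<close>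
  obtain F where F: "finite F" "F \<subseteq> C" "measure lebesgue (\<Union>F) > measure lebesgue (\<Union>C) - e"
  proof (rule ccontr)
    assume "\<not> thesis"
    then have "\<And>F. F \<subseteq> C \<Longrightarrow> finite F \<Longrightarrow> measure lebesgue (\<Union>k\<in>F. k) \<le> measure lebesgue (\<Union>C) - e"
      using that by force
    from measure_UN_bound[OF C(1) _ this] meas C(2) have "measure lebesgue (\<Union>C) \<le> measure lebesgue (\<Union>C) - e"
      by auto
    with e show False by simp
  qed
  have UFm: "\<Union>F \<in> lmeasurable" using F C(2) meas by auto
  define N where "N = S - \<Union>C"
  have N: "negligible N" using C(4) UC by (simp add: N_def)
  define R where "R = N \<union> (\<Union>C - \<Union>F)"
  have Rm: "R \<in> lmeasurable" unfolding R_def using N UCm UFm by (auto intro: negligible_imp_measurable fmeasurable.Un fmeasurable.Diff)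
  have "measure lebesgue R \<le> measure lebesgue N + measure lebesgue (\<Union>C - \<Union>F)"
    unfolding R_def by (rule measure_Un_le) (use N UCm UFm in \<open>auto intro: negligible_imp_sets\<close>)
  also have "measure lebesgue (\<Union>C - \<Union>F) = measure lebesgue (\<Union>C) - measure lebesgue (\<Union>F)"
    by (rule measurable_measure_Diff[OF UCm]) (use UFm F in auto)
  finally have "measure lebesgue R < e" using F(3) negligible_imp_measure0[OF N] by simp
  moreover have "S - \<Union>F \<subseteq> R" by (auto simp: R_def N_def)
  moreover have "pairwise disjnt F"
    using C(3) F(2) C(2) ball unfolding pairwise_def by (metis subset_iff)
  ultimately show thesis using that F C(2) Rm by blast
qed

text \<open>Tagging each interval by its left endpoint reduces the telescoping sum to the one for
  tagged divisions.\<close>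

lemma sum_division_increments:
  fixes h :: "real \<Rightarrow> 'a::real_normed_vector"
  assumes r: "r division_of {u..v}" and uv: "u \<le> v"
  shows "(\<Sum>k\<in>r. h (Sup k) - h (Inf k)) = h v - h u"
proof -
  define p where "p = (\<lambda>k. (Inf k, k)) ` r"
  have kI: "\<exists>a b. a \<le> b \<and> k = {a..b}" if "k \<in> r" for k
    using division_ofD(3,4)[OF r that] by (metis atLeastatMost_empty_iff cbox_interval)
  have "p tagged_division_of {u..v}"
  proof (rule tagged_division_ofI)
    show "finite p" using r by (auto simp: p_def)
    fix x k assume "(x,k) \<in> p"
    then have k: "k \<in> r" "x = Inf k" by (auto simp: p_def)
    then obtain a b where ab: "a \<le> b" "k = {a..b}" using kI by blast
    show "x \<in> k" using k ab by auto
    show "k \<subseteq> {u..v}" using k r by blast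
    show "\<exists>a b. k = cbox a b" using ab by auto
    fix y l assume "(y,l) \<in> p" "(x,k) \<noteq> (y,l)"
    then show "interior k \<inter> interior l = {}" using k division_ofD(5)[OF r] by (auto simp: p_def)
  next
    show "\<Union>{K. \<exists>x. (x, K) \<in> p} = {u..v}" using division_ofD(6)[OF r] by (auto simp: p_def image_iff)
  qed
  from additive_tagged_division_1[OF uv this, of h]
  have "(\<Sum>(x, K)\<in>p. h (Sup K) - h (Inf K)) = h v - h u" .
  also have "(\<Sum>(x, K)\<in>p. h (Sup K) - h (Inf K)) = (\<Sum>k\<in>r. h (Sup k) - h (Inf k))"
    unfolding p_def by (subst sum.reindex) (auto simp: inj_on_def)
  finally show ?thesis .
qed

text \<open>A version of \<open>abs_cont\<close> for any normed target, since differentiability is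
  proved for real and imaginary parts separately.\<close>

definition ac :: "(real \<Rightarrow> 'a::real_normed_vector) \<Rightarrow> bool"
  where "ac f \<longleftrightarrow>
    (\<forall>\<epsilon>>0. \<exists>\<delta>>0. \<forall>d t. d division_of t \<and> t \<subseteq> {0..1} \<and> (\<Sum>k\<in>d. Sup k - Inf k) < \<delta> \<longrightarrow>
      (\<Sum>k\<in>d. norm (f (Sup k) - f (Inf k))) < \<epsilon>)"

lemma abs_cont_iff_ac: "abs_cont f \<longleftrightarrow> ac f"
  unfolding abs_cont_def ac_def by simp

lemma acE:
  assumes "ac f" "e > 0"
  obtains \<delta> where "\<delta> > 0" "\<And>d. d division_of \<Union>d \<Longrightarrow> \<Union>d \<subseteq> {0..1} \<Longrightarrow> (\<Sum>k\<in>d. Sup k - Inf k) < \<delta> \<Longrightarrow>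
      (\<Sum>k\<in>d. norm (f (Sup k) - f (Inf k))) < e"
proof -
  obtain \<delta> where "\<delta> > 0" and \<delta>: "\<forall>d t. d division_of t \<and> t \<subseteq> {0..1} \<and> (\<Sum>k\<in>d. Sup k - Inf k) < \<delta> \<longrightarrow>
      (\<Sum>k\<in>d. norm (f (Sup k) - f (Inf k))) < e"
    using assms unfolding ac_def by metis
  show thesis by (rule that[OF \<open>\<delta> > 0\<close>]) (use \<delta> in metis)
qed

lemma disjoint_intervals_division:
  fixes F :: "real set set"
  assumes "finite F" "pairwise disjnt F" "\<And>k. k \<in> F \<Longrightarrow> \<exists>u v. u < v \<and> k = {u..v}"
  shows "F division_of \<Union>F"
proof (rule division_ofI)
  fix k assume "k \<in> F"
  from assms(3)[OF this] show "k \<noteq> {}" "\<exists>a b. k = cbox a b" by auto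
  fix l assume "l \<in> F" "k \<noteq> l"
  then have "k \<inter> l = {}" using assms(2) \<open>k \<in> F\<close> by (auto simp: pairwise_def disjnt_def)
  then show "interior k \<inter> interior l = {}" by (metis interior_Int interior_empty)
qed (use assms(1) in auto)

lemma measure_disjoint_intervals:
  fixes F :: "real set set"
  assumes "finite F" "pairwise disjnt F" "\<And>k. k \<in> F \<Longrightarrow> \<exists>u v. u < v \<and> k = {u..v}"
  shows "measure lebesgue (\<Union>F) = (\<Sum>k\<in>F. Sup k - Inf k)" and "\<Union>F \<in> lmeasurable"
proof -
  have "measure lebesgue (\<Union>F) = (\<Sum>k\<in>F. measure lebesgue k)"
    by (rule measure_Union') (use assms in auto)
  also have "\<dots> = (\<Sum>k\<in>F. Sup k - Inf k)"
    by (rule sum.cong) (use assms(3) in fastforce)+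
  finally show "measure lebesgue (\<Union>F) = (\<Sum>k\<in>F. Sup k - Inf k)" .
  show "\<Union>F \<in> lmeasurable" using assms by (auto intro!: fmeasurable.finite_Union)
qed

text \<open>Intervals of increment above \<open>c\<close> times their length nearly exhaust a disjoint family of
  intervals with negative increment, and absolute continuity makes the increment over the rest small.\<close>

lemma negligible_oscillating_slopes:
  fixes h :: "real \<Rightarrow> real"
  assumes h: "ac h" and c: "c > 0" and S01: "S \<subseteq> {0<..<1}"
    and lo: "\<And>x d. x \<in> S \<Longrightarrow> d > 0 \<Longrightarrow> \<exists>u v. u < v \<and> v - u < d \<and> x \<in> {u..v} \<and> h v - h u < 0"
    and hi: "\<And>x d. x \<in> S \<Longrightarrow> d > 0 \<Longrightarrow> \<exists>u v. u < v \<and> v - u < d \<and> x \<in> {u..v} \<and> h v - h u > c * (v - u)"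
  shows "negligible S"
proof -
  \<comment> \<open>\<open>m\<close> is the outer measure of \<open>S\<close>, which is not assumed
    measurable; the aim is \<open>c * m < e\<close> for every positive \<open>e\<close>.\<close>
  define M where "M = {measure lebesgue T | T. S \<subseteq> T \<and> T \<in> lmeasurable}"
  define m where "m = Inf M"
  have M0: "M \<noteq> {}" unfolding M_def using S01 by (auto intro!: exI[of _ "{0<..<1}"])
  have Mb: "bdd_below M" unfolding M_def by (rule bdd_belowI[of _ 0]) auto
  have mle: "m \<le> measure lebesgue T" if "S \<subseteq> T" "T \<in> lmeasurable" for T
    unfolding m_def by (rule cInf_lower[OF _ Mb]) (use that in \<open>auto simp: M_def\<close>)
  have key: "c * m < e" if e: "e > 0" for e
  proof -
    obtain \<delta> where \<delta>: "\<delta> > 0" "\<And>d. d division_of \<Union>d \<Longrightarrow> \<Union>d \<subseteq> {0..1} \<Longrightarrow> (\<Sum>k\<in>d. Sup k - Inf k) < \<delta> \<Longrightarrow>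
      (\<Sum>k\<in>d. norm (h (Sup k) - h (Inf k))) < e/2" using acE[OF h half_gt_zero[OF e]] by blast
    \<comment> \<open>The leftover length will be below \<open>4 * \<eta>\<close>, to stay under
      \<open>\<delta>\<close>; the measure of \<open>S\<close> missed by the second covering will be
      at most \<open>2 * \<eta>\<close>, to cost less than \<open>e / 2\<close> after multiplication
      by \<open>c\<close>.\<close>
    define \<eta> where "\<eta> = min (\<delta>/5) (e/(5*c))"
    have \<eta>: "\<eta> > 0" "4*\<eta> < \<delta>" "c * (2*\<eta>) < e/2" using \<delta>(1) e c by (auto simp: \<eta>_def min_def field_simps)
    obtain T0 where T0: "S \<subseteq> T0" "T0 \<in> lmeasurable" "measure lebesgue T0 < m + \<eta>"
      using cInf_lessD[OF M0, of "m + \<eta>"] \<eta>(1) by (auto simp: m_def M_def)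
    obtain O1 where O1: "open O1" "T0 \<subseteq> O1" "(O1 - T0) \<in> lmeasurable" "emeasure lebesgue (O1 - T0) < ennreal \<eta>"
      using sets_lebesgue_outer_open[of T0 \<eta>] T0(2) \<eta>(1) by auto
    define W where "W = O1 \<inter> {0<..<1}"
    have W: "open W" "S \<subseteq> W" "W \<subseteq> {0<..<1}" using O1 T0 S01 by (auto simp: W_def)
    then have Wm: "W \<in> lmeasurable" using lmeasurable_open[OF bounded_subset[of "box 0 (1::real)"]] by (auto simp: bounded_box)
    have "measure lebesgue W \<le> measure lebesgue (T0 \<union> (O1 - T0))"
      by (intro measure_mono_fmeasurable fmeasurable.Un fmeasurableD)
        (use O1(3) T0(2) Wm in \<open>auto simp: W_def\<close>)
    also have "\<dots> \<le> measure lebesgue T0 + measure lebesgue (O1 - T0)"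
      by (rule measure_Un_le) (use O1 T0 in auto)
    also have "measure lebesgue (O1 - T0) < \<eta>"
      using O1(3,4) \<eta>(1) by (simp add: emeasure_eq_measure2 ennreal_less_iff)
    finally have Wle: "measure lebesgue W < m + 2*\<eta>" using T0(3) by simp
    define K1 where "K1 = {{u..v} | u v. u < v \<and> {u..v} \<subseteq> W \<and> h v - h u < 0}"
    obtain F R1 where F: "finite F" "F \<subseteq> K1" "pairwise disjnt F" "R1 \<in> lmeasurable" "measure lebesgue R1 < \<eta>"
      "S - \<Union>F \<subseteq> R1"
    proof (rule vitali_finite_cover[of K1 W S \<eta>])
      fix x d :: real assume x: "x \<in> S" "d > 0"
      obtain r where r: "r > 0" "ball x r \<subseteq> W" using W x by (meson openE subsetD)
      obtain u v where uv: "u < v" "v - u < min d r" "x \<in> {u..v}" "h v - h u < 0" using lo[of x "min d r"] x r by auto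
      moreover have "{u..v} \<subseteq> ball x r" using uv by (auto simp: dist_real_def)
      ultimately show "\<exists>k\<in>K1. x \<in> k \<and> Sup k - Inf k < d" using r by (intro bexI[of _ "{u..v}"]) (auto simp: K1_def)
    qed (use Wm \<eta> in \<open>auto simp: K1_def\<close>)
    have Fi: "\<And>k. k \<in> F \<Longrightarrow> \<exists>u v. u < v \<and> k = {u..v}" using F(2) by (auto simp: K1_def)
    note mF = measure_disjoint_intervals[OF F(1,3) Fi]
    have FW: "\<Union>F \<subseteq> W" using F(2) by (auto simp: K1_def)
    have mFle: "measure lebesgue (\<Union>F) < m + 2*\<eta>"
      using measure_mono_fmeasurable[OF FW _ Wm] mF(2) Wle by auto
    define S' where "S' = S \<inter> (\<Union>k\<in>F. interior k)"
    define K2 where "K2 = {{u..v} | u v. u < v \<and> (\<exists>k\<in>F. {u..v} \<subseteq> k) \<and> h v - h u > c * (v - u)}"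
    obtain G R2 where G: "finite G" "G \<subseteq> K2" "pairwise disjnt G" "R2 \<in> lmeasurable" "measure lebesgue R2 < \<eta>"
      "S' - \<Union>G \<subseteq> R2"
    proof (rule vitali_finite_cover[of K2 W S' \<eta>])
      fix x d :: real assume x: "x \<in> S'" "d > 0"
      then obtain k where k: "k \<in> F" "x \<in> interior k" by (auto simp: S'_def)
      obtain r where r: "r > 0" "ball x r \<subseteq> interior k" using k by (meson openE open_interior)
      obtain u v where uv: "u < v" "v - u < min d r" "x \<in> {u..v}" "h v - h u > c * (v - u)"
        using hi[of x "min d r"] x r by (auto simp: S'_def)
      moreover have "{u..v} \<subseteq> ball x r" using uv by (auto simp: dist_real_def)
      moreover have "interior k \<subseteq> k" by (rule interior_subset)
      ultimately show "\<exists>k\<in>K2. x \<in> k \<and> Sup k - Inf k < d" using r k(1)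
        by (intro bexI[of _ "{u..v}"]) (auto simp: K2_def)
    next
      fix k assume "k \<in> K2"
      then show "k \<subseteq> W \<and> (\<exists>u v. u < v \<and> k = {u..v})" using FW by (auto simp: K2_def)
    qed (use Wm \<eta> in auto)
    have Gi: "\<And>k. k \<in> G \<Longrightarrow> \<exists>u v. u < v \<and> k = {u..v}" using G(2) by (auto simp: K2_def)
    note mG = measure_disjoint_intervals[OF G(1,3) Gi]
    \<comment> \<open>Endpoints of \<open>F\<close> escape the second covering, which only treats
      points in the interiors; they form a finite set.\<close>
    define E where "E = Inf ` F \<union> Sup ` F"
    have Efin: "finite E" using F by (auto simp: E_def)
    have "S \<subseteq> \<Union>G \<union> (R1 \<union> R2 \<union> E)"
    proof
      fix x assume x: "x \<in> S"
      show "x \<in> \<Union>G \<union> (R1 \<union> R2 \<union> E)"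
      proof (cases "x \<in> \<Union>F")
        case True
        then obtain k where k: "k \<in> F" "x \<in> k" by auto
        from Fi[OF k(1)] obtain u v where uv: "u < v" "k = {u..v}" by auto
        then have E: "u \<in> E" "v \<in> E" using k(1) by (auto simp: E_def intro: rev_image_eqI)
        from uv consider "x = u" | "x = v" | "x \<in> interior k" using k(2) by fastforce
        then show ?thesis
        proof cases
          case 1 then show ?thesis using E by simp
        next
          case 2 then show ?thesis using E by simp
        next
          case 3 then show ?thesis using G(6) x k(1) by (auto simp: S'_def)
        qed
      qed (use F(6) x in auto)
    qed
    then have "m \<le> measure lebesgue (\<Union>G \<union> (R1 \<union> R2 \<union> E))"
      by (rule mle) (intro fmeasurable.Un mG(2) F(4) G(4) negligible_imp_measurable[OF negligible_finite] Efin)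
    also have "\<dots> \<le> measure lebesgue (\<Union>G) + (measure lebesgue R1 + measure lebesgue R2 + measure lebesgue E)"
      by (intro order.trans[OF measure_Un_le] add_mono measure_Un_le order.refl sets.Un
          fmeasurableD[OF mG(2)] fmeasurableD[OF F(4)] fmeasurableD[OF G(4)]
          negligible_imp_sets[OF negligible_finite] Efin)
    finally have mGge: "measure lebesgue (\<Union>G) > m - 2*\<eta>"
      using F(5) G(5) negligible_imp_measure0[OF negligible_finite[OF Efin]] by simp
    have Gdiv: "G division_of \<Union>G" by (rule disjoint_intervals_division) (use G Gi in auto)
    \<comment> \<open>Inside each interval of \<open>F\<close> the intervals of \<open>G\<close> are
      completed to a division, so that the increments over \<open>F\<close> split into those over
      \<open>G\<close> and those over the leftover pieces.\<close>
    define GG where "GG k = {l \<in> G. l \<subseteq> k}" for k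
    have "\<exists>r. GG k \<subseteq> r \<and> r division_of k" if k: "k \<in> F" for k
    proof -
      obtain u v where uv: "u < v" "k = {u..v}" using Fi[OF k] by auto
      have "GG k division_of \<Union>(GG k)" by (rule division_of_subset[OF Gdiv]) (auto simp: GG_def)
      moreover have "{k} division_of k" using division_of_self[of u v] uv by simp
      moreover have "\<Union>(GG k) \<subseteq> k" by (auto simp: GG_def)
      ultimately show ?thesis by (metis partial_division_extend)
    qed
    then obtain r where r: "\<And>k. k \<in> F \<Longrightarrow> GG k \<subseteq> r k \<and> r k division_of k" by metis
    have rsub: "l \<subseteq> k" "l \<noteq> {}" if "k \<in> F" "l \<in> r k" for k l
      using r[OF that(1)] that(2) division_ofD(2,3)[of "r k" k] by auto
    have rdisj: "l1 \<inter> l2 = {}" if "k1 \<in> F" "k2 \<in> F" "k1 \<noteq> k2" "l1 \<in> r k1" "l2 \<in> r k2" for k1 k2 l1 l2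
    proof -
      have "k1 \<inter> k2 = {}" using F(3) that(1-3) by (auto simp: pairwise_def disjnt_def)
      then show ?thesis using rsub(1)[OF that(1,4)] rsub(1)[OF that(2,5)] by blast
    qed
    define R where "R = (\<Union>k\<in>F. r k)"
    have Rdiv: "R division_of \<Union>R"
    proof (rule division_ofI)
      show "finite R" using F(1) r by (auto simp: R_def)
      fix l assume "l \<in> R"
      then obtain k where k: "k \<in> F" "l \<in> r k" by (auto simp: R_def)
      show "l \<noteq> {}" using rsub[OF k] by simp
      show "\<exists>a b. l = cbox a b" using r[OF k(1)] k(2) by blast
      fix l' assume "l' \<in> R" "l \<noteq> l'"
      then obtain k' where k': "k' \<in> F" "l' \<in> r k'" by (auto simp: R_def)
      show "interior l \<inter> interior l' = {}"
      proof (cases "k = k'")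
        case True then show ?thesis using r[OF k(1)] k k' \<open>l \<noteq> l'\<close> division_ofD(5) by blast
      next
        case False then show ?thesis using rdisj[OF k(1) k'(1) False k(2) k'(2)] interior_subset by blast
      qed
    qed (auto simp: R_def)
    have GR: "G \<subseteq> R"
    proof
      fix l assume l: "l \<in> G"
      then obtain k where "k \<in> F" "l \<subseteq> k" using G(2) by (auto simp: K2_def)
      then show "l \<in> R" using r[of k] l by (auto simp: R_def GG_def)
    qed
    have sumR: "(\<Sum>l\<in>R. \<phi> (Sup l) - \<phi> (Inf l)) = (\<Sum>k\<in>F. \<phi> (Sup k) - \<phi> (Inf k))" for \<phi> :: "real \<Rightarrow> real"
    proof -
      have "(\<Sum>l\<in>R. \<phi> (Sup l) - \<phi> (Inf l)) = (\<Sum>k\<in>F. \<Sum>l\<in>r k. \<phi> (Sup l) - \<phi> (Inf l))"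
        unfolding R_def
      proof (rule sum.UNION_disjoint[OF F(1)])
        show "\<forall>k\<in>F. finite (r k)" using r by blast
        show "\<forall>i\<in>F. \<forall>j\<in>F. i \<noteq> j \<longrightarrow> r i \<inter> r j = {}"
        proof (intro ballI impI, rule ccontr)
          fix i j assume ij: "i \<in> F" "j \<in> F" "i \<noteq> j" "r i \<inter> r j \<noteq> {}"
          then obtain l where "l \<in> r i" "l \<in> r j" by auto
          then show False using rdisj[OF ij(1-3), of l l] rsub(2)[OF ij(1), of l] by simp
        qed
      qed
      also have "\<dots> = (\<Sum>k\<in>F. \<phi> (Sup k) - \<phi> (Inf k))"
      proof (rule sum.cong[OF refl])
        fix k assume k: "k \<in> F"
        then obtain u v where uv: "u < v" "k = {u..v}" using Fi by blast
        show "(\<Sum>l\<in>r k. \<phi> (Sup l) - \<phi> (Inf l)) = \<phi> (Sup k) - \<phi> (Inf k)"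
          using sum_division_increments[of "r k" u v \<phi>] r[OF k] uv by simp
      qed
      finally show ?thesis .
    qed
    have Rfin: "finite R" using Rdiv by blast
    have split: "sum \<psi> R = sum \<psi> G + sum \<psi> (R - G)" for \<psi> :: "real set \<Rightarrow> real"
      using sum.subset_diff[OF GR Rfin, of \<psi>] by simp
    \<comment> \<open>The leftover length is that of \<open>F\<close> minus that of
      \<open>G\<close>, hence below \<open>(m + 2 * \<eta>) - (m - 2 * \<eta>)\<close>.\<close>
    have "(\<Sum>l\<in>R-G. Sup l - Inf l) < \<delta>"
      using split[of "\<lambda>l. Sup l - Inf l"] sumR[of "\<lambda>x. x"] mF(1) mG(1) mFle mGge \<eta>(2) by simp
    moreover have "(R - G) division_of \<Union>(R-G)" by (rule division_of_subset[OF Rdiv]) auto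
    moreover have "\<Union>(R-G) \<subseteq> {0..1}"
    proof -
      have "\<Union>R \<subseteq> \<Union>F" using rsub(1) by (auto simp: R_def)
      then have "\<Union>(R-G) \<subseteq> {0<..<1}" using FW W(3) by blast
      then show ?thesis by (rule order.trans) auto
    qed
    ultimately have "(\<Sum>k\<in>R-G. norm (h (Sup k) - h (Inf k))) < e/2" using \<delta>(2) by blast
    then have rem: "(\<Sum>k\<in>R-G. h (Sup k) - h (Inf k)) > - (e/2)"
      using sum_abs[of "\<lambda>k. h (Sup k) - h (Inf k)" "R-G"] unfolding real_norm_def by linarith
    have "(\<Sum>k\<in>F. h (Sup k) - h (Inf k)) \<le> 0"
      by (rule sum_nonpos) (use F(2) in \<open>auto simp: K1_def\<close>)
    moreover have "(\<Sum>k\<in>G. h (Sup k) - h (Inf k)) \<ge> (\<Sum>k\<in>G. c * (Sup k - Inf k))"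
      by (rule sum_mono) (use G(2) in \<open>auto simp: K2_def\<close>)
    ultimately have "c * measure lebesgue (\<Union>G) < e/2"
      using rem split[of "\<lambda>k. h (Sup k) - h (Inf k)"] sumR[of h] mG(1) by (simp add: sum_distrib_left)
    moreover have "c * measure lebesgue (\<Union>G) \<ge> c * (m - 2*\<eta>)" using mGge c by simp
    ultimately show "c * m < e" using \<eta>(3) by (simp add: algebra_simps)
  qed
  have "c * m \<le> 0" by (rule field_le_epsilon) (use key in force)
  then have "m \<le> 0" using c by (simp add: mult_le_0_iff)
  show ?thesis unfolding negligible_outer
  proof (intro allI impI)
    fix e :: real assume "e > 0"
    then obtain T where "S \<subseteq> T" "T \<in> lmeasurable" "measure lebesgue T < e"
      using cInf_lessD[OF M0, of e] \<open>m \<le> 0\<close> by (auto simp: m_def M_def)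
    then show "\<exists>T. S \<subseteq> T \<and> T \<in> lmeasurable \<and> measure lebesgue T < e" by blast
  qed
qed


text \<open>One comparison principle that covers subtraction of a linear function, real and
  imaginary parts, and, with \<open>C = 0\<close>, Lipschitz functions.\<close>

lemma ac_mono:
  assumes f: "ac f" and le: "\<And>x y. x \<in> {0..1} \<Longrightarrow> y \<in> {0..1} \<Longrightarrow> norm (g x - g y) \<le> C * norm (f x - f y) + D * \<bar>x - y\<bar>"
    and C: "C \<ge> 0" and D: "D \<ge> 0"
  shows "ac g"
  unfolding ac_def
proof (intro allI impI)
  fix e :: real assume e: "e > 0"
  obtain \<delta> where \<delta>: "\<delta> > 0" "\<And>d. d division_of \<Union>d \<Longrightarrow> \<Union>d \<subseteq> {0..1} \<Longrightarrow> (\<Sum>k\<in>d. Sup k - Inf k) < \<delta> \<Longrightarrow>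
      (\<Sum>k\<in>d. norm (f (Sup k) - f (Inf k))) < e / (2 * (C + 1))"
  proof -
    have "e / (2 * (C + 1)) > 0" using e C by simp
    show ?thesis by (rule acE[OF f \<open>e / (2 * (C + 1)) > 0\<close>]) (rule that)
  qed
  show "\<exists>\<delta>>0. \<forall>d t. d division_of t \<and> t \<subseteq> {0..1} \<and> (\<Sum>k\<in>d. Sup k - Inf k) < \<delta> \<longrightarrow>
      (\<Sum>k\<in>d. norm (g (Sup k) - g (Inf k))) < e"
  proof (intro exI conjI allI impI; (elim conjE)?)
    show "min \<delta> (e / (2 * (D + 1))) > 0" using \<delta> e D by simp
    fix d t assume d: "d division_of t" "t \<subseteq> {0..1}" "(\<Sum>k\<in>d. Sup k - Inf k) < min \<delta> (e / (2 * (D + 1)))"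
    have t: "t = \<Union>d" using d(1) by blast
    have k: "Sup k \<in> {0..1}" "Inf k \<in> {0..1}" "Inf k \<le> Sup k" if kd: "k \<in> d" for k
    proof -
      obtain u v where uv: "u \<le> v" "k = {u..v}"
        using division_ofD(3)[OF d(1) kd] division_ofD(4)[OF d(1) kd] by (metis atLeastatMost_empty_iff cbox_interval)
      moreover have "k \<subseteq> {0..1}" using d kd by blast
      ultimately show "Sup k \<in> {0..1}" "Inf k \<in> {0..1}" "Inf k \<le> Sup k" by auto
    qed
    have "(\<Sum>k\<in>d. norm (g (Sup k) - g (Inf k))) \<le> (\<Sum>k\<in>d. C * norm (f (Sup k) - f (Inf k)) + D * (Sup k - Inf k))"
      using le k by (intro sum_mono) (metis abs_of_nonneg diff_ge_0_iff_ge)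
    also have "\<dots> = C * (\<Sum>k\<in>d. norm (f (Sup k) - f (Inf k))) + D * (\<Sum>k\<in>d. Sup k - Inf k)"
      by (simp add: sum.distrib sum_distrib_left)
    also have "\<dots> \<le> C * (e / (2 * (C + 1))) + D * (e / (2 * (D + 1)))"
      using \<delta>(2)[of d] d t C D by (intro add_mono mult_left_mono) auto
    also have "\<dots> < (C + 1) * (e / (2 * (C + 1))) + (D + 1) * (e / (2 * (D + 1)))"
      using e C D by (intro add_strict_mono mult_strict_right_mono) auto
    also have "(C + 1) * (e / (2 * (C + 1))) = e/2" using C by (simp add: field_simps)
    also have "(D + 1) * (e / (2 * (D + 1))) = e/2" using D by (simp add: field_simps)
    also have "e/2 + e/2 = e" by simp
    finally show "(\<Sum>k\<in>d. norm (g (Sup k) - g (Inf k))) < e" .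
  qed
qed

text \<open>On disjoint intervals of slope above \<open>c = 2 / e\<close> and total length below
  \<open>\<delta>\<close> the increments add up to less than \<open>1\<close>, so the length is
  below \<open>e / 2\<close>. Windows of length \<open>\<delta> / 2\<close> keep the total length
  admissible; rational left ends make them countably many.\<close>

lemma negligible_unbounded_slopes:
  fixes h :: "real \<Rightarrow> real"
  assumes h: "ac h" and S01: "S \<subseteq> {0<..<1}"
    and hi: "\<And>x d c. x \<in> S \<Longrightarrow> d > 0 \<Longrightarrow> \<exists>u v. u < v \<and> v - u < d \<and> x \<in> {u..v} \<and> \<bar>h v - h u\<bar> > c * (v - u)"
  shows "negligible S"
proof -
  obtain \<delta> where \<delta>: "\<delta> > 0" "\<And>d. d division_of \<Union>d \<Longrightarrow> \<Union>d \<subseteq> {0..1} \<Longrightarrow> (\<Sum>k\<in>d. Sup k - Inf k) < \<delta> \<Longrightarrow>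
      (\<Sum>k\<in>d. norm (h (Sup k) - h (Inf k))) < 1" using acE[OF h zero_less_one] by blast
  have loc: "negligible (S \<inter> {a<..<a+\<delta>/2})" for a
    unfolding negligible_outer
  proof (intro allI impI)
    fix e :: real assume e: "e > 0"
    define c where "c = 2 / e"
    define W where "W = {a<..<a+\<delta>/2} \<inter> {0<..<1::real}"
    have W: "open W" "W \<in> lmeasurable" by (auto simp: W_def intro!: fmeasurable.Int)
    define K where "K = {{u..v} | u v. u < v \<and> {u..v} \<subseteq> W \<and> \<bar>h v - h u\<bar> > c * (v - u)}"
    obtain F R where F: "finite F" "F \<subseteq> K" "pairwise disjnt F" "R \<in> lmeasurable" "measure lebesgue R < e/2"
      "(S \<inter> {a<..<a+\<delta>/2}) - \<Union>F \<subseteq> R"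
    proof (rule vitali_finite_cover[of K W "S \<inter> {a<..<a+\<delta>/2}" "e/2"])
      fix x d :: real assume x: "x \<in> S \<inter> {a<..<a+\<delta>/2}" "d > 0"
      then have "x \<in> W" using S01 by (auto simp: W_def)
      then obtain r where r: "r > 0" "ball x r \<subseteq> W" using W by (meson openE)
      obtain u v where uv: "u < v" "v - u < min d r" "x \<in> {u..v}" "\<bar>h v - h u\<bar> > c * (v - u)"
        using hi[of x "min d r" c] x r by auto
      moreover have "{u..v} \<subseteq> ball x r" using uv by (auto simp: dist_real_def)
      ultimately show "\<exists>k\<in>K. x \<in> k \<and> Sup k - Inf k < d" using r by (intro bexI[of _ "{u..v}"]) (auto simp: K_def)
    qed (use W e in \<open>auto simp: K_def\<close>)
    have Fi: "\<And>k. k \<in> F \<Longrightarrow> \<exists>u v. u < v \<and> k = {u..v}" using F(2) by (auto simp: K_def)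
    note mF = measure_disjoint_intervals[OF F(1,3) Fi]
    have FW: "\<Union>F \<subseteq> W" using F(2) by (auto simp: K_def)
    have "measure lebesgue (\<Union>F) \<le> measure lebesgue {a<..<a+\<delta>/2}"
      by (rule measure_mono_fmeasurable) (use FW mF(2) in \<open>auto simp: W_def\<close>)
    then have "(\<Sum>k\<in>F. Sup k - Inf k) < \<delta>" using mF(1) \<delta>(1) by simp
    moreover have "\<Union>F \<subseteq> {0..1}" using FW by (force simp: W_def)
    ultimately have "(\<Sum>k\<in>F. norm (h (Sup k) - h (Inf k))) < 1"
      using \<delta>(2) disjoint_intervals_division[OF F(1,3) Fi] by blast
    moreover have "(\<Sum>k\<in>F. c * (Sup k - Inf k)) \<le> (\<Sum>k\<in>F. norm (h (Sup k) - h (Inf k)))"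
      by (rule sum_mono) (use F(2) in \<open>auto simp: K_def\<close>)
    ultimately have "c * measure lebesgue (\<Union>F) < 1" using mF(1) by (simp add: sum_distrib_left)
    then have "measure lebesgue (\<Union>F) < e/2" using e by (simp add: c_def field_simps)
    moreover have "measure lebesgue (\<Union>F \<union> R) \<le> measure lebesgue (\<Union>F) + measure lebesgue R"
      by (rule measure_Un_le) (use mF F in auto)
    ultimately have "measure lebesgue (\<Union>F \<union> R) < e" using F(5) by linarith
    moreover have "S \<inter> {a<..<a+\<delta>/2} \<subseteq> \<Union>F \<union> R" using F(6) by blast
    moreover have "\<Union>F \<union> R \<in> lmeasurable" using mF(2) F(4) by (rule fmeasurable.Un)
    ultimately show "\<exists>T. S \<inter> {a<..<a+\<delta>/2} \<subseteq> T \<and> T \<in> lmeasurable \<and> measure lebesgue T < e" by blast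
  qed
  have "S \<subseteq> (\<Union>a\<in>\<rat>. S \<inter> {a<..<a+\<delta>/2})"
  proof
    fix x assume x: "x \<in> S"
    obtain a where "a \<in> \<rat>" "x - \<delta>/2 < a" "a < x" using Rats_dense_in_real[of "x - \<delta>/2" x] \<delta>(1) by auto
    then show "x \<in> (\<Union>a\<in>\<rat>. S \<inter> {a<..<a+\<delta>/2})" using x by auto
  qed
  moreover have "negligible (\<Union>a\<in>\<rat>. S \<inter> {a<..<a+\<delta>/2})"
    using loc by (intro negligible_countable_Union) (auto simp: countable_rat)
  ultimately show ?thesis by (rule negligible_subset[rotated])
qed

text \<open>Where the difference quotients stay bounded near \<open>x\<close> (off
  \<open>Sinf\<close>) and no two rationals separate their lower and upper limits (off the sets
  \<open>Sab a b\<close>), they converge. Subtracting \<open>a * x\<close> turns the separation at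
  \<open>a < b\<close> into slopes below \<open>0\<close> and above \<open>b - a\<close>.\<close>

lemma ac_real_differentiable_ae:
  fixes h :: "real \<Rightarrow> real"
  assumes h: "ac h"
  shows "negligible {x \<in> {0<..<1}. \<not> (\<exists>D. (h has_real_derivative D) (at x))}"
proof -
  define sl where "sl x y = (h y - h x) / (y - x)" for x y
  define Sinf where "Sinf = {x \<in> {0<..<1}. \<forall>c. \<exists>\<^sub>F y in at x. \<bar>sl x y\<bar> > c}"
  define Sab where "Sab a b = {x \<in> {0<..<1}. (\<exists>\<^sub>F y in at x. sl x y < a) \<and> (\<exists>\<^sub>F y in at x. sl x y > b)}" for a b
  have near: "\<exists>u v. u < v \<and> v - u < d \<and> x \<in> {u..v} \<and> P u v"
    if P: "\<exists>\<^sub>F y in at x. Q y" "d > 0" "\<And>y. y > x \<Longrightarrow> Q y \<Longrightarrow> P x y" "\<And>y. y < x \<Longrightarrow> Q y \<Longrightarrow> P y x" for x d :: real and P Q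
  proof -
    have "\<forall>\<^sub>F y in at x. dist y x < d \<and> y \<noteq> x" using that(2) by (auto simp: eventually_at)
    then obtain y where y: "Q y" "dist y x < d" "y \<noteq> x"
      using frequently_eventually_frequently[OF P(1)] frequently_ex by (metis (mono_tags, lifting))
    show ?thesis
    proof (cases "y > x")
      case True then show ?thesis using y that(3) by (intro exI[of _ x] exI[of _ y]) (auto simp: dist_real_def)
    next
      case False then show ?thesis using y that(4)[of y] by (intro exI[of _ y] exI[of _ x]) (auto simp: dist_real_def)
    qed
  qed
  have "negligible Sinf"
  proof (rule negligible_unbounded_slopes[OF h])
    fix x d c :: real assume "x \<in> Sinf" "d > 0"
    then have "\<exists>\<^sub>F y in at x. \<bar>sl x y\<bar> > c" "d > 0" by (auto simp: Sinf_def)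
    then show "\<exists>u v. u < v \<and> v - u < d \<and> x \<in> {u..v} \<and> \<bar>h v - h u\<bar> > c * (v - u)"
      by (rule near) (auto simp: sl_def abs_divide field_simps abs_if split: if_splits)
  qed (auto simp: Sinf_def)
  moreover have "negligible (Sab a b)" if "a < b" for a b
  proof -
    have 1: "ac (\<lambda>x. h x - a * x)"
    proof (rule ac_mono[OF h, of _ 1 "\<bar>a\<bar>"])
      fix x y :: real
      have "h x - a * x - (h y - a * y) = (h x - h y) - a * (x - y)" by (simp add: algebra_simps)
      then show "norm (h x - a * x - (h y - a * y)) \<le> 1 * norm (h x - h y) + \<bar>a\<bar> * \<bar>x - y\<bar>"
        using abs_triangle_ineq4[of "h x - h y" "a * (x - y)"] by (simp add: abs_mult)
    qed auto
    show ?thesis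
    proof (rule negligible_oscillating_slopes[OF 1, of "b - a"])
      fix x d :: real assume "x \<in> Sab a b" and d: "d > 0"
      then have f: "\<exists>\<^sub>F y in at x. sl x y < a" "\<exists>\<^sub>F y in at x. sl x y > b" by (auto simp: Sab_def)
      show "\<exists>u v. u < v \<and> v - u < d \<and> x \<in> {u..v} \<and> h v - a * v - (h u - a * u) < 0"
        by (rule near[OF f(1) d]) (auto simp: sl_def field_simps)
      show "\<exists>u v. u < v \<and> v - u < d \<and> x \<in> {u..v} \<and> h v - a * v - (h u - a * u) > (b - a) * (v - u)"
        by (rule near[OF f(2) d]) (auto simp: sl_def field_simps)
    qed (use that in \<open>auto simp: Sab_def\<close>)
  qed
  ultimately have neg: "negligible (Sinf \<union> (\<Union>(a,b)\<in>{(a,b) \<in> \<rat> \<times> \<rat>. a < b}. Sab a b))"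
    by (intro negligible_Un negligible_countable_Union)
      (auto intro!: countable_image countable_subset[of _ "\<rat> \<times> \<rat>"] countable_SIGMA countable_rat)
  have "\<exists>D. (h has_real_derivative D) (at x)"
    if x: "x \<in> {0<..<1}" "x \<notin> Sinf" "\<And>a b. a \<in> \<rat> \<Longrightarrow> b \<in> \<rat> \<Longrightarrow> a < b \<Longrightarrow> x \<notin> Sab a b" for x
  proof -
    define F where "F y = ereal (sl x y)" for y
    obtain c where c: "\<forall>\<^sub>F y in at x. \<bar>sl x y\<bar> \<le> c"
      using x(1,2) by (auto simp: Sinf_def frequently_def not_less)
    have nt: "\<not> trivial_limit (at x)" by simp
    have eq: "Liminf (at x) F = Limsup (at x) F"
    proof (rule ccontr)
      assume "Liminf (at x) F \<noteq> Limsup (at x) F"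
      then have "Liminf (at x) F < Limsup (at x) F" using Liminf_le_Limsup[OF nt, of F] by simp
      then obtain a' where a': "Liminf (at x) F < ereal a'" "ereal a' < Limsup (at x) F" using ereal_dense2 by blast
      obtain b' where b': "ereal a' < ereal b'" "ereal b' < Limsup (at x) F" using ereal_dense2[OF a'(2)] by blast
      obtain a where a: "a \<in> \<rat>" "a' < a" "a < b'" using Rats_dense_in_real[of a' b'] b'(1) by auto
      obtain b where b: "b \<in> \<rat>" "a < b" "b < b'" using Rats_dense_in_real[of a b'] a by auto
      have "\<exists>\<^sub>F y in at x. sl x y < a"
      proof (rule ccontr)
        assume "\<not> (\<exists>\<^sub>F y in at x. sl x y < a)"
        then have "\<forall>\<^sub>F y in at x. ereal a \<le> F y" by (auto simp: frequently_def not_less F_def)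
        then have "ereal a \<le> Liminf (at x) F" by (rule Liminf_bounded)
        then show False using a'(1) a(2) by (metis ereal_less_eq(3) leD less_eq_real_def order.trans)
      qed
      moreover have "\<exists>\<^sub>F y in at x. sl x y > b"
      proof (rule ccontr)
        assume "\<not> (\<exists>\<^sub>F y in at x. sl x y > b)"
        then have "\<forall>\<^sub>F y in at x. F y \<le> ereal b" by (auto simp: frequently_def not_less F_def)
        then have "Limsup (at x) F \<le> ereal b" by (rule Limsup_bounded)
        then show False using b'(2) b(3) by (metis ereal_less_eq(3) leD less_eq_real_def order.trans)
      qed
      ultimately show False using x(1) x(3)[OF a(1) b(1,2)] by (auto simp: Sab_def)
    qed
    define l where "l = Limsup (at x) F"
    have lim: "(F \<longlongrightarrow> l) (at x)" by (rule Liminf_eq_Limsup[OF nt]) (simp_all only: l_def eq)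
    have "\<bar>l\<bar> \<noteq> \<infinity>"
    proof -
      have "l \<le> ereal c" using c by (intro tendsto_upperbound[OF lim _ nt]) (auto elim!: eventually_mono simp: F_def)
      moreover have "ereal (-c) \<le> l" using c by (intro tendsto_lowerbound[OF lim _ nt]) (auto elim!: eventually_mono simp: F_def)
      ultimately show ?thesis by auto
    qed
    then obtain D where "l = ereal D" by auto
    with lim have "(sl x \<longlongrightarrow> D) (at x)" by (simp add: F_def[abs_def])
    then have "(h has_real_derivative D) (at x)" by (simp add: has_field_derivative_iff sl_def[abs_def])
    then show ?thesis by blast
  qed
  then have "{x \<in> {0<..<1}. \<not> (\<exists>D. (h has_real_derivative D) (at x))} \<subseteq> Sinf \<union> (\<Union>(a,b)\<in>{(a,b) \<in> \<rat> \<times> \<rat>. a < b}. Sab a b)"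
    by blast
  then show ?thesis by (rule negligible_subset[OF neg])
qed

lemma abs_cont_differentiable_ae:
  assumes f: "abs_cont f"
  shows "negligible {x \<in> {0..1}. \<not> f differentiable (at x within {0..1})}"
proof -
  have f: "ac f" using f by (simp add: abs_cont_iff_ac)
  have re: "ac (\<lambda>x. Re (f x))"
    by (rule ac_mono[OF f, of _ 1 0]) (use abs_Re_le_cmod[of "f _ - f _"] in auto)
  have im: "ac (\<lambda>x. Im (f x))"
    by (rule ac_mono[OF f, of _ 1 0]) (use abs_Im_le_cmod[of "f _ - f _"] in auto)
  define N where "N = {x \<in> {0<..<1}. \<not> (\<exists>D. ((\<lambda>x. Re (f x)) has_real_derivative D) (at x))} \<union>
     {x \<in> {0<..<1}. \<not> (\<exists>D. ((\<lambda>x. Im (f x)) has_real_derivative D) (at x))} \<union> {0,1}"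
  have N: "negligible N" unfolding N_def
    using ac_real_differentiable_ae[OF re] ac_real_differentiable_ae[OF im] by auto
  have "f differentiable (at x within {0..1})" if x: "x \<in> {0..1}" "x \<notin> N" for x
  proof -
    have "x \<in> {0<..<1}" using x by (auto simp: N_def)
    then obtain D E where "((\<lambda>x. Re (f x)) has_real_derivative D) (at x)" "((\<lambda>x. Im (f x)) has_real_derivative E) (at x)"
      using x(2) unfolding N_def by blast
    then have "(f has_vector_derivative Complex D E) (at x)" by (simp add: has_vector_derivative_complex_iff)
    then show ?thesis
      by (meson differentiableI_vector has_vector_derivative_at_within)
  qed
  then have "{x \<in> {0..1}. \<not> f differentiable (at x within {0..1})} \<subseteq> N" by blast
  then show ?thesis by (rule negligible_subset[OF N])
qed

section \<open>The fundamental theorem of calculus for absolutely continuous functions\<close>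

lemma sum_division_lengths_le:
  fixes D :: "real set set"
  assumes D: "D division_of \<Union>D" and W: "\<Union>D \<subseteq> W" "W \<in> lmeasurable"
  shows "(\<Sum>k\<in>D. Sup k - Inf k) \<le> measure lebesgue W"
proof -
  have kI: "\<exists>u v. u \<le> v \<and> k = {u..v}" if kD: "k \<in> D" for k
    using division_ofD(3)[OF D kD] division_ofD(4)[OF D kD] by (metis atLeastatMost_empty_iff cbox_interval)
  have "(\<Sum>k\<in>D. Sup k - Inf k) = (\<Sum>k\<in>D. measure lebesgue (interior k))"
  proof (rule sum.cong[OF refl])
    fix k assume "k \<in> D"
    from kI[OF this] obtain u v where "u \<le> v" "k = {u..v}" by blast
    then show "Sup k - Inf k = measure lebesgue (interior k)" by simp
  qed
  also have "\<dots> = measure lebesgue (\<Union>k\<in>D. interior k)"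
  proof (rule measure_UNION'[symmetric])
    show "finite D" using D by blast
    show "interior k \<in> lmeasurable" if "k \<in> D" for k
      using kI[OF that] by (auto)
    show "pairwise (\<lambda>i j. disjnt (interior i) (interior j)) D"
      using division_ofD(5)[OF D] by (auto simp: pairwise_def disjnt_def)
  qed
  also have "\<dots> \<le> measure lebesgue W"
  proof (rule measure_mono_fmeasurable[OF _ _ W(2)])
    show "(\<Union>k\<in>D. interior k) \<subseteq> W" using W(1) interior_subset by blast
    have "open (\<Union>k\<in>D. interior k)" by auto
    then show "(\<Union>k\<in>D. interior k) \<in> sets lebesgue" by (simp add: borel_open sets_completionI_sets)
  qed
  finally show ?thesis .
qed

text \<open>A gauge argument that does not presuppose integrability of the derivative. At tags in
  the null set \<open>N\<close> of non-differentiability the gauge forces the intervals into an open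
  set \<open>W\<close> of measure below \<open>\<delta>\<close>, where absolute continuity bounds
  the increments; at the other tags the derivative approximates them.\<close>

theorem abs_cont_has_integral_deriv01:
  assumes f: "abs_cont f" and ab: "0 \<le> a" "a \<le> b" "b \<le> 1"
  shows "(deriv01 f has_integral f b - f a) {a..b}"
proof -
  define N where "N = {x \<in> {0..1}. \<not> f differentiable (at x within {0..1})}"
  have N: "negligible N" unfolding N_def by (rule abs_cont_differentiable_ae[OF f])
  define g where "g x = (if x \<in> N then 0 else deriv01 f x)" for x
  have der: "(f has_vector_derivative g x) (at x within {0..1})" if "x \<in> {0..1}" "x \<notin> N" for x
    using that vector_derivative_works[of f "at x within {0..1}"] by (simp add: N_def g_def deriv01_def)
  have ab01: "{a..b} \<subseteq> {0..1}" using ab by auto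
  have "(g has_integral f b - f a) {a..b}"
    unfolding has_integral_real
  proof (intro allI impI)
    fix e :: real assume e: "e > 0"
    define e' where "e' = e / 2 / 2"
    have e': "e' > 0" using e by (simp add: e'_def)
    obtain \<delta> where \<delta>: "\<delta> > 0" "\<And>d. d division_of \<Union>d \<Longrightarrow> \<Union>d \<subseteq> {0..1} \<Longrightarrow> (\<Sum>k\<in>d. Sup k - Inf k) < \<delta> \<Longrightarrow>
      (\<Sum>k\<in>d. norm (f (Sup k) - f (Inf k))) < e/2"
      by (rule acE[OF _ half_gt_zero[OF e], of f]) (use f in \<open>simp_all add: abs_cont_iff_ac\<close>)
    obtain W where W: "open W" "N \<subseteq> W" "(W - N) \<in> lmeasurable" "emeasure lebesgue (W - N) < ennreal \<delta>"
      using sets_lebesgue_outer_open[OF negligible_imp_sets[OF N] \<delta>(1)] by blast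
    have WN: "W = N \<union> (W - N)" using W(2) by auto
    have Wm: "W \<in> lmeasurable" by (subst WN) (intro fmeasurable.Un W(3) negligible_imp_measurable N)
    have "measure lebesgue W \<le> measure lebesgue N + measure lebesgue (W - N)"
      by (subst WN) (intro measure_Un_le negligible_imp_sets N fmeasurableD W(3))
    also have "\<dots> < \<delta>" using W(3,4) \<delta>(1) negligible_imp_measure0[OF N]
      by (simp add: emeasure_eq_measure2 ennreal_less_iff)
    finally have Wd: "measure lebesgue W < \<delta>" .
    have "\<exists>r>0. (x \<in> N \<longrightarrow> ball x r \<subseteq> W) \<and>
        (x \<in> {0..1} \<and> x \<notin> N \<longrightarrow> (\<forall>y\<in>{0..1}. \<bar>y - x\<bar> < r \<longrightarrow> cmod (f y - f x - (y - x) *\<^sub>R g x) \<le> e' * \<bar>y - x\<bar>))" for x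
    proof (cases "x \<in> N")
      case True
      then show ?thesis using W(1,2) by (meson openE subsetD)
    next
      case False
      show ?thesis
      proof (cases "x \<in> {0..1}")
        case True
        from der[OF this False] obtain r where "r > 0"
          "\<forall>y\<in>{0..1}. norm (y - x) < r \<longrightarrow> norm (f y - f x - (y - x) *\<^sub>R g x) \<le> e' * norm (y - x)"
          using e' by (auto simp: has_vector_derivative_def has_derivative_within_alt)
        then show ?thesis using False by auto
      qed (use False in \<open>auto intro: exI[of _ 1]\<close>)
    qed
    then obtain r where r: "\<And>x. r x > 0" "\<And>x. x \<in> N \<Longrightarrow> ball x (r x) \<subseteq> W"
      "\<And>x y. x \<in> {0..1} \<Longrightarrow> x \<notin> N \<Longrightarrow> y \<in> {0..1} \<Longrightarrow> \<bar>y - x\<bar> < r x \<Longrightarrow> cmod (f y - f x - (y - x) *\<^sub>R g x) \<le> e' * \<bar>y - x\<bar>"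
      by metis
    define \<gamma> where "\<gamma> x = ball x (r x)" for x
    have gauge: "gauge \<gamma>" using r(1) by (auto simp: gauge_def \<gamma>_def)
    have "norm ((\<Sum>(x,k)\<in>D. measure lborel k *\<^sub>R g x) - (f b - f a)) < e"
      if D: "D tagged_division_of {a..b}" and fine: "\<gamma> fine D" for D
    proof -
      note Dd = tagged_division_ofD[OF D]
      have kI: "\<exists>u v. u \<le> v \<and> k = {u..v} \<and> x \<in> {u..v} \<and> {u..v} \<subseteq> {0..1}" if xk: "(x,k) \<in> D" for x k
      proof -
        obtain u v where "k = cbox u v" using Dd(4)[OF xk] by blast
        then show ?thesis using Dd(2,3)[OF xk] ab01
          by (intro exI[of _ u] exI[of _ v]) auto
      qed
      define DN where "DN = {(x,k) \<in> D. x \<in> N}"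
      define DG where "DG = {(x,k) \<in> D. x \<notin> N}"
      have fin: "finite DN" "finite DG" using Dd(1) by (auto simp: DN_def DG_def intro: finite_subset)
      have split: "sum \<phi> D = sum \<phi> DN + sum \<phi> DG" for \<phi> :: "real \<times> real set \<Rightarrow> 'b::comm_monoid_add"
      proof -
        have "D = DN \<union> DG" "DN \<inter> DG = {}" by (auto simp: DN_def DG_def)
        then show ?thesis using sum.union_disjoint[OF fin] by metis
      qed
      have "f b - f a = (\<Sum>(x,k)\<in>D. f (Sup k) - f (Inf k))"
        using additive_tagged_division_1[OF ab(2) D, of f] by simp
      then have "(\<Sum>(x,k)\<in>D. measure lborel k *\<^sub>R g x) - (f b - f a) = (\<Sum>(x,k)\<in>D. measure lborel k *\<^sub>R g x - (f (Sup k) - f (Inf k)))"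
        by (simp add: sum_subtractf case_prod_unfold)
      also have "norm \<dots> \<le> norm (\<Sum>(x,k)\<in>DN. measure lborel k *\<^sub>R g x - (f (Sup k) - f (Inf k)))
          + norm (\<Sum>(x,k)\<in>DG. measure lborel k *\<^sub>R g x - (f (Sup k) - f (Inf k)))"
        unfolding split by (rule norm_triangle_ineq)
      also have "norm (\<Sum>(x,k)\<in>DN. measure lborel k *\<^sub>R g x - (f (Sup k) - f (Inf k))) < e/2"
      proof -
        have "norm (\<Sum>(x,k)\<in>DN. measure lborel k *\<^sub>R g x - (f (Sup k) - f (Inf k))) \<le> (\<Sum>(x,k)\<in>DN. norm (f (Sup k) - f (Inf k)))"
          unfolding case_prod_unfold
        proof (rule sum_norm_le)
          fix p assume "p \<in> DN"
          then have "fst p \<in> N" by (auto simp: DN_def)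
          then show "norm (measure lborel (snd p) *\<^sub>R g (fst p) - (f (Sup (snd p)) - f (Inf (snd p)))) \<le> norm (f (Sup (snd p)) - f (Inf (snd p)))"
            by (simp add: g_def norm_minus_commute)
        qed
        \<comment> \<open>The guard makes the summand vanish on every degenerate box, including the
          empty one, where \<open>Sup\<close> and \<open>Inf\<close> carry no information; the
          passage from tagged intervals to intervals requires this.\<close>
        also have "\<dots> = (\<Sum>(x,k)\<in>DN. if k = {} then 0 else norm (f (Sup k) - f (Inf k)))"
          by (rule sum.cong) (auto simp: DN_def dest: Dd(2))
        also have DNt: "DN tagged_division_of \<Union>(snd ` DN)"
          by (rule tagged_partial_division_of_Union_self, rule tagged_partial_division_subset[of D])
            (use D in \<open>auto simp: DN_def tagged_division_of_def\<close>)
        have "(\<Sum>(x,k)\<in>DN. if k = {} then 0 else norm (f (Sup k) - f (Inf k))) = (\<Sum>k\<in>snd ` DN. if k = {} then 0 else norm (f (Sup k) - f (Inf k)))"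
          by (rule sum.over_tagged_division_lemma[OF DNt]) (auto simp: box_real)
        also have "\<dots> = (\<Sum>k\<in>snd ` DN. norm (f (Sup k) - f (Inf k)))"
          by (rule sum.cong) (auto simp: DN_def dest: Dd(2))
        also have "\<dots> < e/2"
        proof (rule \<delta>(2))
          show Dv: "snd ` DN division_of \<Union> (snd ` DN)" by (rule division_of_tagged_division[OF DNt])
          show "\<Union> (snd ` DN) \<subseteq> {0..1}" using Dd(3) ab01 unfolding DN_def by fastforce
          have "\<Union> (snd ` DN) \<subseteq> W"
          proof
            fix y assume "y \<in> \<Union> (snd ` DN)"
            then obtain x k where "(x,k) \<in> D" "x \<in> N" "y \<in> k" by (auto simp: DN_def)
            then show "y \<in> W" using fineD[OF fine] r(2) unfolding \<gamma>_def by blast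
          qed
          from sum_division_lengths_le[OF Dv this Wm] Wd
          show "(\<Sum>k\<in>snd ` DN. Sup k - Inf k) < \<delta>" by linarith
        qed
        finally show ?thesis .
      qed
      also have "norm (\<Sum>(x,k)\<in>DG. measure lborel k *\<^sub>R g x - (f (Sup k) - f (Inf k))) \<le> e/2"
      proof -
        have "norm (\<Sum>(x,k)\<in>DG. measure lborel k *\<^sub>R g x - (f (Sup k) - f (Inf k))) \<le> (\<Sum>(x,k)\<in>DG. e' * measure lborel k)"
          unfolding case_prod_unfold
        proof (rule sum_norm_le)
          fix p assume p: "p \<in> DG"
          obtain x k where xk: "p = (x,k)" by fastforce
          with p have D1: "(x,k) \<in> D" "x \<notin> N" by (auto simp: DG_def)
          obtain u v where uv: "u \<le> v" "k = {u..v}" "x \<in> {u..v}" "{u..v} \<subseteq> {0..1}" using kI[OF D1(1)] by blast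
          have kb: "{u..v} \<subseteq> ball x (r x)" using fineD[OF fine D1(1)] uv(2) by (simp add: \<gamma>_def)
          have 1: "cmod (f v - f x - (v - x) *\<^sub>R g x) \<le> e' * \<bar>v - x\<bar>"
            by (rule r(3)) (use uv D1 kb[THEN subsetD, of v] in \<open>auto simp: dist_real_def\<close>)
          have 2: "cmod (f u - f x - (u - x) *\<^sub>R g x) \<le> e' * \<bar>u - x\<bar>"
            by (rule r(3)) (use uv D1 kb[THEN subsetD, of u] in \<open>auto simp: dist_real_def\<close>)
          have eq: "(v - u) *\<^sub>R g x - (f v - f u) = (f u - f x - (u - x) *\<^sub>R g x) - (f v - f x - (v - x) *\<^sub>R g x)"
            by (simp add: algebra_simps)
          have "cmod ((v - u) *\<^sub>R g x - (f v - f u)) \<le> cmod (f u - f x - (u - x) *\<^sub>R g x) + cmod (f v - f x - (v - x) *\<^sub>R g x)"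
            unfolding eq by (rule norm_triangle_ineq4)
          also have "\<dots> \<le> e' * \<bar>u - x\<bar> + e' * \<bar>v - x\<bar>" using 1 2 by (rule add_mono[rotated])
          also have "\<dots> = e' * (v - u)" using uv(3) by (simp add: abs_if algebra_simps)
          finally show "norm (measure lborel (snd p) *\<^sub>R g (fst p) - (f (Sup (snd p)) - f (Inf (snd p)))) \<le> e' * measure lborel (snd p)"
            using uv xk by simp
        qed
        also have "\<dots> \<le> (\<Sum>(x,k)\<in>D. e' * measure lborel k)"
          by (rule sum_mono2) (use Dd(1) e' in \<open>auto simp: DG_def\<close>)
        also have "\<dots> = e' * (b - a)"
          using additive_content_tagged_division[of D a b] D ab by (simp add: sum_distrib_left[symmetric] case_prod_unfold)
        also have "\<dots> \<le> e/2" using ab e by (simp add: e'_def mult_left_le)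
        finally show ?thesis .
      qed
      finally show ?thesis by simp
    qed
    then show "\<exists>\<gamma>. gauge \<gamma> \<and> (\<forall>\<D>. \<D> tagged_division_of {a..b} \<and> \<gamma> fine \<D> \<longrightarrow>
        norm ((\<Sum>(x, k)\<in>\<D>. measure lborel k *\<^sub>R g x) - (f b - f a)) < e)" using gauge by blast
  qed
  then show ?thesis by (rule has_integral_spike[OF N, rotated]) (simp add: g_def)
qed

section \<open>Closure properties of absolute continuity\<close>

lemma abs_cont_lipschitz:
  assumes "\<And>x y. x \<in> {0..1} \<Longrightarrow> y \<in> {0..1} \<Longrightarrow> cmod (g x - g y) \<le> L * \<bar>x - y\<bar>"
  shows "abs_cont g"
proof -
  have "ac (\<lambda>x. 0 :: complex)" unfolding ac_def by (auto intro: exI[of _ 1])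
  moreover have "L \<ge> 0" using assms[of 0 1] norm_ge_zero[of "g 0 - g 1"] by (simp del: norm_ge_zero)
  ultimately show ?thesis unfolding abs_cont_iff_ac using assms by (intro ac_mono[of "\<lambda>x. 0 :: complex" g 0 L]) auto
qed

lemma abs_cont_continuous:
  assumes f: "abs_cont f"
  shows "continuous_on {0..1} f"
  unfolding continuous_on_iff
proof (intro ballI allI impI)
  fix x e :: real assume x: "x \<in> {0..1}" and e: "e > 0"
  obtain \<delta> where \<delta>: "\<delta> > 0" "\<And>d. d division_of \<Union>d \<Longrightarrow> \<Union>d \<subseteq> {0..1} \<Longrightarrow> (\<Sum>k\<in>d. Sup k - Inf k) < \<delta> \<Longrightarrow>
      (\<Sum>k\<in>d. norm (f (Sup k) - f (Inf k))) < e"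
    by (rule acE[OF _ e, of f]) (use f in \<open>simp_all add: abs_cont_iff_ac\<close>)
  have *: "cmod (f v - f u) < e" if "u \<le> v" "0 \<le> u" "v \<le> 1" "v - u < \<delta>" for u v
    using \<delta>(2)[of "{{u..v}}"] that division_of_self[of u v] by auto
  show "\<exists>d>0. \<forall>x'\<in>{0..1}. dist x' x < d \<longrightarrow> dist (f x') (f x) < e"
  proof (intro exI[of _ \<delta>] conjI ballI impI \<delta>(1))
    fix y assume y: "y \<in> {0..1}" "dist y x < \<delta>"
    show "dist (f y) (f x) < e"
      using *[of x y] *[of y x] x y by (cases "x \<le> y") (auto simp: dist_norm norm_minus_commute)
  qed
qed

lemma abs_cont_bounded:
  assumes f: "abs_cont f"
  obtains B where "B > 0" "\<And>x. x \<in> {0..1} \<Longrightarrow> cmod (f x) \<le> B"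
proof -
  have "compact (f ` {0..1})" by (rule compact_continuous_image[OF abs_cont_continuous[OF f]]) simp
  then obtain B where "B > 0" "\<forall>y\<in>f ` {0..1}. cmod y \<le> B" using compact_imp_bounded bounded_pos by blast
  then show thesis using that by auto
qed

lemma abs_cont_mult:
  assumes f: "abs_cont f" and g: "abs_cont g"
  shows "abs_cont (\<lambda>x. f x * g x)"
proof -
  obtain A where A: "A > 0" "\<And>x. x \<in> {0..1} \<Longrightarrow> cmod (f x) \<le> A" using abs_cont_bounded[OF f] by metis
  obtain B where B: "B > 0" "\<And>x. x \<in> {0..1} \<Longrightarrow> cmod (g x) \<le> B" using abs_cont_bounded[OF g] by metis
  show ?thesis unfolding abs_cont_iff_ac ac_def
  proof (intro allI impI)
    fix e :: real assume e: "e > 0"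
    define e1 e2 where "e1 = e / 2 / B" and "e2 = e / 2 / A"
    have e12: "e1 > 0" "e2 > 0" using e A B by (auto simp: e1_def e2_def)
    obtain \<delta> where \<delta>: "\<delta> > 0" "\<And>d. d division_of \<Union>d \<Longrightarrow> \<Union>d \<subseteq> {0..1} \<Longrightarrow> (\<Sum>k\<in>d. Sup k - Inf k) < \<delta> \<Longrightarrow>
      (\<Sum>k\<in>d. norm (f (Sup k) - f (Inf k))) < e1"
      by (rule acE[OF _ e12(1), of f]) (use f in \<open>simp_all add: abs_cont_iff_ac\<close>)
    obtain \<eta> where \<eta>: "\<eta> > 0" "\<And>d. d division_of \<Union>d \<Longrightarrow> \<Union>d \<subseteq> {0..1} \<Longrightarrow> (\<Sum>k\<in>d. Sup k - Inf k) < \<eta> \<Longrightarrow>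
      (\<Sum>k\<in>d. norm (g (Sup k) - g (Inf k))) < e2"
      by (rule acE[OF _ e12(2), of g]) (use g in \<open>simp_all add: abs_cont_iff_ac\<close>)
    have "(\<Sum>k\<in>d. norm (f (Sup k) * g (Sup k) - f (Inf k) * g (Inf k))) < e"
      if d: "d division_of t" "t \<subseteq> {0..1}" "(\<Sum>k\<in>d. Sup k - Inf k) < min \<delta> \<eta>" for d t
    proof -
      have t: "t = \<Union>d" using d(1) by blast
      have k01: "Sup k \<in> {0..1}" "Inf k \<in> {0..1}" if kd: "k \<in> d" for k
      proof -
        obtain u v where uv: "u \<le> v" "k = {u..v}"
          using division_ofD(3)[OF d(1) kd] division_ofD(4)[OF d(1) kd] by (metis atLeastatMost_empty_iff cbox_interval)
        moreover have "k \<subseteq> {0..1}" using d kd by blast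
        ultimately show "Sup k \<in> {0..1}" "Inf k \<in> {0..1}" by auto
      qed
      have "(\<Sum>k\<in>d. norm (f (Sup k) * g (Sup k) - f (Inf k) * g (Inf k)))
          \<le> (\<Sum>k\<in>d. A * norm (g (Sup k) - g (Inf k)) + B * norm (f (Sup k) - f (Inf k)))"
      proof (rule sum_mono)
        fix k assume k: "k \<in> d"
        have "f (Sup k) * g (Sup k) - f (Inf k) * g (Inf k) = f (Sup k) * (g (Sup k) - g (Inf k)) + g (Inf k) * (f (Sup k) - f (Inf k))"
          by (simp add: algebra_simps)
        then have "norm (f (Sup k) * g (Sup k) - f (Inf k) * g (Inf k))
            \<le> cmod (f (Sup k)) * cmod (g (Sup k) - g (Inf k)) + cmod (g (Inf k)) * cmod (f (Sup k) - f (Inf k))"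
          by (metis norm_mult norm_triangle_ineq)
        also have "\<dots> \<le> A * norm (g (Sup k) - g (Inf k)) + B * norm (f (Sup k) - f (Inf k))"
          by (intro add_mono mult_right_mono A(2) B(2) k01 k) auto
        finally show "norm (f (Sup k) * g (Sup k) - f (Inf k) * g (Inf k)) \<le> A * norm (g (Sup k) - g (Inf k)) + B * norm (f (Sup k) - f (Inf k))" .
      qed
      also have "\<dots> = A * (\<Sum>k\<in>d. norm (g (Sup k) - g (Inf k))) + B * (\<Sum>k\<in>d. norm (f (Sup k) - f (Inf k)))"
        by (simp add: sum.distrib sum_distrib_left)
      also have "\<dots> < A * e2 + B * e1"
        using \<delta>(2)[of d] \<eta>(2)[of d] d t A(1) B(1) by (intro add_strict_mono mult_strict_left_mono) auto
      also have "\<dots> = e" using A(1) B(1) by (simp add: e1_def e2_def)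
      finally show ?thesis .
    qed
    then show "\<exists>\<delta>>0. \<forall>d t. d division_of t \<and> t \<subseteq> {0..1} \<and> (\<Sum>k\<in>d. Sup k - Inf k) < \<delta> \<longrightarrow>
        (\<Sum>k\<in>d. norm (f (Sup k) * g (Sup k) - f (Inf k) * g (Inf k))) < e"
      using \<delta>(1) \<eta>(1) by (intro exI[of _ "min \<delta> \<eta>"]) auto
  qed
qed

lemma abs_cont_add:
  assumes f: "abs_cont f" and g: "abs_cont g"
  shows "abs_cont (\<lambda>x. f x + g x)"
  unfolding abs_cont_iff_ac ac_def
proof (intro allI impI)
  fix e :: real assume e: "e > 0"
  obtain \<delta> where \<delta>: "\<delta> > 0" "\<And>d. d division_of \<Union>d \<Longrightarrow> \<Union>d \<subseteq> {0..1} \<Longrightarrow> (\<Sum>k\<in>d. Sup k - Inf k) < \<delta> \<Longrightarrow>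
    (\<Sum>k\<in>d. norm (f (Sup k) - f (Inf k))) < e/2"
    by (rule acE[OF _ half_gt_zero[OF e], of f]) (use f in \<open>simp_all add: abs_cont_iff_ac\<close>)
  obtain \<eta> where \<eta>: "\<eta> > 0" "\<And>d. d division_of \<Union>d \<Longrightarrow> \<Union>d \<subseteq> {0..1} \<Longrightarrow> (\<Sum>k\<in>d. Sup k - Inf k) < \<eta> \<Longrightarrow>
    (\<Sum>k\<in>d. norm (g (Sup k) - g (Inf k))) < e/2"
    by (rule acE[OF _ half_gt_zero[OF e], of g]) (use g in \<open>simp_all add: abs_cont_iff_ac\<close>)
  have "(\<Sum>k\<in>d. norm (f (Sup k) + g (Sup k) - (f (Inf k) + g (Inf k)))) < e"
    if d: "d division_of t" "t \<subseteq> {0..1}" "(\<Sum>k\<in>d. Sup k - Inf k) < min \<delta> \<eta>" for d t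
  proof -
    have t: "t = \<Union>d" using d(1) by blast
    have "(\<Sum>k\<in>d. norm (f (Sup k) + g (Sup k) - (f (Inf k) + g (Inf k))))
       \<le> (\<Sum>k\<in>d. norm (f (Sup k) - f (Inf k)) + norm (g (Sup k) - g (Inf k)))"
      by (rule sum_mono) (metis add_diff_add norm_triangle_ineq)
    also have "\<dots> < e" using \<delta>(2)[of d] \<eta>(2)[of d] d t by (simp add: sum.distrib)
    finally show ?thesis .
  qed
  then show "\<exists>\<delta>>0. \<forall>d t. d division_of t \<and> t \<subseteq> {0..1} \<and> (\<Sum>k\<in>d. Sup k - Inf k) < \<delta> \<longrightarrow>
      (\<Sum>k\<in>d. norm (f (Sup k) + g (Sup k) - (f (Inf k) + g (Inf k)))) < e"
    using \<delta>(1) \<eta>(1) by (intro exI[of _ "min \<delta> \<eta>"]) auto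
qed

section \<open>Square integrable functions\<close>

lemma finite_measure_mu: "finite_measure \<mu>"
  by (rule finite_measure_lebesgue_on) simp

interpretation mu: finite_measure \<mu> by (rule finite_measure_mu)

lemma measure_mu_space: "measure \<mu> (space \<mu>) = 1"
  by (simp add: measure_restrict_space)

lemma L2_measurable [measurable_dest]: "f \<in> L2 \<Longrightarrow> f \<in> borel_measurable \<mu>"
  and L2_integrable_square: "f \<in> L2 \<Longrightarrow> integrable \<mu> (\<lambda>x. (cmod (f x))\<^sup>2)"
  by (auto simp: L2_def)

lemma L2_norm_nonneg [simp]: "L2_norm f \<ge> 0"
  by (simp add: L2_norm_def)

lemma L2_norm_square: "(L2_norm f)\<^sup>2 = (LINT x|\<mu>. (cmod (f x))\<^sup>2)"
  by (simp add: L2_norm_def integral_nonneg_AE)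

lemma L2_bounded:
  assumes f: "f \<in> borel_measurable \<mu>" and B: "\<And>x. x \<in> {0..1} \<Longrightarrow> cmod (f x) \<le> B"
  shows "f \<in> L2" "L2_norm f \<le> B"
proof -
  have B0: "B \<ge> 0" using B[of 0] norm_ge_zero[of "f 0"] by (simp del: norm_ge_zero)
  have sq: "AE x in \<mu>. norm ((cmod (f x))\<^sup>2) \<le> B\<^sup>2"
    by (rule AE_I2) (use B in \<open>auto intro!: power_mono\<close>)
  have int: "integrable \<mu> (\<lambda>x. (cmod (f x))\<^sup>2)"
    by (rule mu.integrable_const_bound[OF sq]) (use f in measurable)
  then show "f \<in> L2" using f by (simp add: L2_def)
  have "(LINT x|\<mu>. (cmod (f x))\<^sup>2) \<le> (LINT x|\<mu>. B\<^sup>2)"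
    by (rule integral_mono_AE[OF int]) (use sq in auto)
  also have "\<dots> = B\<^sup>2" using measure_mu_space by simp
  finally show "L2_norm f \<le> B" unfolding L2_norm_def using B0 by (simp add: real_le_lsqrt)
qed

lemma continuous_measurable_mu:
  fixes f :: "real \<Rightarrow> complex"
  shows "continuous_on {0..1} f \<Longrightarrow> f \<in> borel_measurable \<mu>"
  by (rule continuous_imp_measurable_on_sets_lebesgue) auto

lemma L2_continuous:
  assumes "continuous_on {0..1} f" shows "f \<in> L2"
proof -
  have "compact (f ` {0..1})" by (rule compact_continuous_image[OF assms]) simp
  then obtain B where "\<forall>y\<in>f ` {0..1}. cmod y \<le> B" using compact_imp_bounded bounded_iff by blast
  then show ?thesis using L2_bounded(1)[OF continuous_measurable_mu[OF assms], of B] by auto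
qed

lemma L2_cmult: "f \<in> L2 \<Longrightarrow> (\<lambda>x. c * f x) \<in> L2"
  by (auto simp: L2_def norm_mult power_mult_distrib)

lemma L2_norm_cmult: "L2_norm (\<lambda>x. c * f x) = cmod c * L2_norm f"
  by (simp add: L2_norm_def norm_mult power_mult_distrib real_sqrt_mult)

lemma sum_square_bound: "(a + b)\<^sup>2 \<le> 2 * a\<^sup>2 + 2 * b\<^sup>2" for a b :: real
  using zero_le_power2[of "a - b"] by (simp add: power2_eq_square algebra_simps)

lemma L2_add:
  assumes f: "f \<in> L2" and g: "g \<in> L2" shows "(\<lambda>x. f x + g x) \<in> L2"
proof -
  note [measurable] = L2_measurable[OF f] L2_measurable[OF g]
  have "integrable \<mu> (\<lambda>x. 2 * (cmod (f x))\<^sup>2 + 2 * (cmod (g x))\<^sup>2)"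
    using L2_integrable_square[OF f] L2_integrable_square[OF g] by simp
  then have "integrable \<mu> (\<lambda>x. (cmod (f x + g x))\<^sup>2)"
  proof (rule Bochner_Integration.integrable_bound)
    show "AE x in \<mu>. norm ((cmod (f x + g x))\<^sup>2) \<le> norm (2 * (cmod (f x))\<^sup>2 + 2 * (cmod (g x))\<^sup>2)"
    proof (rule AE_I2)
      fix x
      have "(cmod (f x + g x))\<^sup>2 \<le> (cmod (f x) + cmod (g x))\<^sup>2" by (intro power_mono norm_triangle_ineq) auto
      also have "\<dots> \<le> 2 * (cmod (f x))\<^sup>2 + 2 * (cmod (g x))\<^sup>2" by (rule sum_square_bound)
      finally show "norm ((cmod (f x + g x))\<^sup>2) \<le> norm (2 * (cmod (f x))\<^sup>2 + 2 * (cmod (g x))\<^sup>2)" by simp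
    qed
  qed measurable
  then show ?thesis by (simp add: L2_def)
qed

lemma L2_uminus: "f \<in> L2 \<Longrightarrow> (\<lambda>x. - f x) \<in> L2"
  using L2_cmult[of f "-1"] by simp

lemma L2_diff: "f \<in> L2 \<Longrightarrow> g \<in> L2 \<Longrightarrow> (\<lambda>x. f x - g x) \<in> L2"
  using L2_add[of f "\<lambda>x. - g x"] L2_uminus[of g] by simp

lemma L2_zero: "(\<lambda>x. 0) \<in> L2"
  by (auto simp: L2_def)

lemma L2_sum: "(\<And>i. i \<in> I \<Longrightarrow> f i \<in> L2) \<Longrightarrow> (\<lambda>x. \<Sum>i\<in>I. f i x) \<in> L2"
  by (induction I rule: infinite_finite_induct) (auto simp: L2_zero intro!: L2_add)

lemma L2_lincomb: "(\<And>i. i \<in> I \<Longrightarrow> f i \<in> L2) \<Longrightarrow> (\<lambda>x. \<Sum>i\<in>I. c i * f i x) \<in> L2"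
  by (intro L2_sum L2_cmult)

lemma L2_cnj: "f \<in> L2 \<Longrightarrow> (\<lambda>x. cnj (f x)) \<in> L2"
proof -
  assume f: "f \<in> L2"
  have "cnj \<in> borel_measurable borel" by (intro borel_measurable_continuous_onI continuous_intros)
  from measurable_compose[OF L2_measurable[OF f] this] show ?thesis using f by (auto simp: L2_def)
qed

lemma L2_norm_cnj: "L2_norm (\<lambda>x. cnj (f x)) = L2_norm f"
  by (simp add: L2_norm_def)

lemma L2_integrable_mult:
  assumes f: "f \<in> L2" and g: "g \<in> L2" shows "integrable \<mu> (\<lambda>x. f x * g x)"
proof -
  note [measurable] = L2_measurable[OF f] L2_measurable[OF g]
  have "integrable \<mu> (\<lambda>x. (cmod (f x))\<^sup>2 + (cmod (g x))\<^sup>2)"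
    using L2_integrable_square[OF f] L2_integrable_square[OF g] by simp
  then show ?thesis
  proof (rule Bochner_Integration.integrable_bound)
    show "AE x in \<mu>. norm (f x * g x) \<le> norm ((cmod (f x))\<^sup>2 + (cmod (g x))\<^sup>2)"
    proof (rule AE_I2)
      fix x
      have "2 * (cmod (f x) * cmod (g x)) \<le> (cmod (f x))\<^sup>2 + (cmod (g x))\<^sup>2"
        using zero_le_power2[of "cmod (f x) - cmod (g x)"] by (simp add: power2_eq_square algebra_simps)
      moreover have "0 \<le> cmod (f x) * cmod (g x)" by simp
      ultimately have "cmod (f x) * cmod (g x) \<le> (cmod (f x))\<^sup>2 + (cmod (g x))\<^sup>2" by linarith
      then show "norm (f x * g x) \<le> norm ((cmod (f x))\<^sup>2 + (cmod (g x))\<^sup>2)" by (simp add: norm_mult)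
    qed
  qed measurable
qed

lemma L2_integrable: "f \<in> L2 \<Longrightarrow> integrable \<mu> f"
  using L2_integrable_mult[of f "\<lambda>x. 1"] L2_continuous[of "\<lambda>x. 1"] by simp

text \<open>Integrate \<open>2 * a * b \<le> t * a\<^sup>2 + b\<^sup>2 / t\<close> and take for
  \<open>t\<close> the quotient of the two norms. If one of the norms vanishes, let \<open>t\<close>
  tend to infinity or to \<open>0\<close> instead.\<close>

lemma L2_Cauchy_Schwarz_abs:
  assumes f: "f \<in> L2" and g: "g \<in> L2"
  shows "(LINT x|\<mu>. cmod (f x) * cmod (g x)) \<le> L2_norm f * L2_norm g"
proof -
  let ?I = "LINT x|\<mu>. cmod (f x) * cmod (g x)"
  have int: "integrable \<mu> (\<lambda>x. cmod (f x) * cmod (g x))"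
    using integrable_norm[OF L2_integrable_mult[OF f g]] by (simp add: norm_mult)
  have bd: "2 * ?I \<le> t * (L2_norm f)\<^sup>2 + (L2_norm g)\<^sup>2 / t" if "t > 0" for t
  proof -
    have "2 * ?I = (LINT x|\<mu>. 2 * (cmod (f x) * cmod (g x)))" by simp
    also have "\<dots> \<le> (LINT x|\<mu>. t * (cmod (f x))\<^sup>2 + (cmod (g x))\<^sup>2 / t)"
    proof (rule integral_mono)
      fix x
      have "0 \<le> (t * cmod (f x) - cmod (g x))\<^sup>2 / t" using that by simp
      then show "2 * (cmod (f x) * cmod (g x)) \<le> t * (cmod (f x))\<^sup>2 + (cmod (g x))\<^sup>2 / t"
        using that by (simp add: power2_eq_square field_simps)
    qed (use int L2_integrable_square[OF f] L2_integrable_square[OF g] in auto)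
    also have "\<dots> = t * (L2_norm f)\<^sup>2 + (L2_norm g)\<^sup>2 / t"
      using L2_integrable_square[OF f] L2_integrable_square[OF g] by (simp add: L2_norm_square)
    finally show ?thesis .
  qed
  show ?thesis
  proof (cases "L2_norm f > 0 \<and> L2_norm g > 0")
    case True
    then show ?thesis using bd[of "L2_norm g / L2_norm f"] by (simp add: power2_eq_square)
  next
    case False
    have "L2_norm f = 0 \<or> L2_norm g = 0" using False L2_norm_nonneg[of f] L2_norm_nonneg[of g] by linarith
    moreover have "2 * ?I \<le> 0" if z: "L2_norm f = 0"
    proof (rule field_le_epsilon)
      fix e :: real assume e: "e > 0"
      define D where "D = (L2_norm g)\<^sup>2 + 1"
      have D: "D > 0" "(L2_norm g)\<^sup>2 \<le> D" by (simp_all add: D_def add_nonneg_pos)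
      have "2 * ?I \<le> (L2_norm g)\<^sup>2 / (D / e)" using bd[of "D / e"] z D(1) e by simp
      also have "\<dots> \<le> D / (D / e)" using D e by (intro divide_right_mono) auto
      finally show "2 * ?I \<le> 0 + e" using D(1) e by simp
    qed
    moreover have "2 * ?I \<le> 0" if z: "L2_norm g = 0"
    proof (rule field_le_epsilon)
      fix e :: real assume e: "e > 0"
      define D where "D = (L2_norm f)\<^sup>2 + 1"
      have D: "D > 0" "(L2_norm f)\<^sup>2 \<le> D" by (simp_all add: D_def add_nonneg_pos)
      have "2 * ?I \<le> e / D * (L2_norm f)\<^sup>2" using bd[of "e / D"] z D(1) e by simp
      also have "\<dots> \<le> e / D * D" using D e by (intro mult_left_mono) auto
      finally show "2 * ?I \<le> 0 + e" using D(1) e by simp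
    qed
    ultimately show ?thesis by auto
  qed
qed

lemma L2_Cauchy_Schwarz:
  assumes f: "f \<in> L2" and g: "g \<in> L2"
  shows "cmod (LINT x|\<mu>. f x * g x) \<le> L2_norm f * L2_norm g"
  using integral_norm_bound[of \<mu> "\<lambda>x. f x * g x"] L2_Cauchy_Schwarz_abs[OF f g] by (simp add: norm_mult)

lemma L2_inner_bound: "f \<in> L2 \<Longrightarrow> g \<in> L2 \<Longrightarrow> cmod (L2_inner f g) \<le> L2_norm f * L2_norm g"
  unfolding L2_inner_def using L2_Cauchy_Schwarz[of f "\<lambda>x. cnj (g x)"] L2_cnj[of g] by (simp add: L2_norm_cnj)

lemma L2_integral_bound: "f \<in> L2 \<Longrightarrow> (LINT x|\<mu>. cmod (f x)) \<le> L2_norm f"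
  using L2_Cauchy_Schwarz_abs[of f "\<lambda>x. 1"] L2_continuous[of "\<lambda>x. 1"] measure_mu_space by (simp add: L2_norm_def)

lemma L2_triangle:
  assumes f: "f \<in> L2" and g: "g \<in> L2"
  shows "L2_norm (\<lambda>x. f x + g x) \<le> L2_norm f + L2_norm g"
proof -
  have int: "integrable \<mu> (\<lambda>x. cmod (f x) * cmod (g x))"
    using integrable_norm[OF L2_integrable_mult[OF f g]] by (simp add: norm_mult)
  have "(L2_norm (\<lambda>x. f x + g x))\<^sup>2 \<le> (LINT x|\<mu>. (cmod (f x))\<^sup>2 + (cmod (g x))\<^sup>2 + 2 * (cmod (f x) * cmod (g x)))"
    unfolding L2_norm_square
  proof (rule integral_mono)
    fix x
    have "(cmod (f x + g x))\<^sup>2 \<le> (cmod (f x) + cmod (g x))\<^sup>2" by (intro power_mono norm_triangle_ineq) auto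
    then show "(cmod (f x + g x))\<^sup>2 \<le> (cmod (f x))\<^sup>2 + (cmod (g x))\<^sup>2 + 2 * (cmod (f x) * cmod (g x))"
      by (simp add: power2_eq_square algebra_simps)
  qed (use int L2_integrable_square[OF f] L2_integrable_square[OF g] L2_integrable_square[OF L2_add[OF f g]] in auto)
  also have "\<dots> = (L2_norm f)\<^sup>2 + (L2_norm g)\<^sup>2 + 2 * (LINT x|\<mu>. cmod (f x) * cmod (g x))"
    using int L2_integrable_square[OF f] L2_integrable_square[OF g] by (simp add: L2_norm_square)
  also have "\<dots> \<le> (L2_norm f + L2_norm g)\<^sup>2"
    using L2_Cauchy_Schwarz_abs[OF f g] by (simp add: power2_eq_square algebra_simps)
  finally show ?thesis by (rule power2_le_imp_le) simp
qed

lemma L2_norm_uminus: "L2_norm (\<lambda>x. - f x) = L2_norm f"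
  by (simp add: L2_norm_def)

lemma L2_norm_minus_commute: "L2_norm (\<lambda>x. f x - g x) = L2_norm (\<lambda>x. g x - f x)"
  by (simp add: L2_norm_def norm_minus_commute)

lemma L2_triangle_sub:
  assumes "f \<in> L2" "g \<in> L2" "h \<in> L2"
  shows "L2_norm (\<lambda>x. f x - h x) \<le> L2_norm (\<lambda>x. f x - g x) + L2_norm (\<lambda>x. g x - h x)"
  using L2_triangle[of "\<lambda>x. f x - g x" "\<lambda>x. g x - h x"] L2_diff assms by auto

lemma L2_norm_triangle_abs:
  assumes "f \<in> L2" "g \<in> L2" shows "\<bar>L2_norm f - L2_norm g\<bar> \<le> L2_norm (\<lambda>x. f x - g x)"
  using L2_triangle[of "\<lambda>x. f x - g x" g] L2_triangle[of "\<lambda>x. g x - f x" f] L2_diff assms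
    L2_norm_minus_commute[of f g] by auto

lemma L2_norm_cong_AE:
  assumes "f \<in> borel_measurable \<mu>" "g \<in> borel_measurable \<mu>" "AE x in \<mu>. f x = g x"
  shows "L2_norm f = L2_norm g"
proof -
  have "(LINT x|\<mu>. (cmod (f x))\<^sup>2) = (LINT x|\<mu>. (cmod (g x))\<^sup>2)"
    by (rule integral_cong_AE) (use assms in auto)
  then show ?thesis by (simp add: L2_norm_def)
qed

lemma L2_norm_eq_0_iff:
  assumes f: "f \<in> L2" shows "L2_norm f = 0 \<longleftrightarrow> (AE x in \<mu>. f x = 0)"
  using integral_nonneg_eq_0_iff_AE[OF L2_integrable_square[OF f]] by (simp add: L2_norm_def)

lemma L2_limit_unique:
  assumes f: "f \<in> L2" and g: "g \<in> L2" and h: "\<And>n. h n \<in> L2"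
    and "(\<lambda>n. L2_norm (\<lambda>x. h n x - f x)) \<longlonglongrightarrow> 0" "(\<lambda>n. L2_norm (\<lambda>x. h n x - g x)) \<longlonglongrightarrow> 0"
  shows "AE x in \<mu>. f x = g x"
proof -
  have "(\<lambda>n. L2_norm (\<lambda>x. h n x - f x) + L2_norm (\<lambda>x. h n x - g x)) \<longlonglongrightarrow> 0 + 0"
    by (intro tendsto_add assms)
  moreover have "L2_norm (\<lambda>x. f x - g x) \<le> L2_norm (\<lambda>x. h n x - f x) + L2_norm (\<lambda>x. h n x - g x)" for n
    using L2_triangle_sub[OF f h g, of n] L2_norm_minus_commute[of f "h n"] by simp
  ultimately have "L2_norm (\<lambda>x. f x - g x) \<le> 0"
    by (intro tendsto_lowerbound[of _ "0::real"]) (auto intro: always_eventually)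
  then have "L2_norm (\<lambda>x. f x - g x) = 0" using L2_norm_nonneg[of "\<lambda>x. f x - g x"] by linarith
  then show ?thesis using L2_norm_eq_0_iff[OF L2_diff[OF f g]] by simp
qed

text \<open>Riesz-Fischer: the \<open>L2\<close> norm dominates the \<open>L1\<close> norm on a
  space of measure one, which yields an almost everywhere convergent subsequence; Fatou's lemma
  upgrades this to convergence in norm.\<close>

theorem L2_complete:
  assumes f: "\<And>n. f n \<in> L2"
    and cauchy: "\<And>e. e > 0 \<Longrightarrow> \<exists>N. \<forall>m\<ge>N. \<forall>n\<ge>N. L2_norm (\<lambda>x. f m x - f n x) < e"
  obtains g where "g \<in> L2" "(\<lambda>n. L2_norm (\<lambda>x. f n x - g x)) \<longlonglongrightarrow> 0"
proof -
  have [measurable]: "f n \<in> borel_measurable \<mu>" for n using f L2_measurable by blast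
  obtain r where r: "strict_mono r" "AE x in \<mu>. Cauchy (\<lambda>i. f (r i) x)"
  proof (rule cauchy_L1_AE_cauchy_subseq[of \<mu> f])
    show "integrable \<mu> (f n)" for n using f L2_integrable by blast
    fix e :: real assume "e > 0"
    then obtain N where "\<forall>m\<ge>N. \<forall>n\<ge>N. L2_norm (\<lambda>x. f m x - f n x) < e" using cauchy by blast
    then show "\<exists>N. \<forall>i\<ge>N. \<forall>j\<ge>N. (LINT x|\<mu>. norm (f i x - f j x)) < e"
      using L2_integral_bound[OF L2_diff[OF f f]] by (meson le_less_trans)
  qed
  define g where "g x = lim (\<lambda>i. f (r i) x)" for x
  have [measurable]: "g \<in> borel_measurable \<mu>" unfolding g_def by measurable
  have gl: "AE x in \<mu>. (\<lambda>i. f (r i) x) \<longlonglongrightarrow> g x"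
    using r(2) by eventually_elim (simp add: g_def Cauchy_convergent_iff convergent_LIMSEQ_iff)
  have nn: "(\<integral>\<^sup>+x. ennreal ((cmod (h x))\<^sup>2) \<partial>\<mu>) = ennreal ((L2_norm h)\<^sup>2)" if "h \<in> L2" for h
    unfolding L2_norm_square by (rule nn_integral_eq_integral[OF L2_integrable_square[OF that]]) simp
  have key: "(\<lambda>x. f n x - g x) \<in> L2 \<and> L2_norm (\<lambda>x. f n x - g x) \<le> e"
    if e: "e > 0" and n: "\<forall>m\<ge>n. L2_norm (\<lambda>x. f n x - f m x) < e" for n e
  proof -
    have "(\<integral>\<^sup>+x. ennreal ((cmod (f n x - g x))\<^sup>2) \<partial>\<mu>) = (\<integral>\<^sup>+x. liminf (\<lambda>i. ennreal ((cmod (f n x - f (r i) x))\<^sup>2)) \<partial>\<mu>)"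
    proof (rule nn_integral_cong_AE)
      show "AE x in \<mu>. ennreal ((cmod (f n x - g x))\<^sup>2) = liminf (\<lambda>i. ennreal ((cmod (f n x - f (r i) x))\<^sup>2))"
        using gl
      proof eventually_elim
        case (elim x)
        have "(\<lambda>i. ennreal ((cmod (f n x - f (r i) x))\<^sup>2)) \<longlonglongrightarrow> ennreal ((cmod (f n x - g x))\<^sup>2)"
          by (intro tendsto_intros elim)
        then show ?case by (rule lim_imp_Liminf[symmetric, rotated]) simp
      qed
    qed
    also have "\<dots> \<le> liminf (\<lambda>i. \<integral>\<^sup>+x. ennreal ((cmod (f n x - f (r i) x))\<^sup>2) \<partial>\<mu>)"
      by (rule nn_integral_liminf) measurable
    also have "\<dots> \<le> ennreal (e\<^sup>2)"
    proof (rule Liminf_le)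
      show "\<forall>\<^sub>F i in sequentially. (\<integral>\<^sup>+x. ennreal ((cmod (f n x - f (r i) x))\<^sup>2) \<partial>\<mu>) \<le> ennreal (e\<^sup>2)"
        using eventually_ge_at_top[of n]
      proof eventually_elim
        case (elim i)
        then have "r i \<ge> n" using seq_suble[OF r(1), of i] by simp
        then have "L2_norm (\<lambda>x. f n x - f (r i) x) \<le> e" using n less_imp_le by blast
        then show ?case unfolding nn[OF L2_diff[OF f f]] by (intro ennreal_leI power_mono) auto
      qed
    qed simp
    finally have le: "(\<integral>\<^sup>+x. ennreal ((cmod (f n x - g x))\<^sup>2) \<partial>\<mu>) \<le> ennreal (e\<^sup>2)" .
    have "integrable \<mu> (\<lambda>x. (cmod (f n x - g x))\<^sup>2)"
      unfolding integrable_iff_bounded using le by (auto simp: less_top[symmetric] top_unique)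
    then have 1: "(\<lambda>x. f n x - g x) \<in> L2" by (simp add: L2_def)
    from le nn[OF 1] have "(L2_norm (\<lambda>x. f n x - g x))\<^sup>2 \<le> e\<^sup>2" by simp
    then show ?thesis using 1 e by (auto intro: power2_le_imp_le)
  qed
  obtain n0 where "\<forall>m\<ge>n0. \<forall>n\<ge>n0. L2_norm (\<lambda>x. f m x - f n x) < 1" using cauchy[of 1] by auto
  then have "(\<lambda>x. f n0 x - g x) \<in> L2" using key[of 1 n0] by auto
  from L2_diff[OF f[of n0] this] have g: "g \<in> L2" by simp
  moreover have "(\<lambda>n. L2_norm (\<lambda>x. f n x - g x)) \<longlonglongrightarrow> 0"
  proof (rule LIMSEQ_I)
    fix e :: real assume e: "e > 0"
    obtain N where "\<forall>m\<ge>N. \<forall>n\<ge>N. L2_norm (\<lambda>x. f m x - f n x) < e/2" using cauchy[of "e/2"] e by auto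
    then have "\<forall>n\<ge>N. L2_norm (\<lambda>x. f n x - g x) \<le> e/2"
      using key[of "e/2"] e by (metis half_gt_zero order.trans)
    then show "\<exists>N. \<forall>n\<ge>N. norm (L2_norm (\<lambda>x. f n x - g x) - 0) < e" using e by (intro exI[of _ N]) force
  qed
  ultimately show thesis using that by blast
qed

section \<open>Fourier series\<close>

definition ex :: "int \<Rightarrow> real \<Rightarrow> complex" where "ex k x = cis (2 * pi * of_int k * x)"

lemma ex_add: "ex j x * ex k x = ex (j + k) x"
  by (simp add: ex_def cis_mult algebra_simps)

lemma ex_0: "ex 0 x = 1"
  by (simp add: ex_def)

lemma cnj_ex: "cnj (ex k x) = ex (- k) x"
  by (simp add: ex_def cis_cnj)

lemma norm_ex [simp]: "cmod (ex k x) = 1"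
  by (simp add: ex_def)

lemma ex_at_0 [simp]: "ex k 0 = 1"
  by (simp add: ex_def)

lemma ex_at_1 [simp]: "ex k 1 = 1"
  by (simp add: ex_def complex_eq_iff)

lemma ex_has_derivative:
  "(ex k has_vector_derivative (2 * pi * \<i> * of_int k) * ex k x) (at x within S)"
  unfolding ex_def has_vector_derivative_complex_iff
  by (auto intro!: derivative_eq_intros)

lemma continuous_ex [continuous_intros]: "continuous_on S (ex k)"
  unfolding ex_def by (intro continuous_intros)

lemma ex_L2: "ex k \<in> L2"
  by (intro L2_continuous continuous_intros)

lemma lint_eq_integral:
  fixes f :: "real \<Rightarrow> complex"
  assumes "integrable \<mu> f"
  shows "(LINT x|\<mu>. f x) = integral {0..1} f"
  using assms by (simp add: lebesgue_integral_eq_integral)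

lemma continuous_integrable_mu:
  fixes f :: "real \<Rightarrow> complex"
  shows "continuous_on {0..1} f \<Longrightarrow> integrable \<mu> f"
  using L2_integrable L2_continuous by blast

lemma has_integral_lint:
  fixes f :: "real \<Rightarrow> complex"
  assumes "integrable \<mu> f" "(f has_integral I) {0..1}"
  shows "(LINT x|\<mu>. f x) = I"
  using lint_eq_integral[OF assms(1)] integral_unique[OF assms(2)] by simp

lemma integral_ex: "(LINT x|\<mu>. ex k x) = (if k = 0 then 1 else 0)"
proof (cases "k = 0")
  case True
  then show ?thesis using measure_mu_space by (simp add: ex_0)
next
  case False
  have "((\<lambda>x. ex k x) has_integral ex k 1 / (2 * pi * \<i> * of_int k) - ex k 0 / (2 * pi * \<i> * of_int k)) {0..1}"
  proof (rule fundamental_theorem_of_calculus)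
    fix x :: real
    show "((\<lambda>x. ex k x / (2 * pi * \<i> * of_int k)) has_vector_derivative ex k x) (at x within {0..1})"
      using has_vector_derivative_divide[OF ex_has_derivative[of k x "{0..1}"], of "2 * pi * \<i> * of_int k"] False by simp
  qed simp
  then show ?thesis using has_integral_lint[OF continuous_integrable_mu[OF continuous_ex]] False by simp
qed

lemma L2_inner_ex: "L2_inner (ex j) (ex k) = (if j = k then 1 else 0)"
  by (simp add: L2_inner_def cnj_ex ex_add integral_ex)

definition fc :: "(real \<Rightarrow> complex) \<Rightarrow> int \<Rightarrow> complex" where "fc f k = (LINT x|\<mu>. f x * ex (- k) x)"

lemma fc_inner: "fc f k = L2_inner f (ex k)"
  by (simp add: fc_def L2_inner_def cnj_ex)

lemma fc_add: "f \<in> L2 \<Longrightarrow> g \<in> L2 \<Longrightarrow> fc (\<lambda>x. f x + g x) k = fc f k + fc g k"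
  unfolding fc_def by (simp add: distrib_right L2_integrable_mult ex_L2)

lemma fc_diff: "f \<in> L2 \<Longrightarrow> g \<in> L2 \<Longrightarrow> fc (\<lambda>x. f x - g x) k = fc f k - fc g k"
  unfolding fc_def by (simp add: left_diff_distrib L2_integrable_mult ex_L2)

lemma fc_cmult: "fc (\<lambda>x. c * f x) k = c * fc f k"
  unfolding fc_def by (simp add: mult.assoc)

lemma fc_sum: "(\<And>i. i \<in> I \<Longrightarrow> f i \<in> L2) \<Longrightarrow> fc (\<lambda>x. \<Sum>i\<in>I. f i x) k = (\<Sum>i\<in>I. fc (f i) k)"
proof (induction I rule: infinite_finite_induct)
  case (insert i I)
  then show ?case by (simp add: fc_add L2_sum)
qed (simp_all add: fc_def)

lemma fc_ex: "fc (ex j) k = (if j = k then 1 else 0)"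
  by (simp add: fc_inner L2_inner_ex)

lemma fc_lincomb_ex: "finite F \<Longrightarrow> fc (\<lambda>x. \<Sum>j\<in>F. c j * ex j x) k = (if k \<in> F then c k else 0)"
  by (subst fc_sum) (auto simp: fc_cmult fc_ex L2_cmult ex_L2 if_distrib cong: if_cong)

lemma fc_bound: "f \<in> L2 \<Longrightarrow> cmod (fc f k) \<le> L2_norm f"
  using L2_inner_bound[of f "ex k"] ex_L2[of k] measure_mu_space by (simp add: fc_inner L2_norm_def)

section \<open>Completeness of the exponentials\<close>

text \<open>Stone-Weierstrass on the circle supplies real polynomials in the plane. Along
  \<open>ex 1\<close> they become trigonometric polynomials: a linear functional involves the
  frequencies \<open>1\<close> and \<open>-1\<close> only, and products add frequencies.\<close>

lemma trig_real_polynomial: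
  assumes "real_polynomial_function (p :: complex \<Rightarrow> real)"
  shows "\<exists>F c. finite F \<and> (\<forall>x. complex_of_real (p (ex 1 x)) = (\<Sum>k\<in>F. c k * ex k x))"
  using assms
proof induction
  case (linear f)
  interpret bounded_linear f by fact
  have "complex_of_real (f (ex 1 x)) =
     ((of_real (f 1) - \<i> * of_real (f \<i>)) / 2 * ex 1 x + (of_real (f 1) + \<i> * of_real (f \<i>)) / 2 * ex (-1) x)" for x
  proof -
    have "ex 1 x = Re (ex 1 x) *\<^sub>R 1 + Im (ex 1 x) *\<^sub>R \<i>" by (simp add: complex_eq_iff)
    then have "f (ex 1 x) = Re (ex 1 x) * f 1 + Im (ex 1 x) * f \<i>" by (metis add scaleR real_scaleR_def)
    then show ?thesis
      by (simp add: complex_eq_iff cnj_ex[symmetric] ex_def algebra_simps add_divide_distrib diff_divide_distrib)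
  qed
  then show ?case
    by (intro exI[of _ "{1,-1}"] exI[of _ "\<lambda>k. if k = 1 then (of_real (f 1) - \<i> * of_real (f \<i>)) / 2 else (of_real (f 1) + \<i> * of_real (f \<i>)) / 2"])
      simp
next
  case (const c)
  show ?case by (intro exI[of _ "{0}"] exI[of _ "\<lambda>k. of_real c"]) (simp add: ex_0)
next
  case (add f g)
  then obtain F c G d where F: "finite F" "\<And>x. complex_of_real (f (ex 1 x)) = (\<Sum>k\<in>F. c k * ex k x)"
    and G: "finite G" "\<And>x. complex_of_real (g (ex 1 x)) = (\<Sum>k\<in>G. d k * ex k x)" by metis
  have "(\<Sum>k\<in>F. c k * ex k x) = (\<Sum>k\<in>F\<union>G. (if k \<in> F then c k else 0) * ex k x)" for x
    by (rule sum.mono_neutral_cong_left) (use F G in auto)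
  moreover have "(\<Sum>k\<in>G. d k * ex k x) = (\<Sum>k\<in>F\<union>G. (if k \<in> G then d k else 0) * ex k x)" for x
    by (rule sum.mono_neutral_cong_left) (use F G in auto)
  ultimately show ?case using F G
    by (intro exI[of _ "F \<union> G"] exI[of _ "\<lambda>k. (if k \<in> F then c k else 0) + (if k \<in> G then d k else 0)"])
      (simp add: sum.distrib distrib_right)
next
  case (mult f g)
  then obtain F c G d where F: "finite F" "\<And>x. complex_of_real (f (ex 1 x)) = (\<Sum>k\<in>F. c k * ex k x)"
    and G: "finite G" "\<And>x. complex_of_real (g (ex 1 x)) = (\<Sum>k\<in>G. d k * ex k x)" by metis
  define H where "H = (\<lambda>(i,j). i + j) ` (F \<times> G)"
  have "complex_of_real (f (ex 1 x) * g (ex 1 x)) = (\<Sum>k\<in>H. (\<Sum>(i,j)\<in>{p\<in>F\<times>G. (\<lambda>(i,j). i + j) p = k}. c i * d j) * ex k x)" for x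
  proof -
    have "complex_of_real (f (ex 1 x) * g (ex 1 x)) = (\<Sum>(i,j)\<in>F\<times>G. c i * d j * ex (i + j) x)"
      by (simp add: F G sum_product sum.cartesian_product ex_add[symmetric] mult_ac)
    also have "\<dots> = (\<Sum>k\<in>H. \<Sum>(i,j)\<in>{p\<in>F\<times>G. (\<lambda>(i,j). i + j) p = k}. c i * d j * ex (i + j) x)"
      unfolding H_def by (rule sum.image_gen) (use F G in auto)
    also have "\<dots> = (\<Sum>k\<in>H. (\<Sum>(i,j)\<in>{p\<in>F\<times>G. (\<lambda>(i,j). i + j) p = k}. c i * d j) * ex k x)"
      by (rule sum.cong[OF refl]) (auto simp: sum_distrib_right intro!: sum.cong)
    finally show ?thesis .
  qed
  then show ?case using F G by (intro exI[of _ H] exI[of _ "\<lambda>k. \<Sum>(i,j)\<in>{p\<in>F\<times>G. (\<lambda>(i,j). i + j) p = k}. c i * d j"]) (auto simp: H_def)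
qed

lemma integral_circle_function_zero:
  assumes f: "f \<in> L2" and z: "\<And>k. fc f k = 0" and \<phi>: "continuous_on UNIV (\<phi> :: complex \<Rightarrow> real)"
  shows "(LINT x|\<mu>. f x * of_real (\<phi> (ex 1 x))) = 0"
proof -
  have \<phi>c: "continuous_on {0..1} (\<lambda>x. complex_of_real (\<phi> (ex 1 x)))"
    by (intro continuous_intros continuous_on_compose2[OF \<phi>]) auto
  have "cmod (LINT x|\<mu>. f x * of_real (\<phi> (ex 1 x))) \<le> 0 + e" if e: "e > 0" for e
  proof -
    define e' where "e' = e / (L2_norm f + 1)"
    have n1: "L2_norm f + 1 > 0" by (simp add: add_nonneg_pos)
    then have e': "e' > 0" using e by (simp add: e'_def)
    obtain p where p: "real_polynomial_function p" "\<And>z. z \<in> sphere 0 1 \<Longrightarrow> \<bar>\<phi> z - p z\<bar> < e'"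
      using Stone_Weierstrass_real_polynomial_function[of "sphere 0 1" \<phi> e'] e' \<phi> continuous_on_subset
      by (metis compact_sphere subset_UNIV)
    obtain F c where F: "finite F" "\<And>x. complex_of_real (p (ex 1 x)) = (\<Sum>k\<in>F. c k * ex k x)"
      using trig_real_polynomial[OF p(1)] by blast
    have pc: "continuous_on {0..1} (\<lambda>x. complex_of_real (p (ex 1 x)))"
      unfolding F by (intro continuous_intros)
    have "(LINT x|\<mu>. f x * of_real (p (ex 1 x))) = (LINT x|\<mu>. (\<Sum>k\<in>F. c k * (f x * ex k x)))"
      by (simp add: F sum_distrib_left mult_ac)
    also have "\<dots> = (\<Sum>k\<in>F. c k * fc f (-k))"
      by (subst Bochner_Integration.integral_sum) (auto simp: fc_def L2_integrable_mult f ex_L2)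
    also have "\<dots> = 0" by (simp add: z)
    finally have p0: "(LINT x|\<mu>. f x * of_real (p (ex 1 x))) = 0" .
    have "(LINT x|\<mu>. f x * of_real (\<phi> (ex 1 x))) = (LINT x|\<mu>. f x * of_real (\<phi> (ex 1 x)) - f x * of_real (p (ex 1 x)))"
      using p0 L2_integrable_mult[OF f L2_continuous[OF \<phi>c]] L2_integrable_mult[OF f L2_continuous[OF pc]] by simp
    also have "\<dots> = (LINT x|\<mu>. f x * (of_real (\<phi> (ex 1 x)) - of_real (p (ex 1 x))))"
      by (simp add: algebra_simps)
    also have "cmod \<dots> \<le> L2_norm f * L2_norm (\<lambda>x. of_real (\<phi> (ex 1 x)) - of_real (p (ex 1 x)))"
      by (rule L2_Cauchy_Schwarz[OF f L2_diff[OF L2_continuous[OF \<phi>c] L2_continuous[OF pc]]])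
    also have "\<dots> \<le> L2_norm f * e'"
    proof (rule mult_left_mono[OF L2_bounded(2)])
      show "(\<lambda>x. complex_of_real (\<phi> (ex 1 x)) - complex_of_real (p (ex 1 x))) \<in> borel_measurable \<mu>"
        by (intro continuous_measurable_mu continuous_intros \<phi>c pc)
      show "cmod (complex_of_real (\<phi> (ex 1 x)) - complex_of_real (p (ex 1 x))) \<le> e'" for x
        using p(2)[of "ex 1 x"] by (simp flip: of_real_diff)
    qed simp
    also have "\<dots> \<le> (L2_norm f + 1) * e'" using e' by simp
    also have "\<dots> = e" using n1 by (simp add: e'_def)
    finally show ?thesis by simp
  qed
  from field_le_epsilon[OF this] show ?thesis by simp
qed

text \<open>The indicator of \<open>K\<close> is a pointwise limit of the continuous functions
  \<open>\<phi> n\<close> on the circle, for which the integral is already known to vanish. The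
  points \<open>0\<close> and \<open>1\<close> have the same image under \<open>ex 1\<close> and are
  left out as a null set.\<close>

lemma integral_compact_zero:
  assumes f: "f \<in> L2" and z: "\<And>k. fc f k = 0" and K: "compact K" "K \<subseteq> {0..1}"
  shows "(LINT x|\<mu>. indicator K x * f x) = 0"
proof (cases "K = {}")
  case False
  define C where "C = ex 1 ` K"
  have C: "compact C" "C \<noteq> {}" unfolding C_def using K False by (auto intro!: compact_continuous_image continuous_intros)
  define \<phi> where "\<phi> n z = max 0 (1 - real n * infdist z C)" for n z
  have \<phi>c: "continuous_on UNIV (\<phi> n)" for n unfolding \<phi>_def[abs_def] by (intro continuous_intros)
  have inj: "x \<in> K" if x01: "x \<in> {0<..<1}" and xC: "ex 1 x \<in> C" for x
  proof -
    obtain y where y: "y \<in> K" "ex 1 x = ex 1 y" using xC by (auto simp: C_def)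
    then have "sin (2 * pi * x) = sin (2 * pi * y)" "cos (2 * pi * x) = cos (2 * pi * y)" by (auto simp: ex_def complex_eq_iff)
    then obtain n :: int where n: "2 * pi * x = 2 * pi * y + 2 * pi * of_int n"
      using sin_cos_eq_iff[of "2 * pi * x" "2 * pi * y"] by (auto simp: mult_ac)
    have "2 * pi * x = 2 * pi * (y + of_int n)" using n by (simp add: algebra_simps)
    then have xy: "x = y + of_int n" using pi_gt_zero by simp
    moreover have "0 \<le> y" "y \<le> 1" using y(1) K(2) by auto
    ultimately have "-1 < real_of_int n" "real_of_int n < 1" using x01 by auto
    then have "n = 0" by linarith
    then show ?thesis using xy y(1) by simp
  qed
  have lim: "(\<lambda>n. \<phi> n (ex 1 x)) \<longlonglongrightarrow> indicator K x" if x: "x \<in> {0<..<1}" for x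
  proof (cases "x \<in> K")
    case True
    then have "ex 1 x \<in> C" by (auto simp: C_def)
    then show ?thesis using True by (simp add: \<phi>_def)
  next
    case False
    then have "ex 1 x \<notin> C" using inj x by blast
    then have d: "infdist (ex 1 x) C > 0"
      using C compact_imp_closed in_closed_iff_infdist_zero[of C "ex 1 x"] infdist_nonneg[of "ex 1 x" C] by force
    obtain N where N: "1 / infdist (ex 1 x) C < real N" using reals_Archimedean2 by blast
    have "\<forall>\<^sub>F n in sequentially. \<phi> n (ex 1 x) = 0"
      using eventually_ge_at_top[of N]
    proof eventually_elim
      case (elim n)
      then have "1 / infdist (ex 1 x) C < real n" using N by linarith
      then show ?case using d by (simp add: \<phi>_def field_simps)
    qed
    then show ?thesis using False by (simp add: tendsto_eventually)
  qed
  have Km: "(\<lambda>x. indicator K x * f x :: complex) \<in> borel_measurable \<mu>"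
  proof -
    have "K \<in> sets \<mu>" using K by (auto simp: sets_restrict_space_iff compact_imp_closed borel_closed)
    then show ?thesis using L2_measurable[OF f] by measurable
  qed
  have "(\<lambda>n. LINT x|\<mu>. f x * of_real (\<phi> n (ex 1 x))) \<longlonglongrightarrow> (LINT x|\<mu>. indicator K x * f x)"
  proof (rule integral_dominated_convergence[where w = "\<lambda>x. cmod (f x)"])
    show "(\<lambda>x. f x * of_real (\<phi> n (ex 1 x))) \<in> borel_measurable \<mu>" for n
      by (intro borel_measurable_times L2_measurable f continuous_measurable_mu continuous_intros continuous_on_compose2[OF \<phi>c]) auto
    show "integrable \<mu> (\<lambda>x. cmod (f x))" using L2_integrable[OF f] by simp
    have "negligible {0, 1::real}" by (simp add: negligible_finite)
    then have "AE x in \<mu>. x \<notin> {0, 1}"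
      by (intro AE_restrict_space_iff[THEN iffD2] AE_I'[of "{0,1}"]) (auto simp: negligible_iff_null_sets)
    then show "AE x in \<mu>. (\<lambda>n. f x * of_real (\<phi> n (ex 1 x))) \<longlonglongrightarrow> indicator K x * f x"
    proof (rule AE_mp, intro AE_I2 impI)
      fix x assume "x \<in> space \<mu>" "x \<notin> {0, 1::real}"
      then have "x \<in> {0<..<1}" by auto
      have "(\<lambda>n. f x * complex_of_real (\<phi> n (ex 1 x))) \<longlonglongrightarrow> f x * of_real (indicator K x)"
        by (intro tendsto_intros lim \<open>x \<in> {0<..<1}\<close>)
      moreover have "f x * of_real (indicator K x) = indicator K x * f x" by (cases "x \<in> K") auto
      ultimately show "(\<lambda>n. f x * complex_of_real (\<phi> n (ex 1 x))) \<longlonglongrightarrow> indicator K x * f x" by simp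
    qed
    show "AE x in \<mu>. norm (f x * complex_of_real (\<phi> n (ex 1 x))) \<le> cmod (f x)" for n
      by (rule AE_I2) (auto simp: norm_mult \<phi>_def infdist_nonneg intro!: mult_left_le)
  qed (use Km in auto)
  then show ?thesis using integral_circle_function_zero[OF f z \<phi>c] by (simp add: LIMSEQ_const_iff)
qed simp

text \<open>If \<open>h\<close> were at least \<open>1 / Suc n\<close> on a set of positive measure,
  inner regularity would give a compact subset of positive measure, over which the integral is
  positive.\<close>

lemma nonpos_AE_of_compact_integrals:
  fixes h :: "real \<Rightarrow> real"
  assumes h: "integrable \<mu> h" and z: "\<And>K. compact K \<Longrightarrow> K \<subseteq> {0..1} \<Longrightarrow> (LINT x|\<mu>. indicator K x * h x) = 0"
  shows "AE x in \<mu>. h x \<le> 0"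
proof -
  have "{x \<in> {0..1}. h x \<ge> 1 / Suc n} \<in> null_sets \<mu>" for n
  proof (rule ccontr)
    define E where "E = {x \<in> {0..1}. h x \<ge> 1 / Suc n}"
    assume E0: "{x \<in> {0..1}. h x \<ge> 1 / Suc n} \<notin> null_sets \<mu>"
    have "{x \<in> space \<mu>. h x \<ge> 1 / Suc n} \<in> sets \<mu>" using h by measurable
    then have Emu: "E \<in> sets \<mu>" by (simp add: E_def)
    then have El: "E \<in> sets lebesgue" by (auto simp: sets_restrict_space_iff)
    have Ef: "E \<in> lmeasurable" using El by (rule bounded_set_imp_lmeasurable[rotated]) (auto simp: E_def intro: bounded_subset[of "{0..1}"])
    have "E \<notin> null_sets \<mu>" using E0 unfolding E_def .
    then have "emeasure lebesgue E \<noteq> 0" using Emu by (auto simp: null_sets_def emeasure_restrict_space sets_restrict_space_iff Int_absorb2)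
    then have mE: "measure lebesgue E > 0" using Ef by (simp add: emeasure_eq_measure2 zero_less_measure_iff)
    obtain K where K: "closed K" "K \<subseteq> E" "(E - K) \<in> lmeasurable" "emeasure lebesgue (E - K) < ennreal (measure lebesgue E)"
      using sets_lebesgue_inner_closed[OF El mE] by metis
    have K01: "K \<subseteq> {0..1}" using K(2) by (auto simp: E_def)
    then have "bounded K" by (rule bounded_subset[rotated]) simp
    then have Kc: "compact K" using K(1) by (simp add: compact_eq_bounded_closed)
    then have Kl: "K \<in> lmeasurable" by (rule lmeasurable_compact)
    have "measure lebesgue (E - K) = measure lebesgue E - measure lebesgue K"
      by (rule measurable_measure_Diff[OF Ef]) (use Kl K(2) in auto)
    moreover have "measure lebesgue (E - K) < measure lebesgue E"
      using K(3,4) mE by (simp add: emeasure_eq_measure2 ennreal_less_iff)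
    ultimately have mK: "measure lebesgue K > 0" by simp
    have Kmu: "K \<in> sets \<mu>" using Kl K01 by (auto simp: sets_restrict_space_iff)
    have "(LINT x|\<mu>. indicator K x * (1 / Suc n)) \<le> (LINT x|\<mu>. indicator K x * h x)"
    proof (rule integral_mono)
      show "integrable \<mu> (\<lambda>x. indicator K x * (1 / real (Suc n)))"
        using Kmu by (intro integrable_mult_left integrable_real_indicator) (auto simp: mu.emeasure_finite less_top[symmetric])
      show "integrable \<mu> (\<lambda>x. indicator K x * h x)"
        using integrable_mult_indicator[OF Kmu h] by simp
      show "indicator K x * (1 / real (Suc n)) \<le> indicator K x * h x" for x
        using K(2) by (auto simp: indicator_def E_def)
    qed
    moreover have "(LINT x|\<mu>. indicator K x * (1 / Suc n)) = measure lebesgue K * (1 / Suc n)"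
      using Kmu K01 by (simp add: measure_restrict_space Int_absorb2)
    ultimately show False using z[OF Kc K01] mK by (simp add: divide_simps split: if_splits)
  qed
  then have "(\<Union>n. {x \<in> {0..1}. h x \<ge> 1 / Suc n}) \<in> null_sets \<mu>" by (intro null_sets_UN) auto
  moreover have "{x \<in> space \<mu>. \<not> h x \<le> 0} \<subseteq> (\<Union>n. {x \<in> {0..1}. h x \<ge> 1 / Suc n})"
  proof
    fix x assume x: "x \<in> {x \<in> space \<mu>. \<not> h x \<le> 0}"
    then obtain n where "1 / Suc n < h x" using nat_approx_posE[of "h x"] by auto
    then show "x \<in> (\<Union>n. {x \<in> {0..1}. h x \<ge> 1 / Suc n})" using x by (auto intro!: exI[of _ n])
  qed
  ultimately show ?thesis by (rule AE_I'[of _ \<mu>])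
qed

lemma indicator_scaleR_eq: "indicator K x *\<^sub>R z = indicator K x * (z :: complex)"
  by (simp add: indicator_def)

text \<open>Integrals over compact sets vanish, and a real functional may be moved inside them; the
  sign criterion is then applied to the real and imaginary parts and to their negatives.\<close>

theorem fc_zero_imp_AE_zero:
  assumes f: "f \<in> L2" and z: "\<And>k. fc f k = 0"
  shows "AE x in \<mu>. f x = 0"
proof -
  have int: "integrable \<mu> f" using L2_integrable[OF f] .
  have gen: "AE x in \<mu>. g (f x) \<le> 0" if g: "bounded_linear (g :: complex \<Rightarrow> real)" for g
  proof (rule nonpos_AE_of_compact_integrals)
    interpret bounded_linear g by fact
    show "integrable \<mu> (\<lambda>x. g (f x))" by (rule integrable_bounded_linear[OF g int])
    fix K :: "real set" assume K: "compact K" "K \<subseteq> {0..1}"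
    then have Kmu: "K \<in> sets \<mu>" by (auto simp: sets_restrict_space_iff compact_imp_closed borel_closed)
    have "(LINT x|\<mu>. indicator K x * g (f x)) = (LINT x|\<mu>. g (indicator K x * f x))"
      by (rule Bochner_Integration.integral_cong) (auto simp: indicator_def zero)
    also have "\<dots> = g (LINT x|\<mu>. indicator K x * f x)"
      by (rule integral_bounded_linear[OF g])
        (use integrable_mult_indicator[OF Kmu int] in \<open>simp add: indicator_scaleR_eq\<close>)
    also have "\<dots> = 0" using integral_compact_zero[OF f z K] by (simp add: zero)
    finally show "(LINT x|\<mu>. indicator K x * g (f x)) = 0" .
  qed
  have "AE x in \<mu>. Re (f x) \<le> 0" "AE x in \<mu>. Im (f x) \<le> 0" "AE x in \<mu>. - Re (f x) \<le> 0" "AE x in \<mu>. - Im (f x) \<le> 0"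
    by (intro gen bounded_linear_Re bounded_linear_Im bounded_linear_minus)+
  then show ?thesis
    by eventually_elim (auto simp: complex_eq_iff)
qed

lemma L2_norm_square_inner: "complex_of_real ((L2_norm f)\<^sup>2) = L2_inner f f"
proof -
  have "L2_inner f f = (LINT x|\<mu>. complex_of_real ((cmod (f x))\<^sup>2))"
    unfolding L2_inner_def by (intro Bochner_Integration.integral_cong) (simp_all only: complex_norm_square)
  also have "\<dots> = complex_of_real (LINT x|\<mu>. (cmod (f x))\<^sup>2)" by (rule integral_complex_of_real)
  finally show ?thesis by (simp add: L2_norm_square)
qed

lemma L2_inner_lincomb_left:
  assumes "\<And>i. i \<in> F \<Longrightarrow> f i \<in> L2" "g \<in> L2"
  shows "L2_inner (\<lambda>x. \<Sum>i\<in>F. c i * f i x) g = (\<Sum>i\<in>F. c i * L2_inner (f i) g)"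
proof -
  have "L2_inner (\<lambda>x. \<Sum>i\<in>F. c i * f i x) g = (LINT x|\<mu>. (\<Sum>i\<in>F. c i * (f i x * cnj (g x))))"
    unfolding L2_inner_def by (simp add: sum_distrib_right mult.assoc)
  also have "\<dots> = (\<Sum>i\<in>F. c i * L2_inner (f i) g)"
    unfolding L2_inner_def using assms
    by (subst Bochner_Integration.integral_sum) (auto intro!: integrable_mult_right L2_integrable_mult L2_cnj)
  finally show ?thesis .
qed

lemma L2_inner_cnj: "L2_inner g f = cnj (L2_inner f g)"
  unfolding L2_inner_def 
  by (subst Bochner_Integration.integral_cnj[symmetric]) (simp add: mult.commute)

lemma L2_norm_trig:
  assumes "finite F"
  shows "(L2_norm (\<lambda>x. \<Sum>k\<in>F. c k * ex k x))\<^sup>2 = (\<Sum>k\<in>F. (cmod (c k))\<^sup>2)"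
proof -
  let ?f = "\<lambda>x. \<Sum>k\<in>F. c k * ex k x"
  have f: "?f \<in> L2" by (intro L2_lincomb ex_L2)
  have "complex_of_real ((L2_norm ?f)\<^sup>2) = (\<Sum>k\<in>F. c k * L2_inner (ex k) ?f)"
    unfolding L2_norm_square_inner by (rule L2_inner_lincomb_left) (auto intro: ex_L2 f)
  also have "\<dots> = (\<Sum>k\<in>F. c k * cnj (c k))"
  proof (rule sum.cong[OF refl])
    fix k assume "k \<in> F"
    then show "c k * L2_inner (ex k) ?f = c k * cnj (c k)"
      using fc_lincomb_ex[OF assms, of c k] by (simp add: L2_inner_cnj[of "ex k"] fc_inner)
  qed
  also have "\<dots> = complex_of_real (\<Sum>k\<in>F. (cmod (c k))\<^sup>2)" by (simp only: complex_norm_square of_real_sum)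
  finally show ?thesis using of_real_eq_iff by blast
qed

lemma L2_norm_diff_trig:
  assumes f: "f \<in> L2" and F: "finite F"
  shows "(L2_norm (\<lambda>x. f x - (\<Sum>k\<in>F. fc f k * ex k x)))\<^sup>2 = (L2_norm f)\<^sup>2 - (\<Sum>k\<in>F. (cmod (fc f k))\<^sup>2)"
proof -
  let ?g = "\<lambda>x. \<Sum>k\<in>F. fc f k * ex k x"
  let ?h = "\<lambda>x. f x - ?g x"
  have g: "?g \<in> L2" by (intro L2_lincomb ex_L2)
  have h: "?h \<in> L2" by (rule L2_diff[OF f g])
  have "L2_inner ?g ?h = (\<Sum>k\<in>F. fc f k * L2_inner (ex k) ?h)"
    by (rule L2_inner_lincomb_left) (auto intro: ex_L2 h)
  also have "\<dots> = 0"
  proof (rule sum.neutral, rule ballI)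
    fix k assume "k \<in> F"
    then have "fc ?h k = 0" by (subst fc_diff[OF f g]) (simp add: fc_lincomb_ex[OF F])
    then show "fc f k * L2_inner (ex k) ?h = 0" by (simp add: L2_inner_cnj[of "ex k"] fc_inner)
  qed
  finally have gh: "L2_inner ?g ?h = 0" .
  have hg: "L2_inner ?h ?g = 0" using gh L2_inner_cnj[of ?h ?g] by simp
  have "L2_inner f f = (LINT x|\<mu>. (?h x * cnj (?h x) + ?h x * cnj (?g x)) + (?g x * cnj (?h x) + ?g x * cnj (?g x)))"
    unfolding L2_inner_def by (intro Bochner_Integration.integral_cong) (simp_all add: algebra_simps)
  also have "\<dots> = (L2_inner ?h ?h + L2_inner ?h ?g) + (L2_inner ?g ?h + L2_inner ?g ?g)"
    unfolding L2_inner_def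
    by (subst Bochner_Integration.integral_add; (intro Bochner_Integration.integrable_add L2_integrable_mult L2_cnj h g)?)+ simp
  finally have "complex_of_real ((L2_norm f)\<^sup>2) = complex_of_real ((L2_norm ?h)\<^sup>2 + (L2_norm ?g)\<^sup>2)"
    by (simp add: gh hg flip: L2_norm_square_inner)
  then have "(L2_norm f)\<^sup>2 = (L2_norm ?h)\<^sup>2 + (L2_norm ?g)\<^sup>2" by (simp only: of_real_eq_iff)
  then show ?thesis using L2_norm_trig[OF F, of "fc f"] by simp
qed

section \<open>Bessel, Parseval and Riemann-Lebesgue\<close>

lemma bessel:
  "f \<in> L2 \<Longrightarrow> finite F \<Longrightarrow> (\<Sum>k\<in>F. (cmod (fc f k))\<^sup>2) \<le> (L2_norm f)\<^sup>2"
  using L2_norm_diff_trig[of f F] zero_le_power2[of "L2_norm (\<lambda>x. f x - (\<Sum>k\<in>F. fc f k * ex k x))"] by linarith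

lemma AE_imp1: "AE x in M. P x \<Longrightarrow> (\<And>x. P x \<Longrightarrow> Q x) \<Longrightarrow> AE x in M. Q x"
  by (erule eventually_mono)

lemma AE_imp2: "AE x in M. P x \<Longrightarrow> AE x in M. Q x \<Longrightarrow> (\<And>x. P x \<Longrightarrow> Q x \<Longrightarrow> R x) \<Longrightarrow> AE x in M. R x"
  by (erule eventually_elim2)

definition ibox :: "nat \<Rightarrow> int set" where "ibox n = {- int n..int n}"

lemma finite_ibox [simp]: "finite (ibox n)"
  by (simp add: ibox_def)

lemma ibox_mono: "m \<le> n \<Longrightarrow> ibox m \<subseteq> ibox n"
  by (auto simp: ibox_def)

lemma in_ibox_iff: "k \<in> ibox n \<longleftrightarrow> \<bar>k\<bar> \<le> int n"
  by (auto simp: ibox_def)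

lemma finite_subset_ibox: "finite F \<Longrightarrow> \<exists>n. F \<subseteq> ibox n"
proof (induction F rule: finite_induct)
  case (insert k F)
  then obtain n where "F \<subseteq> ibox n" by blast
  then have "insert k F \<subseteq> ibox (max n (nat \<bar>k\<bar>))" using ibox_mono[of n "max n (nat \<bar>k\<bar>)"] by (auto simp: in_ibox_iff)
  then show ?case by blast
qed simp

text \<open>Finite partial sums are bounded by Bessel's inequality. A finite set whose sum comes
  within \<open>e\<close> of the supremum leaves less than \<open>e\<close> for any set disjoint
  from it.\<close>

lemma bessel_Cauchy:
  assumes f: "f \<in> L2" and e: "e > 0"
  obtains N where "\<And>F. finite F \<Longrightarrow> F \<inter> ibox N = {} \<Longrightarrow> (\<Sum>k\<in>F. (cmod (fc f k))\<^sup>2) < e"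
proof -
  define P where "P = {\<Sum>k\<in>F. (cmod (fc f k))\<^sup>2 | F. finite F}"
  have ne: "P \<noteq> {}" by (auto simp: P_def)
  have bdd: "bdd_above P" by (rule bdd_aboveI[of _ "(L2_norm f)\<^sup>2"]) (use bessel[OF f] in \<open>auto simp: P_def\<close>)
  obtain F0 where F0: "finite F0" "Sup P - e < (\<Sum>k\<in>F0. (cmod (fc f k))\<^sup>2)"
    using less_cSupD[OF ne, of "Sup P - e"] e by (auto simp: P_def)
  obtain N where N: "F0 \<subseteq> ibox N" using finite_subset_ibox[OF F0(1)] by blast
  show thesis
  proof (rule that[of N])
    fix F assume F: "finite F" "F \<inter> ibox N = {}"
    have "(\<Sum>k\<in>F. (cmod (fc f k))\<^sup>2) + (\<Sum>k\<in>F0. (cmod (fc f k))\<^sup>2) = (\<Sum>k\<in>F\<union>F0. (cmod (fc f k))\<^sup>2)"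
      by (rule sum.union_disjoint[symmetric]) (use F F0 N in auto)
    also have "\<dots> \<le> Sup P" by (rule cSup_upper[OF _ bdd]) (use F F0 in \<open>auto simp: P_def\<close>)
    finally show "(\<Sum>k\<in>F. (cmod (fc f k))\<^sup>2) < e" using F0(2) by linarith
  qed
qed

lemma ibox_diff_sum:
  assumes "m \<le> n"
  shows "(\<Sum>k\<in>ibox n. c k) - (\<Sum>k\<in>ibox m. c k) = (\<Sum>k\<in>ibox n - ibox m. (c k :: 'a::ab_group_add))"
  using sum.subset_diff[OF ibox_mono[OF assms], of c] by simp

text \<open>The partial sums are Cauchy by Bessel's inequality; their limit has the Fourier
  coefficients of \<open>f\<close> and therefore equals \<open>f\<close> by uniqueness.\<close>

theorem fourier_series_L2:
  assumes f: "f \<in> L2"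
  shows "(\<lambda>n. L2_norm (\<lambda>x. f x - (\<Sum>k\<in>ibox n. fc f k * ex k x))) \<longlonglongrightarrow> 0"
proof -
  define S where "S n x = (\<Sum>k\<in>ibox n. fc f k * ex k x)" for n x
  have S: "S n \<in> L2" for n unfolding S_def[abs_def] by (intro L2_lincomb ex_L2)
  obtain g where g: "g \<in> L2" "(\<lambda>n. L2_norm (\<lambda>x. S n x - g x)) \<longlonglongrightarrow> 0"
  proof (rule L2_complete[OF S])
    fix e :: real assume e: "e > 0"
    obtain N where N: "\<And>F. finite F \<Longrightarrow> F \<inter> ibox N = {} \<Longrightarrow> (\<Sum>k\<in>F. (cmod (fc f k))\<^sup>2) < e\<^sup>2"
      using bessel_Cauchy[OF f, of "e\<^sup>2"] e by (metis zero_less_power)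
    have *: "L2_norm (\<lambda>x. S n x - S m x) < e" if "N \<le> m" "m \<le> n" for m n
    proof -
      have "(L2_norm (\<lambda>x. S n x - S m x))\<^sup>2 = (\<Sum>k\<in>ibox n - ibox m. (cmod (fc f k))\<^sup>2)"
        unfolding S_def ibox_diff_sum[OF that(2)] by (rule L2_norm_trig) simp
      also have "\<dots> < e\<^sup>2" by (rule N) (use ibox_mono[OF that(1)] in auto)
      finally show ?thesis using e by (simp add: power_less_imp_less_base)
    qed
    show "\<exists>N. \<forall>m\<ge>N. \<forall>n\<ge>N. L2_norm (\<lambda>x. S m x - S n x) < e"
      by (intro exI[of _ N] allI impI) (metis * L2_norm_minus_commute nle_le)
  qed
  have "fc g k = fc f k" for k
  proof -
    have "(\<lambda>n. fc (S n) k) \<longlonglongrightarrow> fc g k"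
    proof (rule LIM_zero_cancel, rule Lim_null_comparison[OF _ g(2)], rule always_eventually, rule allI)
      fix n
      show "norm (fc (S n) k - fc g k) \<le> L2_norm (\<lambda>x. S n x - g x)"
        using fc_bound[OF L2_diff[OF S g(1)], of n k] fc_diff[OF S g(1), of n k] by simp
    qed
    moreover have "\<forall>\<^sub>F n in sequentially. fc (S n) k = fc f k"
      using eventually_ge_at_top[of "nat \<bar>k\<bar>"]
    proof eventually_elim
      case (elim n)
      then have "k \<in> ibox n" by (auto simp: in_ibox_iff)
      then show ?case unfolding S_def[abs_def] by (simp add: fc_lincomb_ex)
    qed
    ultimately show ?thesis by (metis LIMSEQ_unique tendsto_eventually)
  qed
  then have "AE x in \<mu>. f x - g x = 0"
    by (intro fc_zero_imp_AE_zero L2_diff f g(1)) (simp add: fc_diff f g(1))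
  then have eq: "L2_norm (\<lambda>x. f x - S n x) = L2_norm (\<lambda>x. S n x - g x)" for n
    unfolding L2_norm_minus_commute[of "S n" g]
    by (intro L2_norm_cong_AE L2_measurable L2_diff f S g(1)) (auto elim!: AE_mp intro!: AE_I2)
  show ?thesis using g(2) unfolding eq[unfolded S_def, symmetric] S_def[symmetric] eq by simp
qed

lemma L2_continuous_limit:
  assumes "f \<in> L2" "\<And>n. h n \<in> L2" "(\<lambda>n. L2_norm (\<lambda>x. h n x - f x)) \<longlonglongrightarrow> 0"
  shows "(\<lambda>n. L2_norm (h n)) \<longlonglongrightarrow> L2_norm f"
  by (rule LIM_zero_cancel, rule Lim_null_comparison[OF _ assms(3)])
    (use L2_norm_triangle_abs assms in \<open>auto intro!: always_eventually\<close>)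

theorem parseval:
  assumes f: "f \<in> L2"
  shows "(\<lambda>n. \<Sum>k\<in>ibox n. (cmod (fc f k))\<^sup>2) \<longlonglongrightarrow> (L2_norm f)\<^sup>2"
proof -
  have "(\<lambda>n. (L2_norm f)\<^sup>2 - (L2_norm (\<lambda>x. f x - (\<Sum>k\<in>ibox n. fc f k * ex k x)))\<^sup>2) \<longlonglongrightarrow> (L2_norm f)\<^sup>2 - 0\<^sup>2"
    by (intro tendsto_intros fourier_series_L2 f)
  then show ?thesis using L2_norm_diff_trig[OF f] by simp
qed

lemma riemann_lebesgue_L2:
  assumes f: "f \<in> L2" and e: "e > 0"
  shows "\<exists>N. \<forall>k. \<bar>k\<bar> > int N \<longrightarrow> cmod (fc f k) < e"
proof -
  obtain N where N: "\<And>F. finite F \<Longrightarrow> F \<inter> ibox N = {} \<Longrightarrow> (\<Sum>k\<in>F. (cmod (fc f k))\<^sup>2) < e\<^sup>2"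
    using bessel_Cauchy[OF f, of "e\<^sup>2"] e by (metis zero_less_power)
  have "cmod (fc f k) < e" if "\<bar>k\<bar> > int N" for k
    using N[of "{k}"] that e by (auto simp: in_ibox_iff intro: power_less_imp_less_base)
  then show ?thesis by blast
qed

text \<open>Truncation at a height \<open>M\<close> approximates \<open>g\<close> in the
  \<open>L1\<close> norm by a function in \<open>L2\<close>, and the \<open>L1\<close> norm bounds
  all Fourier coefficients of the difference.\<close>

theorem riemann_lebesgue:
  assumes g: "integrable \<mu> g" and e: "e > 0"
  shows "\<exists>N. \<forall>k. \<bar>k\<bar> > int N \<longrightarrow> cmod (fc g k) < e"
proof -
  have gm [measurable]: "g \<in> borel_measurable \<mu>" using g by simp
  define t where "t M x = (if cmod (g x) \<le> real M then g x else 0)" for M x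
  have tm [measurable]: "t M \<in> borel_measurable \<mu>" for M unfolding t_def[abs_def] by measurable
  have "(\<lambda>M. LINT x|\<mu>. cmod (g x - t M x)) \<longlonglongrightarrow> (LINT x|\<mu>. 0)"
  proof (rule integral_dominated_convergence[where w = "\<lambda>x. cmod (g x)"])
    show "AE x in \<mu>. (\<lambda>M. cmod (g x - t M x)) \<longlonglongrightarrow> 0"
    proof (rule AE_I2, rule tendsto_eventually)
      fix x
      obtain M0 where "cmod (g x) \<le> real M0" using real_arch_simple by blast
      then show "\<forall>\<^sub>F M in sequentially. cmod (g x - t M x) = 0"
        by (intro eventually_sequentiallyI[of M0]) (auto simp: t_def)
    qed
    show "AE x in \<mu>. norm (cmod (g x - t M x)) \<le> cmod (g x)" for M by (rule AE_I2) (simp add: t_def)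
  qed (use g in auto)
  then have "\<forall>\<^sub>F M in sequentially. (LINT x|\<mu>. cmod (g x - t M x)) < e/2"
    using e by (auto dest: order_tendstoD(2)[of _ _ _ "e/2"])
  then obtain M where M: "(LINT x|\<mu>. cmod (g x - t M x)) < e/2" by (auto simp: eventually_sequentially)
  have tL: "t M \<in> L2" by (rule L2_bounded(1)[OF tm, of _ "real M"]) (simp add: t_def)
  obtain N where N: "\<forall>k. \<bar>k\<bar> > int N \<longrightarrow> cmod (fc (t M) k) < e/2"
    using riemann_lebesgue_L2[OF tL, of "e/2"] e by auto
  have "cmod (fc g k) < e" if "\<bar>k\<bar> > int N" for k
  proof -
    have em [measurable]: "ex j \<in> borel_measurable \<mu>" for j using L2_measurable[OF ex_L2] .
    have i1: "integrable \<mu> (\<lambda>x. g x * ex (- k) x)"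
      by (rule Bochner_Integration.integrable_bound[OF integrable_norm[OF g]]) (auto simp: norm_mult)
    have i2: "integrable \<mu> (\<lambda>x. t M x * ex (- k) x)" by (rule L2_integrable_mult[OF tL ex_L2])
    have "fc g k - fc (t M) k = (LINT x|\<mu>. (g x - t M x) * ex (- k) x)"
      unfolding fc_def using i1 i2 by (simp add: left_diff_distrib)
    then have "cmod (fc g k - fc (t M) k) \<le> (LINT x|\<mu>. cmod (g x - t M x))"
      using integral_norm_bound[of \<mu> "\<lambda>x. (g x - t M x) * ex (- k) x"] by (simp add: norm_mult)
    moreover have "cmod (fc g k) \<le> cmod (fc g k - fc (t M) k) + cmod (fc (t M) k)"
      using norm_triangle_ineq[of "fc g k - fc (t M) k" "fc (t M) k"] by simp
    ultimately show ?thesis using M N that by fastforce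
  qed
  then show ?thesis by blast
qed

text \<open>The exponentials are transported along \<open>\<sigma>\<close> because a normal system
  is indexed by pairs and not by integers.\<close>

lemma ex_orthonormal_basis:
  assumes "bij_betw \<sigma> I (UNIV :: int set)"
  shows "L2_orthonormal_basis I (\<lambda>i. ex (\<sigma> i))"
  unfolding L2_orthonormal_basis_def
proof (intro conjI ballI allI impI)
  show "ex (\<sigma> i) \<in> L2" for i by (rule ex_L2)
  have inj: "inj_on \<sigma> I" using assms by (simp add: bij_betw_def)
  then show "L2_inner (ex (\<sigma> i)) (ex (\<sigma> j)) = (if i = j then 1 else 0)" if "i \<in> I" "j \<in> I" for i j
    using that by (auto simp: L2_inner_ex inj_on_def)
  fix f and e :: real assume f: "f \<in> L2" and e: "e > 0"
  have "\<forall>\<^sub>F n in sequentially. L2_norm (\<lambda>x. f x - (\<Sum>k\<in>ibox n. fc f k * ex k x)) < e"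
    using order_tendstoD(2)[OF fourier_series_L2[OF f] e] .
  then obtain n where n: "L2_norm (\<lambda>x. f x - (\<Sum>k\<in>ibox n. fc f k * ex k x)) < e" by (auto simp: eventually_sequentially)
  define F where "F = {i \<in> I. \<sigma> i \<in> ibox n}"
  have bij: "bij_betw \<sigma> F (ibox n)"
    using assms inj unfolding F_def bij_betw_def by (auto simp: inj_on_def image_iff)
  then have "finite F" using bij_betw_finite finite_ibox by blast
  moreover have "(\<Sum>i\<in>F. fc f (\<sigma> i) * ex (\<sigma> i) x) = (\<Sum>k\<in>ibox n. fc f k * ex k x)" for x
    by (rule sum.reindex_bij_betw[OF bij])
  ultimately show "\<exists>F c. finite F \<and> F \<subseteq> I \<and> L2_norm (\<lambda>x. f x - (\<Sum>i\<in>F. c i * ex (\<sigma> i) x)) < e"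
    using n by (intro exI[of _ F] exI[of _ "\<lambda>i. fc f (\<sigma> i)"]) (auto simp: F_def)
qed

section \<open>Riesz bases\<close>

text \<open>The working form of a Riesz basis: two-sided bounds on finite combinations, plus density
  of the span. The operator required by \<open>L2_Riesz_basis\<close> is built from these as
  \<open>T\<close>, with inverse \<open>S\<close>.\<close>

locale riesz_family =
  fixes v :: "int \<Rightarrow> real \<Rightarrow> complex" and A B :: real
  assumes v: "v k \<in> L2" and A: "A > 0"
    and lower: "finite F \<Longrightarrow> A * sqrt (\<Sum>k\<in>F. (cmod (c k))\<^sup>2) \<le> L2_norm (\<lambda>x. \<Sum>k\<in>F. c k * v k x)"
    and upper: "finite F \<Longrightarrow> L2_norm (\<lambda>x. \<Sum>k\<in>F. c k * v k x) \<le> B * sqrt (\<Sum>k\<in>F. (cmod (c k))\<^sup>2)"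
    and dense: "f \<in> L2 \<Longrightarrow> e > 0 \<Longrightarrow> \<exists>F c. finite F \<and> L2_norm (\<lambda>x. f x - (\<Sum>k\<in>F. c k * v k x)) < e"
begin

lemma B_pos: "B > 0"
  using lower[of "{0}" "\<lambda>_. 1"] upper[of "{0}" "\<lambda>_. 1"] A by simp

definition part :: "nat \<Rightarrow> (real \<Rightarrow> complex) \<Rightarrow> real \<Rightarrow> complex"
  where "part n f x = (\<Sum>k\<in>ibox n. fc f k * v k x)"

lemma part_L2: "part n f \<in> L2"
  unfolding part_def[abs_def] by (intro L2_lincomb v)

text \<open>The operator that sends \<open>ex k\<close> to \<open>v k\<close>. Limits in
  \<open>L2\<close> are unique only almost everywhere, so a representative is chosen.\<close>

definition T :: "(real \<Rightarrow> complex) \<Rightarrow> real \<Rightarrow> complex"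
  where "T f = (SOME g. g \<in> L2 \<and> (\<lambda>n. L2_norm (\<lambda>x. part n f x - g x)) \<longlonglongrightarrow> 0)"

lemma part_upper: assumes "f \<in> L2" shows "L2_norm (part n f) \<le> B * L2_norm f"
proof -
  have "L2_norm (part n f) \<le> B * sqrt (\<Sum>k\<in>ibox n. (cmod (fc f k))\<^sup>2)"
    unfolding part_def[abs_def] by (rule upper) simp
  also have "\<dots> \<le> B * L2_norm f"
    using bessel[OF assms finite_ibox] B_pos by (intro mult_left_mono real_le_lsqrt) auto
  finally show ?thesis .
qed

lemma T_limit:
  assumes f: "f \<in> L2"
  shows "T f \<in> L2" "(\<lambda>n. L2_norm (\<lambda>x. part n f x - T f x)) \<longlonglongrightarrow> 0"
proof -
  have "\<exists>g. g \<in> L2 \<and> (\<lambda>n. L2_norm (\<lambda>x. part n f x - g x)) \<longlonglongrightarrow> 0"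
  proof (rule L2_complete[of "\<lambda>n. part n f", OF part_L2])
    fix e :: real assume e: "e > 0"
    have eB: "(e / B)\<^sup>2 > 0" using e B_pos by simp
    obtain N where N: "\<And>F. finite F \<Longrightarrow> F \<inter> ibox N = {} \<Longrightarrow> (\<Sum>k\<in>F. (cmod (fc f k))\<^sup>2) < (e / B)\<^sup>2"
      using bessel_Cauchy[OF f eB] by blast
    have *: "L2_norm (\<lambda>x. part n f x - part m f x) < e" if "N \<le> m" "m \<le> n" for m n
    proof -
      have "L2_norm (\<lambda>x. part n f x - part m f x) \<le> B * sqrt (\<Sum>k\<in>ibox n - ibox m. (cmod (fc f k))\<^sup>2)"
        unfolding part_def ibox_diff_sum[OF that(2)] by (rule upper) simp
      also have "\<dots> < B * (e / B)"
      proof (rule mult_strict_left_mono[OF _ B_pos])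
        have "(\<Sum>k\<in>ibox n - ibox m. (cmod (fc f k))\<^sup>2) < (e / B)\<^sup>2"
          by (rule N) (use ibox_mono[OF that(1)] in auto)
        then show "sqrt (\<Sum>k\<in>ibox n - ibox m. (cmod (fc f k))\<^sup>2) < e / B"
          using e B_pos by (intro real_less_lsqrt) (auto intro: sum_nonneg)
      qed
      finally show ?thesis using B_pos by simp
    qed
    show "\<exists>N. \<forall>m\<ge>N. \<forall>n\<ge>N. L2_norm (\<lambda>x. part m f x - part n f x) < e"
      by (intro exI[of _ N] allI impI) (metis * L2_norm_minus_commute nle_le)
  qed blast
  from someI_ex[OF this] show "T f \<in> L2" "(\<lambda>n. L2_norm (\<lambda>x. part n f x - T f x)) \<longlonglongrightarrow> 0"
    unfolding T_def[symmetric] by auto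
qed

lemma T_upper: assumes f: "f \<in> L2" shows "L2_norm (T f) \<le> B * L2_norm f"
  by (rule tendsto_upperbound[OF L2_continuous_limit[OF T_limit(1)[OF f] part_L2 T_limit(2)[OF f]]])
    (use part_upper[OF f] in \<open>auto intro: always_eventually\<close>)

lemma T_lower: assumes f: "f \<in> L2" shows "A * L2_norm f \<le> L2_norm (T f)"
proof -
  have "(\<lambda>n. A * sqrt (\<Sum>k\<in>ibox n. (cmod (fc f k))\<^sup>2)) \<longlonglongrightarrow> A * sqrt ((L2_norm f)\<^sup>2)"
    by (intro tendsto_intros parseval f)
  then have 1: "(\<lambda>n. A * sqrt (\<Sum>k\<in>ibox n. (cmod (fc f k))\<^sup>2)) \<longlonglongrightarrow> A * L2_norm f" by simp
  show ?thesis
    by (rule LIMSEQ_le[OF 1 L2_continuous_limit[OF T_limit(1)[OF f] part_L2 T_limit(2)[OF f]]])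
      (use lower[OF finite_ibox] in \<open>auto simp: part_def[abs_def]\<close>)
qed

lemma T_linear:
  assumes f: "f \<in> L2" and g: "g \<in> L2"
  shows "AE x in \<mu>. T (\<lambda>t. a * f t + b * g t) x = a * T f x + b * T g x"
proof (rule L2_limit_unique[where h = "\<lambda>n. part n (\<lambda>t. a * f t + b * g t)"])
  have fg: "(\<lambda>t. a * f t + b * g t) \<in> L2" by (intro L2_add L2_cmult f g)
  show "T (\<lambda>t. a * f t + b * g t) \<in> L2" "(\<lambda>n. L2_norm (\<lambda>x. part n (\<lambda>t. a * f t + b * g t) x - T (\<lambda>t. a * f t + b * g t) x)) \<longlonglongrightarrow> 0"
    using T_limit[OF fg] by auto
  show "(\<lambda>x. a * T f x + b * T g x) \<in> L2" by (intro L2_add L2_cmult T_limit f g)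
  show "part n (\<lambda>t. a * f t + b * g t) \<in> L2" for n by (rule part_L2)
  have "(\<lambda>n. cmod a * L2_norm (\<lambda>x. part n f x - T f x) + cmod b * L2_norm (\<lambda>x. part n g x - T g x)) \<longlonglongrightarrow> cmod a * 0 + cmod b * 0"
    by (intro tendsto_intros T_limit f g)
  then have lim: "(\<lambda>n. cmod a * L2_norm (\<lambda>x. part n f x - T f x) + cmod b * L2_norm (\<lambda>x. part n g x - T g x)) \<longlonglongrightarrow> 0" by simp
  show "(\<lambda>n. L2_norm (\<lambda>x. part n (\<lambda>t. a * f t + b * g t) x - (a * T f x + b * T g x))) \<longlonglongrightarrow> 0"
  proof (rule Lim_null_comparison[OF _ lim], rule always_eventually, rule allI)
    fix n
    have "part n (\<lambda>t. a * f t + b * g t) x - (a * T f x + b * T g x) = a * (part n f x - T f x) + b * (part n g x - T g x)" for x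
      unfolding part_def using fc_add[OF L2_cmult[OF f] L2_cmult[OF g], of a b]
      by (simp add: fc_cmult algebra_simps sum.distrib sum_distrib_left)
    then have "L2_norm (\<lambda>x. part n (\<lambda>t. a * f t + b * g t) x - (a * T f x + b * T g x)) =
       L2_norm (\<lambda>x. a * (part n f x - T f x) + b * (part n g x - T g x))" by simp
    also have "\<dots> \<le> L2_norm (\<lambda>x. a * (part n f x - T f x)) + L2_norm (\<lambda>x. b * (part n g x - T g x))"
      by (intro L2_triangle L2_cmult L2_diff part_L2 T_limit f g)
    also have "\<dots> = cmod a * L2_norm (\<lambda>x. part n f x - T f x) + cmod b * L2_norm (\<lambda>x. part n g x - T g x)"
      by (simp add: L2_norm_cmult)
    finally show "norm (L2_norm (\<lambda>x. part n (\<lambda>t. a * f t + b * g t) x - (a * T f x + b * T g x)))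
      \<le> cmod a * L2_norm (\<lambda>x. part n f x - T f x) + cmod b * L2_norm (\<lambda>x. part n g x - T g x)" by simp
  qed
qed

lemma T_trig:
  assumes F: "finite F"
  shows "AE x in \<mu>. T (\<lambda>x. \<Sum>k\<in>F. c k * ex k x) x = (\<Sum>k\<in>F. c k * v k x)"
proof -
  let ?f = "\<lambda>x. \<Sum>k\<in>F. c k * ex k x"
  have f: "?f \<in> L2" by (intro L2_lincomb ex_L2)
  obtain N where N: "F \<subseteq> ibox N" using finite_subset_ibox[OF F] by blast
  have "part n ?f x = (\<Sum>k\<in>F. c k * v k x)" if "n \<ge> N" for n x
    unfolding part_def fc_lincomb_ex[OF F]
    by (rule sum.mono_neutral_cong_right) (use N ibox_mono[OF that] in auto)
  then have "\<forall>\<^sub>F n in sequentially. L2_norm (\<lambda>x. part n ?f x - (\<Sum>k\<in>F. c k * v k x)) = 0"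
    by (intro eventually_sequentiallyI[of N]) (simp add: L2_norm_def)
  then show ?thesis
    by (intro L2_limit_unique[where h = "\<lambda>n. part n ?f"] T_limit f part_L2 L2_lincomb v tendsto_eventually)
qed

text \<open>Approximations of \<open>g\<close> from the span of \<open>v\<close> are images of
  trigonometric polynomials; the lower bound makes these a Cauchy sequence, and its limit is a
  preimage.\<close>

lemma T_surj:
  assumes g: "g \<in> L2"
  shows "\<exists>f\<in>L2. AE x in \<mu>. T f x = g x"
proof -
  have "\<exists>F c. finite F \<and> L2_norm (\<lambda>x. g x - (\<Sum>k\<in>F. c k * v k x)) < 1 / Suc n" for n :: nat
    by (rule dense[OF g]) simp
  then obtain F c where F: "\<And>n. finite (F n)" and c: "\<And>n. L2_norm (\<lambda>x. g x - (\<Sum>k\<in>F n. c n k * v k x)) < 1 / Suc n"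
    by metis
  define p where "p n x = (\<Sum>k\<in>F n. c n k * ex k x)" for n x
  define w where "w n x = (\<Sum>k\<in>F n. c n k * v k x)" for n x
  have p: "p n \<in> L2" and w: "w n \<in> L2" for n
    unfolding p_def[abs_def] w_def[abs_def] by (intro L2_lincomb ex_L2 v)+
  have Tp: "AE x in \<mu>. T (p n) x = w n x" for n unfolding p_def[abs_def] w_def[abs_def] by (rule T_trig[OF F])
  have diff: "L2_norm (T (\<lambda>x. f x - h x)) = L2_norm (\<lambda>x. T f x - T h x)" if "f \<in> L2" "h \<in> L2" for f h
  proof (rule L2_norm_cong_AE)
    show "AE x in \<mu>. T (\<lambda>x. f x - h x) x = T f x - T h x"
      using T_linear[OF that, of 1 "-1"] by simp
  qed (intro L2_measurable L2_diff T_limit(1) that)+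
  have small: "L2_norm (\<lambda>x. w m x - w n x) \<le> 1 / Suc m + 1 / Suc n" for m n
  proof -
    have "L2_norm (\<lambda>x. w m x - w n x) \<le> L2_norm (\<lambda>x. w m x - g x) + L2_norm (\<lambda>x. g x - w n x)"
      by (rule L2_triangle_sub[OF w g w])
    then show ?thesis using c[of m] c[of n] L2_norm_minus_commute[of "w m" g] by (simp add: w_def)
  qed
  have pw: "A * L2_norm (\<lambda>x. p m x - p n x) \<le> L2_norm (\<lambda>x. w m x - w n x)" for m n
  proof -
    have "A * L2_norm (\<lambda>x. p m x - p n x) \<le> L2_norm (T (\<lambda>x. p m x - p n x))" by (rule T_lower[OF L2_diff[OF p p]])
    also have "\<dots> = L2_norm (\<lambda>x. T (p m) x - T (p n) x)" by (rule diff[OF p p])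
    also have "\<dots> = L2_norm (\<lambda>x. w m x - w n x)"
      by (rule L2_norm_cong_AE) (intro L2_measurable L2_diff T_limit(1) p w | rule AE_imp2[OF Tp[of m] Tp[of n]], simp)+
    finally show ?thesis .
  qed
  obtain f where f: "f \<in> L2" "(\<lambda>n. L2_norm (\<lambda>x. p n x - f x)) \<longlonglongrightarrow> 0"
  proof (rule L2_complete[OF p])
    fix e :: real assume e: "e > 0"
    obtain N where N: "2 / (e * A) < real (Suc N)" using reals_Archimedean2[of "2 / (e * A)"] by (meson less_SucI less_trans of_nat_less_iff lessI)
    show "\<exists>N. \<forall>m\<ge>N. \<forall>n\<ge>N. L2_norm (\<lambda>x. p m x - p n x) < e"
    proof (intro exI[of _ N] allI impI)
      fix m n assume mn: "m \<ge> N" "n \<ge> N"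
      have "1 / real (Suc m) + 1 / real (Suc n) \<le> 1 / real (Suc N) + 1 / real (Suc N)"
        using mn by (intro add_mono divide_left_mono) auto
      also have "\<dots> < e * A" using N e A by (simp add: field_simps)
      finally have "A * L2_norm (\<lambda>x. p m x - p n x) < A * e" using pw[of m n] small[of m n] by (simp add: mult.commute)
      then show "L2_norm (\<lambda>x. p m x - p n x) < e" using A by simp
    qed
  qed
  have "AE x in \<mu>. T f x = g x"
  proof (rule L2_limit_unique[where h = w, OF T_limit(1)[OF f(1)] g w])
    have lim1: "(\<lambda>n. B * L2_norm (\<lambda>x. p n x - f x)) \<longlonglongrightarrow> 0" using tendsto_mult_left[OF f(2), of B] by simp
    show "(\<lambda>n. L2_norm (\<lambda>x. w n x - T f x)) \<longlonglongrightarrow> 0"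
    proof (rule Lim_null_comparison[OF _ lim1], rule always_eventually, rule allI)
      fix n
      have "L2_norm (\<lambda>x. w n x - T f x) = L2_norm (\<lambda>x. T (p n) x - T f x)"
        by (rule L2_norm_cong_AE) (intro L2_measurable L2_diff T_limit(1) p w f(1) | rule AE_imp1[OF Tp[of n]], simp)+
      also have "\<dots> = L2_norm (T (\<lambda>x. p n x - f x))" by (rule diff[OF p f(1), symmetric])
      also have "\<dots> \<le> B * L2_norm (\<lambda>x. p n x - f x)" by (rule T_upper[OF L2_diff[OF p f(1)]])
      finally show "norm (L2_norm (\<lambda>x. w n x - T f x)) \<le> B * L2_norm (\<lambda>x. p n x - f x)" by simp
    qed
    show "(\<lambda>n. L2_norm (\<lambda>x. w n x - g x)) \<longlonglongrightarrow> 0"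
    proof (rule Lim_null_comparison[OF _ LIMSEQ_inverse_real_of_nat], rule always_eventually, rule allI)
      fix n show "norm (L2_norm (\<lambda>x. w n x - g x)) \<le> inverse (real (Suc n))"
        using c[of n] L2_norm_minus_commute[of "w n" g] by (simp add: w_def inverse_eq_divide)
    qed
  qed
  then show ?thesis using f(1) by blast
qed

lemma T_inj:
  assumes f: "f \<in> L2" and g: "g \<in> L2" and eq: "AE x in \<mu>. T f x = T g x"
  shows "AE x in \<mu>. f x = g x"
proof -
  have "A * L2_norm (\<lambda>x. f x - g x) \<le> L2_norm (T (\<lambda>x. f x - g x))" by (rule T_lower[OF L2_diff[OF f g]])
  also have "\<dots> = L2_norm (\<lambda>x. 0)"
  proof (rule L2_norm_cong_AE)
    show "AE x in \<mu>. T (\<lambda>x. f x - g x) x = 0"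
      by (rule AE_imp2[OF eq T_linear[OF f g, of 1 "-1"]]) simp
  qed (intro L2_measurable L2_diff T_limit(1) f g L2_zero)+
  also have "L2_norm (\<lambda>x. 0) = 0" by (simp add: L2_norm_def)
  finally have "L2_norm (\<lambda>x. f x - g x) \<le> 0" using A mult_le_cancel_left_pos[of A _ 0] by simp
  then have "L2_norm (\<lambda>x. f x - g x) = 0" using L2_norm_nonneg[of "\<lambda>x. f x - g x"] by linarith
  then show ?thesis using L2_norm_eq_0_iff[OF L2_diff[OF f g]] by simp
qed

lemma expansion:
  assumes g: "g \<in> L2"
  obtains a where "(\<lambda>n. L2_norm (\<lambda>x. (\<Sum>k\<in>ibox n. a k * v k x) - g x)) \<longlonglongrightarrow> 0"
proof -
  obtain f where f: "f \<in> L2" "AE x in \<mu>. T f x = g x" using T_surj[OF g] by blast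
  have "L2_norm (\<lambda>x. part n f x - T f x) = L2_norm (\<lambda>x. part n f x - g x)" for n
    by (rule L2_norm_cong_AE) (intro L2_measurable L2_diff part_L2 T_limit(1) f(1) g | rule AE_imp1[OF f(2)], simp)+
  then show thesis using T_limit(2)[OF f(1)] that[of "fc f"] by (simp add: part_def)
qed

definition S :: "(real \<Rightarrow> complex) \<Rightarrow> real \<Rightarrow> complex"
  where "S g = (SOME f. f \<in> L2 \<and> (AE x in \<mu>. T f x = g x))"

lemma S: assumes "g \<in> L2" shows "S g \<in> L2" "AE x in \<mu>. T (S g) x = g x"
  using someI_ex[of "\<lambda>f. f \<in> L2 \<and> (AE x in \<mu>. T f x = g x)"] T_surj[OF assms] unfolding S_def by blast+

theorem riesz_basis:
  assumes \<sigma>: "bij_betw \<sigma> I (UNIV :: int set)" and u: "\<And>i. i \<in> I \<Longrightarrow> u i \<in> L2" "\<And>i. i \<in> I \<Longrightarrow> AE x in \<mu>. u i x = v (\<sigma> i) x"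
  shows "L2_Riesz_basis I u"
  unfolding L2_Riesz_basis_def
proof (intro conjI ballI exI[of _ "\<lambda>i. ex (\<sigma> i)"] exI[of _ T])
  show "u i \<in> L2" if "i \<in> I" for i by (rule u(1)[OF that])
  show "L2_orthonormal_basis I (\<lambda>i. ex (\<sigma> i))" by (rule ex_orthonormal_basis[OF \<sigma>])
  show "L2_bounded_linear T"
    unfolding L2_bounded_linear_def using T_limit(1) T_linear T_upper by blast
  show "AE x in \<mu>. u i x = T (ex (\<sigma> i)) x" if "i \<in> I" for i
  proof -
    have "AE x in \<mu>. T (ex (\<sigma> i)) x = v (\<sigma> i) x" using T_trig[of "{\<sigma> i}" "\<lambda>_. 1"] by simp
    then show ?thesis by (rule AE_imp2[OF u(2)[OF that]]) simp
  qed
  have "L2_bounded_linear S"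
    unfolding L2_bounded_linear_def
  proof (intro conjI ballI allI)
    show "S f \<in> L2" if "f \<in> L2" for f by (rule S(1)[OF that])
    show "\<exists>C. \<forall>f\<in>L2. L2_norm (S f) \<le> C * L2_norm f"
    proof (intro exI ballI)
      fix f assume f: "f \<in> L2"
      have "A * L2_norm (S f) \<le> L2_norm (T (S f))" by (rule T_lower[OF S(1)[OF f]])
      also have "\<dots> = L2_norm f" by (intro L2_norm_cong_AE L2_measurable T_limit(1) S f)
      finally show "L2_norm (S f) \<le> 1 / A * L2_norm f" using A by (simp add: field_simps)
    qed
    fix f g a b assume f: "f \<in> L2" and g: "g \<in> L2"
    have fg: "(\<lambda>t. a * f t + b * g t) \<in> L2" by (intro L2_add L2_cmult f g)
    show "AE x in \<mu>. S (\<lambda>t. a * f t + b * g t) x = a * S f x + b * S g x"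
    proof (rule T_inj)
      show "AE x in \<mu>. T (S (\<lambda>t. a * f t + b * g t)) x = T (\<lambda>x. a * S f x + b * S g x) x"
        using S(2)[OF fg] T_linear[OF S(1)[OF f] S(1)[OF g], of a b] S(2)[OF f] S(2)[OF g]
        by eventually_elim simp
    qed (intro L2_add L2_cmult S f g fg)+
  qed
  moreover have "AE x in \<mu>. S (T f) x = f x" if "f \<in> L2" for f
    by (rule T_inj) (use S T_limit(1) that in auto)
  ultimately show "L2_boundedly_invertible T" unfolding L2_boundedly_invertible_def using S(2) by blast
qed

end

text \<open>A perturbation of norm at most \<open>\<kappa>\<close> changes the norm of a combination
  of exponentials by at most the fraction \<open>\<kappa>\<close>. Density follows because the
  distance \<open>d\<close> of \<open>f\<close> from the span satisfies
  \<open>d \<le> \<kappa> * d\<close>.\<close>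

lemma paley_wiener:
  assumes v: "\<And>k. v k \<in> L2" and \<kappa>: "0 \<le> \<kappa>" "\<kappa> < 1"
    and close: "\<And>F c. finite F \<Longrightarrow> L2_norm (\<lambda>x. \<Sum>k\<in>F. c k * (v k x - ex k x)) \<le> \<kappa> * sqrt (\<Sum>k\<in>F. (cmod (c k))\<^sup>2)"
  shows "riesz_family v (1 - \<kappa>) (1 + \<kappa>)"
proof
  have trig: "L2_norm (\<lambda>x. \<Sum>k\<in>F. c k * ex k x) = sqrt (\<Sum>k\<in>F. (cmod (c k))\<^sup>2)" if "finite F" for F c
    using L2_norm_trig[OF that, of c] by (metis L2_norm_nonneg real_sqrt_unique)
  have L: "(\<lambda>x. \<Sum>k\<in>F. c k * ex k x) \<in> L2" "(\<lambda>x. \<Sum>k\<in>F. c k * v k x) \<in> L2" "(\<lambda>x. \<Sum>k\<in>F. c k * (v k x - ex k x)) \<in> L2" for F c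
    by (intro L2_lincomb ex_L2 v L2_diff)+
  show "v k \<in> L2" for k by (rule v)
  show "1 - \<kappa> > 0" using \<kappa> by simp
  fix F :: "int set" and c assume F: "finite F"
  have dec: "(\<Sum>k\<in>F. c k * v k x) - (\<Sum>k\<in>F. c k * ex k x) = (\<Sum>k\<in>F. c k * (v k x - ex k x))" for x
    by (simp add: right_diff_distrib sum_subtractf)
  have "\<bar>L2_norm (\<lambda>x. \<Sum>k\<in>F. c k * v k x) - sqrt (\<Sum>k\<in>F. (cmod (c k))\<^sup>2)\<bar> \<le> \<kappa> * sqrt (\<Sum>k\<in>F. (cmod (c k))\<^sup>2)"
    using L2_norm_triangle_abs[OF L(2)[where F=F and c=c] L(1)[where F=F and c=c]] close[OF F, of c] trig[OF F, of c] unfolding dec by linarith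
  then show "(1 - \<kappa>) * sqrt (\<Sum>k\<in>F. (cmod (c k))\<^sup>2) \<le> L2_norm (\<lambda>x. \<Sum>k\<in>F. c k * v k x)"
    "L2_norm (\<lambda>x. \<Sum>k\<in>F. c k * v k x) \<le> (1 + \<kappa>) * sqrt (\<Sum>k\<in>F. (cmod (c k))\<^sup>2)"
    by (auto simp: algebra_simps)
next
  have L: "(\<lambda>x. \<Sum>k\<in>F. c k * ex k x) \<in> L2" "(\<lambda>x. \<Sum>k\<in>F. c k * v k x) \<in> L2" "(\<lambda>x. \<Sum>k\<in>F. c k * (v k x - ex k x)) \<in> L2" for F c
    by (intro L2_lincomb ex_L2 v L2_diff)+
  fix f and e :: real assume f: "f \<in> L2" and e: "e > 0"
  define D where "D = {L2_norm (\<lambda>x. f x - (\<Sum>k\<in>F. c k * v k x)) | F c. finite F}"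
  define d where "d = Inf D"
  have D0: "D \<noteq> {}" by (auto simp: D_def)
  have Db: "bdd_below D" by (rule bdd_belowI[of _ 0]) (auto simp: D_def)
  have d0: "d \<ge> 0" unfolding d_def by (rule cInf_greatest[OF D0]) (auto simp: D_def)
  \<comment> \<open>Replacing each exponential by \<open>v\<close> in a trigonometric approximation of the residual shrinks its distance to the span by the factor \<open>\<kappa>\<close>.\<close>
  have improve: "d \<le> \<kappa> * t" if t: "t \<in> D" for t
  proof (rule field_le_epsilon)
    fix \<epsilon> :: real assume \<epsilon>: "\<epsilon> > 0"
    from t obtain F c where F: "finite F" "t = L2_norm (\<lambda>x. f x - (\<Sum>k\<in>F. c k * v k x))" by (auto simp: D_def)
    define h where "h x = f x - (\<Sum>k\<in>F. c k * v k x)" for x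
    have h: "h \<in> L2" unfolding h_def[abs_def] by (intro L2_diff f L)
    have "\<forall>\<^sub>F n in sequentially. L2_norm (\<lambda>x. h x - (\<Sum>k\<in>ibox n. fc h k * ex k x)) < \<epsilon>"
      using order_tendstoD(2)[OF fourier_series_L2[OF h] \<epsilon>] .
    then obtain n where n: "L2_norm (\<lambda>x. h x - (\<Sum>k\<in>ibox n. fc h k * ex k x)) < \<epsilon>" by (auto simp: eventually_sequentially)
    define c' where "c' k = (if k \<in> F then c k else 0) + (if k \<in> ibox n then fc h k else 0)" for k
    have sum: "(\<Sum>k\<in>F \<union> ibox n. c' k * v k x) = (\<Sum>k\<in>F. c k * v k x) + (\<Sum>k\<in>ibox n. fc h k * v k x)" for x
    proof -
      have "(\<Sum>k\<in>F \<union> ibox n. (if k \<in> F then c k else 0) * v k x) = (\<Sum>k\<in>F. c k * v k x)"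
        by (rule sum.mono_neutral_cong_right) (use F in auto)
      moreover have "(\<Sum>k\<in>F \<union> ibox n. (if k \<in> ibox n then fc h k else 0) * v k x) = (\<Sum>k\<in>ibox n. fc h k * v k x)"
        by (rule sum.mono_neutral_cong_right) (use F in auto)
      ultimately show ?thesis by (simp add: c'_def distrib_right sum.distrib)
    qed
    have "d \<le> L2_norm (\<lambda>x. f x - (\<Sum>k\<in>F \<union> ibox n. c' k * v k x))"
      unfolding d_def by (rule cInf_lower[OF _ Db]) (use F in \<open>auto simp: D_def\<close>)
    also have "\<dots> = L2_norm (\<lambda>x. h x - (\<Sum>k\<in>ibox n. fc h k * v k x))"
      by (simp add: sum h_def diff_diff_eq)
    also have "\<dots> \<le> L2_norm (\<lambda>x. h x - (\<Sum>k\<in>ibox n. fc h k * ex k x)) + L2_norm (\<lambda>x. (\<Sum>k\<in>ibox n. fc h k * ex k x) - (\<Sum>k\<in>ibox n. fc h k * v k x))"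
      by (rule L2_triangle_sub[OF h L(1) L(2)])
    finally have 1: "d \<le> L2_norm (\<lambda>x. h x - (\<Sum>k\<in>ibox n. fc h k * ex k x)) + L2_norm (\<lambda>x. (\<Sum>k\<in>ibox n. fc h k * ex k x) - (\<Sum>k\<in>ibox n. fc h k * v k x))" .
    have "L2_norm (\<lambda>x. (\<Sum>k\<in>ibox n. fc h k * ex k x) - (\<Sum>k\<in>ibox n. fc h k * v k x)) = L2_norm (\<lambda>x. (\<Sum>k\<in>ibox n. fc h k * (v k x - ex k x)))"
      by (subst L2_norm_minus_commute) (simp add: right_diff_distrib sum_subtractf)
    also have "\<dots> \<le> \<kappa> * sqrt (\<Sum>k\<in>ibox n. (cmod (fc h k))\<^sup>2)" by (rule close) simp
    also have "\<dots> \<le> \<kappa> * L2_norm h"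
      using bessel[OF h finite_ibox] \<kappa> by (intro mult_left_mono real_le_lsqrt) auto
    finally show "d \<le> \<kappa> * t + \<epsilon>" unfolding F(2)[folded h_def] using 1 n by linarith
  qed
  have "d \<le> \<kappa> * d"
  proof (cases "\<kappa> = 0")
    case True
    then show ?thesis using improve D0 by auto
  next
    case False
    then have "d / \<kappa> \<le> d" unfolding d_def
      by (intro cInf_greatest[OF D0]) (use improve \<kappa> False in \<open>auto simp: d_def field_simps\<close>)
    then show ?thesis using \<kappa> False by (simp add: field_simps)
  qed
  then have "(1 - \<kappa>) * d \<le> 0" by (simp add: algebra_simps)
  then have "d = 0" using d0 \<kappa> by (simp add: mult_le_0_iff)
  then obtain t where "t \<in> D" "t < e" using cInf_lessD[OF D0, of e] e by (auto simp: d_def)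
  then show "\<exists>F c. finite F \<and> L2_norm (\<lambda>x. f x - (\<Sum>k\<in>F. c k * v k x)) < e" by (auto simp: D_def)
qed

section \<open>Absolutely convergent trigonometric series\<close>

lemma filterlim_ibox: "filterlim ibox (finite_subsets_at_top UNIV) sequentially"
  unfolding filterlim_finite_subsets_at_top
proof (intro allI impI)
  fix X :: "int set" assume "finite X \<and> X \<subseteq> UNIV"
  then obtain n where n: "X \<subseteq> ibox n" using finite_subset_ibox by blast
  show "\<forall>\<^sub>F y in sequentially. finite (ibox y) \<and> X \<subseteq> ibox y \<and> ibox y \<subseteq> UNIV"
    by (rule eventually_sequentiallyI[of n]) (use n ibox_mono in \<open>auto simp: subset_iff\<close>)
qed

lemma infsum_ibox_limit:
  fixes f :: "int \<Rightarrow> 'a::banach"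
  assumes "f summable_on UNIV"
  shows "(\<lambda>n. \<Sum>k\<in>ibox n. f k) \<longlonglongrightarrow> infsum f UNIV"
  using filterlim_compose[OF infsum_tendsto[OF assms] filterlim_ibox] .

text \<open>The columns of \<open>U\<close>, and finite combinations of the columns of
  \<open>K\<close>, are absolutely summable; the functions with such coefficients are continuous and
  their series converge uniformly.\<close>

locale abs_trig =
  fixes c :: "int \<Rightarrow> complex"
  assumes c: "(\<lambda>k. cmod (c k)) summable_on UNIV"
begin

definition f :: "real \<Rightarrow> complex" where "f x = (\<Sum>\<^sub>\<infinity>k. c k * ex k x)"
definition S :: "nat \<Rightarrow> real \<Rightarrow> complex" where "S n x = (\<Sum>k\<in>ibox n. c k * ex k x)"
definition tail :: "nat \<Rightarrow> real" where "tail n = (\<Sum>\<^sub>\<infinity>k. cmod (c k)) - (\<Sum>k\<in>ibox n. cmod (c k))"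

lemma summ: "(\<lambda>k. c k * ex k x) summable_on UNIV"
  by (rule abs_summable_summable) (simp add: norm_mult c)

lemma tail_limit: "tail \<longlonglongrightarrow> 0"
proof -
  have "(\<lambda>n. (\<Sum>\<^sub>\<infinity>k. cmod (c k)) - (\<Sum>k\<in>ibox n. cmod (c k))) \<longlonglongrightarrow> (\<Sum>\<^sub>\<infinity>k. cmod (c k)) - (\<Sum>\<^sub>\<infinity>k. cmod (c k))"
    by (intro tendsto_intros infsum_ibox_limit c)
  then show ?thesis by (simp add: tail_def[abs_def])
qed

lemma f_minus_S: "cmod (f x - S n x) \<le> tail n"
proof -
  have sub: "(\<lambda>k. c k * ex k x) summable_on A" "(\<lambda>k. cmod (c k)) summable_on A" for A
    by (rule summable_on_subset_banach[OF summ], simp) (rule summable_on_subset_banach[OF c], simp)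
  have U: "ibox n \<union> - ibox n = UNIV" and dj: "ibox n \<inter> - ibox n = {}" by auto
  have "f x = (\<Sum>\<^sub>\<infinity>k\<in>ibox n. c k * ex k x) + (\<Sum>\<^sub>\<infinity>k\<in>- ibox n. c k * ex k x)"
    unfolding f_def using infsum_Un_disjoint[OF sub(1) sub(1) dj] U by simp
  then have "f x - S n x = (\<Sum>\<^sub>\<infinity>k\<in>- ibox n. c k * ex k x)" by (simp add: S_def)
  also have "cmod \<dots> \<le> (\<Sum>\<^sub>\<infinity>k\<in>- ibox n. cmod (c k * ex k x))"
    by (rule norm_infsum_bound) (simp add: norm_mult sub(2))
  also have "\<dots> = (\<Sum>\<^sub>\<infinity>k\<in>- ibox n. cmod (c k))" by (simp add: norm_mult)
  also have "\<dots> = tail n"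
    unfolding tail_def using infsum_Un_disjoint[OF sub(2) sub(2) dj] U by simp
  finally show ?thesis .
qed

lemma continuous_f: "continuous_on A f"
proof (rule uniform_limit_theorem[OF _ _ sequentially_bot])
  show "\<forall>\<^sub>F n in sequentially. continuous_on A (S n)"
    unfolding S_def[abs_def] by (intro always_eventually allI continuous_intros)
  show "uniform_limit A S f sequentially"
    unfolding uniform_limit_iff
  proof (intro allI impI)
    fix e :: real assume "e > 0"
    then have "\<forall>\<^sub>F n in sequentially. tail n < e" using order_tendstoD(2)[OF tail_limit] by blast
    then show "\<forall>\<^sub>F n in sequentially. \<forall>x\<in>A. dist (S n x) (f x) < e"
    proof eventually_elim
      case (elim n)
      then show ?case using f_minus_S by (auto simp: dist_norm norm_minus_commute intro: le_less_trans)
    qed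
  qed
qed

lemma f_L2: "f \<in> L2"
  by (rule L2_continuous[OF continuous_f])

lemma S_L2: "S n \<in> L2"
  unfolding S_def[abs_def] by (intro L2_lincomb ex_L2)

lemma f_periodic: "f 1 = f 0"
  by (simp add: f_def)

lemma S_limit_L2: "(\<lambda>n. L2_norm (\<lambda>x. S n x - f x)) \<longlonglongrightarrow> 0"
proof (rule Lim_null_comparison[OF _ tail_limit], rule always_eventually, rule allI)
  fix n
  have "L2_norm (\<lambda>x. S n x - f x) \<le> tail n"
    by (rule L2_bounded(2)[OF L2_measurable[OF L2_diff[OF S_L2 f_L2]]])
      (use f_minus_S in \<open>simp add: norm_minus_commute\<close>)
  then show "norm (L2_norm (\<lambda>x. S n x - f x)) \<le> tail n" by simp
qed

text \<open>The convolution formula holds for the partial sums \<open>S n\<close> and passes to the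
  limit, because a Fourier coefficient of \<open>q * h\<close> is continuous in \<open>h\<close> for
  the \<open>L2\<close> norm.\<close>

lemma fc_mult:
  assumes q: "q \<in> L2"
  shows "fc (\<lambda>x. q x * f x) k = (\<Sum>\<^sub>\<infinity>i. fc q (k - i) * c i)"
proof -
  have qe: "integrable \<mu> (\<lambda>x. q x * ex j x)" for j by (rule L2_integrable_mult[OF q ex_L2])
  have cont: "continuous_on {0..1} (\<lambda>x. g x * ex j x)" if "continuous_on {0..1} g" for g j
    by (intro continuous_intros that)
  have Sc: "continuous_on {0..1} (S n)" for n unfolding S_def[abs_def] by (intro continuous_intros)
  have eq: "fc (\<lambda>x. q x * S n x) k = (\<Sum>i\<in>ibox n. fc q (k - i) * c i)" for n
  proof -
    have "fc (\<lambda>x. q x * S n x) k = (LINT x|\<mu>. (\<Sum>i\<in>ibox n. c i * (q x * ex (i - k) x)))"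
      unfolding fc_def
    proof (intro Bochner_Integration.integral_cong refl)
      fix x
      have e: "ex (i - k) x = ex i x * ex (- k) x" for i using ex_add[of i x "- k"] by simp
      show "q x * S n x * ex (- k) x = (\<Sum>i\<in>ibox n. c i * (q x * ex (i - k) x))"
        unfolding S_def sum_distrib_left sum_distrib_right e by (intro sum.cong refl) (simp add: mult_ac)
    qed
    also have "\<dots> = (\<Sum>i\<in>ibox n. c i * fc q (k - i))"
      unfolding fc_def by (subst Bochner_Integration.integral_sum) (auto intro!: integrable_mult_right qe)
    finally show ?thesis by (simp add: mult.commute)
  qed
  have "(\<lambda>n. fc (\<lambda>x. q x * S n x) k) \<longlonglongrightarrow> fc (\<lambda>x. q x * f x) k"
  proof (rule LIM_zero_cancel)
    have lim: "(\<lambda>n. L2_norm q * L2_norm (\<lambda>x. S n x - f x)) \<longlonglongrightarrow> 0"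
      using tendsto_mult_left[OF S_limit_L2, of "L2_norm q"] by simp
    show "(\<lambda>n. fc (\<lambda>x. q x * S n x) k - fc (\<lambda>x. q x * f x) k) \<longlonglongrightarrow> 0"
    proof (rule Lim_null_comparison[OF _ lim], rule always_eventually, rule allI)
      fix n
      have i1: "integrable \<mu> (\<lambda>x. q x * (S n x * ex (-k) x))" by (intro L2_integrable_mult q L2_continuous cont Sc)
      have i2: "integrable \<mu> (\<lambda>x. q x * (f x * ex (-k) x))" by (intro L2_integrable_mult q L2_continuous cont continuous_f)
      have L: "(\<lambda>x. (S n x - f x) * ex (-k) x) \<in> L2" by (intro L2_continuous cont continuous_intros Sc continuous_f)
      have "fc (\<lambda>x. q x * S n x) k - fc (\<lambda>x. q x * f x) k = (LINT x|\<mu>. q x * ((S n x - f x) * ex (-k) x))"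
        unfolding fc_def using Bochner_Integration.integral_diff[OF i1 i2] by (simp add: algebra_simps)
      also have "cmod \<dots> \<le> L2_norm q * L2_norm (\<lambda>x. (S n x - f x) * ex (-k) x)"
        by (rule L2_Cauchy_Schwarz[OF q L])
      also have "L2_norm (\<lambda>x. (S n x - f x) * ex (-k) x) = L2_norm (\<lambda>x. S n x - f x)"
        by (simp add: L2_norm_def norm_mult)
      finally show "norm (fc (\<lambda>x. q x * S n x) k - fc (\<lambda>x. q x * f x) k) \<le> L2_norm q * L2_norm (\<lambda>x. S n x - f x)" .
    qed
  qed
  moreover have "(\<lambda>n. fc (\<lambda>x. q x * S n x) k) \<longlonglongrightarrow> (\<Sum>\<^sub>\<infinity>i. fc q (k - i) * c i)"
    unfolding eq
  proof (rule infsum_ibox_limit, rule abs_summable_summable)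
    have "(\<lambda>i. L2_norm q * cmod (c i)) summable_on UNIV" by (intro summable_on_cmult_right c)
    then show "(\<lambda>i. norm (fc q (k - i) * c i)) summable_on UNIV"
      by (rule summable_on_comparison_test) (auto simp: norm_mult intro!: mult_right_mono fc_bound q)
  qed
  ultimately show ?thesis by (rule LIMSEQ_unique)
qed

text \<open>This is the convolution formula with the constant function \<open>1\<close> in place of
  \<open>q\<close>.\<close>

lemma fc_f: "fc f k = c k"
proof -
  have "fc f k = (\<Sum>\<^sub>\<infinity>i. fc (\<lambda>x. 1) (k - i) * c i)"
    using fc_mult[OF L2_continuous[OF continuous_on_const[of _ 1]], of k] by simp
  also have "\<dots> = (\<Sum>\<^sub>\<infinity>i\<in>{k}. c i)"
  proof (rule infsum_cong_neutral)
    have fc1: "fc (\<lambda>x. 1) j = (if j = 0 then 1 else 0)" for j by (simp add: fc_def integral_ex)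
    show "fc (\<lambda>x. 1) (k - i) * c i = 0" if "i \<in> UNIV - {k}" for i using that by (simp add: fc1)
    show "fc (\<lambda>x. 1) (k - i) * c i = c i" if "i \<in> UNIV \<inter> {k}" for i using that by (simp add: fc1)
  qed auto
  finally show ?thesis by simp
qed

lemma L2_norm_f_le:
  assumes "\<And>F. finite F \<Longrightarrow> (\<Sum>k\<in>F. (cmod (c k))\<^sup>2) \<le> s\<^sup>2" "s \<ge> 0"
  shows "L2_norm f \<le> s"
proof -
  have "(L2_norm f)\<^sup>2 \<le> s\<^sup>2"
    by (rule Lim_bounded[OF parseval[OF f_L2], of 0]) (use assms(1) finite_ibox fc_f in simp)
  then show ?thesis using assms(2) by (rule power2_le_imp_le)
qed

end

lemma continuous_fc_zero:
  assumes f: "continuous_on {0..1} f" and z: "\<And>k. fc f k = 0" and x: "x \<in> {0..1}"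
  shows "f x = 0"
proof -
  have "AE x in \<mu>. f x = 0" by (rule fc_zero_imp_AE_zero[OF L2_continuous[OF f] z])
  then have "L2_norm f = 0" using L2_norm_eq_0_iff[OF L2_continuous[OF f]] by simp
  then have z: "(LINT x|\<mu>. (cmod (f x))\<^sup>2) = 0" using L2_norm_square[of f] by simp
  have c: "continuous_on {0..1} (\<lambda>x. (cmod (f x))\<^sup>2)" by (intro continuous_intros f)
  have int: "integrable \<mu> (\<lambda>x. (cmod (f x))\<^sup>2)" using L2_integrable_square[OF L2_continuous[OF f]] .
  have "((\<lambda>x. (cmod (f x))\<^sup>2) has_integral 0) {0..1}"
  proof -
    have "(\<lambda>x. (cmod (f x))\<^sup>2) integrable_on {0..1}" by (rule integrable_continuous_real[OF c])
    moreover have "integral {0..1} (\<lambda>x. (cmod (f x))\<^sup>2) = 0"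
      using lebesgue_integral_eq_integral[OF int] z by simp
    ultimately show ?thesis by (simp add: has_integral_iff)
  qed
  then have "(cmod (f x))\<^sup>2 = 0"
    using has_integral_0_cbox_imp_0[of 0 1 "\<lambda>x. (cmod (f x))\<^sup>2" x] c x by simp
  then show ?thesis by simp
qed

section \<open>From Fourier coefficients back to differentiability\<close>

lemma fc_derivative:
  assumes F: "\<And>x. x \<in> {0..1} \<Longrightarrow> (F has_vector_derivative f x) (at x within {0..1})"
    and f: "continuous_on {0..1} f" and per: "F 1 = F 0"
  shows "fc f k = 2 * pi * \<i> * of_int k * fc F k"
proof -
  have Fc: "continuous_on {0..1} F" by (rule continuous_on_vector_derivative[OF F])
  have "((\<lambda>x. f x * ex (-k) x + F x * ((2 * pi * \<i> * of_int (-k)) * ex (-k) x)) has_integral F 1 * ex (-k) 1 - F 0 * ex (-k) 0) {0..1}"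
    by (rule fundamental_theorem_of_calculus)
      (use F in \<open>auto intro!: derivative_eq_intros has_vector_derivative_mult ex_has_derivative[of "-k", simplified] simp: algebra_simps\<close>)
  moreover have i1: "integrable \<mu> (\<lambda>x. f x * ex (-k) x)" by (intro continuous_integrable_mu continuous_intros f)
  moreover have i2: "integrable \<mu> (\<lambda>x. F x * ((2 * pi * \<i> * of_int (-k)) * ex (-k) x))"
    by (intro continuous_integrable_mu continuous_intros Fc)
  ultimately have "(LINT x|\<mu>. f x * ex (-k) x + F x * ((2 * pi * \<i> * of_int (-k)) * ex (-k) x)) = 0"
    using has_integral_lint[OF Bochner_Integration.integrable_add[OF i1 i2]] per by simp
  moreover have "(LINT x|\<mu>. F x * ((2 * pi * \<i> * of_int (-k)) * ex (-k) x)) = (2 * pi * \<i> * of_int (-k)) * fc F k"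
    unfolding fc_def by (subst integral_mult_right_zero[symmetric]) (simp add: mult_ac)
  ultimately show ?thesis using Bochner_Integration.integral_add[OF i1 i2] by (simp add: fc_def)
qed

lemma continuous_periodic_antiderivative:
  assumes h: "continuous_on {0..1} h" and h0: "fc h 0 = 0"
  obtains H where "\<And>x. x \<in> {0..1} \<Longrightarrow> (H has_vector_derivative h x) (at x within {0..1})"
    "H 1 = H 0" "fc H 0 = 0" "continuous_on {0..1} H"
proof -
  define H1 where "H1 x = integral {0..x} h" for x
  have d: "(H1 has_vector_derivative h x) (at x within {0..1})" if "x \<in> {0..1}" for x
    unfolding H1_def by (rule integral_has_vector_derivative[OF h that])
  have c: "continuous_on {0..1} H1" by (rule continuous_on_vector_derivative[OF d])
  have "H1 1 = fc h 0" using lint_eq_integral[OF continuous_integrable_mu[OF h]] by (simp add: H1_def fc_def ex_0)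
  then have per: "H1 1 = H1 0" by (simp add: h0 H1_def)
  show thesis
  proof (rule that[of "\<lambda>x. H1 x - fc H1 0"])
    show "((\<lambda>x. H1 x - fc H1 0) has_vector_derivative h x) (at x within {0..1})" if "x \<in> {0..1}" for x
      using d[OF that] by (auto intro!: derivative_eq_intros)
    show "fc (\<lambda>x. H1 x - fc H1 0) 0 = 0"
    proof -
      have "fc (\<lambda>x. fc H1 0) 0 = fc H1 0" unfolding fc_def[of "\<lambda>x. fc H1 0"] using integral_ex[of 0] by simp
      then show ?thesis using fc_diff[OF L2_continuous[OF c] L2_continuous[OF continuous_on_const[of _ "fc H1 0"]], of 0] by simp
    qed
  qed (use per c in \<open>auto intro!: continuous_intros\<close>)
qed

text \<open>The derivatives are carried as data, so that linear combinations and integrations by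
  parts can be formed without evaluating \<open>deriv01\<close>.\<close>

definition C2_periodic :: "(real \<Rightarrow> complex) \<Rightarrow> (real \<Rightarrow> complex) \<Rightarrow> (real \<Rightarrow> complex) \<Rightarrow> bool"
  where "C2_periodic y y' y'' \<longleftrightarrow> continuous_on {0..1} y'' \<and> y 1 = y 0 \<and> y' 1 = y' 0 \<and>
    (\<forall>x\<in>{0..1}. (y has_vector_derivative y' x) (at x within {0..1}) \<and>
       (y' has_vector_derivative y'' x) (at x within {0..1}))"

text \<open>Integrating \<open>h\<close> twice, with the means removed, gives a periodic
  \<open>G\<close> that shares with \<open>f\<close> all Fourier coefficients except the one at
  \<open>0\<close>. Both functions are continuous, so they differ by the constant
  \<open>fc f 0\<close>.\<close>

lemma C2_periodic_of_fourier:
  assumes f: "continuous_on {0..1} f" "f 1 = f 0" and h: "continuous_on {0..1} h"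
    and fh: "\<And>k. fc h k = - of_real (4 * pi\<^sup>2 * of_int (k\<^sup>2)) * fc f k"
  shows "\<exists>f'. C2_periodic f f' h"
proof -
  have h0: "fc h 0 = 0" by (simp add: fh)
  obtain H where H: "\<And>x. x \<in> {0..1} \<Longrightarrow> (H has_vector_derivative h x) (at x within {0..1})"
    "H 1 = H 0" "fc H 0 = 0" "continuous_on {0..1} H"
    using continuous_periodic_antiderivative[OF h h0] by metis
  obtain G where G: "\<And>x. x \<in> {0..1} \<Longrightarrow> (G has_vector_derivative H x) (at x within {0..1})"
    "G 1 = G 0" "fc G 0 = 0" "continuous_on {0..1} G"
    using continuous_periodic_antiderivative[OF H(4,3)] by metis
  have "fc f k = fc G k" if "k \<noteq> 0" for k
  proof -
    have "fc h k = 2 * pi * \<i> * of_int k * (2 * pi * \<i> * of_int k * fc G k)"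
      using fc_derivative[OF H(1) h H(2), of k] fc_derivative[OF G(1) H(4) G(2), of k] by simp
    also have "\<dots> = - of_real (4 * pi\<^sup>2 * of_int (k\<^sup>2)) * fc G k"
      by (simp add: power2_eq_square)
    finally have "of_real (4 * pi\<^sup>2 * of_int (k\<^sup>2)) * fc f k = of_real (4 * pi\<^sup>2 * of_int (k\<^sup>2)) * fc G k"
      using fh[of k] by simp
    moreover have "complex_of_real (4 * pi\<^sup>2 * of_int (k\<^sup>2)) \<noteq> 0" using that by simp
    ultimately show ?thesis using mult_cancel_left by blast
  qed
  moreover have "fc (\<lambda>x. a) k = (if k = 0 then a else 0)" for a k
    unfolding fc_def using integral_ex[of "-k"] by simp
  ultimately have z: "fc (\<lambda>x. (f x - G x) - fc f 0) k = 0" for k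
    using G(3)
    by (cases "k = 0") (simp_all add: fc_diff L2_continuous f(1) G(4) L2_diff)
  then have eq: "f x = G x + fc f 0" if "x \<in> {0..1}" for x
  proof -
    have "continuous_on {0..1} (\<lambda>x. (f x - G x) - fc f 0)" by (intro continuous_intros f(1) G(4))
    from continuous_fc_zero[OF this z that] show ?thesis by (simp add: algebra_simps)
  qed
  have "(f has_vector_derivative H x) (at x within {0..1})" if "x \<in> {0..1}" for x
  proof -
    have "((\<lambda>x. G x + fc f 0) has_vector_derivative H x) (at x within {0..1})"
      using G(1)[OF that] by (auto intro!: derivative_eq_intros)
    then show ?thesis by (rule has_vector_derivative_transform[OF that, rotated]) (use eq in auto)
  qed
  then have "C2_periodic f H h" unfolding C2_periodic_def using H h f(2) by auto
  then show ?thesis by blast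
qed

section \<open>Block diagonalisation of the Fourier matrix\<close>

text \<open>Picard iteration from zero. Limits are taken pointwise, but the tail estimate
  \<open>2 * R * (1/2)^n\<close> is uniform, which is what the contraction hypothesis asks
  for.\<close>

lemma sup_contraction_fixpoint:
  fixes F :: "('a \<Rightarrow> complex) \<Rightarrow> 'a \<Rightarrow> complex"
  assumes self: "\<And>Y x. (\<And>x. cmod (Y x) \<le> R) \<Longrightarrow> cmod (F Y x) \<le> R"
    and contr: "\<And>Y Y' \<epsilon> x. (\<And>x. cmod (Y x) \<le> R) \<Longrightarrow> (\<And>x. cmod (Y' x) \<le> R) \<Longrightarrow>
      (\<And>x. cmod (Y x - Y' x) \<le> \<epsilon>) \<Longrightarrow> cmod (F Y x - F Y' x) \<le> \<epsilon> / 2"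
    and R: "R \<ge> 0"
  obtains Y where "\<And>x. cmod (Y x) \<le> R" "F Y = Y"
proof -
  define X where "X n = (F ^^ n) (\<lambda>x. 0)" for n
  have X0: "X 0 = (\<lambda>x. 0)" and XS: "X (Suc n) = F (X n)" for n by (simp_all add: X_def)
  have XR: "cmod (X n x) \<le> R" for n x
    by (induction n arbitrary: x) (auto simp: X0 XS R intro: self)
  have step: "cmod (X (Suc n) x - X n x) \<le> R * (1/2)^n" for n x
  proof (induction n arbitrary: x)
    case 0 then show ?case using XR[of 1 x] by (simp add: X0)
  next
    case (Suc n)
    have "cmod (F (X (Suc n)) x - F (X n) x) \<le> R * (1/2)^n / 2"
      by (rule contr[OF XR XR Suc])
    then show ?case by (simp add: XS)
  qed
  have summ: "summable (\<lambda>n. X (Suc n) x - X n x)" for x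
    by (rule summable_comparison_test'[of "\<lambda>n. R * (1/2)^n" 0]) (auto intro: step summable_mult summable_geometric)
  have telescope: "(\<Sum>i<n. X (Suc i) x - X i x) = X n x" for n x
    using sum_lessThan_telescope[of "\<lambda>i. X i x" n] by (simp add: X0)
  define Y where "Y x = (\<Sum>n. X (Suc n) x - X n x)" for x
  have lim: "(\<lambda>n. X n x) \<longlonglongrightarrow> Y x" for x
    using summable_LIMSEQ[OF summ, of x] by (simp add: telescope Y_def)
  have YR: "cmod (Y x) \<le> R" for x
    by (rule Lim_bounded[OF tendsto_norm[OF lim], of 0]) (simp add: XR)
  have tail: "cmod (Y x - X n x) \<le> 2 * R * (1/2)^n" for n x
  proof -
    have "cmod (X (n + m) x - X n x) \<le> 2 * R * (1/2)^n - 2 * R * (1/2)^(n+m)" for m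
    proof (induction m)
      case (Suc m)
      have "cmod (X (n + Suc m) x - X n x) \<le> cmod (X (Suc (n + m)) x - X (n + m) x) + cmod (X (n + m) x - X n x)"
        using norm_triangle_ineq[of "X (Suc (n + m)) x - X (n + m) x" "X (n + m) x - X n x"] by simp
      then show ?case using Suc step[of "n+m" x] by simp
    qed simp
    moreover have "2 * R * (1/2)^(n+m) \<ge> 0" for m using R by simp
    ultimately have "cmod (X (n + m) x - X n x) \<le> 2 * R * (1/2)^n" for m by (smt (verit))
    moreover have "(\<lambda>m. cmod (X (n + m) x - X n x)) \<longlonglongrightarrow> cmod (Y x - X n x)"
      using LIMSEQ_ignore_initial_segment[OF lim[of x], of n] by (intro tendsto_intros) (simp add: add.commute)
    ultimately show ?thesis by (intro Lim_bounded[of _ _ 0]) auto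
  qed
  have "F Y x = Y x" for x
  proof -
    have "(\<lambda>n. X (Suc n) x) \<longlonglongrightarrow> F Y x"
    proof (rule LIM_zero_cancel, rule Lim_null_comparison)
      show "\<forall>\<^sub>F n in sequentially. norm (X (Suc n) x - F Y x) \<le> R * (1/2)^n"
      proof (rule always_eventually, rule allI)
        fix n
        have "cmod (F Y x - F (X n) x) \<le> 2 * R * (1/2)^n / 2" by (rule contr[OF YR XR tail])
        then show "norm (X (Suc n) x - F Y x) \<le> R * (1/2)^n" by (simp add: XS norm_minus_commute)
      qed
      show "(\<lambda>n. R * (1/2)^n) \<longlonglongrightarrow> 0" using tendsto_mult_left[OF LIMSEQ_realpow_zero[of "1/2"], of R] by simp
    qed
    moreover have "(\<lambda>n. X (Suc n) x) \<longlonglongrightarrow> Y x" using lim by (rule LIMSEQ_Suc)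
    ultimately show ?thesis by (rule LIMSEQ_unique)
  qed
  then have "F Y = Y" by auto
  with YR show thesis by (rule that)
qed

text \<open>The spectral blocks of the unperturbed operator, with the first \<open>N + 1\<close> of them merged into one.\<close>

definition rel :: "nat \<Rightarrow> int \<Rightarrow> int \<Rightarrow> bool"
  where "rel N i j \<longleftrightarrow> \<bar>i\<bar> = \<bar>j\<bar> \<or> \<bar>i\<bar> \<le> int N \<and> \<bar>j\<bar> \<le> int N"

definition blk :: "nat \<Rightarrow> int \<Rightarrow> int set" where "blk N j = {l. rel N l j}"

lemma rel_refl [simp]: "rel N i i" by (simp add: rel_def)
lemma rel_sym: "rel N i j \<Longrightarrow> rel N j i" unfolding rel_def by metis
lemma rel_commute: "rel N i j \<longleftrightarrow> rel N j i" using rel_sym by blast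
lemma rel_trans: "rel N i j \<Longrightarrow> rel N j k \<Longrightarrow> rel N i k" unfolding rel_def by metis

lemma finite_blk [simp]: "finite (blk N j)"
proof (rule finite_subset)
  show "blk N j \<subseteq> {- (\<bar>j\<bar> + int N)..\<bar>j\<bar> + int N}"
  proof
    fix l assume "l \<in> blk N j"
    then have "\<bar>l\<bar> \<le> \<bar>j\<bar> + int N" unfolding blk_def rel_def by fastforce
    then show "l \<in> {- (\<bar>j\<bar> + int N)..\<bar>j\<bar> + int N}" by (simp add: abs_le_iff)
  qed
qed simp

lemma blk_self [simp]: "j \<in> blk N j" by (simp add: blk_def)

lemma blk_eq: "rel N i j \<Longrightarrow> blk N i = blk N j"
  unfolding blk_def using rel_trans rel_sym by blast

text \<open>Up to the factor \<open>4 * pi\<^sup>2\<close> this is the inverse distance of two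
  unperturbed eigenvalues. The value \<open>0\<close> within a block lets sums over all integers see
  the other blocks only.\<close>

definition gapinv :: "nat \<Rightarrow> int \<Rightarrow> int \<Rightarrow> real"
  where "gapinv N i j = (if rel N i j then 0 else 1 / of_int \<bar>i\<^sup>2 - j\<^sup>2\<bar>)"

lemma gapinv_commute: "gapinv N i j = gapinv N j i"
  by (simp add: gapinv_def rel_commute abs_minus_commute)

lemma gapinv_nonneg [simp]: "gapinv N i j \<ge> 0" by (simp add: gapinv_def)

lemma not_rel_square: "\<not> rel N i j \<Longrightarrow> i\<^sup>2 \<noteq> j\<^sup>2"
  by (metis abs_eq_iff power2_eq_iff rel_def)

lemma gapinv_le_1: "gapinv N i j \<le> 1"
proof (cases "rel N i j")
  case False
  then have "\<bar>i\<^sup>2 - j\<^sup>2\<bar> \<ge> 1" using not_rel_square[OF False] by linarith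
  then have "real_of_int \<bar>i\<^sup>2 - j\<^sup>2\<bar> \<ge> 1" by linarith
  then show ?thesis using False by (simp add: gapinv_def)
qed (simp add: gapinv_def)

text \<open>The summable sequence \<open>|m|\<close> to the power \<open>-3/2\<close>. It majorises
  what remains of the inverse gap after a factor \<open>1 / sqrt N\<close> has been split
  off.\<close>

definition z32 :: "int \<Rightarrow> real" where "z32 m = (if m = 0 then 0 else 1 / (of_int \<bar>m\<bar> * sqrt (of_int \<bar>m\<bar>)))"

lemma z32_nonneg [simp]: "z32 m \<ge> 0" by (simp add: z32_def)

lemma z32_summable: "z32 summable_on UNIV"
proof -
  have "summable (\<lambda>n. real n powr (-3/2))" by (simp add: summable_real_powr_iff)
  moreover have "real n powr (-3/2) = z32 (int n)" for n
  proof (cases "n = 0")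
    case False
    then have "real n powr (-3/2) = inverse (real n powr (1 + 1/2))" by (simp add: powr_minus[symmetric])
    also have "real n powr (1 + 1/2) = real n * sqrt (real n)" using False by (simp only: powr_add powr_half_sqrt) simp
    finally show ?thesis using False by (simp add: z32_def inverse_eq_divide)
  qed (simp add: z32_def)
  ultimately have s: "summable (\<lambda>n. z32 (int n))" by simp
  then have 1: "(\<lambda>n. z32 (int n)) summable_on UNIV" by (intro summable_nonneg_imp_summable_on) auto
  then have "z32 summable_on (int ` UNIV)" by (subst summable_on_reindex) (auto simp: o_def)
  moreover have "z32 summable_on ((\<lambda>n. - int n) ` UNIV)"
  proof (subst summable_on_reindex)
    have "(z32 \<circ> (\<lambda>n. - int n)) = (\<lambda>n. z32 (int n))" by (auto simp: z32_def)
    then show "(z32 \<circ> (\<lambda>n. - int n)) summable_on UNIV" using 1 by simp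
  qed (auto simp: inj_on_def)
  ultimately have "z32 summable_on (int ` UNIV \<union> (\<lambda>n. - int n) ` UNIV)"
    by (rule summable_on_union)
  also have "int ` UNIV \<union> (\<lambda>n. - int n) ` UNIV = UNIV"
  proof -
    have "m \<in> int ` UNIV \<union> (\<lambda>n. - int n) ` UNIV" for m :: int
      by (cases "m \<ge> 0") (auto simp: image_iff intro: exI[of _ "nat m"] exI[of _ "nat (-m)"])
    then show ?thesis by blast
  qed
  finally show ?thesis .
qed

text \<open>The factor \<open>2\<close> allows for the two signs of \<open>i\<close> in the sums
  over \<open>|i|\<close> of \<open>z32_shift\<close>.\<close>

definition Z32 :: real where "Z32 = 2 * infsum z32 UNIV"

lemma Z32_nonneg: "Z32 \<ge> 0" by (simp add: Z32_def infsum_nonneg)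

lemma z32_shift: "(\<lambda>i. z32 (\<bar>i\<bar> - a)) summable_on UNIV" "infsum (\<lambda>i. z32 (\<bar>i\<bar> - a)) UNIV \<le> Z32"
proof -
  have sub: "z32 summable_on A" for A by (rule summable_on_subset_banach[OF z32_summable]) simp
  have le: "infsum z32 A \<le> infsum z32 UNIV" for A by (rule infsum_mono2[OF sub sub]) auto
  have bij1: "bij_betw (\<lambda>i. \<bar>i\<bar> - a) {0..} ((\<lambda>i. \<bar>i\<bar> - a) ` {0..})" by (auto simp: bij_betw_def inj_on_def)
  have bij2: "bij_betw (\<lambda>i. \<bar>i\<bar> - a) {..<0} ((\<lambda>i. \<bar>i\<bar> - a) ` {..<0})" by (auto simp: bij_betw_def inj_on_def)
  have s1: "(\<lambda>i. z32 (\<bar>i\<bar> - a)) summable_on {0..}" using summable_on_reindex_bij_betw[OF bij1, of z32] sub by blast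
  have s2: "(\<lambda>i. z32 (\<bar>i\<bar> - a)) summable_on {..<0}" using summable_on_reindex_bij_betw[OF bij2, of z32] sub by blast
  have U: "{0..} \<union> {..<0} = (UNIV :: int set)" and dj: "{0..} \<inter> {..<0::int} = {}" by auto
  show "(\<lambda>i. z32 (\<bar>i\<bar> - a)) summable_on UNIV" using summable_on_Un_disjoint[OF s1 s2 dj] U by simp
  have "infsum (\<lambda>i. z32 (\<bar>i\<bar> - a)) UNIV = infsum (\<lambda>i. z32 (\<bar>i\<bar> - a)) {0..} + infsum (\<lambda>i. z32 (\<bar>i\<bar> - a)) {..<0}"
    using infsum_Un_disjoint[OF s1 s2 dj] U by simp
  also have "\<dots> \<le> infsum z32 UNIV + infsum z32 UNIV"
    using infsum_reindex_bij_betw[OF bij1, of z32] infsum_reindex_bij_betw[OF bij2, of z32] le by (intro add_mono) auto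
  finally show "infsum (\<lambda>i. z32 (\<bar>i\<bar> - a)) UNIV \<le> Z32" by (simp add: Z32_def)
qed

text \<open>The gap factors as \<open>m * t\<close> with \<open>t\<close> at least \<open>m\<close>
  and at least \<open>N\<close>, so that \<open>t\<close> is at least
  \<open>sqrt m * sqrt N\<close>: one half of the large factor buys summability, the other half
  decay in \<open>N\<close>.\<close>

lemma gapinv_le_z32:
  assumes N: "N > 0"
  shows "gapinv N i j \<le> z32 (\<bar>i\<bar> - \<bar>j\<bar>) / sqrt (real N)"
proof (cases "rel N i j")
  case False
  define m where "m = \<bar>\<bar>i\<bar> - \<bar>j\<bar>\<bar>"
  define t where "t = \<bar>i\<bar> + \<bar>j\<bar>"
  have m: "m > 0" using False by (auto simp: m_def rel_def)
  have tm: "t \<ge> m" "real N \<le> of_int t" using False by (auto simp: t_def m_def rel_def)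
  have "\<bar>i\<^sup>2 - j\<^sup>2\<bar> = m * t"
  proof -
    have "i\<^sup>2 - j\<^sup>2 = (\<bar>i\<bar> - \<bar>j\<bar>) * (\<bar>i\<bar> + \<bar>j\<bar>)" by (simp add: power2_eq_square algebra_simps)
    then show ?thesis by (simp add: abs_mult m_def t_def)
  qed
  then have eq: "gapinv N i j = 1 / (of_int m * of_int t)" using False by (simp add: gapinv_def)
  have "sqrt (of_int m) * sqrt (real N) \<le> sqrt (of_int t) * sqrt (real_of_int t)"
    using tm m by (intro mult_mono) auto
  then have "sqrt (of_int m) * sqrt (real N) \<le> real_of_int t" using tm m by simp
  then have "of_int m * (sqrt (of_int m) * sqrt (real N)) \<le> of_int m * real_of_int t" using m by (intro mult_left_mono) auto
  then have "1 / (of_int m * of_int t) \<le> 1 / (of_int m * (sqrt (of_int m) * sqrt (real N)))"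
    using m N tm by (intro divide_left_mono mult_pos_pos) auto
  also have "\<dots> = z32 (\<bar>i\<bar> - \<bar>j\<bar>) / sqrt (real N)" using m by (simp add: z32_def m_def[symmetric] mult.assoc) (simp add: m_def)
  finally show ?thesis by (simp add: eq)
qed (simp add: gapinv_def)

lemma gapinv_summable: "N > 0 \<Longrightarrow> (\<lambda>i. gapinv N i j) summable_on UNIV"
  and gapinv_sum_N: "N > 0 \<Longrightarrow> infsum (\<lambda>i. gapinv N i j) UNIV \<le> Z32 / sqrt (real N)"
proof -
  assume N: "N > 0"
  have s: "(\<lambda>i. z32 (\<bar>i\<bar> - \<bar>j\<bar>) / sqrt (real N)) summable_on UNIV"
    using summable_on_cmult_left[OF z32_shift(1), of "\<bar>j\<bar>" "1 / sqrt (real N)"] by simp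
  have le: "gapinv N i j \<le> z32 (\<bar>i\<bar> - \<bar>j\<bar>) / sqrt (real N)" for i
    by (rule gapinv_le_z32[OF N])
  show 1: "(\<lambda>i. gapinv N i j) summable_on UNIV" by (rule summable_on_comparison_test[OF s le]) auto
  have "infsum (\<lambda>i. gapinv N i j) UNIV \<le> infsum (\<lambda>i. z32 (\<bar>i\<bar> - \<bar>j\<bar>) / sqrt (real N)) UNIV"
    by (rule infsum_mono[OF 1 s le])
  also have "\<dots> = infsum (\<lambda>i. z32 (\<bar>i\<bar> - \<bar>j\<bar>)) UNIV / sqrt (real N)"
    using infsum_cmult_left[of "1 / sqrt (real N)" "\<lambda>i. z32 (\<bar>i\<bar> - \<bar>j\<bar>)" UNIV] z32_shift(1) by simp
  also have "\<dots> \<le> Z32 / sqrt (real N)" by (intro divide_right_mono z32_shift(2)) simp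
  finally show "infsum (\<lambda>i. gapinv N i j) UNIV \<le> Z32 / sqrt (real N)" .
qed

text \<open>\<open>Vf\<close> stands for the Fourier coefficients of the potential and
  \<open>w\<close> for their rate of decay. The last assumption makes the fixed point equation below
  contractive.\<close>

locale decoupling =
  fixes Vf :: "int \<Rightarrow> complex" and w :: "int \<Rightarrow> real" and C :: real and N :: nat
  assumes w_pos: "w k > 0" and w_le_1: "w k \<le> 1" and w_mult: "w a * w b \<le> w (a + b)"
    and Vf: "cmod (Vf k) \<le> C * w k" and C: "C > 0" and N: "N > 0" and small: "C * (Z32 / sqrt (real N)) \<le> 1/8"
begin

abbreviation \<gamma> :: real where "\<gamma> \<equiv> Z32 / sqrt (real N)"

definition d :: "int \<Rightarrow> complex" where "d k = of_real (4 * pi\<^sup>2 * of_int (k\<^sup>2))"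

definition KY :: "(int \<times> int \<Rightarrow> complex) \<Rightarrow> int \<Rightarrow> int \<Rightarrow> complex"
  where "KY Y k j = (if rel N k j then 0 else Y (k,j) * of_real (w (k - j)) / of_int (k\<^sup>2 - j\<^sup>2))"

definition VKY :: "(int \<times> int \<Rightarrow> complex) \<Rightarrow> int \<Rightarrow> int \<Rightarrow> complex"
  where "VKY Y k j = (\<Sum>\<^sub>\<infinity>i. Vf (k - i) * KY Y i j)"

definition BY :: "(int \<times> int \<Rightarrow> complex) \<Rightarrow> int \<Rightarrow> int \<Rightarrow> complex"
  where "BY Y l j = Vf (l - j) + VKY Y l j"

text \<open>
  The entries of \<open>U = 1 + K\<close> outside the blocks are sought as \<open>K k j = w (k - j) * Y (k, j) / (k\<^sup>2 - j\<^sup>2)\<close>.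
  Solving the intertwining relation for \<open>Y\<close> gives the equation \<open>FY Y = Y\<close>; as \<open>w\<close> is submultiplicative
  and the gaps \<open>\<bar>k\<^sup>2 - j\<^sup>2\<bar>\<close> between blocks are large, \<open>FY\<close> is a contraction in the supremum norm.
\<close>

definition FY :: "(int \<times> int \<Rightarrow> complex) \<Rightarrow> int \<times> int \<Rightarrow> complex"
  where "FY Y = (\<lambda>(k,j). if rel N k j then 0 else
     (- BY Y k j + (\<Sum>l\<in>blk N j. KY Y k l * BY Y l j)) / of_real (4 * pi\<^sup>2 * w (k - j)))"

lemma KY_bound: "\<forall>x. cmod (Y x) \<le> R \<Longrightarrow> cmod (KY Y k j) \<le> R * w (k - j) * gapinv N k j"
proof -
  assume Y: "\<forall>x. cmod (Y x) \<le> R"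
  show ?thesis
  proof (cases "rel N k j")
    case False
    then have "cmod (KY Y k j) = cmod (Y (k,j)) * w (k - j) * gapinv N k j"
      using w_pos[of "k - j"] by (simp add: KY_def gapinv_def norm_divide norm_mult norm_of_int del: of_int_diff of_int_power)
    then show ?thesis using spec[OF Y, of "(k,j)"] w_pos[of "k - j"] by (auto intro!: mult_right_mono)
  qed (simp add: KY_def gapinv_def)
qed

lemma KY_diff: "KY Y k j - KY Y' k j = KY (\<lambda>x. Y x - Y' x) k j"
  by (simp add: KY_def algebra_simps diff_divide_distrib)

lemma R_nonneg: "(\<forall>x. cmod (Y x) \<le> R) \<Longrightarrow> R \<ge> 0"
  by (metis norm_ge_zero order.trans)

lemma VK_term_bound:
  assumes Y: "\<forall>x. cmod (Y x) \<le> R"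
  shows "cmod (Vf (k - i) * KY Y i j) \<le> C * R * w (k - j) * gapinv N i j"
proof -
  have "cmod (Vf (k - i) * KY Y i j) \<le> (C * w (k - i)) * (R * w (i - j) * gapinv N i j)"
    unfolding norm_mult using Vf KY_bound[OF Y] C w_pos[of "k - i"] by (intro mult_mono) auto
  also have "\<dots> = C * R * gapinv N i j * (w (k - i) * w (i - j))" by simp
  also have "\<dots> \<le> C * R * gapinv N i j * w (k - j)"
    using w_mult[of "k - i" "i - j"] C R_nonneg[OF Y] by (intro mult_left_mono) auto
  finally show ?thesis by (simp add: mult_ac)
qed

lemma VK_summable:
  assumes Y: "\<forall>x. cmod (Y x) \<le> R"
  shows "(\<lambda>i. cmod (Vf (k - i) * KY Y i j)) summable_on UNIV"
proof (rule summable_on_comparison_test[OF _ VK_term_bound[OF Y]])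
  show "(\<lambda>i. C * R * w (k - j) * gapinv N i j) summable_on UNIV"
    by (intro summable_on_cmult_right gapinv_summable N)
qed simp

lemma VKY_bound_gen:
  assumes Y: "\<forall>x. cmod (Y x) \<le> R"
  shows "cmod (VKY Y k j) \<le> C * R * w (k - j) * infsum (\<lambda>i. gapinv N i j) UNIV"
proof -
  have "cmod (VKY Y k j) \<le> infsum (\<lambda>i. cmod (Vf (k - i) * KY Y i j)) UNIV"
    unfolding VKY_def by (rule norm_infsum_bound[OF VK_summable[OF Y]])
  also have "\<dots> \<le> infsum (\<lambda>i. C * R * w (k - j) * gapinv N i j) UNIV"
    by (rule infsum_mono[OF VK_summable[OF Y] _ VK_term_bound[OF Y]]) (intro summable_on_cmult_right gapinv_summable N)
  also have "\<dots> = C * R * w (k - j) * infsum (\<lambda>i. gapinv N i j) UNIV"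
    by (rule infsum_cmult_right) (use gapinv_summable N in auto)
  finally show ?thesis .
qed

lemma VKY_bound:
  assumes Y: "\<forall>x. cmod (Y x) \<le> R"
  shows "cmod (VKY Y k j) \<le> R * w (k - j) / 8"
proof -
  have "cmod (VKY Y k j) \<le> C * R * w (k - j) * \<gamma>"
    by (rule order.trans[OF VKY_bound_gen[OF Y]])
      (rule mult_left_mono[OF gapinv_sum_N[OF N]], use C R_nonneg[OF Y] w_pos[of "k - j"] in simp)
  also have "\<dots> = R * w (k - j) * (C * \<gamma>)" by simp
  also have "\<dots> \<le> R * w (k - j) * (1/8)" by (rule mult_left_mono[OF small]) (use R_nonneg[OF Y] w_pos[of "k - j"] in auto)
  finally show ?thesis by simp
qed

lemma VKY_diff:
  assumes Y: "\<forall>x. cmod (Y x) \<le> R" and Y': "\<forall>x. cmod (Y' x) \<le> R"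
  shows "VKY Y k j - VKY Y' k j = VKY (\<lambda>x. Y x - Y' x) k j"
  unfolding VKY_def KY_diff[symmetric] right_diff_distrib
  using infsum_add[OF abs_summable_summable[OF VK_summable[OF Y]] summable_on_uminus[THEN iffD2, OF abs_summable_summable[OF VK_summable[OF Y']]]]
  by (simp add: infsum_uminus)

lemma BY_bound:
  assumes Y: "\<forall>x. cmod (Y x) \<le> C"
  shows "cmod (BY Y k j) \<le> (9/8) * C * w (k - j)"
  using norm_triangle_ineq[of "Vf (k - j)" "VKY Y k j"] Vf[of "k - j"] VKY_bound[OF Y, where k=k and j=j]
  by (simp add: BY_def)

lemma KB_bound:
  assumes K: "\<And>l. l \<in> blk N j \<Longrightarrow> cmod (K l) \<le> a * w (k - l) * gapinv N k l"
    and B: "\<And>l. cmod (B l) \<le> b * w (l - j)" and a: "a \<ge> 0" and b: "b \<ge> 0"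
  shows "cmod (\<Sum>l\<in>blk N j. K l * B l) \<le> a * b * w (k - j) * \<gamma>"
proof -
  have "cmod (\<Sum>l\<in>blk N j. K l * B l) \<le> (\<Sum>l\<in>blk N j. a * b * w (k - j) * gapinv N l k)"
  proof (rule sum_norm_le)
    fix l assume l: "l \<in> blk N j"
    have "cmod (K l * B l) \<le> (a * w (k - l) * gapinv N k l) * (b * w (l - j))"
      unfolding norm_mult using K[OF l] B[of l] a w_pos[of "k - l"] by (intro mult_mono) auto
    also have "\<dots> = a * b * gapinv N k l * (w (k - l) * w (l - j))" by simp
    also have "\<dots> \<le> a * b * gapinv N k l * w (k - j)" using w_mult[of "k - l" "l - j"] a b by (intro mult_left_mono) auto
    finally show "cmod (K l * B l) \<le> a * b * w (k - j) * gapinv N l k" by (simp add: mult_ac gapinv_commute[of N l k])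
  qed
  also have "\<dots> = a * b * w (k - j) * (\<Sum>l\<in>blk N j. gapinv N l k)" by (simp add: sum_distrib_left)
  also have "(\<Sum>l\<in>blk N j. gapinv N l k) \<le> infsum (\<lambda>l. gapinv N l k) UNIV"
    by (rule finite_sum_le_infsum[OF gapinv_summable[OF N]]) auto
  also have "\<dots> \<le> \<gamma>" by (rule gapinv_sum_N[OF N])
  finally show ?thesis using a b w_pos[of "k - j"] by (simp add: mult_left_mono)
qed

lemma pi_sq: "4 * pi\<^sup>2 \<ge> 4"
  using pi_ge_two power_mono[of 2 pi 2] by simp

text \<open>The two terms contribute \<open>9/8\<close> and \<open>9/64\<close> of
  \<open>C * w (k - j)\<close>, which is well below the divisor
  \<open>4 * pi\<^sup>2\<close>.\<close>

lemma FY_self: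
  assumes Y: "\<forall>x. cmod (Y x) \<le> C" shows "cmod (FY Y x) \<le> C"
proof (cases x)
  case (Pair k j)
  have w: "w (k - j) > 0" by (rule w_pos)
  have "cmod (\<Sum>l\<in>blk N j. KY Y k l * BY Y l j) \<le> C * ((9/8) * C) * w (k - j) * \<gamma>"
    by (rule KB_bound[OF KY_bound[OF Y] BY_bound[OF Y]]) (use C in auto)
  also have "\<dots> = (9/8) * C * w (k - j) * (C * \<gamma>)" by simp
  also have "\<dots> \<le> (9/8) * C * w (k - j) * (1/8)" by (rule mult_left_mono[OF small]) (use C w in auto)
  finally have "cmod (- BY Y k j + (\<Sum>l\<in>blk N j. KY Y k l * BY Y l j)) \<le> 2 * C * w (k - j)"
    using norm_triangle_ineq[of "- BY Y k j" "\<Sum>l\<in>blk N j. KY Y k l * BY Y l j"] BY_bound[OF Y, where k=k and j=j] mult_pos_pos[OF C w] by simp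
  also have "\<dots> \<le> C * (4 * pi\<^sup>2 * w (k - j))"
    using mult_right_mono[OF pi_sq, of "C * w (k - j)"] mult_pos_pos[OF C w] by (simp add: mult_ac)
  finally show ?thesis using Pair w C by (simp add: FY_def norm_divide norm_mult norm_power divide_le_eq)
qed

text \<open>The quadratic term is split as \<open>(K - K') * B + K' * (B - B')\<close>. The
  resulting constants \<open>9/64\<close>, \<open>1/64\<close> and \<open>1/8\<close> add up to far
  less than one half of \<open>4 * pi\<^sup>2\<close>.\<close>

lemma FY_contraction:
  assumes Y: "\<forall>x. cmod (Y x) \<le> C" and Y': "\<forall>x. cmod (Y' x) \<le> C" and e: "\<forall>x. cmod (Y x - Y' x) \<le> \<epsilon>"
  shows "cmod (FY Y x - FY Y' x) \<le> \<epsilon> / 2"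
proof (cases x)
  case (Pair k j)
  have w: "w (k - j) > 0" by (rule w_pos)
  have e0: "\<epsilon> \<ge> 0" by (rule R_nonneg[OF e])
  have ew: "\<epsilon> * w (k - j) \<ge> 0" using e0 w by simp
  have dB: "cmod (BY Y l j - BY Y' l j) \<le> (\<epsilon> / 8) * w (l - j)" for l
    using VKY_bound[OF e, where k=l and j=j] VKY_diff[OF Y Y', where k=l and j=j] by (simp add: BY_def)
  have "cmod (\<Sum>l\<in>blk N j. (KY Y k l - KY Y' k l) * BY Y l j) \<le> \<epsilon> * ((9/8) * C) * w (k - j) * \<gamma>"
    by (rule KB_bound) (use KY_bound[OF e] BY_bound[OF Y] C e0 in \<open>auto simp: KY_diff\<close>)
  also have "\<dots> = (9/8) * (\<epsilon> * w (k - j)) * (C * \<gamma>)" by simp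
  also have "\<dots> \<le> (9/8) * (\<epsilon> * w (k - j)) * (1/8)" by (rule mult_left_mono[OF small]) (use ew in auto)
  finally have 1: "cmod (\<Sum>l\<in>blk N j. (KY Y k l - KY Y' k l) * BY Y l j) \<le> (9/64) * (\<epsilon> * w (k - j))" by simp
  have "cmod (\<Sum>l\<in>blk N j. KY Y' k l * (BY Y l j - BY Y' l j)) \<le> C * (\<epsilon> / 8) * w (k - j) * \<gamma>"
    by (rule KB_bound[OF KY_bound[OF Y'] dB]) (use C e0 in auto)
  also have "\<dots> = (1/8) * (\<epsilon> * w (k - j)) * (C * \<gamma>)" by simp
  also have "\<dots> \<le> (1/8) * (\<epsilon> * w (k - j)) * (1/8)" by (rule mult_left_mono[OF small]) (use ew in auto)
  finally have 2: "cmod (\<Sum>l\<in>blk N j. KY Y' k l * (BY Y l j - BY Y' l j)) \<le> (1/64) * (\<epsilon> * w (k - j))" by simp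
  have eq: "(\<Sum>l\<in>blk N j. KY Y k l * BY Y l j) - (\<Sum>l\<in>blk N j. KY Y' k l * BY Y' l j) =
     (\<Sum>l\<in>blk N j. (KY Y k l - KY Y' k l) * BY Y l j) + (\<Sum>l\<in>blk N j. KY Y' k l * (BY Y l j - BY Y' l j))"
    by (simp add: algebra_simps sum_subtractf sum.distrib)
  have eq2: "(- BY Y k j + (\<Sum>l\<in>blk N j. KY Y k l * BY Y l j)) - (- BY Y' k j + (\<Sum>l\<in>blk N j. KY Y' k l * BY Y' l j)) =
     ((\<Sum>l\<in>blk N j. (KY Y k l - KY Y' k l) * BY Y l j) + (\<Sum>l\<in>blk N j. KY Y' k l * (BY Y l j - BY Y' l j))) - (BY Y k j - BY Y' k j)"
    unfolding eq[symmetric] by simp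
  have "cmod ((- BY Y k j + (\<Sum>l\<in>blk N j. KY Y k l * BY Y l j)) - (- BY Y' k j + (\<Sum>l\<in>blk N j. KY Y' k l * BY Y' l j)))
      \<le> ((9/64) * (\<epsilon> * w (k - j)) + (1/64) * (\<epsilon> * w (k - j))) + \<epsilon> / 8 * w (k - j)"
    unfolding eq2
    by (rule order.trans[OF norm_triangle_ineq4 add_mono[OF order.trans[OF norm_triangle_ineq add_mono[OF 1 2]] dB]])
  also have "\<dots> \<le> 2 * (\<epsilon> * w (k - j))" using ew by simp
  also have "\<dots> \<le> \<epsilon> / 2 * (4 * pi\<^sup>2 * w (k - j))" using mult_right_mono[OF pi_sq ew] by (simp add: mult_ac)
  finally have 3: "cmod ((- BY Y k j + (\<Sum>l\<in>blk N j. KY Y k l * BY Y l j)) - (- BY Y' k j + (\<Sum>l\<in>blk N j. KY Y' k l * BY Y' l j)))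
     \<le> \<epsilon> / 2 * (4 * pi\<^sup>2 * w (k - j))" .
  show ?thesis
  proof (cases "rel N k j")
    case False
    then have "FY Y x - FY Y' x = ((- BY Y k j + (\<Sum>l\<in>blk N j. KY Y k l * BY Y l j)) - (- BY Y' k j + (\<Sum>l\<in>blk N j. KY Y' k l * BY Y' l j))) / of_real (4 * pi\<^sup>2 * w (k - j))"
      using Pair by (simp add: FY_def diff_divide_distrib)
    then show ?thesis using 3 w by (simp add: norm_divide norm_mult norm_power divide_le_eq)
  qed (use Pair e0 in \<open>simp add: FY_def\<close>)
qed

definition Y0 :: "int \<times> int \<Rightarrow> complex"
  where "Y0 = (SOME Y. (\<forall>x. cmod (Y x) \<le> C) \<and> FY Y = Y)"

lemma Y0: "\<forall>x. cmod (Y0 x) \<le> C" "FY Y0 = Y0"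
proof -
  obtain Y where "\<And>x. cmod (Y x) \<le> C" "FY Y = Y"
  proof (rule sup_contraction_fixpoint[of C FY])
    show "cmod (FY Y x) \<le> C" if "\<And>x. cmod (Y x) \<le> C" for Y x by (rule FY_self) (use that in simp)
    show "cmod (FY Y x - FY Y' x) \<le> \<epsilon> / 2"
      if "\<And>x. cmod (Y x) \<le> C" "\<And>x. cmod (Y' x) \<le> C" "\<And>x. cmod (Y x - Y' x) \<le> \<epsilon>" for Y Y' \<epsilon> x
      by (rule FY_contraction) (use that in simp_all)
  qed (use C in auto)
  then have "\<exists>Y. (\<forall>x. cmod (Y x) \<le> C) \<and> FY Y = Y" by blast
  from someI_ex[OF this] show "\<forall>x. cmod (Y0 x) \<le> C" "FY Y0 = Y0" unfolding Y0_def[symmetric] by blast+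
qed

text \<open>\<open>K\<close> lives outside the blocks and \<open>B\<close> inside them;
  \<open>M\<close> is the block diagonal matrix that \<open>U\<close> intertwines with the Fourier
  matrix of the operator.\<close>

definition K :: "int \<Rightarrow> int \<Rightarrow> complex" where "K = KY Y0"
definition B :: "int \<Rightarrow> int \<Rightarrow> complex" where "B l j = (if rel N l j then BY Y0 l j else 0)"
definition U :: "int \<Rightarrow> int \<Rightarrow> complex" where "U k j = (if k = j then 1 else 0) + K k j"
definition M :: "int \<Rightarrow> int \<Rightarrow> complex" where "M l j = (if l = j then d j else 0) + B l j"

lemma K_rel [simp]: "rel N k j \<Longrightarrow> K k j = 0" by (simp add: K_def KY_def)

lemma K_bound: "cmod (K k j) \<le> C * w (k - j) * gapinv N k j"
  unfolding K_def by (rule KY_bound[OF Y0(1)])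

lemma K_bound1: "cmod (K k j) \<le> C * gapinv N k j"
proof (rule order.trans[OF K_bound])
  have "C * w (k - j) \<le> C * 1" by (rule mult_left_mono[OF w_le_1]) (use C in simp)
  then show "C * w (k - j) * gapinv N k j \<le> C * gapinv N k j" by (intro mult_right_mono) auto
qed

lemma B_bound: "cmod (B l j) \<le> 2 * C * w (l - j)"
  using BY_bound[OF Y0(1), where k=l and j=j] mult_pos_pos[OF C w_pos[of "l - j"]] by (simp add: B_def mult.assoc)

text \<open>The correction inherits the weight \<open>w (l - j)\<close> of the Fourier coefficient
  and gains the gap sum as a factor. This is what makes the off-diagonal entries comparable to
  Fourier coefficients in spite of their decay.\<close>

lemma B_asymp:
  assumes "rel N l j"
  shows "cmod (B l j - Vf (l - j)) \<le> C * C * w (l - j) * infsum (\<lambda>i. gapinv N i j) UNIV"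
  using VKY_bound_gen[OF Y0(1), where k=l and j=j] assms by (simp add: B_def BY_def)

lemma K_summable: "(\<lambda>k. cmod (K k j)) summable_on UNIV"
  by (rule summable_on_comparison_test[OF summable_on_cmult_right[OF gapinv_summable[OF N]] K_bound1]) simp

lemma U_summable: "(\<lambda>k. cmod (U k j)) summable_on UNIV"
proof -
  have "(\<lambda>k. cmod (if k = j then 1 else 0)) summable_on UNIV"
    by (rule summable_on_cong_neutral[THEN iffD1, OF _ _ _ summable_on_finite[of "{j}" "\<lambda>k. norm (1::complex)"]]) auto
  then have "(\<lambda>k. cmod (if k = j then 1 else 0) + cmod (K k j)) summable_on UNIV" by (rule summable_on_add[OF _ K_summable])
  then show ?thesis by (rule summable_on_comparison_test) (auto simp: U_def norm_triangle_ineq)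
qed

text \<open>Inside a block \<open>K\<close> vanishes and the relation is the definition of
  \<open>B\<close>; outside it is the fixed point equation for \<open>Y0\<close>, multiplied
  out.\<close>

theorem intertwining:
  "d k * U k j + (\<Sum>\<^sub>\<infinity>i. Vf (k - i) * U i j) = (\<Sum>l\<in>blk N j. U k l * M l j)"
proof -
  have s1: "(\<lambda>i. Vf (k - i) * (if i = j then 1 else 0)) summable_on UNIV"
    by (rule summable_on_cong_neutral[THEN iffD1, OF _ _ _ summable_on_finite[of "{j}" "\<lambda>i. Vf (k - j)"]]) auto
  have "(\<Sum>\<^sub>\<infinity>i. Vf (k - i) * U i j) = (\<Sum>\<^sub>\<infinity>i. Vf (k - i) * (if i = j then 1 else 0)) + (\<Sum>\<^sub>\<infinity>i. Vf (k - i) * K i j)"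
    unfolding U_def distrib_left
    by (rule infsum_add[OF s1]) (unfold K_def, rule abs_summable_summable[OF VK_summable[OF Y0(1)]])
  also have "(\<Sum>\<^sub>\<infinity>i. Vf (k - i) * (if i = j then 1 else 0)) = (\<Sum>\<^sub>\<infinity>i\<in>{j}. Vf (k - i))"
    by (rule infsum_cong_neutral) auto
  finally have VU: "(\<Sum>\<^sub>\<infinity>i. Vf (k - i) * U i j) = BY Y0 k j" by (simp add: BY_def VKY_def K_def)
  show ?thesis
  proof (cases "rel N k j")
    case True
    have "(\<Sum>l\<in>blk N j. U k l * M l j) = (\<Sum>l\<in>blk N j. if l = k then M k j else 0)"
    proof (rule sum.cong[OF refl])
      fix l assume "l \<in> blk N j"
      then have "rel N k l" using True rel_trans rel_sym unfolding blk_def by blast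
      then show "U k l * M l j = (if l = k then M k j else 0)" by (simp add: U_def)
    qed
    also have "\<dots> = M k j" using True by (subst sum.delta[OF finite_blk]) (simp add: blk_def)
    finally show ?thesis unfolding VU using True by (simp add: M_def B_def U_def)
  next
    case False
    then have kj: "k \<noteq> j" by auto
    have nz: "of_int (k\<^sup>2 - j\<^sup>2) \<noteq> (0::complex)" using not_rel_square[OF False] by (metis of_int_eq_0_iff right_minus_eq)
    have wnz: "complex_of_real (w (k - j)) \<noteq> 0" using w_pos[of "k - j"] by simp
    have "Y0 (k,j) = FY Y0 (k,j)" using Y0(2) by simp
    also have "\<dots> = (- BY Y0 k j + (\<Sum>l\<in>blk N j. K k l * BY Y0 l j)) / of_real (4 * pi\<^sup>2 * w (k - j))"
      using False by (simp add: FY_def K_def)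
    finally have "Y0 (k,j) * of_real (4 * pi\<^sup>2 * w (k - j)) = - BY Y0 k j + (\<Sum>l\<in>blk N j. K k l * BY Y0 l j)"
      using wnz by simp
    moreover have "K k j * of_int (k\<^sup>2 - j\<^sup>2) = Y0 (k,j) * of_real (w (k - j))"
      using False nz by (simp add: K_def KY_def)
    then have "(d k - d j) * K k j = Y0 (k,j) * of_real (4 * pi\<^sup>2 * w (k - j))"
    proof -
      have "d k - d j = of_real (4 * pi\<^sup>2) * of_int (k\<^sup>2 - j\<^sup>2)" by (simp add: d_def algebra_simps)
      then have "(d k - d j) * K k j = of_real (4 * pi\<^sup>2) * (K k j * of_int (k\<^sup>2 - j\<^sup>2))" by simp
      also have "\<dots> = of_real (4 * pi\<^sup>2) * (Y0 (k,j) * of_real (w (k - j)))"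
        using \<open>K k j * of_int (k\<^sup>2 - j\<^sup>2) = Y0 (k,j) * of_real (w (k - j))\<close> by simp
      finally show ?thesis by simp
    qed
    ultimately have key: "(d k - d j) * K k j = - BY Y0 k j + (\<Sum>l\<in>blk N j. K k l * BY Y0 l j)" by simp
    have "(\<Sum>l\<in>blk N j. U k l * M l j) = (\<Sum>l\<in>blk N j. (if l = j then K k j * d j else 0) + K k l * BY Y0 l j)"
    proof (rule sum.cong[OF refl])
      fix l assume l: "l \<in> blk N j"
      then have "k \<noteq> l" using False by (auto simp: blk_def)
      then show "U k l * M l j = (if l = j then K k j * d j else 0) + K k l * BY Y0 l j"
        using l by (simp add: U_def M_def B_def blk_def distrib_left)
    qed
    also have "\<dots> = K k j * d j + (\<Sum>l\<in>blk N j. K k l * BY Y0 l j)" by (simp add: sum.distrib)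
    finally show ?thesis unfolding VU using key kj by (simp add: U_def algebra_simps)
  qed
qed

end

section \<open>The periodic Sturm--Liouville operator\<close>

lemma deriv01_eq:
  assumes "(f has_vector_derivative D) (at x within {0..1})" "x \<in> {0..1}"
  shows "deriv01 f x = D"
  unfolding deriv01_def using vector_derivative_within_cbox[of 0 1 x f D] assms by simp

lemma has_deriv01:
  "f differentiable (at x within {0..1}) \<Longrightarrow> (f has_vector_derivative deriv01 f x) (at x within {0..1})"
  unfolding deriv01_def by (simp add: vector_derivative_works)

lemma abs_cont_cong:
  assumes "abs_cont f" "\<And>x. x \<in> {0..1} \<Longrightarrow> f x = g x" shows "abs_cont g"
  using assms(1) unfolding abs_cont_iff_ac by (rule ac_mono[where C = 1 and D = 0]) (use assms(2) in auto)

lemma abs_cont_C1: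
  assumes f: "\<And>x. x \<in> {0..1} \<Longrightarrow> (f has_vector_derivative f' x) (at x within {0..1})" and f': "continuous_on {0..1} f'"
  shows "abs_cont f"
proof -
  have "compact (f' ` {0..1})" by (rule compact_continuous_image[OF f']) simp
  then obtain L where L: "\<forall>y\<in>f' ` {0..1}. cmod y \<le> L" using compact_imp_bounded bounded_iff by blast
  show ?thesis
  proof (rule abs_cont_lipschitz)
    fix x y :: real assume xy: "x \<in> {0..1}" "y \<in> {0..1}"
    have der: "(f has_derivative (\<lambda>t. t *\<^sub>R f' z)) (at z within {0..1})" if "z \<in> {0..1}" for z
      using f[OF that] by (simp add: has_vector_derivative_def)
    have on: "onorm (\<lambda>t. t *\<^sub>R f' z) \<le> L" if "z \<in> {0..1}" for z
    proof (rule onorm_le)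
      fix t :: real
      have "cmod (f' z) * \<bar>t\<bar> \<le> L * \<bar>t\<bar>" using L that by (intro mult_right_mono) auto
      then show "norm (t *\<^sub>R f' z) \<le> L * norm t" by (simp add: mult.commute)
    qed
    have "cmod (f x - f y) \<le> L * norm (x - y)"
      by (rule differentiable_bound[of "{0..1}" f "\<lambda>z t. t *\<^sub>R f' z"]) (use der on xy in auto)
    then show "cmod (f x - f y) \<le> L * \<bar>x - y\<bar>" by simp
  qed
qed

lemma AE_mu_negligible:
  assumes N: "negligible N" and P: "\<And>x. x \<in> {0..1} \<Longrightarrow> x \<notin> N \<Longrightarrow> P x"
  shows "AE x in \<mu>. P x"
proof -
  have "AE x in lebesgue. x \<notin> N" using N by (intro AE_not_in) (simp add: negligible_iff_null_sets)
  then have "AE x in lebesgue. x \<in> {0..1} \<longrightarrow> P x" by (rule AE_imp1) (use P in blast)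
  then show ?thesis by (subst AE_restrict_space_iff) auto
qed

section \<open>Integration by parts and jumps of derivatives\<close>

lemma lint_deriv_abs_cont:
  assumes f: "abs_cont f" and N: "negligible N" and h: "integrable \<mu> h"
    and der: "\<And>x. x \<in> {0..1} \<Longrightarrow> x \<notin> N \<Longrightarrow> (f has_vector_derivative h x) (at x within {0..1})"
  shows "(LINT x|\<mu>. h x) = f 1 - f 0"
proof -
  have "(deriv01 f has_integral f 1 - f 0) {0..1}" by (rule abs_cont_has_integral_deriv01[OF f]) auto
  then have "(h has_integral f 1 - f 0) {0..1}"
    by (rule has_integral_spike[OF N, rotated]) (use deriv01_eq[OF der] in auto)
  then show ?thesis by (rule has_integral_lint[OF h])
qed

text \<open>Exponentials equal \<open>1\<close> at both ends, so the boundary term of the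
  integration by parts is the jump \<open>f 1 - f 0\<close>.\<close>

lemma fc_deriv_abs_cont:
  assumes f: "abs_cont f" and int: "integrable \<mu> (deriv01 f)"
  shows "fc (deriv01 f) k = f 1 - f 0 + 2 * pi * \<i> * of_int k * fc f k"
proof -
  define N where "N = {x \<in> {0..1}. \<not> f differentiable (at x within {0..1})}"
  have N: "negligible N" unfolding N_def by (rule abs_cont_differentiable_ae[OF f])
  have fcont: "continuous_on {0..1} f" by (rule abs_cont_continuous[OF f])
  have exac: "abs_cont (ex (-k))" by (rule abs_cont_C1[OF ex_has_derivative]) (intro continuous_intros)
  have [measurable]: "ex (-k) \<in> borel_measurable \<mu>" using L2_measurable[OF ex_L2] .
  have i1: "integrable \<mu> (\<lambda>x. deriv01 f x * ex (-k) x)"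
    by (rule Bochner_Integration.integrable_bound[OF integrable_norm[OF int]]) (use int in \<open>auto simp: norm_mult\<close>)
  have i2: "integrable \<mu> (\<lambda>x. f x * ((2 * pi * \<i> * of_int (-k)) * ex (-k) x))"
    by (intro continuous_integrable_mu continuous_intros fcont)
  have "(LINT x|\<mu>. deriv01 f x * ex (-k) x + f x * ((2 * pi * \<i> * of_int (-k)) * ex (-k) x)) = f 1 * ex (-k) 1 - f 0 * ex (-k) 0"
  proof (rule lint_deriv_abs_cont[OF abs_cont_mult[OF f exac] N Bochner_Integration.integrable_add[OF i1 i2]])
    fix x :: real assume x: "x \<in> {0..1}" "x \<notin> N"
    then have "(f has_vector_derivative deriv01 f x) (at x within {0..1})" by (intro has_deriv01) (simp add: N_def)
    from has_vector_derivative_mult[OF this ex_has_derivative[of "-k"]]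
    show "((\<lambda>x. f x * ex (-k) x) has_vector_derivative deriv01 f x * ex (-k) x + f x * ((2 * pi * \<i> * of_int (-k)) * ex (-k) x)) (at x within {0..1})"
      by (simp add: add.commute)
  qed
  moreover have "(LINT x|\<mu>. f x * ((2 * pi * \<i> * of_int (-k)) * ex (-k) x)) = (2 * pi * \<i> * of_int (-k)) * fc f k"
    unfolding fc_def by (subst integral_mult_right_zero[symmetric]) (simp add: mult_ac)
  ultimately show ?thesis using Bochner_Integration.integral_add[OF i1 i2] by (simp add: fc_def)
qed

text \<open>Below order \<open>s\<close> the jumps vanish, so that each integration by parts only
  multiplies the coefficient by \<open>2 * pi * \<i> * k\<close>; the last one brings in the jump of
  order \<open>s\<close>.\<close>

lemma fourier_jump:
  assumes ac: "\<And>m. m \<le> s \<Longrightarrow> abs_cont ((deriv01 ^^ m) q)"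
    and per: "\<And>m. m < s \<Longrightarrow> (deriv01 ^^ m) q 1 = (deriv01 ^^ m) q 0"
    and int: "integrable \<mu> ((deriv01 ^^ Suc s) q)"
  shows "(2 * pi * \<i> * of_int k) ^ Suc s * fc q k = fc ((deriv01 ^^ Suc s) q) k - ((deriv01 ^^ s) q 1 - (deriv01 ^^ s) q 0)"
proof -
  have "m \<le> s \<Longrightarrow> fc ((deriv01 ^^ m) q) k = (2 * pi * \<i> * of_int k) ^ m * fc q k" for m
  proof (induction m)
    case (Suc m)
    have "continuous_on {0..1} ((deriv01 ^^ Suc m) q)" by (rule abs_cont_continuous[OF ac[OF Suc.prems]])
    then have "integrable \<mu> (deriv01 ((deriv01 ^^ m) q))" using continuous_integrable_mu by simp
    from fc_deriv_abs_cont[OF ac this, of k] show ?case using Suc per[of m] by simp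
  qed simp
  from this[of s] show ?thesis using fc_deriv_abs_cont[OF ac[of s], of k] int by simp
qed

lemma C2_periodic_deriv:
  assumes "C2_periodic y y' y''" "x \<in> {0..1}"
  shows "deriv01 y x = y' x" "deriv01 (deriv01 y) x = y'' x"
proof -
  have d: "(y has_vector_derivative y' x) (at x within {0..1})" "(y' has_vector_derivative y'' x) (at x within {0..1})" if "x \<in> {0..1}" for x
    using assms that by (auto simp: C2_periodic_def)
  show "deriv01 y x = y' x" using d(1) assms(2) deriv01_eq by blast
  have "(deriv01 y has_vector_derivative y'' x) (at x within {0..1})"
    by (rule has_vector_derivative_transform[OF assms(2) _ d(2)[OF assms(2)]]) (use d(1) deriv01_eq in metis)
  then show "deriv01 (deriv01 y) x = y'' x" using assms(2) deriv01_eq by blast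
qed

lemma C2_periodic_continuous:
  assumes "C2_periodic y y' y''"
  shows "continuous_on {0..1} y" "continuous_on {0..1} y'" "continuous_on {0..1} y''"
  using assms unfolding C2_periodic_def by (auto intro: continuous_on_vector_derivative)

lemma C2_periodic_abs_cont:
  assumes "C2_periodic y y' y''"
  shows "abs_cont y" "abs_cont y'"
  using abs_cont_C1[of y y'] abs_cont_C1[of y' y''] C2_periodic_continuous[OF assms] assms unfolding C2_periodic_def by auto

lemma C2_periodic_lincomb:
  assumes "finite F" "\<And>i. i \<in> F \<Longrightarrow> C2_periodic (y i) (y' i) (y'' i)"
  shows "C2_periodic (\<lambda>x. \<Sum>i\<in>F. c i * y i x) (\<lambda>x. \<Sum>i\<in>F. c i * y' i x) (\<lambda>x. \<Sum>i\<in>F. c i * y'' i x)"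
  using assms unfolding C2_periodic_def
  by (auto intro!: continuous_intros has_vector_derivative_sum has_vector_derivative_mult_right)

lemma SL_op_C2_periodic:
  assumes "C2_periodic y y' y''" "x \<in> {0..1}"
  shows "SL_op q y x = - y'' x + q x * y x"
  using C2_periodic_deriv[OF assms] by (simp add: SL_op_def)

lemma C2_periodic_SL_domain:
  assumes y: "C2_periodic y y' y''" and q: "continuous_on {0..1} q"
  shows "y \<in> SL_domain q"
proof -
  have d: "\<And>x. x \<in> {0..1} \<Longrightarrow> y' x = deriv01 y x" using C2_periodic_deriv(1)[OF y] by simp
  have "derivs_abs_cont 2 y"
    unfolding derivs_abs_cont_def
  proof (intro conjI allI impI ballI)
    fix s x assume "Suc s < 2" "x \<in> {0..1::real}"
    then show "(deriv01 ^^ s) y differentiable at x within {0..1}"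
      using y by (auto simp: C2_periodic_def intro: differentiableI_vector)
  next
    fix s :: nat assume "s < 2"
    then consider "s = 0" | "s = 1" by linarith
    then show "abs_cont ((deriv01 ^^ s) y)"
      using C2_periodic_abs_cont[OF y] abs_cont_cong[OF _ d] by cases auto
  qed
  moreover have "continuous_on {0..1} (SL_op q y)"
  proof -
    have "continuous_on {0..1} (\<lambda>x. - y'' x + q x * y x)" by (intro continuous_intros C2_periodic_continuous[OF y] q)
    then show ?thesis by (rule continuous_on_eq) (use SL_op_C2_periodic[OF y] in auto)
  qed
  ultimately show ?thesis using y d unfolding SL_domain_def by (auto intro: L2_continuous simp: C2_periodic_def)
qed

lemma SL_domain_facts:
  assumes y: "y \<in> SL_domain q"
  shows "abs_cont y" "abs_cont (deriv01 y)" "y \<in> L2" "SL_op q y \<in> L2" "y 1 = y 0" "deriv01 y 1 = deriv01 y 0"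
    "\<And>x. x \<in> {0..1} \<Longrightarrow> (y has_vector_derivative deriv01 y x) (at x within {0..1})"
proof -
  have d: "\<And>s. s < 2 \<Longrightarrow> abs_cont ((deriv01 ^^ s) y)" "\<And>s x. Suc s < 2 \<Longrightarrow> x \<in> {0..1} \<Longrightarrow> (deriv01 ^^ s) y differentiable (at x within {0..1})"
    using y by (auto simp: SL_domain_def derivs_abs_cont_def)
  show "abs_cont y" "abs_cont (deriv01 y)" using d(1)[of 0] d(1)[of 1] by auto
  then show "y \<in> L2" using L2_continuous abs_cont_continuous by blast
  show "SL_op q y \<in> L2" "y 1 = y 0" "deriv01 y 1 = deriv01 y 0" using y by (auto simp: SL_domain_def)
  show "(y has_vector_derivative deriv01 y x) (at x within {0..1})" if "x \<in> {0..1}" for x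
    using d(2)[of 0 x] that has_deriv01 by simp
qed

text \<open>The function \<open>y' * g - y * g'\<close> is absolutely continuous with derivative
  \<open>y'' * g - y * g''\<close> almost everywhere, and it takes the same value at both
  ends.\<close>

theorem SL_symmetric:
  assumes y: "y \<in> SL_domain q" and g: "C2_periodic g g' g''" and q: "continuous_on {0..1} q"
  shows "(LINT x|\<mu>. SL_op q y x * g x) = (LINT x|\<mu>. y x * (- g'' x + q x * g x))"
proof -
  note Y = SL_domain_facts[OF y]
  note gc = C2_periodic_continuous[OF g]
  define y2 where "y2 = deriv01 (deriv01 y)"
  have yc: "continuous_on {0..1} y" by (rule abs_cont_continuous[OF Y(1)])
  have qy: "(\<lambda>x. q x * y x) \<in> L2" by (intro L2_continuous continuous_intros q yc)
  have "y2 = (\<lambda>x. q x * y x - SL_op q y x)" by (simp add: SL_op_def y2_def)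
  then have y2: "y2 \<in> L2" using L2_diff[OF qy Y(4)] by simp
  define N where "N = {x \<in> {0..1}. \<not> deriv01 y differentiable (at x within {0..1})}"
  have N: "negligible N" unfolding N_def by (rule abs_cont_differentiable_ae[OF Y(2)])
  have gd: "(g has_vector_derivative g' x) (at x within {0..1})" "(g' has_vector_derivative g'' x) (at x within {0..1})"
    if "x \<in> {0..1}" for x using g that by (auto simp: C2_periodic_def)
  have i1: "integrable \<mu> (\<lambda>x. y2 x * g x)" by (intro L2_integrable_mult y2 L2_continuous gc)
  have i2: "integrable \<mu> (\<lambda>x. y x * g'' x)" by (intro L2_integrable_mult Y L2_continuous gc)
  have i3: "integrable \<mu> (\<lambda>x. y x * (q x * g x))" by (intro L2_integrable_mult Y L2_continuous continuous_intros q gc)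
  have ac: "abs_cont (\<lambda>x. deriv01 y x * g x + y x * (- 1 * g' x))"
    by (intro abs_cont_add abs_cont_mult Y C2_periodic_abs_cont[OF g] abs_cont_C1[of "\<lambda>x. -1" "\<lambda>x. 0"]) auto
  have "(LINT x|\<mu>. y2 x * g x - y x * g'' x) = (deriv01 y 1 * g 1 + y 1 * (- 1 * g' 1)) - (deriv01 y 0 * g 0 + y 0 * (- 1 * g' 0))"
  proof (rule lint_deriv_abs_cont[OF ac N Bochner_Integration.integrable_diff[OF i1 i2]])
    fix x :: real assume x: "x \<in> {0..1}" "x \<notin> N"
    have "(deriv01 y has_vector_derivative y2 x) (at x within {0..1})"
      unfolding y2_def by (rule has_deriv01) (use x in \<open>simp add: N_def\<close>)
    from has_vector_derivative_diff[OF has_vector_derivative_mult[OF this gd(1)[OF x(1)]] has_vector_derivative_mult[OF Y(7)[OF x(1)] gd(2)[OF x(1)]]]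
    show "((\<lambda>x. deriv01 y x * g x + y x * (- 1 * g' x)) has_vector_derivative y2 x * g x - y x * g'' x) (at x within {0..1})"
      by (simp add: algebra_simps)
  qed
  also have "\<dots> = 0" using Y(5,6) g by (simp add: C2_periodic_def)
  finally have eq: "(LINT x|\<mu>. y2 x * g x) = (LINT x|\<mu>. y x * g'' x)" using i1 i2 by simp
  have "(LINT x|\<mu>. SL_op q y x * g x) = (LINT x|\<mu>. y x * (q x * g x) - y2 x * g x)"
    by (simp add: SL_op_def y2_def algebra_simps)
  also have "\<dots> = (LINT x|\<mu>. y x * (q x * g x) - y x * g'' x)" using i1 i2 i3 eq by simp
  also have "\<dots> = (LINT x|\<mu>. y x * (- g'' x + q x * g x))" by (simp add: algebra_simps)
  finally show ?thesis .
qed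

text \<open>No conjugation: the potential is complex, so the operator is symmetric for this pairing
  but in general not for \<open>L2_inner\<close>.\<close>

definition bl :: "(real \<Rightarrow> complex) \<Rightarrow> (real \<Rightarrow> complex) \<Rightarrow> complex"
  where "bl f g = (LINT x|\<mu>. f x * g x)"

lemma bl_lincomb_right:
  assumes "f \<in> L2" "\<And>i. i \<in> F \<Longrightarrow> g i \<in> L2"
  shows "bl f (\<lambda>x. \<Sum>i\<in>F. c i * g i x) = (\<Sum>i\<in>F. c i * bl f (g i))"
proof -
  have "bl f (\<lambda>x. \<Sum>i\<in>F. c i * g i x) = (LINT x|\<mu>. (\<Sum>i\<in>F. c i * (f x * g i x)))"
    unfolding bl_def sum_distrib_left by (intro Bochner_Integration.integral_cong refl sum.cong) simp
  also have "\<dots> = (\<Sum>i\<in>F. c i * bl f (g i))"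
    unfolding bl_def using assms
    by (subst Bochner_Integration.integral_sum) (auto intro!: integrable_mult_right L2_integrable_mult)
  finally show ?thesis .
qed

lemma bl_commute: "bl f g = bl g f"
  by (simp add: bl_def mult.commute)

lemma bl_lincomb_left:
  assumes "f \<in> L2" "\<And>i. i \<in> F \<Longrightarrow> g i \<in> L2"
  shows "bl (\<lambda>x. \<Sum>i\<in>F. c i * g i x) f = (\<Sum>i\<in>F. c i * bl (g i) f)"
  using bl_lincomb_right[of f F g c] assms by (simp add: bl_commute)

lemma bl_diff_left: "f \<in> L2 \<Longrightarrow> h \<in> L2 \<Longrightarrow> g \<in> L2 \<Longrightarrow> bl (\<lambda>x. f x - h x) g = bl f g - bl h g"
  unfolding bl_def by (simp add: left_diff_distrib L2_integrable_mult)

lemma bl_cmult_left: "bl (\<lambda>x. c * f x) g = c * bl f g"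
  unfolding bl_def by (simp add: mult.assoc)

lemma bl_cong_AE:
  assumes "f \<in> L2" "h \<in> L2" "g \<in> L2" "AE x in \<mu>. f x = h x"
  shows "bl f g = bl h g"
  unfolding bl_def
  by (rule integral_cong_AE)
    (intro borel_measurable_times L2_measurable assms(1-3) | rule AE_imp1[OF assms(4)], simp)+

lemma sum_infsum:
  fixes f :: "'b \<Rightarrow> 'a \<Rightarrow> complex"
  assumes "finite F" "\<And>j. j \<in> F \<Longrightarrow> f j summable_on A"
  shows "(\<lambda>k. \<Sum>j\<in>F. f j k) summable_on A \<and> (\<Sum>j\<in>F. infsum (f j) A) = (\<Sum>\<^sub>\<infinity>k\<in>A. \<Sum>j\<in>F. f j k)"
  using assms by (induction F rule: finite_induct) (auto simp: infsum_add summable_on_add)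

text \<open>The modulus of \<open>a l k\<close> is split into two square roots and Cauchy-Schwarz is
  applied; row sums are used first, column sums after the order of summation has been
  exchanged.\<close>

lemma schur_test:
  fixes a :: "'l \<Rightarrow> 'k \<Rightarrow> complex"
  assumes row: "\<And>l. l \<in> H \<Longrightarrow> (\<Sum>k\<in>F. cmod (a l k)) \<le> R" and col: "\<And>k. k \<in> F \<Longrightarrow> (\<Sum>l\<in>H. cmod (a l k)) \<le> R"
    and R: "R \<ge> 0"
  shows "(\<Sum>l\<in>H. (cmod (\<Sum>k\<in>F. a l k * c k))\<^sup>2) \<le> R\<^sup>2 * (\<Sum>k\<in>F. (cmod (c k))\<^sup>2)"
proof -
  have bk: "(cmod (\<Sum>k\<in>F. a l k * c k))\<^sup>2 \<le> R * (\<Sum>k\<in>F. cmod (a l k) * (cmod (c k))\<^sup>2)" if l: "l \<in> H" for l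
  proof -
    have "cmod (\<Sum>k\<in>F. a l k * c k) \<le> (\<Sum>k\<in>F. (cmod (c k) * sqrt (cmod (a l k))) * sqrt (cmod (a l k)))"
    proof (rule order.trans[OF norm_sum], rule sum_mono)
      fix k
      have "cmod (c k) * sqrt (cmod (a l k)) * sqrt (cmod (a l k)) = cmod (c k) * cmod (a l k)" by (simp add: mult.assoc)
      then show "cmod (a l k * c k) \<le> cmod (c k) * sqrt (cmod (a l k)) * sqrt (cmod (a l k))"
        by (simp only: norm_mult mult.commute[of "cmod (a l k)"] order.refl)
    qed
    then have "(cmod (\<Sum>k\<in>F. a l k * c k))\<^sup>2 \<le> (\<Sum>k\<in>F. (cmod (c k) * sqrt (cmod (a l k))) * sqrt (cmod (a l k)))\<^sup>2"
      by (intro power_mono) auto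
    also have "\<dots> \<le> (\<Sum>k\<in>F. (cmod (c k) * sqrt (cmod (a l k)))\<^sup>2) * (\<Sum>k\<in>F. (sqrt (cmod (a l k)))\<^sup>2)"
      by (rule Cauchy_Schwarz_ineq_sum)
    also have "\<dots> = (\<Sum>k\<in>F. cmod (a l k) * (cmod (c k))\<^sup>2) * (\<Sum>k\<in>F. cmod (a l k))"
      by (simp add: power_mult_distrib mult.commute)
    also have "\<dots> \<le> (\<Sum>k\<in>F. cmod (a l k) * (cmod (c k))\<^sup>2) * R"
      by (intro mult_left_mono row l sum_nonneg) auto
    finally show ?thesis by (simp add: mult.commute)
  qed
  have "(\<Sum>l\<in>H. (cmod (\<Sum>k\<in>F. a l k * c k))\<^sup>2) \<le> (\<Sum>l\<in>H. R * (\<Sum>k\<in>F. cmod (a l k) * (cmod (c k))\<^sup>2))" by (rule sum_mono[OF bk])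
  also have "\<dots> = R * (\<Sum>k\<in>F. (\<Sum>l\<in>H. cmod (a l k)) * (cmod (c k))\<^sup>2)"
    unfolding sum_distrib_left sum_distrib_right by (rule sum.swap)
  also have "\<dots> \<le> R * (\<Sum>k\<in>F. R * (cmod (c k))\<^sup>2)"
    by (intro mult_left_mono sum_mono mult_right_mono col R) auto
  also have "\<dots> = R\<^sup>2 * (\<Sum>k\<in>F. (cmod (c k))\<^sup>2)" by (simp add: sum_distrib_left power2_eq_square mult.assoc)
  finally show ?thesis .
qed

text \<open>\<open>w_small\<close> keeps the row and column sums of the central block of order
  \<open>sqrt N\<close>, and \<open>big\<close> then separates the Gershgorin discs of different
  blocks.\<close>

locale sl_family = decoupling "fc q" w C N for q w C N +
  assumes q: "continuous_on {0..1} q"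
    and w_small: "w k \<le> 1 / (1 + of_int \<bar>k\<bar>)"
    and big: "2 * (2 * C * (2 + sqrt (2 * real N) * Z32)) < 4 * real N"
begin

text \<open>A bound for the absolute row and column sums of \<open>B\<close> over any block, and
  therefore a common radius for all Gershgorin discs.\<close>

abbreviation rho :: real where "rho \<equiv> 2 * C * (2 + sqrt (2 * real N) * Z32)"

definition g :: "int \<Rightarrow> real \<Rightarrow> complex" where "g j = abs_trig.f (\<lambda>k. U k j)"

lemma U_abs_trig: "abs_trig (\<lambda>k. U k j)"
  by (rule abs_trig.intro[OF U_summable])

lemma g_cont: "continuous_on A (g j)" and g_L2: "g j \<in> L2" and g_per: "g j 1 = g j 0" and fc_g: "fc (g j) k = U k j"
  unfolding g_def
  using abs_trig.continuous_f[OF U_abs_trig] abs_trig.f_L2[OF U_abs_trig] abs_trig.f_periodic[OF U_abs_trig] abs_trig.fc_f[OF U_abs_trig] by auto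

text \<open>The candidate for the image of \<open>g j\<close> under the operator, formed with column
  \<open>j\<close> of \<open>M\<close>; \<open>SL_op_comb\<close> confirms it.\<close>

definition Lg :: "int \<Rightarrow> real \<Rightarrow> complex" where "Lg j x = (\<Sum>l\<in>blk N j. M l j * g l x)"

lemma Lg_cont: "continuous_on A (Lg j)"
  unfolding Lg_def[abs_def] by (intro continuous_intros g_cont)

text \<open>By \<open>intertwining\<close>, the factors \<open>- 4 * pi\<^sup>2 * k\<^sup>2\<close>
  take the coefficients of \<open>g j\<close> to those of the continuous function
  \<open>q * g j - Lg j\<close>, which is therefore the second derivative of
  \<open>g j\<close>.\<close>

lemma g_C2: "\<exists>g'. C2_periodic (g j) g' (\<lambda>x. q x * g j x - Lg j x)"
proof (rule C2_periodic_of_fourier[OF g_cont g_per])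
  have qg: "continuous_on {0..1} (\<lambda>x. q x * g j x)" by (intro continuous_intros q g_cont)
  show "continuous_on {0..1} (\<lambda>x. q x * g j x - Lg j x)" by (intro continuous_intros qg Lg_cont)
  fix k
  have "fc (\<lambda>x. q x * g j x - Lg j x) k = fc (\<lambda>x. q x * g j x) k - fc (Lg j) k"
    by (rule fc_diff) (intro L2_continuous qg Lg_cont)+
  also have "fc (\<lambda>x. q x * g j x) k = (\<Sum>\<^sub>\<infinity>i. fc q (k - i) * U i j)"
    unfolding g_def by (rule abs_trig.fc_mult[OF U_abs_trig L2_continuous[OF q]])
  also have "fc (Lg j) k = (\<Sum>l\<in>blk N j. U k l * M l j)"
    unfolding Lg_def[abs_def] by (subst fc_sum) (auto intro!: L2_cmult g_L2 sum.cong simp: fc_cmult fc_g)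
  also have "\<dots> = d k * U k j + (\<Sum>\<^sub>\<infinity>i. fc q (k - i) * U i j)" by (rule intertwining[symmetric])
  finally show "fc (\<lambda>x. q x * g j x - Lg j x) k = - complex_of_real (4 * pi\<^sup>2 * of_int (k\<^sup>2)) * fc (g j) k"
    by (simp add: fc_g d_def)
qed

definition gp :: "int \<Rightarrow> real \<Rightarrow> complex" where "gp j = (SOME g'. C2_periodic (g j) g' (\<lambda>x. q x * g j x - Lg j x))"

lemma g_C2p: "C2_periodic (g j) (gp j) (\<lambda>x. q x * g j x - Lg j x)"
  unfolding gp_def by (rule someI_ex[OF g_C2])

definition comb :: "int set \<Rightarrow> (int \<Rightarrow> complex) \<Rightarrow> real \<Rightarrow> complex" where "comb P v x = (\<Sum>l\<in>P. v l * g l x)"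

lemma comb_L2: "comb P v \<in> L2"
  unfolding comb_def[abs_def] by (intro L2_lincomb g_L2)

lemma comb_C2:
  "finite P \<Longrightarrow> C2_periodic (comb P v) (\<lambda>x. \<Sum>l\<in>P. v l * gp l x) (\<lambda>x. \<Sum>l\<in>P. v l * (q x * g l x - Lg l x))"
  unfolding comb_def[abs_def] by (intro C2_periodic_lincomb g_C2p)

lemma comb_domain: "finite P \<Longrightarrow> comb P v \<in> SL_domain q"
  by (rule C2_periodic_SL_domain[OF comb_C2 q])

lemma SL_op_comb:
  assumes "finite P" "x \<in> {0..1}"
  shows "SL_op q (comb P v) x = (\<Sum>l\<in>P. v l * Lg l x)"
  unfolding SL_op_C2_periodic[OF comb_C2[OF assms(1)] assms(2)] comb_def
  by (simp add: right_diff_distrib sum_subtractf sum_distrib_left mult_ac)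

text \<open>An element of the domain need not be a finite combination of \<open>g\<close>; its
  moments against \<open>g\<close> nevertheless see the operator as the transpose of
  \<open>M\<close>.\<close>

lemma SL_adjoint:
  assumes y: "y \<in> SL_domain q"
  shows "bl (SL_op q y) (g i) = (\<Sum>l\<in>blk N i. M l i * bl y (g l))"
proof -
  have "bl (SL_op q y) (g i) = bl y (Lg i)"
    unfolding bl_def SL_symmetric[OF y g_C2p q] by simp
  then show ?thesis unfolding Lg_def[abs_def] using bl_lincomb_right[of y "blk N i" g "\<lambda>l. M l i"] SL_domain_facts(3)[OF y] g_L2 by simp
qed

text \<open>Rows and columns of \<open>K\<close> have absolute sums at most
  \<open>C * \<gamma>\<close>, hence at most \<open>1/8\<close>, so Schur's test bounds the
  deviation from the exponentials by \<open>1/8\<close>.\<close>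

lemma riesz_g: "riesz_family g (1 - 1/8) (1 + 1/8)"
proof (rule paley_wiener[OF g_L2])
  fix F :: "int set" and c :: "int \<Rightarrow> complex" assume F: "finite F"
  define b where "b k = (\<Sum>j\<in>F. c j * K k j)" for k
  have Ks: "(\<lambda>k. K k j * ex k x) summable_on UNIV" for j x
    by (rule abs_summable_summable) (simp add: norm_mult K_summable)
  have bs: "(\<lambda>k. cmod (b k)) summable_on UNIV"
  proof (rule summable_on_comparison_test)
    show "(\<lambda>k. \<Sum>j\<in>F. cmod (c j) * cmod (K k j)) summable_on UNIV"
      using F by (induction F rule: finite_induct) (auto intro!: summable_on_add summable_on_cmult_right K_summable)
    show "cmod (b k) \<le> (\<Sum>j\<in>F. cmod (c j) * cmod (K k j))" for k
      unfolding b_def by (rule order.trans[OF norm_sum]) (simp add: norm_mult)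
  qed simp
  interpret b: abs_trig b by (rule abs_trig.intro[OF bs])
  have gK: "g j x - ex j x = (\<Sum>\<^sub>\<infinity>k. K k j * ex k x)" for j x
  proof -
    have s1: "(\<lambda>k. (if k = j then 1 else 0) * ex k x) summable_on UNIV"
      by (rule summable_on_cong_neutral[THEN iffD1, OF _ _ _ summable_on_finite[of "{j}" "\<lambda>k. ex k x"]]) auto
    have "g j x = (\<Sum>\<^sub>\<infinity>k. U k j * ex k x)" by (simp add: g_def abs_trig.f_def[OF U_abs_trig])
    also have "\<dots> = (\<Sum>\<^sub>\<infinity>k. (if k = j then 1 else 0) * ex k x) + (\<Sum>\<^sub>\<infinity>k. K k j * ex k x)"
      unfolding U_def distrib_right by (rule infsum_add[OF s1 Ks])
    also have "(\<Sum>\<^sub>\<infinity>k. (if k = j then 1 else 0) * ex k x) = (\<Sum>\<^sub>\<infinity>k\<in>{j}. ex k x)"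
      by (rule infsum_cong_neutral) auto
    finally show ?thesis by simp
  qed
  have "(\<Sum>j\<in>F. c j * (g j x - ex j x)) = b.f x" for x
  proof -
    have "(\<Sum>j\<in>F. c j * (g j x - ex j x)) = (\<Sum>j\<in>F. \<Sum>\<^sub>\<infinity>k. c j * (K k j * ex k x))"
      unfolding gK using Ks by (simp add: infsum_cmult_right)
    also have "\<dots> = (\<Sum>\<^sub>\<infinity>k. \<Sum>j\<in>F. c j * (K k j * ex k x))"
      by (rule sum_infsum[OF F, THEN conjunct2]) (intro summable_on_cmult_right Ks)
    finally show ?thesis unfolding b.f_def b_def by (simp add: sum_distrib_right mult.assoc)
  qed
  then have eq: "L2_norm (\<lambda>x. \<Sum>j\<in>F. c j * (g j x - ex j x)) = L2_norm b.f" by (simp add: L2_norm_def)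
  define s where "s = (\<Sum>j\<in>F. (cmod (c j))\<^sup>2)"
  have s0: "s \<ge> 0" by (simp add: s_def sum_nonneg)
  have row: "(\<Sum>j\<in>F. cmod (K k j)) \<le> 1/8" if "finite F" for k F
  proof -
    have "(\<Sum>j\<in>F. cmod (K k j)) \<le> (\<Sum>j\<in>F. C * gapinv N j k)"
      by (rule sum_mono) (use K_bound1 in \<open>simp add: gapinv_commute[of N _ k]\<close>)
    also have "\<dots> = C * (\<Sum>j\<in>F. gapinv N j k)" by (simp add: sum_distrib_left)
    also have "\<dots> \<le> C * \<gamma>"
      using finite_sum_le_infsum[OF gapinv_summable[OF N] that, of k] gapinv_sum_N[OF N, of k] C by (intro mult_left_mono) auto
    finally show ?thesis using small by linarith
  qed
  have col: "(\<Sum>k\<in>H. cmod (K k j)) \<le> 1/8" if "finite H" for j H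
  proof -
    have "(\<Sum>k\<in>H. cmod (K k j)) \<le> (\<Sum>k\<in>H. C * gapinv N k j)" by (rule sum_mono[OF K_bound1])
    also have "\<dots> = C * (\<Sum>k\<in>H. gapinv N k j)" by (simp add: sum_distrib_left)
    also have "\<dots> \<le> C * \<gamma>"
      using finite_sum_le_infsum[OF gapinv_summable[OF N] that, of j] gapinv_sum_N[OF N, of j] C by (intro mult_left_mono) auto
    finally show ?thesis using small by linarith
  qed
  have "L2_norm b.f \<le> 1/8 * sqrt s"
  proof (rule b.L2_norm_f_le)
    fix H :: "int set" assume H: "finite H"
    have "(\<Sum>k\<in>H. (cmod (b k))\<^sup>2) = (\<Sum>k\<in>H. (cmod (\<Sum>j\<in>F. K k j * c j))\<^sup>2)"
      by (simp add: b_def mult.commute)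
    also have "\<dots> \<le> (1/8)\<^sup>2 * s" unfolding s_def by (rule schur_test[OF row[OF F] col[OF H]]) simp
    also have "\<dots> = (1/8 * sqrt s)\<^sup>2" by (simp only: power_mult_distrib real_sqrt_pow2[OF s0])
    finally show "(\<Sum>k\<in>H. (cmod (b k))\<^sup>2) \<le> (1/8 * sqrt s)\<^sup>2" .
  qed (simp add: s0)
  then show "L2_norm (\<lambda>x. \<Sum>j\<in>F. c j * (g j x - ex j x)) \<le> 1/8 * sqrt (\<Sum>j\<in>F. (cmod (c j))\<^sup>2)"
    unfolding eq s_def .
qed auto

sublocale G: riesz_family g "1 - 1/8" "1 + 1/8" by (rule riesz_g)

text \<open>The conjugate of \<open>y\<close> is a limit of combinations of \<open>g\<close>, so its
  pairing with \<open>y\<close>, which is the squared norm, vanishes.\<close>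

lemma moments_complete:
  assumes y: "y \<in> L2" and z: "\<And>i. bl y (g i) = 0"
  shows "AE x in \<mu>. y x = 0"
proof -
  have yc: "(\<lambda>x. cnj (y x)) \<in> L2" by (rule L2_cnj[OF y])
  obtain a where a: "(\<lambda>n. L2_norm (\<lambda>x. (\<Sum>k\<in>ibox n. a k * g k x) - cnj (y x))) \<longlonglongrightarrow> 0"
    by (rule G.expansion[OF yc])
  have gl: "(\<lambda>x. \<Sum>k\<in>ibox n. a k * g k x) \<in> L2" for n by (intro L2_lincomb g_L2)
  have "(L2_norm y)\<^sup>2 \<le> L2_norm y * L2_norm (\<lambda>x. (\<Sum>k\<in>ibox n. a k * g k x) - cnj (y x))" for n
  proof -
    have "complex_of_real ((L2_norm y)\<^sup>2) = bl y (\<lambda>x. cnj (y x))"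
      unfolding L2_norm_square_inner L2_inner_def bl_def ..
    moreover have "bl y (\<lambda>x. (\<Sum>k\<in>ibox n. a k * g k x)) = 0"
      by (subst bl_lincomb_right) (auto simp: y g_L2 z)
    moreover have "bl y (\<lambda>x. (\<Sum>k\<in>ibox n. a k * g k x) - cnj (y x)) = bl y (\<lambda>x. (\<Sum>k\<in>ibox n. a k * g k x)) - bl y (\<lambda>x. cnj (y x))"
      using bl_diff_left[OF gl[of n] yc y] by (simp add: bl_commute)
    ultimately have "cmod (complex_of_real ((L2_norm y)\<^sup>2)) = cmod (bl y (\<lambda>x. (\<Sum>k\<in>ibox n. a k * g k x) - cnj (y x)))"
      by (simp del: of_real_power)
    also have "\<dots> \<le> L2_norm y * L2_norm (\<lambda>x. (\<Sum>k\<in>ibox n. a k * g k x) - cnj (y x))"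
      unfolding bl_def by (rule L2_Cauchy_Schwarz[OF y L2_diff[OF gl yc]])
    finally show ?thesis by (simp only: norm_of_real abs_power2)
  qed
  moreover have "(\<lambda>n. L2_norm y * L2_norm (\<lambda>x. (\<Sum>k\<in>ibox n. a k * g k x) - cnj (y x))) \<longlonglongrightarrow> L2_norm y * 0"
    by (intro tendsto_intros a)
  ultimately have "(L2_norm y)\<^sup>2 \<le> L2_norm y * 0" by (intro tendsto_lowerbound[of _ "L2_norm y * 0"]) (auto intro: always_eventually)
  then have "L2_norm y = 0" by simp
  then show ?thesis using L2_norm_eq_0_iff[OF y] by simp
qed

lemma comb_zero:
  assumes P: "finite P" and z: "AE x in \<mu>. comb P v x = 0" and l: "l \<in> P"
  shows "v l = 0"
proof -
  have "L2_norm (comb P v) = 0" using z L2_norm_eq_0_iff[OF comb_L2] by simp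
  then have "(1 - 1/8) * sqrt (\<Sum>k\<in>P. (cmod (v k))\<^sup>2) \<le> 0" using G.lower[OF P, of v] by (simp add: comb_def[abs_def])
  then have "sqrt (\<Sum>k\<in>P. (cmod (v k))\<^sup>2) \<le> 0" by simp
  then have "(\<Sum>k\<in>P. (cmod (v k))\<^sup>2) = 0" by (smt (verit) real_sqrt_le_0_iff sum_nonneg zero_le_power2)
  then show ?thesis using l P by (simp add: sum_nonneg_eq_0_iff)
qed

section \<open>Separation of the blocks\<close>

lemma gap: "\<not> rel N i j \<Longrightarrow> cmod (d i - d j) > 2 * rho"
proof -
  assume r: "\<not> rel N i j"
  have "\<bar>i\<^sup>2 - j\<^sup>2\<bar> \<ge> int N"
  proof -
    have "i\<^sup>2 - j\<^sup>2 = (\<bar>i\<bar> - \<bar>j\<bar>) * (\<bar>i\<bar> + \<bar>j\<bar>)" by (simp add: power2_eq_square algebra_simps)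
    then have "\<bar>i\<^sup>2 - j\<^sup>2\<bar> = \<bar>\<bar>i\<bar> - \<bar>j\<bar>\<bar> * (\<bar>i\<bar> + \<bar>j\<bar>)" by (simp add: abs_mult)
    moreover have "\<bar>\<bar>i\<bar> - \<bar>j\<bar>\<bar> \<ge> 1" "\<bar>i\<bar> + \<bar>j\<bar> \<ge> int N" using r by (auto simp: rel_def)
    ultimately show ?thesis using mult_mono[of 1 "\<bar>\<bar>i\<bar> - \<bar>j\<bar>\<bar>" "int N" "\<bar>i\<bar> + \<bar>j\<bar>"] by simp
  qed
  then have "real N \<le> \<bar>of_int (i\<^sup>2 - j\<^sup>2)\<bar>" by linarith
  moreover have "d i - d j = of_real (4 * pi\<^sup>2 * of_int (i\<^sup>2 - j\<^sup>2))" by (simp add: d_def algebra_simps)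
  then have "cmod (d i - d j) = 4 * pi\<^sup>2 * \<bar>of_int (i\<^sup>2 - j\<^sup>2)\<bar>" by (simp only: norm_of_real abs_mult) simp
  ultimately have "4 * real N \<le> cmod (d i - d j)" using mult_mono[OF pi_sq, of "real N" "\<bar>of_int (i\<^sup>2 - j\<^sup>2)\<bar>"] by simp
  then show ?thesis using big by linarith
qed

text \<open>Tail blocks have at most two elements. In the central block \<open>1 / a\<close> is
  written as \<open>sqrt a\<close> times \<open>a\<close> to the power \<open>-3/2\<close> with
  \<open>a \<le> 2 * N\<close>; the price of order \<open>sqrt N\<close> is affordable because the
  gaps are of order \<open>N\<close>. The map \<open>f\<close> allows for rows and columns at
  once.\<close>

lemma w_block_sum:
  assumes m: "\<And>l. l \<in> blk N i \<Longrightarrow> \<bar>f l\<bar> = \<bar>l - i\<bar>"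
  shows "(\<Sum>l\<in>blk N i. w (f l)) \<le> 2 + sqrt (2 * real N) * Z32"
proof (cases "\<bar>i\<bar> \<le> int N")
  case False
  then have "blk N i \<subseteq> {i, -i}" unfolding blk_def rel_def by auto
  then have "card (blk N i) \<le> 2" using card_mono[of "{i,-i}" "blk N i"] by (simp add: card_insert_if split: if_splits)
  moreover have "(\<Sum>l\<in>blk N i. w (f l)) \<le> (\<Sum>l\<in>blk N i. 1)" by (rule sum_mono[OF w_le_1])
  ultimately have "(\<Sum>l\<in>blk N i. w (f l)) \<le> 2" by simp
  then show ?thesis using Z32_nonneg by (simp add: add_increasing2)
next
  case True
  have "w (f l) \<le> (if l = i then 1 else 0) + sqrt (2 * real N) * z32 (l - i)" if l: "l \<in> blk N i" for l
  proof (cases "l = i")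
    case True then show ?thesis using w_le_1[of "f l"] by (simp add: z32_def)
  next
    case False
    define a where "a = real_of_int \<bar>l - i\<bar>"
    have a: "a > 0" "a \<le> 2 * real N" using False l True unfolding a_def blk_def rel_def by auto
    have "w (f l) \<le> 1 / (1 + a)" using w_small[of "f l"] m[OF l] by (simp add: a_def)
    also have "\<dots> \<le> 1 / a" using a by (intro divide_left_mono) auto
    also have "\<dots> = sqrt a * (1 / (a * sqrt a))" using a by simp
    also have "\<dots> \<le> sqrt (2 * real N) * (1 / (a * sqrt a))" using a by (intro mult_right_mono) auto
    finally show ?thesis using False by (simp add: z32_def a_def)
  qed
  then have "(\<Sum>l\<in>blk N i. w (f l)) \<le> (\<Sum>l\<in>blk N i. (if l = i then 1 else 0) + sqrt (2 * real N) * z32 (l - i))" by (rule sum_mono)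
  also have "\<dots> = 1 + sqrt (2 * real N) * (\<Sum>l\<in>blk N i. z32 (l - i))" by (simp add: sum.distrib sum_distrib_left)
  also have "(\<Sum>l\<in>blk N i. z32 (l - i)) = (\<Sum>l\<in>(\<lambda>l. l - i) ` blk N i. z32 l)" by (subst sum.reindex) (auto simp: inj_on_def)
  also have "\<dots> \<le> infsum z32 UNIV" by (rule finite_sum_le_infsum[OF z32_summable]) auto
  also have "\<dots> \<le> Z32" using infsum_nonneg[of UNIV z32] by (simp add: Z32_def)
  finally show ?thesis by (simp add: mult_left_mono)
qed

lemma B_col: "(\<Sum>l\<in>blk N i. cmod (B l i)) \<le> rho"
proof -
  have "(\<Sum>l\<in>blk N i. cmod (B l i)) \<le> (\<Sum>l\<in>blk N i. 2 * C * w (l - i))" by (rule sum_mono[OF B_bound])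
  also have "\<dots> = 2 * C * (\<Sum>l\<in>blk N i. w (l - i))" by (simp add: sum_distrib_left)
  also have "\<dots> \<le> rho" using w_block_sum[of i "\<lambda>l. l - i"] C by (intro mult_left_mono) auto
  finally show ?thesis .
qed

lemma B_row: "(\<Sum>l\<in>blk N i. cmod (B i l)) \<le> rho"
proof -
  have "(\<Sum>l\<in>blk N i. cmod (B i l)) \<le> (\<Sum>l\<in>blk N i. 2 * C * w (i - l))" by (rule sum_mono[OF B_bound])
  also have "\<dots> = 2 * C * (\<Sum>l\<in>blk N i. w (i - l))" by (simp add: sum_distrib_left)
  also have "\<dots> \<le> rho" using w_block_sum[of i "\<lambda>l. i - l"] C by (intro mult_left_mono) auto
  finally show ?thesis .
qed

text \<open>The equation is read at an index where the modulus of \<open>x\<close> is maximal. The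
  matrix \<open>E\<close> is general because a block is needed both as it stands and
  transposed.\<close>

lemma gershgorin:
  fixes E :: "int \<Rightarrow> int \<Rightarrow> complex"
  assumes E: "\<And>k. k \<in> P \<Longrightarrow> (\<Sum>l\<in>P. cmod (E k l)) \<le> rho" and P: "finite P"
    and far: "\<And>k. k \<in> P \<Longrightarrow> cmod (\<zeta> - d k) > rho"
    and eq: "\<And>k. k \<in> P \<Longrightarrow> d k * x k + (\<Sum>l\<in>P. E k l * x l) = \<zeta> * x k" and k: "k \<in> P"
  shows "x k = 0"
proof -
  define m where "m = Max ((\<lambda>k. cmod (x k)) ` P)"
  have le: "cmod (x l) \<le> m" if "l \<in> P" for l unfolding m_def using that P by auto
  have "m \<in> (\<lambda>k. cmod (x k)) ` P" unfolding m_def by (rule Max_in) (use P k in auto)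
  then obtain j where j: "j \<in> P" "m = cmod (x j)" by auto
  have m0: "m \<ge> 0" using j by simp
  have "(\<zeta> - d j) * x j = (\<Sum>l\<in>P. E j l * x l)" using eq[OF j(1)] by (simp add: algebra_simps)
  then have "cmod (\<zeta> - d j) * m = cmod (\<Sum>l\<in>P. E j l * x l)" by (metis j(2) norm_mult)
  also have "\<dots> \<le> (\<Sum>l\<in>P. cmod (E j l) * m)"
    by (rule sum_norm_le) (use le in \<open>auto simp: norm_mult intro: mult_left_mono\<close>)
  also have "\<dots> = (\<Sum>l\<in>P. cmod (E j l)) * m" by (simp add: sum_distrib_right)
  also have "\<dots> \<le> rho * m" by (rule mult_right_mono[OF E[OF j(1)] m0])
  finally have "(cmod (\<zeta> - d j) - rho) * m \<le> 0" by (simp add: algebra_simps)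
  then have "m \<le> 0" using far[OF j(1)] by (simp add: mult_le_0_iff)
  then show ?thesis using le[OF k] by (metis norm_le_zero_iff order.trans)
qed

lemma near_same_block:
  assumes "cmod (\<zeta> - d i) \<le> rho" "cmod (\<zeta> - d j) \<le> rho" shows "rel N i j"
proof (rule ccontr)
  assume "\<not> rel N i j"
  from gap[OF this] show False using assms norm_triangle_ineq4[of "\<zeta> - d j" "\<zeta> - d i"] by simp
qed

definition Gm :: "int \<Rightarrow> int \<Rightarrow> complex" where "Gm i j = bl (g i) (g j)"

lemma Gm_sym: "Gm i j = Gm j i"
  by (simp add: Gm_def bl_commute)

lemma g_comb: "g j = comb {j} (\<lambda>_. 1)"
  by (simp add: comb_def[abs_def])

text \<open>The symmetry of the operator in coordinates: the Gram matrix of the bilinear pairing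
  intertwines \<open>M\<close> with its transpose.\<close>

lemma Gm_relation: "(\<Sum>l\<in>blk N j. M l j * Gm l i) = (\<Sum>l\<in>blk N i. M l i * Gm j l)"
proof -
  have dom: "g j \<in> SL_domain q" unfolding g_comb by (rule comb_domain) simp
  have "SL_op q (g j) x = Lg j x" if "x \<in> {0..1}" for x
    using SL_op_comb[of "{j}" x "\<lambda>_. 1"] that by (simp flip: g_comb)
  then have "bl (SL_op q (g j)) (g i) = bl (Lg j) (g i)"
    unfolding bl_def by (intro Bochner_Integration.integral_cong) auto
  also have "\<dots> = (\<Sum>l\<in>blk N j. M l j * Gm l i)"
    unfolding Lg_def[abs_def] Gm_def by (rule bl_lincomb_left) (rule g_L2)+
  finally show ?thesis using SL_adjoint[OF dom, of i] by (simp add: Gm_def)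
qed

lemma M_sum: "P = blk N j \<Longrightarrow> (\<Sum>l\<in>P. M l j * x l) = d j * x j + (\<Sum>l\<in>P. B l j * x l)"
proof -
  assume P: "P = blk N j"
  have "(\<Sum>l\<in>P. M l j * x l) = (\<Sum>l\<in>P. (if l = j then d j * x j else 0) + B l j * x l)"
    by (rule sum.cong) (auto simp: M_def distrib_right)
  then show ?thesis using P by (simp add: sum.distrib)
qed

lemma M_row_sum: "k \<in> P \<Longrightarrow> finite P \<Longrightarrow> (\<Sum>l\<in>P. M k l * x l) = d k * x k + (\<Sum>l\<in>P. B k l * x l)"
proof -
  assume k: "k \<in> P" "finite P"
  have "(\<Sum>l\<in>P. M k l * x l) = (\<Sum>l\<in>P. (if l = k then d k * x k else 0) + B k l * x l)"
    by (rule sum.cong) (auto simp: M_def distrib_right)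
  then show ?thesis using k by (simp add: sum.distrib)
qed

text \<open>Between two blocks \<open>Gm_relation\<close> is a homogeneous Sylvester equation whose
  diagonal parts are more than \<open>2 * rho\<close> apart. At an entry of maximal modulus the two
  perturbations together weigh at most \<open>2 * rho\<close>, so all entries vanish.\<close>

lemma Gm_off_block:
  assumes r: "\<not> rel N i j"
  shows "Gm i j = 0"
proof -
  let ?P = "blk N i" and ?Q = "blk N j"
  define m where "m = Max ((\<lambda>(k,l). cmod (Gm k l)) ` (?P \<times> ?Q))"
  have fin: "finite ((\<lambda>(k,l). cmod (Gm k l)) ` (?P \<times> ?Q))" by simp
  have le: "cmod (Gm k l) \<le> m" if "k \<in> ?P" "l \<in> ?Q" for k l
    unfolding m_def by (rule Max_ge[OF fin]) (use that in force)
  have "m \<in> (\<lambda>(k,l). cmod (Gm k l)) ` (?P \<times> ?Q)" unfolding m_def by (rule Max_in[OF fin]) (use blk_self in blast)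
  then obtain k l where kl: "k \<in> ?P" "l \<in> ?Q" "m = cmod (Gm k l)" by auto
  have m0: "m \<ge> 0" using kl by simp
  have P: "blk N k = ?P" and Q: "blk N l = ?Q" using kl blk_eq by (auto simp: blk_def)
  have nr: "\<not> rel N k l" using r kl rel_trans rel_sym unfolding blk_def mem_Collect_eq by blast
  have "d k * Gm k l + (\<Sum>a\<in>?P. B a k * Gm a l) = d l * Gm k l + (\<Sum>a\<in>?Q. B a l * Gm k a)"
    using Gm_relation[of k l] M_sum[OF P[symmetric], of "\<lambda>a. Gm a l"] M_sum[OF Q[symmetric], of "\<lambda>a. Gm k a"] P Q by simp
  then have "(d k - d l) * Gm k l = (\<Sum>a\<in>?Q. B a l * Gm k a) - (\<Sum>a\<in>?P. B a k * Gm a l)"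
    by (simp add: algebra_simps)
  then have "cmod (d k - d l) * m \<le> cmod (\<Sum>a\<in>?Q. B a l * Gm k a) + cmod (\<Sum>a\<in>?P. B a k * Gm a l)"
    by (metis kl(3) norm_mult norm_triangle_ineq4)
  also have "cmod (\<Sum>a\<in>?Q. B a l * Gm k a) \<le> (\<Sum>a\<in>?Q. cmod (B a l) * m)"
    by (rule sum_norm_le) (use le kl in \<open>auto simp: norm_mult intro: mult_left_mono\<close>)
  also have "\<dots> = (\<Sum>a\<in>?Q. cmod (B a l)) * m" by (simp add: sum_distrib_right)
  also have "\<dots> \<le> rho * m" using B_col[of l] Q m0 by (intro mult_right_mono) auto
  also have "cmod (\<Sum>a\<in>?P. B a k * Gm a l) \<le> (\<Sum>a\<in>?P. cmod (B a k) * m)"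
    by (rule sum_norm_le) (use le kl in \<open>auto simp: norm_mult intro: mult_left_mono\<close>)
  also have "\<dots> = (\<Sum>a\<in>?P. cmod (B a k)) * m" by (simp add: sum_distrib_right)
  also have "\<dots> \<le> rho * m" using B_col[of k] P m0 by (intro mult_right_mono) auto
  finally have "(cmod (d k - d l) - 2 * rho) * m \<le> 0" by (simp add: algebra_simps)
  then have "m \<le> 0" using gap[OF nr] by (simp add: mult_le_0_iff)
  then show ?thesis using le[of i j] by (metis blk_self norm_le_zero_iff order.trans)
qed

end

section \<open>Generalised eigenvectors of a finite matrix\<close>

interpretation fv: vector_space "\<lambda>(a::complex) (f::'a \<Rightarrow> complex) x. a * f x"
  by standard (auto simp: fun_eq_iff algebra_simps)

text \<open>Vectors are functions supported in \<open>P\<close>, so that blocks of different sizes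
  share one type and the abstract dimension theory applies to all of them.\<close>

locale block_operator =
  fixes P :: "'a set" and Mx :: "'a \<Rightarrow> 'a \<Rightarrow> complex"
  assumes P: "finite P"
begin

definition supp :: "('a \<Rightarrow> complex) set" where "supp = {v. \<forall>k. k \<notin> P \<longrightarrow> v k = 0}"

text \<open>The matrix minus \<open>\<zeta>\<close>; the cut-off outside \<open>P\<close> keeps
  every iterate in \<open>supp\<close>.\<close>

definition A :: "complex \<Rightarrow> ('a \<Rightarrow> complex) \<Rightarrow> 'a \<Rightarrow> complex"
  where "A \<zeta> v k = (if k \<in> P then (\<Sum>l\<in>P. Mx k l * v l) - \<zeta> * v k else 0)"

definition GE :: "complex \<Rightarrow> ('a \<Rightarrow> complex) set" where "GE \<zeta> = {v \<in> supp. \<exists>n. (A \<zeta> ^^ n) v = 0}"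

lemma supp_subspace: "fv.subspace supp"
  by (auto simp: fv.subspace_def supp_def)

lemma A_supp: "A \<zeta> v \<in> supp"
  by (auto simp: A_def supp_def)

lemma A_add: "A \<zeta> (v + w) = A \<zeta> v + A \<zeta> w"
  by (auto simp: A_def fun_eq_iff algebra_simps sum.distrib)

lemma A_scale: "A \<zeta> (\<lambda>x. a * v x) = (\<lambda>x. a * A \<zeta> v x)"
  by (auto simp: A_def fun_eq_iff algebra_simps sum_distrib_left)

lemma A_zero: "A \<zeta> 0 = 0"
  by (auto simp: A_def fun_eq_iff)

lemma A_diff: "A \<zeta> (v - w) = A \<zeta> v - A \<zeta> w"
  by (auto simp: A_def fun_eq_iff algebra_simps sum_subtractf)

lemma A_shift: "v \<in> supp \<Longrightarrow> A \<eta> v = A \<zeta> v + (\<lambda>x. (\<zeta> - \<eta>) * v x)"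
  by (auto simp: A_def supp_def fun_eq_iff algebra_simps)

lemma A_commute: "v \<in> supp \<Longrightarrow> A \<zeta> (A \<eta> v) = A \<eta> (A \<zeta> v)"
proof -
  assume v: "v \<in> supp"
  have "A \<zeta> (A \<eta> v) = A \<zeta> (A \<zeta> v + (\<lambda>x. (\<zeta> - \<eta>) * v x))" by (simp only: A_shift[OF v, where \<eta> = \<eta> and \<zeta> = \<zeta>])
  also have "\<dots> = A \<zeta> (A \<zeta> v) + (\<lambda>x. (\<zeta> - \<eta>) * A \<zeta> v x)" by (simp only: A_add A_scale)
  also have "\<dots> = A \<eta> (A \<zeta> v)" by (rule A_shift[OF A_supp, symmetric])
  finally show ?thesis .
qed

lemma An_supp: "v \<in> supp \<Longrightarrow> (A \<zeta> ^^ n) v \<in> supp"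
  by (cases n) (auto simp: A_supp)

lemma An_add: "(A \<zeta> ^^ n) (v + w) = (A \<zeta> ^^ n) v + (A \<zeta> ^^ n) w"
  by (induction n) (simp_all only: funpow.simps id_apply comp_apply A_add)

lemma An_diff: "(A \<zeta> ^^ n) (v - w) = (A \<zeta> ^^ n) v - (A \<zeta> ^^ n) w"
  by (induction n) (simp_all only: funpow.simps id_apply comp_apply A_diff)

lemma An_scale: "(A \<zeta> ^^ n) (\<lambda>x. a * v x) = (\<lambda>x. a * (A \<zeta> ^^ n) v x)"
  by (induction n) (simp_all only: funpow.simps id_apply comp_apply A_scale)

lemma An_zero: "(A \<zeta> ^^ n) 0 = 0"
  by (induction n) (simp_all only: funpow.simps id_apply comp_apply A_zero)

lemma An_sum: "(A \<zeta> ^^ n) (\<Sum>i\<in>I. f i) = (\<Sum>i\<in>I. (A \<zeta> ^^ n) (f i))"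
  by (induction I rule: infinite_finite_induct) (simp_all only: sum.infinite sum.empty sum.insert An_zero An_add not_False_eq_True)

lemma An_A_commute: "v \<in> supp \<Longrightarrow> (A \<zeta> ^^ n) (A \<eta> v) = A \<eta> ((A \<zeta> ^^ n) v)"
  by (induction n) (auto simp: A_commute An_supp)

lemma An_Am_commute: "v \<in> supp \<Longrightarrow> (A \<zeta> ^^ n) ((A \<eta> ^^ m) v) = (A \<eta> ^^ m) ((A \<zeta> ^^ n) v)"
  by (induction m) (auto simp: An_A_commute An_supp)

lemma An_mono: "(A \<zeta> ^^ n) v = 0 \<Longrightarrow> n \<le> m \<Longrightarrow> (A \<zeta> ^^ m) v = 0"
proof -
  assume z: "(A \<zeta> ^^ n) v = 0" and le: "n \<le> m"
  have "(A \<zeta> ^^ m) v = (A \<zeta> ^^ (m - n)) ((A \<zeta> ^^ n) v)"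
    using le by (metis comp_apply funpow_add le_add_diff_inverse2)
  then show ?thesis using z An_zero by simp
qed

lemma GE_subspace: "fv.subspace (GE \<zeta>)"
  unfolding fv.subspace_def
proof (intro conjI ballI allI)
  show "0 \<in> GE \<zeta>" using supp_subspace An_zero by (auto simp: GE_def fv.subspace_def)
  fix v assume v: "v \<in> GE \<zeta>"
  then obtain n where n: "(A \<zeta> ^^ n) v = 0" by (auto simp: GE_def)
  show "(\<lambda>x. a * v x) \<in> GE \<zeta>" for a
    using v n An_scale[of n \<zeta> a v] by (auto simp: GE_def supp_def fun_eq_iff intro!: exI[of _ n])
  fix w assume w: "w \<in> GE \<zeta>"
  then obtain m where m: "(A \<zeta> ^^ m) w = 0" by (auto simp: GE_def)
  have "(A \<zeta> ^^ max n m) (v + w) = 0" unfolding An_add using An_mono[OF n] An_mono[OF m] by simp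
  then show "v + w \<in> GE \<zeta>" using v w unfolding GE_def by (auto simp: supp_def)
qed

lemma GE_pullback: "v \<in> supp \<Longrightarrow> A \<zeta> v \<in> GE \<zeta> \<Longrightarrow> v \<in> GE \<zeta>"
proof -
  assume v: "v \<in> supp" "A \<zeta> v \<in> GE \<zeta>"
  then obtain n where "(A \<zeta> ^^ n) (A \<zeta> v) = 0" by (auto simp: GE_def)
  then have "(A \<zeta> ^^ Suc n) v = 0" by (simp add: funpow_swap1)
  then show ?thesis using v by (auto simp: GE_def simp del: funpow.simps)
qed

lemma GE_A_invariant: "v \<in> GE \<eta> \<Longrightarrow> (A \<zeta> ^^ m) v \<in> GE \<eta>"
proof -
  assume "v \<in> GE \<eta>"
  then obtain n where v: "v \<in> supp" "(A \<eta> ^^ n) v = 0" by (auto simp: GE_def)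
  have "(A \<eta> ^^ n) ((A \<zeta> ^^ m) v) = 0" by (simp only: An_Am_commute[OF v(1), of n \<eta> m \<zeta>] v(2) An_zero)
  then show ?thesis using An_supp[OF v(1)] by (auto simp: GE_def)
qed

text \<open>On \<open>GE \<eta>\<close> the operator \<open>A \<zeta>\<close> differs from the
  nonzero scalar \<open>\<eta> - \<zeta>\<close> by the locally nilpotent \<open>A \<eta>\<close>;
  preimages are found by induction on the order of nilpotency.\<close>

lemma GE_onto:
  assumes "\<eta> \<noteq> \<zeta>" "v \<in> GE \<eta>"
  shows "\<exists>v'\<in>GE \<eta>. A \<zeta> v' = v"
proof -
  have "v \<in> supp \<Longrightarrow> (A \<eta> ^^ n) v = 0 \<Longrightarrow> \<exists>v'\<in>GE \<eta>. A \<zeta> v' = v" for n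
  proof (induction n arbitrary: v)
    case 0
    then have "v = 0" by (simp only: funpow.simps id_apply)
    then show ?case using fv.subspace_0[OF GE_subspace[of \<eta>]] A_zero by blast
  next
    case (Suc n)
    define c where "c = \<eta> - \<zeta>"
    have c: "c \<noteq> 0" using assms(1) by (simp add: c_def)
    have "(A \<eta> ^^ n) (A \<eta> v) = 0" using Suc.prems(2) by (simp only: funpow_Suc_right comp_apply)
    then obtain u' where u': "u' \<in> GE \<eta>" "A \<zeta> u' = A \<eta> v" using Suc.IH[OF A_supp] by blast
    define v' where "v' = (\<lambda>x. (1 / c) * (v - u') x)"
    have vG: "v \<in> GE \<eta>" using Suc.prems unfolding GE_def by blast
    have "v' \<in> GE \<eta>" unfolding v'_def by (intro fv.subspace_scale[OF GE_subspace] fv.subspace_diff[OF GE_subspace] vG u')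
    moreover have "A \<zeta> v' = (\<lambda>x. (1 / c) * (A \<zeta> v x - A \<eta> v x))"
      unfolding v'_def A_scale A_diff u'(2) by simp
    then have "A \<zeta> v' = v" using c A_shift[OF Suc.prems(1), of \<zeta> \<eta>] by (simp add: c_def fun_eq_iff)
    ultimately show ?case by blast
  qed
  then show ?thesis using assms(2) unfolding GE_def by blast
qed

text \<open>A vector of \<open>GE \<eta>\<close> annihilated by \<open>A \<zeta>\<close> is
  multiplied by the nonzero number \<open>\<zeta> - \<eta>\<close> under \<open>A \<eta>\<close>,
  yet some power of \<open>A \<eta>\<close> annihilates it.\<close>

lemma GE_injective:
  assumes "\<eta> \<noteq> \<zeta>" "v \<in> GE \<eta>" "(A \<zeta> ^^ m) v = 0"
  shows "v = 0"
proof -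
  have one: "w = 0" if w: "w \<in> GE \<eta>" "A \<zeta> w = 0" for w
  proof -
    obtain n where n: "w \<in> supp" "(A \<eta> ^^ n) w = 0" using w by (auto simp: GE_def)
    have "A \<eta> w = (\<lambda>x. (\<zeta> - \<eta>) * w x)" using A_shift[OF n(1), of \<eta> \<zeta>] w(2) by (simp add: fun_eq_iff)
    then have "(A \<eta> ^^ k) w = (\<lambda>x. (\<zeta> - \<eta>) ^ k * w x)" for k
    proof (induction k)
      case (Suc k)
      have "(A \<eta> ^^ Suc k) w = (\<lambda>x. (\<zeta> - \<eta>) ^ k * A \<eta> w x)" by (simp only: funpow.simps comp_apply Suc A_scale)
      then show ?case by (simp only: \<open>A \<eta> w = (\<lambda>x. (\<zeta> - \<eta>) * w x)\<close>) (simp add: mult_ac)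
    qed simp
    then show ?thesis using n(2) assms(1) by (auto simp: fun_eq_iff)
  qed
  show ?thesis using assms(3)
  proof (induction m)
    case (Suc m)
    have "(A \<zeta> ^^ m) v = 0" by (rule one[OF GE_A_invariant[OF assms(2)]]) (use Suc.prems in \<open>simp only: funpow.simps comp_apply\<close>)
    then show ?case by (rule Suc.IH)
  qed simp
qed

text \<open>A power of \<open>A \<xi>\<close> removes one summand. By induction it annihilates each
  of the others, on whose spaces it is injective.\<close>

lemma GE_sum_zero:
  assumes "finite Z" "\<And>\<zeta>. \<zeta> \<in> Z \<Longrightarrow> f \<zeta> \<in> GE \<zeta>" "(\<Sum>\<zeta>\<in>Z. f \<zeta>) = 0" "\<zeta> \<in> Z"
  shows "f \<zeta> = 0"
  using assms
proof (induction Z arbitrary: f \<zeta> rule: finite_induct)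
  case (insert \<xi> Z)
  obtain n where n: "(A \<xi> ^^ n) (f \<xi>) = 0" using insert.prems(1)[of \<xi>] by (auto simp: GE_def)
  have "(A \<xi> ^^ n) (\<Sum>\<zeta>\<in>insert \<xi> Z. f \<zeta>) = 0" by (simp only: insert.prems(2) An_zero)
  then have "(A \<xi> ^^ n) (f \<xi>) + (\<Sum>\<zeta>\<in>Z. (A \<xi> ^^ n) (f \<zeta>)) = 0"
    by (simp only: An_sum An_add sum.insert[OF insert.hyps(1,2)])
  then have s: "(\<Sum>\<zeta>\<in>Z. (A \<xi> ^^ n) (f \<zeta>)) = 0" by (simp only: n add_0)
  have z: "f \<zeta> = 0" if "\<zeta> \<in> Z" for \<zeta>
  proof (rule GE_injective)
    show "(A \<xi> ^^ n) (f \<zeta>) = 0"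
      by (rule insert.IH[OF _ s that]) (use insert.prems(1) GE_A_invariant in auto)
    show "f \<zeta> \<in> GE \<zeta>" using insert.prems(1) that by simp
    show "\<zeta> \<noteq> \<xi>" using that insert.hyps by auto
  qed
  have "f \<xi> + (\<Sum>\<zeta>\<in>Z. f \<zeta>) = 0" using insert.prems(2) by (simp only: sum.insert[OF insert.hyps(1,2)])
  moreover have "(\<Sum>\<zeta>\<in>Z. f \<zeta>) = 0" by (rule sum.neutral) (use z in blast)
  ultimately have "f \<xi> = 0" by (simp only: add_0_right)
  then show ?case using z insert.prems(3) by auto
qed simp

section \<open>Annihilating polynomials and completeness of the generalised eigenspaces\<close>

definition pe :: "complex poly \<Rightarrow> ('a \<Rightarrow> complex) \<Rightarrow> 'a \<Rightarrow> complex"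
  where "pe p v x = (\<Sum>i\<le>degree p. coeff p i * (A 0 ^^ i) v x)"

lemma pe_bound: "degree p \<le> n \<Longrightarrow> pe p v x = (\<Sum>i\<le>n. coeff p i * (A 0 ^^ i) v x)"
  unfolding pe_def by (rule sum.mono_neutral_left) (auto simp: coeff_eq_0)

lemma pe_linear_factor:
  assumes v: "v \<in> supp"
  shows "pe ([:- \<zeta>, 1:] * p) v = pe p (A \<zeta> v)"
proof
  fix x
  let ?n = "degree p"
  have Az: "A \<zeta> v = A 0 v - (\<lambda>x. \<zeta> * v x)" using A_shift[OF v, of \<zeta> 0] by (simp add: fun_eq_iff)
  have q: "[:- \<zeta>, 1:] * p = pCons 0 p - smult \<zeta> p" by simp
  have deg: "degree ([:- \<zeta>, 1:] * p) \<le> Suc ?n" unfolding q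
    by (intro degree_diff_le degree_pCons_le order.trans[OF degree_smult_le]) auto
  have "pe ([:- \<zeta>, 1:] * p) v x = (\<Sum>i\<le>Suc ?n. coeff (pCons 0 p) i * (A 0 ^^ i) v x) - (\<Sum>i\<le>Suc ?n. \<zeta> * coeff p i * (A 0 ^^ i) v x)"
    unfolding pe_bound[OF deg] unfolding q by (simp add: left_diff_distrib sum_subtractf del: sum.atMost_Suc)
  also have "(\<Sum>i\<le>Suc ?n. coeff (pCons 0 p) i * (A 0 ^^ i) v x) = (\<Sum>i\<le>?n. coeff p i * (A 0 ^^ i) (A 0 v) x)"
    by (subst sum.atMost_Suc_shift) (simp add: funpow_swap1)
  also have "(\<Sum>i\<le>Suc ?n. \<zeta> * coeff p i * (A 0 ^^ i) v x) = (\<Sum>i\<le>?n. \<zeta> * coeff p i * (A 0 ^^ i) v x)"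
    by (simp add: coeff_eq_0)
  finally show "pe ([:- \<zeta>, 1:] * p) v x = pe p (A \<zeta> v) x"
    unfolding pe_def Az An_diff An_scale by (simp add: algebra_simps sum_subtractf)
qed

definition \<delta> :: "'a \<Rightarrow> 'a \<Rightarrow> complex" where "\<delta> l k = (if k = l then 1 else 0)"

lemma delta_supp: "l \<in> P \<Longrightarrow> \<delta> l \<in> supp"
  by (auto simp: \<delta>_def supp_def)

lemma sum_scale_apply: "(\<Sum>i\<in>I. (\<lambda>x. c i * f i x)) = (\<lambda>x. \<Sum>i\<in>I. c i * f i x)" for c :: "'b \<Rightarrow> complex" and f :: "'b \<Rightarrow> 'a \<Rightarrow> complex"
  by (induction I rule: infinite_finite_induct) (auto simp: fun_eq_iff)

lemma supp_expand: "v \<in> supp \<Longrightarrow> v = (\<lambda>x. \<Sum>l\<in>P. v l * \<delta> l x)"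
  using P by (auto simp: fun_eq_iff supp_def \<delta>_def if_distrib sum.delta cong: if_cong)

lemma span_delta: "fv.span (\<delta> ` P) = supp"
proof
  show "fv.span (\<delta> ` P) \<subseteq> supp" by (rule fv.span_minimal) (use delta_supp supp_subspace in auto)
  show "supp \<subseteq> fv.span (\<delta> ` P)"
  proof
    fix v assume "v \<in> supp"
    then have "v = (\<Sum>l\<in>P. (\<lambda>x. v l * \<delta> l x))" unfolding sum_scale_apply by (rule supp_expand)
    also have "\<dots> \<in> fv.span (\<delta> ` P)" by (intro fv.span_sum fv.span_scale fv.span_base) auto
    finally show "v \<in> fv.span (\<delta> ` P)" .
  qed
qed

text \<open>The first \<open>card P + 1\<close> iterates of \<open>v\<close> lie in a space spanned
  by \<open>card P\<close> vectors. If two of them coincide, a difference of monomials works;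
  otherwise a linear dependence supplies the coefficients.\<close>

lemma annihilating_poly:
  assumes v: "v \<in> supp"
  shows "\<exists>p. p \<noteq> 0 \<and> pe p v = 0"
proof (cases "inj_on (\<lambda>i. (A 0 ^^ i) v) {..card P}")
  case False
  then obtain i j where ij: "i \<noteq> j" "(A 0 ^^ i) v = (A 0 ^^ j) v" by (auto simp: inj_on_def)
  define p where "p = monom (1::complex) i - monom 1 j"
  have "coeff p i \<noteq> 0" using ij by (simp add: p_def)
  then have p: "p \<noteq> 0" by auto
  have "degree p \<le> max i j" unfolding p_def by (intro degree_diff_le order.trans[OF degree_monom_le]) auto
  then have "pe p v x = (\<Sum>k\<le>max i j. coeff p k * (A 0 ^^ k) v x)" for x by (rule pe_bound)
  also have "\<dots> x = (\<Sum>k\<le>max i j. (if k = i then (A 0 ^^ i) v x else 0) - (if k = j then (A 0 ^^ j) v x else 0))" for x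
    by (rule sum.cong) (auto simp: p_def)
  also have "\<dots> x = 0" for x using ij(2) by (simp add: sum_subtractf)
  finally show ?thesis using p by (intro exI[of _ p]) (auto simp: fun_eq_iff)
next
  case True
  define S where "S = (\<lambda>i. (A 0 ^^ i) v) ` {..card P}"
  have "card S = Suc (card P)" using card_image[OF True] by (simp add: S_def)
  moreover have "S \<subseteq> fv.span (\<delta> ` P)" unfolding span_delta S_def using An_supp[OF v] by auto
  moreover have "card (\<delta> ` P) \<le> card P" using P by (rule card_image_le)
  ultimately have "fv.dependent S"
    using fv.independent_span_bound[of "\<delta> ` P" S] P by fastforce
  then obtain u where u: "\<exists>w\<in>S. u w \<noteq> 0" "(\<Sum>w\<in>S. (\<lambda>x. u w * w x)) = 0"
    using fv.dependent_finite[of S] by (auto simp: S_def)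
  define p where "p = (\<Sum>i\<le>card P. monom (u ((A 0 ^^ i) v)) i)"
  have cp: "coeff p k = (if k \<le> card P then u ((A 0 ^^ k) v) else 0)" for k
    by (simp add: p_def coeff_sum)
  have "p \<noteq> 0"
  proof
    assume "p = 0"
    then have "\<And>k. k \<le> card P \<Longrightarrow> u ((A 0 ^^ k) v) = 0" using cp by (metis coeff_0)
    then show False using u(1) by (auto simp: S_def)
  qed
  moreover have "degree p \<le> card P" by (rule degree_le) (simp add: cp)
  then have "pe p v x = 0" for x
  proof -
    have "pe p v x = (\<Sum>i\<le>card P. u ((A 0 ^^ i) v) * (A 0 ^^ i) v x)"
      using pe_bound[OF \<open>degree p \<le> card P\<close>] by (simp add: cp)
    also have "\<dots> = (\<Sum>w\<in>S. u w * w x)" unfolding S_def by (subst sum.reindex[OF True]) simp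
    also have "\<dots> = 0" using u(2) unfolding sum_scale_apply by (simp add: fun_eq_iff)
    finally show ?thesis .
  qed
  ultimately show ?thesis by (auto simp: fun_eq_iff)
qed

text \<open>Up to elements of \<open>GE \<zeta>\<close>, the operator \<open>A \<zeta>\<close> maps
  the span of all \<open>GE \<eta>\<close> onto itself. Subtracting from \<open>w\<close> such an
  approximate preimage of \<open>A \<zeta> w\<close> leaves a vector that \<open>A \<zeta>\<close>
  sends into \<open>GE \<zeta>\<close>, and this vector then lies in \<open>GE \<zeta>\<close>
  itself.\<close>

lemma span_GE_pullback:
  assumes w: "w \<in> supp" "A \<zeta> w \<in> fv.span (\<Union>\<eta>. GE \<eta>)"
  shows "w \<in> fv.span (\<Union>\<eta>. GE \<eta>)"
proof -
  let ?S = "fv.span (\<Union>\<eta>. GE \<eta>)"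
  have Ssupp: "?S \<subseteq> supp" by (rule fv.span_minimal) (use supp_subspace in \<open>auto simp: GE_def\<close>)
  have "\<exists>w'\<in>?S. \<exists>v\<in>GE \<zeta>. A \<zeta> w' + v = x" if "x \<in> ?S" for x
    using that
  proof (induction rule: fv.span_induct_alt)
    case base
    show ?case using fv.span_zero fv.subspace_0[OF GE_subspace[of \<zeta>]] A_zero by (metis add_0)
  next
    case (step c x y)
    then obtain w1 v1 where 1: "w1 \<in> ?S" "v1 \<in> GE \<zeta>" "A \<zeta> w1 + v1 = y" by blast
    obtain \<eta> where \<eta>: "x \<in> GE \<eta>" using step.hyps(1) by blast
    obtain w2 v2 where 2: "w2 \<in> ?S" "v2 \<in> GE \<zeta>" "A \<zeta> w2 + v2 = x"
    proof (cases "\<eta> = \<zeta>")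
      case True
      then show thesis using that[of 0 x] \<eta> fv.span_zero A_zero by auto
    next
      case False
      from GE_onto[OF False \<eta>] obtain v' where "v' \<in> GE \<eta>" "A \<zeta> v' = x" by blast
      then show thesis using that[of v' 0] fv.span_base[of v' "\<Union>\<eta>. GE \<eta>"] fv.subspace_0[OF GE_subspace[of \<zeta>]] by auto
    qed
    have "A \<zeta> ((\<lambda>x. c * w2 x) + w1) + ((\<lambda>x. c * v2 x) + v1) = (\<lambda>z. c * x z) + y"
    proof
      fix z
      have "A \<zeta> w1 z + v1 z = y z" "A \<zeta> w2 z + v2 z = x z" using fun_cong[OF 1(3), of z] fun_cong[OF 2(3), of z] by simp_all
      then have "y z = A \<zeta> w1 z + v1 z" "x z = A \<zeta> w2 z + v2 z" by simp_all
      then show "(A \<zeta> ((\<lambda>x. c * w2 x) + w1) + ((\<lambda>x. c * v2 x) + v1)) z = ((\<lambda>z. c * x z) + y) z"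
        unfolding A_add A_scale by (simp add: algebra_simps)
    qed
    moreover have "(\<lambda>x. c * w2 x) + w1 \<in> ?S" by (intro fv.span_add fv.span_scale 1 2)
    moreover have "(\<lambda>x. c * v2 x) + v1 \<in> GE \<zeta>"
      by (intro fv.subspace_add[OF GE_subspace] fv.subspace_scale[OF GE_subspace] 1 2)
    ultimately show ?case by blast
  qed
  from this[OF w(2)] obtain w' v where wv: "w' \<in> ?S" "v \<in> GE \<zeta>" "A \<zeta> w' + v = A \<zeta> w" by blast
  have "A \<zeta> (w - w') = v" unfolding A_diff using wv(3) by (simp add: algebra_simps)
  moreover have "w - w' \<in> supp" using fv.subspace_diff[OF supp_subspace] w(1) wv(1) Ssupp by blast
  ultimately have "w - w' \<in> GE \<zeta>" using GE_pullback wv(2) by blast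
  then have "w - w' \<in> ?S" by (intro fv.span_base) blast
  then have "(w - w') + w' \<in> ?S" using wv(1) by (rule fv.span_add)
  then show ?thesis by simp
qed

text \<open>The roots of an annihilating polynomial are stripped off one at a time, each step being
  an instance of \<open>span_GE_pullback\<close>.\<close>

theorem span_GE: "fv.span (\<Union>\<eta>. GE \<eta>) = supp"
proof
  let ?S = "fv.span (\<Union>\<eta>. GE \<eta>)"
  show "?S \<subseteq> supp" by (rule fv.span_minimal) (use supp_subspace in \<open>auto simp: GE_def\<close>)
  have key: "p \<noteq> 0 \<Longrightarrow> w \<in> supp \<Longrightarrow> pe p w \<in> ?S \<Longrightarrow> w \<in> ?S" for p w
  proof (induction "degree p" arbitrary: p w)
    case 0
    then obtain a where a: "p = [:a:]" "a \<noteq> 0" by (metis degree_eq_zeroE pCons_0_0)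
    then have "pe p w = (\<lambda>x. a * w x)" by (auto simp: pe_def)
    then have "(\<lambda>x. (1/a) * pe p w x) = w" using a(2) by auto
    then show ?case using fv.span_scale[OF "0.prems"(3), of "1/a"] by simp
  next
    case (Suc n)
    have "\<not> constant (poly p)" using Suc.hyps(2) by (simp add: constant_degree)
    then obtain \<zeta> where "poly p \<zeta> = 0" using fundamental_theorem_of_algebra by blast
    then obtain p' where p': "p = [:- \<zeta>, 1:] * p'" by (metis dvdE poly_eq_0_iff_dvd)
    have p'0: "p' \<noteq> 0" using Suc.prems(1) p' by auto
    then have "degree p = Suc (degree p')" unfolding p' by (subst degree_mult_eq) auto
    then have n: "n = degree p'" using Suc.hyps(2) by simp
    have "A \<zeta> w \<in> ?S"
      by (rule Suc.hyps(1)[OF n p'0 A_supp]) (use Suc.prems(3) pe_linear_factor[OF Suc.prems(2)] p' in metis)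
    then show ?case by (rule span_GE_pullback[OF Suc.prems(2)])
  qed
  show "supp \<subseteq> ?S"
  proof
    fix v assume v: "v \<in> supp"
    from annihilating_poly[OF v] obtain p where "p \<noteq> 0" "pe p v = 0" by blast
    then show "v \<in> ?S" using key[of p v] v fv.span_zero by auto
  qed
qed

lemma fv_independent_delta: "fv.independent (\<delta> ` P)" "inj_on \<delta> P"
proof -
  show inj: "inj_on \<delta> P" by (auto simp: inj_on_def \<delta>_def fun_eq_iff split: if_splits)
  have "u (\<delta> l) = 0" if "(\<Sum>w\<in>\<delta> ` P. (\<lambda>x. u w * w x)) = 0" "l \<in> P" for u l
  proof -
    have "0 = (\<Sum>w\<in>\<delta> ` P. u w * w l)" using that(1) unfolding sum_scale_apply by (simp add: fun_eq_iff)
    also have "\<dots> = (\<Sum>k\<in>P. u (\<delta> k) * \<delta> k l)" by (subst sum.reindex[OF inj]) simp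
    also have "\<dots> = u (\<delta> l)" using that(2) P by (simp add: \<delta>_def if_distrib cong: if_cong)
    finally show ?thesis by simp
  qed
  then show "fv.independent (\<delta> ` P)" using fv.dependent_finite[of "\<delta> ` P"] P by blast
qed

text \<open>Nothing bounds \<open>E\<close> in advance, so independence is shown for finite
  subfamilies first; comparison with the unit vectors of \<open>P\<close> then gives finiteness and
  the exact number.\<close>

theorem generalized_eigenbasis:
  fixes m :: "complex \<Rightarrow> nat"
  assumes J: "J = {(\<zeta>, i). \<zeta> \<in> E \<and> i < m \<zeta>}"
    and c: "\<And>\<zeta> i. \<zeta> \<in> E \<Longrightarrow> i < m \<zeta> \<Longrightarrow> c (\<zeta>, i) \<in> GE \<zeta>"
    and ind: "\<And>\<zeta> a i. \<zeta> \<in> E \<Longrightarrow> (\<Sum>i<m \<zeta>. (\<lambda>x. a i * c (\<zeta>, i) x)) = 0 \<Longrightarrow> i < m \<zeta> \<Longrightarrow> a i = 0"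
    and sp: "\<And>\<zeta> v. \<zeta> \<in> E \<Longrightarrow> v \<in> GE \<zeta> \<Longrightarrow> \<exists>a. v = (\<Sum>i<m \<zeta>. (\<lambda>x. a i * c (\<zeta>, i) x))"
    and triv: "\<And>\<zeta>. \<zeta> \<notin> E \<Longrightarrow> GE \<zeta> \<subseteq> {0}"
  shows "finite J" "card J = card P"
    "\<And>a j. (\<Sum>i\<in>J. (\<lambda>x. a i * c i x)) = 0 \<Longrightarrow> j \<in> J \<Longrightarrow> a j = 0"
    "\<And>v. v \<in> supp \<Longrightarrow> \<exists>a. v = (\<lambda>x. \<Sum>i\<in>J. a i * c i x)"
proof -
  have fam: "a j = 0" if F: "finite F" "F \<subseteq> J" "(\<Sum>i\<in>F. (\<lambda>x. a i * c i x)) = 0" "j \<in> F" for F a j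
  proof -
    define Z where "Z = fst ` F"
    define a' where "a' i = (if i \<in> F then a i else 0)" for i
    define f where "f \<zeta> = (\<Sum>i<m \<zeta>. (\<lambda>x. a' (\<zeta>, i) * c (\<zeta>, i) x))" for \<zeta>
    have Z: "finite Z" "Z \<subseteq> E" using F by (auto simp: Z_def J)
    have "(\<Sum>i\<in>F. (\<lambda>x. a i * c i x)) = (\<Sum>i\<in>Sigma Z (\<lambda>\<zeta>. {..<m \<zeta>}). (\<lambda>x. a' i * c i x))"
    proof (rule sum.mono_neutral_cong_left)
      show "finite (Sigma Z (\<lambda>\<zeta>. {..<m \<zeta>}))" using Z(1) by simp
      show "F \<subseteq> Sigma Z (\<lambda>\<zeta>. {..<m \<zeta>})"
      proof
        fix p assume "p \<in> F"
        moreover obtain \<zeta> i where "p = (\<zeta>, i)" by (cases p)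
        ultimately show "p \<in> Sigma Z (\<lambda>\<zeta>. {..<m \<zeta>})" using F(2) by (force simp: Z_def J)
      qed
    qed (auto simp: a'_def fun_eq_iff)
    also have "\<dots> = (\<Sum>\<zeta>\<in>Z. \<Sum>i\<in>{..<m \<zeta>}. (\<lambda>x. a' (\<zeta>, i) * c (\<zeta>, i) x))"
      by (subst sum.Sigma[OF Z(1)]) (simp_all add: case_prod_unfold)
    also have "\<dots> = (\<Sum>\<zeta>\<in>Z. f \<zeta>)" by (simp only: f_def)
    finally have s: "(\<Sum>\<zeta>\<in>Z. f \<zeta>) = 0" using F(3) by simp
    have fG: "f \<zeta> \<in> GE \<zeta>" if "\<zeta> \<in> Z" for \<zeta>
      unfolding f_def using that Z(2) by (intro fv.subspace_sum[OF GE_subspace] fv.subspace_scale[OF GE_subspace] c) auto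
    obtain \<zeta> i where j: "j = (\<zeta>, i)" by (cases j)
    then have "\<zeta> \<in> Z" "\<zeta> \<in> E" "i < m \<zeta>" using F(2,4) by (auto simp: Z_def J image_iff intro: bexI[of _ j])
    moreover have "f \<zeta> = 0" by (rule GE_sum_zero[OF Z(1) fG s \<open>\<zeta> \<in> Z\<close>])
    ultimately have "a' (\<zeta>, i) = 0" using ind[of \<zeta> "\<lambda>i. a' (\<zeta>, i)" i] by (simp add: f_def)
    then show ?thesis using F(4) j by (simp add: a'_def)
  qed
  have inj: "inj_on c J"
  proof (rule inj_onI, rule ccontr)
    fix i j assume ij: "i \<in> J" "j \<in> J" "c i = c j" "i \<noteq> j"
    have "(\<Sum>k\<in>{i,j}. (\<lambda>x. (if k = i then 1 else -1) * c k x)) = 0" using ij by (auto simp: fun_eq_iff)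
    from fam[OF _ _ this, of i] show False using ij by auto
  qed
  have ind': "fv.independent (c ` J)"
    unfolding fv.dependent_explicit
  proof clarify
    fix S u v assume S: "finite S" "S \<subseteq> c ` J" "(\<Sum>v\<in>S. (\<lambda>x. u v * v x)) = 0" "v \<in> S" "u v \<noteq> 0"
    obtain F where F: "F \<subseteq> J" "S = c ` F" using S(2) by (meson subset_imageE)
    have injF: "inj_on c F" using inj F(1) by (rule inj_on_subset)
    have "finite F" using S(1) F injF by (metis finite_imageD)
    moreover have "(\<Sum>i\<in>F. (\<lambda>x. u (c i) * c i x)) = 0" using S(3) unfolding F(2) by (subst (asm) sum.reindex[OF injF]) simp
    moreover obtain i where "i \<in> F" "v = c i" using S(4) F by auto
    ultimately show False using fam[of F "\<lambda>i. u (c i)" i] F(1) S(5) by auto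
  qed
  have sub: "c ` J \<subseteq> supp" using c by (auto simp: J GE_def)
  have span: "fv.span (c ` J) = supp"
  proof
    show "fv.span (c ` J) \<subseteq> supp" by (rule fv.span_minimal[OF sub supp_subspace])
    have "GE \<zeta> \<subseteq> fv.span (c ` J)" for \<zeta>
    proof (cases "\<zeta> \<in> E")
      case True
      show ?thesis
      proof
        fix v assume "v \<in> GE \<zeta>"
        then obtain a where "v = (\<Sum>i<m \<zeta>. (\<lambda>x. a i * c (\<zeta>, i) x))" using sp[OF True] by blast
        also have "\<dots> \<in> fv.span (c ` J)"
          by (intro fv.span_sum fv.span_scale fv.span_base imageI) (use True in \<open>auto simp: J\<close>)
        finally show "v \<in> fv.span (c ` J)" .
      qed
    next
      case False
      then show ?thesis using triv[OF False] fv.span_zero by auto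
    qed
    then have "fv.span (\<Union>\<zeta>. GE \<zeta>) \<subseteq> fv.span (c ` J)" by (intro fv.span_minimal) auto
    then show "supp \<subseteq> fv.span (c ` J)" using span_GE by simp
  qed
  have fin: "finite (c ` J)" and le: "card (c ` J) \<le> card (\<delta> ` P)"
    using fv.independent_span_bound[of "\<delta> ` P" "c ` J"] P ind' sub span_delta by auto
  have ge: "card (\<delta> ` P) \<le> card (c ` J)"
    using fv.independent_span_bound[OF fin fv_independent_delta(1)] delta_supp span by auto
  show finJ: "finite J" using fin inj by (rule finite_imageD)
  show "card J = card P"
    using le ge card_image[OF inj] card_image[OF fv_independent_delta(2)] by simp
  show "a j = 0" if "(\<Sum>i\<in>J. (\<lambda>x. a i * c i x)) = 0" "j \<in> J" for a j
    by (rule fam[OF finJ order.refl that])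
  show "\<exists>a. v = (\<lambda>x. \<Sum>i\<in>J. a i * c i x)" if "v \<in> supp" for v
  proof -
    have "v \<in> range (\<lambda>u. \<Sum>w\<in>c ` J. (\<lambda>x. u w * w x))" using that span fv.span_finite[OF fin] by simp
    then obtain u where "v = (\<Sum>w\<in>c ` J. (\<lambda>x. u w * w x))" by blast
    also have "\<dots> = (\<lambda>x. \<Sum>i\<in>J. u (c i) * c i x)" unfolding sum_scale_apply by (subst sum.reindex[OF inj]) simp
    finally show ?thesis by (intro exI[of _ "\<lambda>i. u (c i)"])
  qed
qed

end

section \<open>Root functions and the blocks\<close>

context sl_family
begin

sublocale BO: block_operator "blk N j" M for j by standard simp

text \<open>Membership in the closed Gershgorin disc of the unperturbed eigenvalue with index
  \<open>j\<close>.\<close>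

definition near :: "complex \<Rightarrow> int \<Rightarrow> bool" where "near \<zeta> j \<longleftrightarrow> cmod (\<zeta> - d j) \<le> rho"

lemma blk_eq': "k \<in> blk N j \<Longrightarrow> blk N k = blk N j"
  by (rule blk_eq) (simp add: blk_def)

lemma blk_disjoint: "\<not> rel N i j \<Longrightarrow> k \<in> blk N i \<Longrightarrow> l \<in> blk N j \<Longrightarrow> \<not> rel N k l"
  unfolding blk_def mem_Collect_eq using rel_trans rel_sym by blast

lemma SL_shift_comb:
  assumes "x \<in> {0..1}"
  shows "SL_op q (comb (blk N j) v) x - \<zeta> * comb (blk N j) v x = comb (blk N j) (BO.A j \<zeta> v) x"
proof -
  let ?P = "blk N j"
  have "SL_op q (comb ?P v) x = (\<Sum>l\<in>?P. v l * (\<Sum>k\<in>?P. M k l * g k x))"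
    unfolding SL_op_comb[OF finite_blk assms] Lg_def by (rule sum.cong) (simp_all add: blk_eq')
  also have "\<dots> = (\<Sum>k\<in>?P. (\<Sum>l\<in>?P. M k l * v l) * g k x)"
    unfolding sum_distrib_left sum_distrib_right by (subst sum.swap) (simp add: mult_ac)
  also have "\<dots> = comb ?P (BO.A j \<zeta> v) x + (\<Sum>l\<in>?P. \<zeta> * v l * g l x)"
    by (simp add: comb_def BO.A_def left_diff_distrib sum_subtractf)
  also have "(\<Sum>l\<in>?P. \<zeta> * v l * g l x) = \<zeta> * comb ?P v x" by (simp add: comb_def sum_distrib_left mult.assoc)
  finally show ?thesis by simp
qed

lemma shift_maps_comb: "SL_shift_maps q \<zeta> (comb (blk N j) v) (comb (blk N j) (BO.A j \<zeta> v))"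
  unfolding SL_shift_maps_def
  by (intro conjI comb_domain finite_blk AE_mu_negligible[of "{}"] SL_shift_comb) auto

section \<open>Root functions and their moments\<close>

lemma moment_step:
  assumes "SL_shift_maps q \<zeta> y z" "z \<in> L2"
  shows "bl z (g i) = (\<Sum>l\<in>blk N i. M l i * bl y (g l)) - \<zeta> * bl y (g i)"
proof -
  have y: "y \<in> SL_domain q" and ae: "AE x in \<mu>. SL_op q y x - \<zeta> * y x = z x" using assms(1) by (auto simp: SL_shift_maps_def)
  note Y = SL_domain_facts(3,4)[OF y]
  have "bl z (g i) = bl (\<lambda>x. SL_op q y x - \<zeta> * y x) (g i)"
    by (rule bl_cong_AE[symmetric, OF L2_diff[OF Y(2) L2_cmult[OF Y(1)]] assms(2) g_L2 ae])
  also have "\<dots> = bl (SL_op q y) (g i) - \<zeta> * bl y (g i)"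
    by (subst bl_diff_left) (auto simp: Y L2_cmult g_L2 bl_cmult_left)
  finally show ?thesis by (simp add: SL_adjoint[OF y])
qed

lemma kernel_L2: "y \<in> SL_kernel_power q \<zeta> n \<Longrightarrow> y \<in> L2"
  by (cases n) (auto simp: SL_shift_maps_def dest: SL_domain_facts(3))

text \<open>By induction on the order of the root function the moments of \<open>z\<close> vanish,
  so those of \<open>y\<close> solve the homogeneous transposed block equation; far from the block
  this has the zero solution only.\<close>

lemma moments_far:
  assumes "y \<in> SL_kernel_power q \<zeta> n" "\<And>k. k \<in> blk N i \<Longrightarrow> \<not> near \<zeta> k" "k \<in> blk N i"
  shows "bl y (g k) = 0"
  using assms
proof (induction n arbitrary: y k)
  case 0
  then have "y \<in> L2" "AE x in \<mu>. y x = 0" by auto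
  then have "bl y (g k) = bl (\<lambda>x. 0) (g k)" by (intro bl_cong_AE L2_zero g_L2)
  then show ?case by (simp add: bl_def)
next
  case (Suc n)
  then obtain z where z: "z \<in> SL_kernel_power q \<zeta> n" "SL_shift_maps q \<zeta> y z" by auto
  show ?case
  proof (rule gershgorin[where E = "\<lambda>k l. B l k" and P = "blk N i"])
    show "k \<in> blk N i" by fact
    show "(\<Sum>l\<in>blk N i. cmod (B l k)) \<le> rho" if "k \<in> blk N i" for k using B_col[of k] that by (simp add: blk_eq')
    show "cmod (\<zeta> - d k) > rho" if "k \<in> blk N i" for k using Suc.prems(2)[OF that] by (simp add: near_def)
    show "d k * bl y (g k) + (\<Sum>l\<in>blk N i. B l k * bl y (g l)) = \<zeta> * bl y (g k)" if k: "k \<in> blk N i" for k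
      using moment_step[OF z(2) kernel_L2[OF z(1)], of k] Suc.IH[OF z(1) Suc.prems(2) k] M_sum[OF blk_eq'[OF k, symmetric], of "\<lambda>l. bl y (g l)"] k
      by (simp add: blk_eq')
  qed simp
qed

lemma expansion_moments:
  assumes y: "y \<in> L2" and a: "(\<lambda>n. L2_norm (\<lambda>x. (\<Sum>k\<in>ibox n. a k * g k x) - y x)) \<longlonglongrightarrow> 0"
  shows "bl y (g i) = (\<Sum>k\<in>blk N i. a k * Gm k i)"
proof -
  have L: "(\<lambda>x. \<Sum>k\<in>ibox n. a k * g k x) \<in> L2" for n by (intro L2_lincomb g_L2)
  obtain n0 where n0: "blk N i \<subseteq> ibox n0" using finite_subset_ibox[OF finite_blk] by blast
  have "(\<lambda>n. bl (\<lambda>x. \<Sum>k\<in>ibox n. a k * g k x) (g i)) \<longlonglongrightarrow> bl y (g i)"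
  proof (rule LIM_zero_cancel)
    have lim: "(\<lambda>n. L2_norm (\<lambda>x. (\<Sum>k\<in>ibox n. a k * g k x) - y x) * L2_norm (g i)) \<longlonglongrightarrow> 0"
      using tendsto_mult_right[OF a, of "L2_norm (g i)"] by simp
    show "(\<lambda>n. bl (\<lambda>x. \<Sum>k\<in>ibox n. a k * g k x) (g i) - bl y (g i)) \<longlonglongrightarrow> 0"
    proof (rule Lim_null_comparison[OF _ lim], rule always_eventually, rule allI)
      fix n
      show "norm (bl (\<lambda>x. \<Sum>k\<in>ibox n. a k * g k x) (g i) - bl y (g i)) \<le> L2_norm (\<lambda>x. (\<Sum>k\<in>ibox n. a k * g k x) - y x) * L2_norm (g i)"
        unfolding bl_diff_left[OF L y g_L2, symmetric] unfolding bl_def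
        by (rule L2_Cauchy_Schwarz[OF L2_diff[OF L y] g_L2])
    qed
  qed
  moreover have "bl (\<lambda>x. \<Sum>k\<in>ibox n. a k * g k x) (g i) = (\<Sum>k\<in>blk N i. a k * Gm k i)" if "n \<ge> n0" for n
  proof -
    have "bl (\<lambda>x. \<Sum>k\<in>ibox n. a k * g k x) (g i) = (\<Sum>k\<in>ibox n. a k * Gm k i)"
      unfolding Gm_def by (rule bl_lincomb_left) (rule g_L2)+
    also have "\<dots> = (\<Sum>k\<in>blk N i. a k * Gm k i)"
      by (rule sum.mono_neutral_right) (use n0 ibox_mono[OF that] Gm_off_block in \<open>auto simp: blk_def\<close>)
    finally show ?thesis .
  qed
  then have "\<forall>\<^sub>F n in sequentially. bl (\<lambda>x. \<Sum>k\<in>ibox n. a k * g k x) (g i) = (\<Sum>k\<in>blk N i. a k * Gm k i)"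
    by (rule eventually_sequentiallyI)
  then have "(\<lambda>n. bl (\<lambda>x. \<Sum>k\<in>ibox n. a k * g k x) (g i)) \<longlonglongrightarrow> (\<Sum>k\<in>blk N i. a k * Gm k i)" by (rule tendsto_eventually)
  ultimately show ?thesis by (rule LIMSEQ_unique)
qed

lemma comb_moments: "bl (comb P v) (g i) = (\<Sum>l\<in>P. v l * Gm l i)"
  unfolding comb_def[abs_def] Gm_def by (rule bl_lincomb_left) (rule g_L2)+

lemma AE_eq_of_moments:
  assumes "y \<in> L2" "z \<in> L2" "\<And>i. bl y (g i) = bl z (g i)"
  shows "AE x in \<mu>. y x = z x"
  using moments_complete[OF L2_diff[OF assms(1,2)]] assms by (simp add: bl_diff_left g_L2)

lemma root_none:
  assumes y: "y \<in> SL_kernel_power q \<zeta> n" and far: "\<And>k. \<not> near \<zeta> k"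
  shows "AE x in \<mu>. y x = 0"
  by (rule moments_complete[OF kernel_L2[OF y]]) (rule moments_far[OF y far blk_self])

text \<open>The expansion of \<open>y\<close> in \<open>g\<close> is truncated to the block of
  \<open>j\<close>, and the truncation is compared with \<open>y\<close> through moments. They agree
  inside the block by \<open>expansion_moments\<close>; elsewhere those of \<open>y\<close> vanish
  by \<open>moments_far\<close> and those of the truncation by \<open>Gm_off_block\<close>.\<close>

lemma root_form:
  assumes y: "y \<in> SL_kernel_power q \<zeta> n" and j: "near \<zeta> j"
  obtains v where "v \<in> BO.supp j" "AE x in \<mu>. y x = comb (blk N j) v x"
proof -
  have yL: "y \<in> L2" by (rule kernel_L2[OF y])
  obtain a where a: "(\<lambda>n. L2_norm (\<lambda>x. (\<Sum>k\<in>ibox n. a k * g k x) - y x)) \<longlonglongrightarrow> 0"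
    by (rule G.expansion[OF yL])
  define v where "v l = (if l \<in> blk N j then a l else 0)" for l
  have "AE x in \<mu>. y x = comb (blk N j) v x"
  proof (rule AE_eq_of_moments[OF yL comb_L2])
    fix i
    show "bl y (g i) = bl (comb (blk N j) v) (g i)"
    proof (cases "rel N i j")
      case True
      then have "blk N i = blk N j" by (rule blk_eq)
      then show ?thesis unfolding expansion_moments[OF yL a] comb_moments by (simp add: v_def)
    next
      case False
      have "bl y (g i) = 0"
      proof (rule moments_far[OF y _ blk_self])
        fix k assume "k \<in> blk N i"
        then have "\<not> rel N k j" using blk_disjoint[OF False] blk_self by blast
        then show "\<not> near \<zeta> k" using near_same_block j unfolding near_def by blast
      qed
      moreover have "bl (comb (blk N j) v) (g i) = 0"
        unfolding comb_moments
        by (rule sum.neutral) (use Gm_off_block blk_disjoint[OF False blk_self] rel_sym in \<open>auto simp: Gm_sym[of _ i]\<close>)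
      ultimately show ?thesis by simp
    qed
  qed
  moreover have "v \<in> BO.supp j" by (auto simp: BO.supp_def v_def)
  ultimately show thesis by (rule that[rotated])
qed

lemma comb_inj:
  assumes "v \<in> BO.supp j" "v' \<in> BO.supp j" "AE x in \<mu>. comb (blk N j) v x = comb (blk N j) v' x"
  shows "v = v'"
proof
  fix l
  have "AE x in \<mu>. comb (blk N j) (\<lambda>l. v l - v' l) x = 0"
    by (rule AE_imp1[OF assms(3)]) (simp add: comb_def left_diff_distrib sum_subtractf)
  from comb_zero[OF finite_blk this] show "v l = v' l"
    using assms(1,2) by (cases "l \<in> blk N j") (auto simp: BO.supp_def)
qed

text \<open>The function \<open>z\<close> provided by \<open>SL_kernel_power\<close> is identified
  through its moments, which \<open>moment_step\<close> computes from those of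
  \<open>y\<close>.\<close>

lemma kernel_coord:
  assumes "y \<in> SL_kernel_power q \<zeta> n" "near \<zeta> j" "v \<in> BO.supp j" "AE x in \<mu>. y x = comb (blk N j) v x"
  shows "(BO.A j \<zeta> ^^ n) v = 0"
  using assms
proof (induction n arbitrary: y v)
  case 0
  have "AE x in \<mu>. comb (blk N j) v x = comb (blk N j) (\<lambda>_. 0) x"
  proof (rule AE_imp2[OF _ "0.prems"(4)])
    show "AE x in \<mu>. y x = 0" using "0.prems"(1) by simp
  qed (simp add: comb_def)
  from comb_inj[OF "0.prems"(3) _ this] show ?case by (auto simp: BO.supp_def fun_eq_iff)
next
  case (Suc n)
  then obtain z where z: "z \<in> SL_kernel_power q \<zeta> n" "SL_shift_maps q \<zeta> y z" by auto
  have yL: "y \<in> L2" by (rule kernel_L2[OF Suc.prems(1)])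
  have my: "bl y (g l) = bl (comb (blk N j) v) (g l)" for l
    by (rule bl_cong_AE[OF yL comb_L2 g_L2 Suc.prems(4)])
  have "AE x in \<mu>. z x = comb (blk N j) (BO.A j \<zeta> v) x"
  proof (rule AE_eq_of_moments[OF kernel_L2[OF z(1)] comb_L2])
    fix i
    show "bl z (g i) = bl (comb (blk N j) (BO.A j \<zeta> v)) (g i)"
      unfolding moment_step[OF z(2) kernel_L2[OF z(1)]] moment_step[OF shift_maps_comb comb_L2] by (simp add: my)
  qed
  from Suc.IH[OF z(1) Suc.prems(2) BO.A_supp this] show ?case by (simp only: funpow_Suc_right comp_apply)
qed

lemma coord_kernel:
  "v \<in> BO.supp j \<Longrightarrow> (BO.A j \<zeta> ^^ n) v = 0 \<Longrightarrow> comb (blk N j) v \<in> SL_kernel_power q \<zeta> n"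
proof (induction n arbitrary: v)
  case 0
  then have "v = 0" by (simp only: funpow.simps id_apply)
  then show ?case by (simp add: comb_L2) (simp add: comb_def)
next
  case (Suc n)
  have "(BO.A j \<zeta> ^^ n) (BO.A j \<zeta> v) = 0" using Suc.prems(2) by (simp only: funpow_Suc_right comp_apply)
  from Suc.IH[OF BO.A_supp this] show ?case using shift_maps_comb by auto
qed

definition root :: "complex \<Rightarrow> (real \<Rightarrow> complex) set" where "root \<zeta> = (\<Union>n. SL_kernel_power q \<zeta> n)"

lemma root_coord:
  assumes y: "y \<in> root \<zeta>" and j: "near \<zeta> j"
  obtains v where "v \<in> BO.GE j \<zeta>" "AE x in \<mu>. y x = comb (blk N j) v x"
proof -
  obtain n where n: "y \<in> SL_kernel_power q \<zeta> n" using y by (auto simp: root_def)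
  obtain v where v: "v \<in> BO.supp j" "AE x in \<mu>. y x = comb (blk N j) v x" by (rule root_form[OF n j])
  have "(BO.A j \<zeta> ^^ n) v = 0" by (rule kernel_coord[OF n j v])
  then show thesis using that v unfolding BO.GE_def by blast
qed

lemma GE_root: "v \<in> BO.GE j \<zeta> \<Longrightarrow> comb (blk N j) v \<in> root \<zeta>"
  using coord_kernel unfolding BO.GE_def root_def by blast

lemma eigenspace_root: "SL_eigenspace q \<zeta> \<subseteq> root \<zeta>"
proof
  fix y assume "y \<in> SL_eigenspace q \<zeta>"
  then have "y \<in> SL_kernel_power q \<zeta> 1" by (auto simp: SL_eigenspace_def L2_zero intro!: exI[of _ "\<lambda>x. 0"])
  then show "y \<in> root \<zeta>" unfolding root_def by blast
qed

lemma eigenspace_coord: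
  assumes y: "y \<in> SL_eigenspace q \<zeta>" and j: "near \<zeta> j"
  obtains v where "v \<in> BO.supp j" "BO.A j \<zeta> v = 0" "AE x in \<mu>. y x = comb (blk N j) v x"
proof -
  have n: "y \<in> SL_kernel_power q \<zeta> 1" using y by (auto simp: SL_eigenspace_def L2_zero intro!: exI[of _ "\<lambda>x. 0"])
  obtain v where v: "v \<in> BO.supp j" "AE x in \<mu>. y x = comb (blk N j) v x" by (rule root_form[OF n j])
  have "(BO.A j \<zeta> ^^ 1) v = 0" by (rule kernel_coord[OF n j v])
  then show thesis using that v by simp
qed

lemma coord_eigenspace:
  assumes "v \<in> BO.supp j" "BO.A j \<zeta> v = 0"
  shows "comb (blk N j) v \<in> SL_eigenspace q \<zeta>"
proof -
  have "comb (blk N j) (BO.A j \<zeta> v) = (\<lambda>x. 0)" unfolding assms(2) by (simp add: comb_def fun_eq_iff)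
  then show ?thesis using shift_maps_comb[of \<zeta> j v] by (simp add: SL_eigenspace_def)
qed

lemma eigenvalue_near:
  assumes "SL_eigenvalue q \<zeta>" obtains j where "near \<zeta> j"
proof -
  obtain y where y: "y \<in> SL_eigenspace q \<zeta>" "\<not> (AE x in \<mu>. y x = 0)" using assms by (auto simp: SL_eigenvalue_def)
  then obtain n where "y \<in> SL_kernel_power q \<zeta> n" using eigenspace_root by (auto simp: root_def)
  then show thesis using root_none y(2) that by blast
qed

lemma eigenvalue_iff_GE:
  assumes j: "near \<zeta> j"
  shows "SL_eigenvalue q \<zeta> \<longleftrightarrow> \<not> BO.GE j \<zeta> \<subseteq> {0}"
proof
  assume "SL_eigenvalue q \<zeta>"
  then obtain y where y: "y \<in> SL_eigenspace q \<zeta>" "\<not> (AE x in \<mu>. y x = 0)" by (auto simp: SL_eigenvalue_def)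
  obtain v where v: "v \<in> BO.GE j \<zeta>" "AE x in \<mu>. y x = comb (blk N j) v x"
    using root_coord[OF _ j] y(1) eigenspace_root by blast
  have "v \<noteq> 0"
  proof
    assume "v = 0"
    then have "AE x in \<mu>. y x = 0" using v(2) by (simp add: comb_def)
    then show False using y(2) by simp
  qed
  then show "\<not> BO.GE j \<zeta> \<subseteq> {0}" using v(1) by blast
next
  assume "\<not> BO.GE j \<zeta> \<subseteq> {0}"
  then obtain v n where v: "v \<in> BO.supp j" "(BO.A j \<zeta> ^^ n) v = 0" "v \<noteq> 0" by (auto simp: BO.GE_def)
  \<comment> \<open>The last nonzero iterate of \<open>v\<close> is an eigenvector.\<close>
  define m where "m = (LEAST n. (BO.A j \<zeta> ^^ n) v = 0)"
  have m: "(BO.A j \<zeta> ^^ m) v = 0" unfolding m_def by (rule LeastI[of _ n]) (rule v(2))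
  have "m \<noteq> 0" using m v(3) by (metis funpow_0)
  then obtain k where k: "m = Suc k" using not0_implies_Suc by blast
  define u where "u = (BO.A j \<zeta> ^^ k) v"
  have u0: "u \<noteq> 0" unfolding u_def using not_less_Least[of k "\<lambda>n. (BO.A j \<zeta> ^^ n) v = 0"] k by (simp add: m_def)
  have us: "u \<in> BO.supp j" unfolding u_def by (rule BO.An_supp[OF v(1)])
  have Au: "BO.A j \<zeta> u = 0" using m unfolding k u_def by (simp only: funpow.simps comp_apply)
  have "\<not> (AE x in \<mu>. comb (blk N j) u x = 0)"
  proof
    assume "AE x in \<mu>. comb (blk N j) u x = 0"
    then have "AE x in \<mu>. comb (blk N j) u x = comb (blk N j) 0 x" by (simp add: comb_def)
    then have "u = 0" by (rule comb_inj[OF us, rotated]) (simp add: BO.supp_def)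
    then show False using u0 by simp
  qed
  then show "SL_eigenvalue q \<zeta>" unfolding SL_eigenvalue_def using coord_eigenspace[OF us Au] by blast
qed

end

section \<open>Dimensions and the normal system\<close>

lemma L2_dim_ge: "(\<And>i. i < n \<Longrightarrow> f i \<in> V) \<Longrightarrow> L2_independent n f \<Longrightarrow> enat n \<le> L2_dim V"
  unfolding L2_dim_def by (rule Sup_upper) blast

lemma L2_dim_mono: "V \<subseteq> W \<Longrightarrow> L2_dim V \<le> L2_dim W"
  unfolding L2_dim_def by (rule Sup_subset_mono) blast

lemma L2_independent_1: "\<not> (AE x in \<mu>. y x = 0) \<Longrightarrow> L2_independent 1 (\<lambda>_. y)"
  unfolding L2_independent_def by (auto elim!: AE_imp1)

text \<open>Adding \<open>y\<close> to the \<open>n\<close> independent functions exceeds the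
  dimension, and in the resulting relation the coefficient of \<open>y\<close> cannot
  vanish.\<close>

lemma L2_dim_span:
  assumes dim: "L2_dim V = enat n" and f: "\<And>i. i < n \<Longrightarrow> f i \<in> V" and ind: "L2_independent n f" and y: "y \<in> V"
  obtains a where "AE x in \<mu>. y x = (\<Sum>i<n. a i * f i x)"
proof -
  define h where "h = f(n := y)"
  have "h i \<in> V" if "i < Suc n" for i using f y that by (auto simp: h_def less_Suc_eq)
  then have "\<not> L2_independent (Suc n) h" using L2_dim_ge[of "Suc n" h V] dim by auto
  then obtain c i where c: "AE x in \<mu>. (\<Sum>i<Suc n. c i * h i x) = 0" "i < Suc n" "c i \<noteq> 0"
    unfolding L2_independent_def by blast
  have hs: "(\<Sum>i<Suc n. c i * h i x) = (\<Sum>i<n. c i * f i x) + c n * y x" for x by (simp add: h_def)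
  have cn: "c n \<noteq> 0"
  proof
    assume z: "c n = 0"
    then have "AE x in \<mu>. (\<Sum>i<n. c i * f i x) = 0" using c(1) unfolding hs by simp
    then have "\<forall>i<n. c i = 0" using ind unfolding L2_independent_def by blast
    then show False using c(2,3) z by (auto simp: less_Suc_eq)
  qed
  show thesis
  proof (rule that[of "\<lambda>i. - c i / c n"], rule AE_imp1[OF c(1)])
    fix x assume "(\<Sum>i<Suc n. c i * h i x) = 0"
    then have "c n * y x = - (\<Sum>i<n. c i * f i x)" unfolding hs by (simp add: eq_neg_iff_add_eq_0 add.commute)
    then have "y x = - (\<Sum>i<n. c i * f i x) / c n" using cn by (simp add: field_simps)
    then show "y x = (\<Sum>i<n. - c i / c n * f i x)" by (simp add: sum_negf sum_divide_distrib)
  qed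
qed

lemma bl_relation:
  assumes "f \<in> L2" "h \<in> L2" "g \<in> L2" "AE x in \<mu>. a * f x + b * h x = 0"
  shows "a * bl f g + b * bl h g = 0"
proof -
  have "bl (\<lambda>x. a * f x + b * h x) g = (LINT x|\<mu>. a * (f x * g x) + b * (h x * g x))"
    unfolding bl_def by (simp add: algebra_simps)
  also have "\<dots> = a * bl f g + b * bl h g" unfolding bl_def using assms by (simp add: L2_integrable_mult)
  also have "bl (\<lambda>x. a * f x + b * h x) g = bl (\<lambda>x. 0) g"
    by (rule bl_cong_AE[OF _ L2_zero assms(3,4)]) (intro L2_add L2_cmult assms)
  finally show ?thesis by (simp add: bl_def)
qed

context sl_family
begin

lemma SL_alg_mult_root: "SL_alg_mult q \<zeta> = L2_dim (root \<zeta>)"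
  by (simp add: SL_alg_mult_def root_def)

lemma root_L2: "y \<in> root \<zeta> \<Longrightarrow> y \<in> L2"
  using kernel_L2 by (auto simp: root_def)

text \<open>The three clauses of \<open>SL_normal_system\<close> exhaust the possibilities, since
  the geometric multiplicity lies between \<open>1\<close> and the algebraic one, which is at most
  \<open>2\<close>.\<close>

lemma normal_system_basis:
  assumes ev: "SL_eigenvalue q \<zeta>" and le2: "SL_alg_mult q \<zeta> \<le> 2" and u: "SL_normal_system q u"
  obtains m where "SL_alg_mult q \<zeta> = enat m" "m \<ge> 1" "\<And>i. i < m \<Longrightarrow> u (\<zeta>, i) \<in> root \<zeta>"
    "L2_independent m (\<lambda>i. u (\<zeta>, i))" "m = 1 \<Longrightarrow> u (\<zeta>, 0) \<in> SL_eigenspace q \<zeta> \<and> L2_norm (u (\<zeta>, 0)) = 1"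
proof -
  note U = u[unfolded SL_normal_system_def, rule_format, OF ev]
  obtain y where y: "y \<in> SL_eigenspace q \<zeta>" "\<not> (AE x in \<mu>. y x = 0)" using ev by (auto simp: SL_eigenvalue_def)
  have g1: "SL_geom_mult q \<zeta> \<ge> 1"
    unfolding SL_geom_mult_def using L2_dim_ge[of 1 "\<lambda>_. y", OF _ L2_independent_1[OF y(2)]] y(1) by (simp add: one_enat_def)
  have ga: "SL_geom_mult q \<zeta> \<le> SL_alg_mult q \<zeta>"
    unfolding SL_geom_mult_def SL_alg_mult_root by (rule L2_dim_mono[OF eigenspace_root])
  obtain m where m: "SL_alg_mult q \<zeta> = enat m" using le2 by (cases "SL_alg_mult q \<zeta>") auto
  have "1 \<le> enat m" using order.trans[OF g1 ga] m by simp
  then have m12: "m = 1 \<or> m = 2" using le2 m by (auto simp: one_enat_def numeral_eq_enat)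
  have nz: "\<not> (AE x in \<mu>. f x = 0)" if "f \<in> L2" "L2_norm f = 1" for f using L2_norm_eq_0_iff[OF that(1)] that(2) by simp
  have eL2: "f \<in> L2" if "f \<in> SL_eigenspace q \<zeta>" for f using that eigenspace_root root_L2 by blast
  show thesis
  proof (cases "m = 1")
    case True
    then have a1: "SL_alg_mult q \<zeta> = 1" using m by (simp add: one_enat_def)
    have u0: "u (\<zeta>, 0) \<in> SL_eigenspace q \<zeta>" "L2_norm (u (\<zeta>, 0)) = 1" using U a1 by auto
    have "L2_independent 1 (\<lambda>i. u (\<zeta>, i))"
      using L2_independent_1[OF nz[OF eL2[OF u0(1)] u0(2)]] by (simp add: L2_independent_def)
    then show thesis using that[of m] m True u0 eigenspace_root by auto
  next
    case False
    then have m2: "m = 2" using m12 by simp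
    then have a2: "SL_alg_mult q \<zeta> = 2" using m by (simp add: numeral_eq_enat)
    obtain k where k: "SL_geom_mult q \<zeta> = enat k" "k = 1 \<or> k = 2" using g1 ga a2
    proof (cases "SL_geom_mult q \<zeta>")
      case (enat k)
      then have "1 \<le> k" "k \<le> 2" using g1 ga a2 by (auto simp: one_enat_def numeral_eq_enat)
      then show thesis using that[of k] enat by force
    qed (use ga a2 in simp)
    have two: "L2_independent 2 (\<lambda>i. u (\<zeta>, i))"
      if "\<And>a b. AE x in \<mu>. a * u (\<zeta>, 0) x + b * u (\<zeta>, 1) x = 0 \<Longrightarrow> a = 0 \<and> b = 0"
      unfolding L2_independent_def
    proof (intro allI impI)
      fix c i assume c: "AE x in \<mu>. (\<Sum>i<2. c i * u (\<zeta>, i) x) = 0" and i: "i < (2::nat)"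
      have "(\<Sum>i<2. c i * u (\<zeta>, i) x) = c 0 * u (\<zeta>, 0) x + c 1 * u (\<zeta>, 1) x" for x by (simp add: numeral_2_eq_2)
      with c that[of "c 0" "c 1"] have "c 0 = 0" "c 1 = 0" by auto
      then show "c i = 0" using i by (cases i) (auto simp: less_Suc_eq numeral_2_eq_2)
    qed
    show thesis
    proof (cases "k = 2")
      case True
      then have "SL_geom_mult q \<zeta> = 2" using k by (simp add: numeral_eq_enat)
      then have e: "u (\<zeta>, 0) \<in> SL_eigenspace q \<zeta>" "L2_norm (u (\<zeta>, 0)) = 1" "u (\<zeta>, 1) \<in> SL_eigenspace q \<zeta>"
        "L2_norm (u (\<zeta>, 1)) = 1" "L2_inner (u (\<zeta>, 0)) (u (\<zeta>, 1)) = 0" using U by auto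
      note L = eL2[OF e(1)] eL2[OF e(3)]
      have "a = 0 \<and> b = 0" if ab: "AE x in \<mu>. a * u (\<zeta>, 0) x + b * u (\<zeta>, 1) x = 0" for a b
      proof -
        have in0: "a * L2_inner (u (\<zeta>, 0)) h + b * L2_inner (u (\<zeta>, 1)) h = 0" if h: "h \<in> L2" for h
          using bl_relation[OF L L2_cnj[OF h] ab] by (simp add: L2_inner_def bl_def)
        have i0: "L2_inner (u (\<zeta>, 0)) (u (\<zeta>, 0)) = 1" and i1: "L2_inner (u (\<zeta>, 1)) (u (\<zeta>, 1)) = 1"
          using L2_norm_square_inner[of "u (\<zeta>, 0)"] L2_norm_square_inner[of "u (\<zeta>, 1)"] e by simp_all
        have i10: "L2_inner (u (\<zeta>, 1)) (u (\<zeta>, 0)) = 0" using L2_inner_cnj[of "u (\<zeta>, 1)" "u (\<zeta>, 0)"] e(5) by simp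
        show ?thesis using in0[OF L(1)] in0[OF L(2)] i0 i1 i10 e(5) by simp
      qed
      then have "L2_independent 2 (\<lambda>i. u (\<zeta>, i))" by (rule two)
      moreover have "u (\<zeta>, i) \<in> root \<zeta>" if "i < 2" for i
        using that e(1,3) eigenspace_root by (cases i) (auto simp: less_Suc_eq numeral_2_eq_2)
      ultimately show thesis using that[of m] m m2 by auto
    next
      case False
      then have "SL_geom_mult q \<zeta> = 1" using k by (simp add: one_enat_def)
      then have e: "u (\<zeta>, 0) \<in> SL_eigenspace q \<zeta>" "L2_norm (u (\<zeta>, 0)) = 1" "SL_shift_maps q \<zeta> (u (\<zeta>, 1)) (u (\<zeta>, 0))"
        using U a2 by auto
      have k0: "u (\<zeta>, 0) \<in> SL_kernel_power q \<zeta> 1" using e(1) by (auto simp: SL_eigenspace_def L2_zero intro!: exI[of _ "\<lambda>x. 0"])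
      then have k1: "u (\<zeta>, 1) \<in> SL_kernel_power q \<zeta> (Suc 1)" using e(3) by auto
      note L = kernel_L2[OF k0] kernel_L2[OF k1]
      have s0: "SL_shift_maps q \<zeta> (u (\<zeta>, 0)) (\<lambda>x. 0)" using e(1) by (simp add: SL_eigenspace_def)
      have "a = 0 \<and> b = 0" if ab: "AE x in \<mu>. a * u (\<zeta>, 0) x + b * u (\<zeta>, 1) x = 0" for a b
      proof -
        have mm: "a * bl (u (\<zeta>, 0)) (g i) + b * bl (u (\<zeta>, 1)) (g i) = 0" for i
          by (rule bl_relation[OF L g_L2 ab])
        obtain i where i: "bl (u (\<zeta>, 0)) (g i) \<noteq> 0" using moments_complete[OF L(1)] nz[OF L(1) e(2)] by blast
        have m0: "(\<Sum>l\<in>blk N i. M l i * bl (u (\<zeta>, 0)) (g l)) - \<zeta> * bl (u (\<zeta>, 0)) (g i) = 0"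
          using moment_step[OF s0 L2_zero, of i] by (simp add: bl_def)
        have m1: "(\<Sum>l\<in>blk N i. M l i * bl (u (\<zeta>, 1)) (g l)) - \<zeta> * bl (u (\<zeta>, 1)) (g i) = bl (u (\<zeta>, 0)) (g i)"
          using moment_step[OF e(3) L(1), of i] by simp
        \<comment> \<open>Applying the operator minus \<open>\<zeta>\<close> to the relation kills
          the eigenfunction and turns the associated function into the eigenfunction, so
          \<open>b\<close> must vanish; this is carried out on the moments.\<close>
        have "b * bl (u (\<zeta>, 0)) (g i) = a * ((\<Sum>l\<in>blk N i. M l i * bl (u (\<zeta>, 0)) (g l)) - \<zeta> * bl (u (\<zeta>, 0)) (g i))
            + b * ((\<Sum>l\<in>blk N i. M l i * bl (u (\<zeta>, 1)) (g l)) - \<zeta> * bl (u (\<zeta>, 1)) (g i))"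
          by (simp only: m0 m1) simp
        also have "\<dots> = (\<Sum>l\<in>blk N i. M l i * (a * bl (u (\<zeta>, 0)) (g l) + b * bl (u (\<zeta>, 1)) (g l)))
            - \<zeta> * (a * bl (u (\<zeta>, 0)) (g i) + b * bl (u (\<zeta>, 1)) (g i))"
          by (simp add: algebra_simps sum.distrib sum_distrib_left)
        also have "\<dots> = 0" by (simp only: mm mult_zero_right sum.neutral_const diff_zero)
        finally have "b = 0" using i by simp
        then show ?thesis using mm[of i] i by simp
      qed
      then have "L2_independent 2 (\<lambda>i. u (\<zeta>, i))" by (rule two)
      moreover have "u (\<zeta>, i) \<in> root \<zeta>" if "i < 2" for i
      proof -
        from that have "i = 0 \<or> i = 1" by auto
        then show ?thesis unfolding root_def using k0 k1 by blast
      qed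
      ultimately show thesis using that[of m] m m2 by auto
    qed
  qed
qed

end

locale sl_normal = sl_family +
  fixes u :: "complex \<times> nat \<Rightarrow> real \<Rightarrow> complex"
  assumes alg2: "SL_eigenvalue q \<zeta> \<Longrightarrow> SL_alg_mult q \<zeta> \<le> 2" and u: "SL_normal_system q u"
begin

definition mlt :: "complex \<Rightarrow> nat" where "mlt \<zeta> = the_enat (SL_alg_mult q \<zeta>)"

lemma mlt:
  assumes ev: "SL_eigenvalue q \<zeta>"
  shows "SL_alg_mult q \<zeta> = enat (mlt \<zeta>)" "mlt \<zeta> \<ge> 1" "i < mlt \<zeta> \<Longrightarrow> u (\<zeta>, i) \<in> root \<zeta>"
    "L2_independent (mlt \<zeta>) (\<lambda>i. u (\<zeta>, i))" "mlt \<zeta> = 1 \<Longrightarrow> u (\<zeta>, 0) \<in> SL_eigenspace q \<zeta> \<and> L2_norm (u (\<zeta>, 0)) = 1"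
proof -
  obtain m where m: "SL_alg_mult q \<zeta> = enat m" "m \<ge> 1" "\<And>i. i < m \<Longrightarrow> u (\<zeta>, i) \<in> root \<zeta>"
    "L2_independent m (\<lambda>i. u (\<zeta>, i))" "m = 1 \<Longrightarrow> u (\<zeta>, 0) \<in> SL_eigenspace q \<zeta> \<and> L2_norm (u (\<zeta>, 0)) = 1"
    using normal_system_basis[OF ev alg2[OF ev] u] by metis
  have "mlt \<zeta> = m" using m(1) by (simp add: mlt_def)
  then show "SL_alg_mult q \<zeta> = enat (mlt \<zeta>)" "mlt \<zeta> \<ge> 1" "i < mlt \<zeta> \<Longrightarrow> u (\<zeta>, i) \<in> root \<zeta>"
    "L2_independent (mlt \<zeta>) (\<lambda>i. u (\<zeta>, i))" "mlt \<zeta> = 1 \<Longrightarrow> u (\<zeta>, 0) \<in> SL_eigenspace q \<zeta> \<and> L2_norm (u (\<zeta>, 0)) = 1"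
    using m by auto
qed

definition E :: "int \<Rightarrow> complex set" where "E j = {\<zeta>. SL_eigenvalue q \<zeta> \<and> (\<exists>k\<in>blk N j. near \<zeta> k)}"
definition J :: "int \<Rightarrow> (complex \<times> nat) set" where "J j = {(\<zeta>, i). \<zeta> \<in> E j \<and> i < mlt \<zeta>}"
text \<open>Coordinates with respect to \<open>g\<close> in the block of \<open>j\<close>; by
  \<open>comb_inj\<close> there is only one candidate for the choice.\<close>

definition cv :: "int \<Rightarrow> complex \<times> nat \<Rightarrow> int \<Rightarrow> complex"
  where "cv j p = (SOME v. v \<in> BO.GE j (fst p) \<and> (AE x in \<mu>. u p x = comb (blk N j) v x))"

lemma J_cong: "rel N i j \<Longrightarrow> J i = J j" and cv_cong: "rel N i j \<Longrightarrow> cv i = cv j"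
  by (simp_all add: J_def E_def cv_def[abs_def] blk_eq)

lemma root_coord_E:
  assumes y: "y \<in> root \<zeta>" and \<zeta>: "\<zeta> \<in> E j"
  shows "\<exists>v. v \<in> BO.GE j \<zeta> \<and> (AE x in \<mu>. y x = comb (blk N j) v x)"
proof -
  obtain k where k: "k \<in> blk N j" "near \<zeta> k" using \<zeta> by (auto simp: E_def)
  show ?thesis using root_coord[OF y k(2)] unfolding blk_eq'[OF k(1)] by blast
qed

lemma cv:
  assumes "(\<zeta>, i) \<in> J j"
  shows "cv j (\<zeta>, i) \<in> BO.GE j \<zeta>" "AE x in \<mu>. u (\<zeta>, i) x = comb (blk N j) (cv j (\<zeta>, i)) x"
proof -
  have \<zeta>: "\<zeta> \<in> E j" "SL_eigenvalue q \<zeta>" "i < mlt \<zeta>" using assms by (auto simp: J_def E_def)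
  from someI_ex[OF root_coord_E[OF mlt(3)[OF \<zeta>(2,3)] \<zeta>(1)]]
  show "cv j (\<zeta>, i) \<in> BO.GE j \<zeta>" "AE x in \<mu>. u (\<zeta>, i) x = comb (blk N j) (cv j (\<zeta>, i)) x"
    unfolding cv_def by auto
qed

lemma cv_supp: "p \<in> J j \<Longrightarrow> cv j p \<in> BO.supp j"
  using cv(1)[of "fst p" "snd p" j] by (simp add: BO.GE_def)

lemma sum_u:
  assumes F: "finite F" "F \<subseteq> J j"
  shows "AE x in \<mu>. (\<Sum>p\<in>F. a p * u p x) = comb (blk N j) (\<lambda>l. \<Sum>p\<in>F. a p * cv j p l) x"
proof -
  have "AE x in \<mu>. \<forall>p\<in>F. u p x = comb (blk N j) (cv j p) x"
    by (rule eventually_ball_finite[OF F(1)]) (use cv(2) F(2) in force)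
  then show ?thesis
  proof (rule AE_imp1)
    fix x assume h: "\<forall>p\<in>F. u p x = comb (blk N j) (cv j p) x"
    have "(\<Sum>p\<in>F. a p * u p x) = (\<Sum>p\<in>F. \<Sum>l\<in>blk N j. a p * cv j p l * g l x)"
      by (rule sum.cong) (use h in \<open>auto simp: comb_def sum_distrib_left mult.assoc\<close>)
    also have "\<dots> = comb (blk N j) (\<lambda>l. \<Sum>p\<in>F. a p * cv j p l) x"
      by (subst sum.swap) (simp add: comb_def sum_distrib_right)
    finally show "(\<Sum>p\<in>F. a p * u p x) = comb (blk N j) (\<lambda>l. \<Sum>p\<in>F. a p * cv j p l) x" .
  qed
qed

text \<open>Either \<open>\<zeta>\<close> is near the block but no eigenvalue, or it is far from the
  block and Gershgorin's argument, this time with row sums, makes the shifted block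
  injective.\<close>

lemma far_GE:
  assumes "\<zeta> \<notin> E j" shows "BO.GE j \<zeta> \<subseteq> {0}"
proof (cases "\<exists>k\<in>blk N j. near \<zeta> k")
  case True
  then obtain k where k: "k \<in> blk N j" "near \<zeta> k" by blast
  then have "\<not> SL_eigenvalue q \<zeta>" using assms by (auto simp: E_def)
  then show ?thesis using eigenvalue_iff_GE[OF k(2)] by (simp add: blk_eq'[OF k(1)])
next
  case False
  have inj: "v = 0" if v: "v \<in> BO.supp j" "BO.A j \<zeta> v = 0" for v
  proof
    fix k
    show "v k = 0 k"
    proof (cases "k \<in> blk N j")
      case True
      have "v k = 0"
      proof (rule gershgorin[where E = B and P = "blk N j" and \<zeta> = \<zeta>])
        show "(\<Sum>l\<in>blk N j. cmod (B k l)) \<le> rho" if "k \<in> blk N j" for k using B_row[of k] that by (simp add: blk_eq')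
        show "cmod (\<zeta> - d k) > rho" if "k \<in> blk N j" for k using False that by (auto simp: near_def)
        show "d k * v k + (\<Sum>l\<in>blk N j. B k l * v l) = \<zeta> * v k" if k: "k \<in> blk N j" for k
          using fun_cong[OF v(2), of k] M_row_sum[OF k finite_blk, of v] k by (simp add: BO.A_def)
      qed (use True in auto)
      then show ?thesis by simp
    qed (use v(1) in \<open>simp add: BO.supp_def\<close>)
  qed
  have "v = 0" if v: "v \<in> BO.supp j" "(BO.A j \<zeta> ^^ n) v = 0" for v n
    using v
  proof (induction n)
    case 0 then show ?case by (simp only: funpow.simps id_apply)
  next
    case (Suc n)
    then show ?case using inj[OF BO.An_supp[OF v(1), of n \<zeta>]] by (simp only: funpow.simps comp_apply)
  qed
  then show ?thesis unfolding BO.GE_def by blast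
qed

text \<open>The equality of cardinalities is what allows the indices of the normal system to be
  matched with the integers of the block.\<close>

lemma block_basis:
  shows "finite (J j)" "card (J j) = card (blk N j)"
    "\<And>a p. (\<Sum>i\<in>J j. (\<lambda>x. a i * cv j i x)) = 0 \<Longrightarrow> p \<in> J j \<Longrightarrow> a p = 0"
    "\<And>v. v \<in> BO.supp j \<Longrightarrow> \<exists>a. v = (\<lambda>x. \<Sum>i\<in>J j. a i * cv j i x)"
proof -
  have inJ: "(\<lambda>i. (\<zeta>, i)) ` {..<mlt \<zeta>} \<subseteq> J j" if "\<zeta> \<in> E j" for \<zeta> using that by (auto simp: J_def)
  have su: "AE x in \<mu>. (\<Sum>i<mlt \<zeta>. a i * u (\<zeta>, i) x) = comb (blk N j) (\<lambda>l. \<Sum>i<mlt \<zeta>. a i * cv j (\<zeta>, i) l) x"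
    if "\<zeta> \<in> E j" for \<zeta> a
    using sum_u[OF _ inJ[OF that], of "\<lambda>p. a (snd p)"] by (simp add: sum.reindex inj_on_def)
  have ind: "a i = 0" if \<zeta>: "\<zeta> \<in> E j" and z: "(\<Sum>i<mlt \<zeta>. (\<lambda>x. a i * cv j (\<zeta>, i) x)) = 0" and i: "i < mlt \<zeta>" for \<zeta> a i
  proof -
    have ev: "SL_eigenvalue q \<zeta>" using \<zeta> by (simp add: E_def)
    have z': "(\<Sum>i<mlt \<zeta>. a i * cv j (\<zeta>, i) l) = 0" for l
      using fun_cong[OF z, of l] unfolding BO.sum_scale_apply by simp
    have "AE x in \<mu>. (\<Sum>i<mlt \<zeta>. a i * u (\<zeta>, i) x) = 0"
      by (rule AE_imp1[OF su[OF \<zeta>, of a]]) (simp add: z' comb_def)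
    then show ?thesis using mlt(4)[OF ev] i unfolding L2_independent_def by blast
  qed
  have sp: "\<exists>a. v = (\<Sum>i<mlt \<zeta>. (\<lambda>x. a i * cv j (\<zeta>, i) x))" if \<zeta>: "\<zeta> \<in> E j" and v: "v \<in> BO.GE j \<zeta>" for \<zeta> v
  proof -
    have ev: "SL_eigenvalue q \<zeta>" using \<zeta> by (simp add: E_def)
    have "L2_dim (root \<zeta>) = enat (mlt \<zeta>)" using mlt(1)[OF ev] by (simp add: SL_alg_mult_root)
    from L2_dim_span[OF this mlt(3)[OF ev] mlt(4)[OF ev] GE_root[OF v]]
    obtain a where a: "AE x in \<mu>. comb (blk N j) v x = (\<Sum>i<mlt \<zeta>. a i * u (\<zeta>, i) x)" by blast
    have "AE x in \<mu>. comb (blk N j) v x = comb (blk N j) (\<lambda>l. \<Sum>i<mlt \<zeta>. a i * cv j (\<zeta>, i) l) x"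
      by (rule AE_imp2[OF a su[OF \<zeta>, of a]]) simp
    then have "v = (\<lambda>l. \<Sum>i<mlt \<zeta>. a i * cv j (\<zeta>, i) l)"
    proof (rule comb_inj[rotated 2])
      show "v \<in> BO.supp j" using v by (simp add: BO.GE_def)
      show "(\<lambda>l. \<Sum>i<mlt \<zeta>. a i * cv j (\<zeta>, i) l) \<in> BO.supp j"
        using cv_supp inJ[OF \<zeta>] unfolding BO.supp_def by (auto intro!: sum.neutral)
    qed
    then show ?thesis unfolding BO.sum_scale_apply by blast
  qed
  have c: "cv j (\<zeta>, i) \<in> BO.GE j \<zeta>" if "\<zeta> \<in> E j" "i < mlt \<zeta>" for \<zeta> i
    by (rule cv(1)) (use that in \<open>simp add: J_def\<close>)
  note gb = BO.generalized_eigenbasis[of "J j" "E j" mlt "cv j" j, OF J_def[of j]]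
  show "finite (J j)"
    by (rule gb(1)) (fact c, fact ind, fact sp, fact far_GE)
  show "card (J j) = card (blk N j)"
    by (rule gb(2)) (fact c, fact ind, fact sp, fact far_GE)
  show "a p = 0" if "(\<Sum>i\<in>J j. (\<lambda>x. a i * cv j i x)) = 0" "p \<in> J j" for a p
    by (rule gb(3)[where a = a]) (fact c, fact ind, fact sp, fact far_GE, fact+)
  show "\<exists>a. v = (\<lambda>x. \<Sum>i\<in>J j. a i * cv j i x)" if "v \<in> BO.supp j" for v
    by (rule gb(4)) (fact c, fact ind, fact sp, fact far_GE, fact)
qed

lemma J_index: "p \<in> J j \<Longrightarrow> p \<in> SL_index q"
  using mlt(1) by (auto simp: J_def E_def SL_index_def)

lemma index_J:
  assumes "p \<in> SL_index q" obtains j where "near (fst p) j" "p \<in> J j"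
proof -
  obtain \<zeta> i where p: "p = (\<zeta>, i)" "SL_eigenvalue q \<zeta>" "enat i < SL_alg_mult q \<zeta>" using assms by (auto simp: SL_index_def)
  obtain j where j: "near \<zeta> j" by (rule eigenvalue_near[OF p(2)])
  then have "p \<in> J j" using p mlt(1)[OF p(2)] blk_self by (auto simp: J_def E_def)
  then show thesis using that j p(1) by simp
qed

lemma J_near: "p \<in> J j \<Longrightarrow> near (fst p) k \<Longrightarrow> rel N k j"
  unfolding J_def E_def using near_same_block rel_trans by (auto simp: near_def blk_def) blast

text \<open>The choice depends on the block only, not on its representative \<open>j\<close>.\<close>

definition hb :: "int set \<Rightarrow> complex \<times> nat \<Rightarrow> int"
  where "hb Q = (SOME h. \<forall>j. blk N j = Q \<longrightarrow> bij_betw h (J j) Q)"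

lemma hb: "bij_betw (hb (blk N j)) (J j) (blk N j)"
proof -
  obtain h where h: "bij_betw h (J j) (blk N j)"
    using bij_betw_iff_card[OF block_basis(1) finite_blk] block_basis(2) by blast
  have "\<exists>h. \<forall>i. blk N i = blk N j \<longrightarrow> bij_betw h (J i) (blk N j)"
  proof (intro exI allI impI)
    fix i assume "blk N i = blk N j"
    then have "J i = J j" by (simp add: J_def E_def)
    then show "bij_betw h (J i) (blk N j)" using h by simp
  qed
  from someI_ex[OF this] show ?thesis unfolding hb_def[symmetric] by blast
qed

text \<open>A bijection from the index set to the integers that maps the indices belonging to a
  block onto that block. All discs containing \<open>fst p\<close> belong to one block, so the
  choice of \<open>k\<close> is immaterial.\<close>

definition \<sigma> :: "complex \<times> nat \<Rightarrow> int"
  where "\<sigma> p = hb (blk N (SOME k. near (fst p) k)) p"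

lemma \<sigma>_J: "p \<in> J j \<Longrightarrow> \<sigma> p = hb (blk N j) p"
proof -
  assume p: "p \<in> J j"
  then obtain k where "near (fst p) k" by (auto simp: J_def E_def)
  then have "near (fst p) (SOME k. near (fst p) k)" by (rule someI)
  from blk_eq[OF J_near[OF p this]] show ?thesis by (simp add: \<sigma>_def)
qed

lemma \<sigma>_bij_J: "bij_betw \<sigma> (J j) (blk N j)"
  using bij_betw_cong[of "J j" \<sigma> "hb (blk N j)" "blk N j"] \<sigma>_J hb by blast

lemma \<sigma>_bij: "bij_betw \<sigma> (SL_index q) UNIV"
  unfolding bij_betw_def
proof
  show "inj_on \<sigma> (SL_index q)"
  proof (rule inj_onI)
    fix p p' assume p: "p \<in> SL_index q" "p' \<in> SL_index q" "\<sigma> p = \<sigma> p'"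
    obtain j where j: "p \<in> J j" using index_J[OF p(1)] by blast
    obtain j' where j': "p' \<in> J j'" using index_J[OF p(2)] by blast
    have "\<sigma> p \<in> blk N j" "\<sigma> p' \<in> blk N j'" using \<sigma>_bij_J j j' by (auto simp: bij_betw_def)
    then have "rel N j j'" using p(3) rel_sym rel_trans unfolding blk_def mem_Collect_eq by metis
    then have "p \<in> J j'" using j J_cong by simp
    then show "p = p'" using \<sigma>_bij_J[of j'] j' p(3) by (auto simp: bij_betw_def inj_on_def)
  qed
  show "\<sigma> ` SL_index q = UNIV"
  proof -
    have "k \<in> \<sigma> ` SL_index q" for k
    proof -
      have "k \<in> \<sigma> ` J k" using \<sigma>_bij_J[of k] by (simp add: bij_betw_def)
      then show ?thesis using J_index by blast
    qed
    then show ?thesis by blast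
  qed
qed

definition \<tau> :: "int \<Rightarrow> complex \<times> nat" where "\<tau> = inv_into (SL_index q) \<sigma>"

lemma \<tau>: "\<sigma> (\<tau> k) = k" "\<tau> k \<in> SL_index q" "p \<in> SL_index q \<Longrightarrow> \<tau> (\<sigma> p) = p"
  unfolding \<tau>_def using \<sigma>_bij
  by (auto simp: bij_betw_def f_inv_into_f inv_into_into)

lemma \<tau>_J: "\<tau> k \<in> J k"
proof -
  obtain j where j: "\<tau> k \<in> J j" using index_J[OF \<tau>(2)] by blast
  then have "\<sigma> (\<tau> k) \<in> blk N j" using \<sigma>_bij_J[of j] unfolding bij_betw_def by blast
  then have "k \<in> blk N j" by (simp only: \<tau>(1))
  then show ?thesis using j J_cong[of k j] by (simp add: blk_def)
qed

lemma \<tau>_bij_J: "bij_betw \<tau> (blk N j) (J j)"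
proof (rule bij_betw_byWitness[of _ \<sigma>])
  show "\<tau> ` blk N j \<subseteq> J j"
  proof (rule image_subsetI)
    fix k assume "k \<in> blk N j"
    then have "J k = J j" by (intro J_cong) (simp add: blk_def)
    then show "\<tau> k \<in> J j" using \<tau>_J[of k] by simp
  qed
qed (use \<tau>(1,3) J_index \<sigma>_bij_J[of j] in \<open>auto simp: bij_betw_def\<close>)

text \<open>\<open>W\<close> is the matrix of the normal system with respect to \<^term>\<open>g\<close>, and \<open>W'\<close> is its blockwise inverse.\<close>

definition W :: "int \<Rightarrow> int \<Rightarrow> complex" where "W l k = cv k (\<tau> k) l"

lemma W_block: "\<not> rel N l k \<Longrightarrow> W l k = 0"
proof -
  assume "\<not> rel N l k"
  then have "l \<notin> blk N k" by (simp add: blk_def)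
  then show ?thesis using cv_supp[OF \<tau>_J, of k] by (simp add: W_def BO.supp_def)
qed

lemma W_u: "AE x in \<mu>. u (\<tau> k) x = comb (blk N k) (\<lambda>l. W l k) x"
  using cv(2)[of "fst (\<tau> k)" "snd (\<tau> k)" k] \<tau>_J[of k] by (simp add: W_def)

lemma W_inverse_exists: "\<exists>a. \<forall>k\<in>blk N l. (\<Sum>i\<in>blk N l. W k i * a i) = (if k = l then 1 else 0)"
proof -
  obtain a where a: "BO.\<delta> l = (\<lambda>x. \<Sum>i\<in>J l. a i * cv l i x)" using block_basis(4)[OF BO.delta_supp[OF blk_self]] by blast
  have "(\<Sum>i\<in>blk N l. W k i * a (\<tau> i)) = (if k = l then 1 else 0)" for k
  proof -
    have "(\<Sum>i\<in>blk N l. W k i * a (\<tau> i)) = (\<Sum>i\<in>blk N l. a (\<tau> i) * cv l (\<tau> i) k)"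
      by (rule sum.cong) (auto simp: W_def blk_def cv_cong mult.commute)
    also have "\<dots> = (\<Sum>i\<in>J l. a i * cv l i k)" by (rule sum.reindex_bij_betw[OF \<tau>_bij_J])
    also have "\<dots> = BO.\<delta> l k" using a by (simp add: fun_eq_iff)
    finally show ?thesis by (simp add: BO.\<delta>_def)
  qed
  then show ?thesis by (intro exI[of _ "\<lambda>i. a (\<tau> i)"]) simp
qed

definition W' :: "int \<Rightarrow> int \<Rightarrow> complex"
  where "W' i l = (if rel N i l then (SOME a. \<forall>k\<in>blk N l. (\<Sum>i\<in>blk N l. W k i * a i) = (if k = l then 1 else 0)) i else 0)"

lemma W'_block: "\<not> rel N i l \<Longrightarrow> W' i l = 0"
  by (simp add: W'_def)

lemma WW': "rel N k l \<Longrightarrow> (\<Sum>i\<in>blk N l. W k i * W' i l) = (if k = l then 1 else 0)"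
proof -
  assume k: "rel N k l"
  let ?a = "SOME a. \<forall>k\<in>blk N l. (\<Sum>i\<in>blk N l. W k i * a i) = (if k = l then 1 else 0)"
  have "(\<Sum>i\<in>blk N l. W k i * W' i l) = (\<Sum>i\<in>blk N l. W k i * ?a i)"
    by (rule sum.cong) (auto simp: W'_def blk_def)
  also have "\<dots> = (if k = l then 1 else 0)" using someI_ex[OF W_inverse_exists[of l]] k by (simp add: blk_def)
  finally show ?thesis .
qed

lemma W_independent:
  assumes z: "\<And>l. l \<in> blk N j \<Longrightarrow> (\<Sum>i\<in>blk N j. W l i * a i) = 0" and i: "i \<in> blk N j"
  shows "a i = 0"
proof -
  have "(\<Sum>p\<in>J j. a (\<sigma> p) * cv j p l) = 0" for l
  proof (cases "l \<in> blk N j")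
    case True
    have "(\<Sum>p\<in>J j. a (\<sigma> p) * cv j p l) = (\<Sum>i\<in>blk N j. a (\<sigma> (\<tau> i)) * cv j (\<tau> i) l)"
      by (rule sum.reindex_bij_betw[OF \<tau>_bij_J, symmetric])
    also have "\<dots> = (\<Sum>i\<in>blk N j. W l i * a i)"
      by (rule sum.cong) (auto simp: W_def \<tau> blk_def cv_cong mult.commute)
    finally show ?thesis using z[OF True] by simp
  next
    case False
    then show ?thesis using cv_supp by (auto simp: BO.supp_def intro!: sum.neutral)
  qed
  then have "(\<Sum>p\<in>J j. (\<lambda>x. a (\<sigma> p) * cv j p x)) = 0" unfolding BO.sum_scale_apply by (simp add: fun_eq_iff)
  moreover have "\<tau> i \<in> J j" using \<tau>_J[of i] J_cong[of i j] i by (simp add: blk_def)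
  ultimately have "a (\<sigma> (\<tau> i)) = 0" by (rule block_basis(3))
  then show ?thesis by (simp add: \<tau>)
qed

text \<open>In a finite block, a right inverse of a matrix with independent columns is a left
  inverse as well.\<close>

lemma W'W: 
  assumes "rel N i k" shows "(\<Sum>l\<in>blk N k. W' i l * W l k) = (if i = k then 1 else 0)"
proof -
  define a where "a i = (\<Sum>l\<in>blk N k. W' i l * W l k) - (if i = k then 1 else 0)" for i
  have "a i = 0"
  proof (rule W_independent)
    show "i \<in> blk N k" using assms by (simp add: blk_def)
    fix m assume m: "m \<in> blk N k"
    have "(\<Sum>i\<in>blk N k. W m i * a i) = (\<Sum>i\<in>blk N k. \<Sum>l\<in>blk N k. W m i * W' i l * W l k) - (\<Sum>i\<in>blk N k. if i = k then W m k else 0)"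
      unfolding a_def right_diff_distrib sum_subtractf sum_distrib_left
      by (intro arg_cong2[where f = minus] sum.cong refl) (auto simp: mult.assoc)
    also have "(\<Sum>i\<in>blk N k. \<Sum>l\<in>blk N k. W m i * W' i l * W l k) = (\<Sum>l\<in>blk N k. (\<Sum>i\<in>blk N l. W m i * W' i l) * W l k)"
      by (subst sum.swap) (rule sum.cong, auto simp: sum_distrib_right blk_eq')
    also have "\<dots> = (\<Sum>l\<in>blk N k. (if l = m then W m k else 0))"
    proof (rule sum.cong[OF refl])
      fix l assume l: "l \<in> blk N k"
      then have "rel N m l" using m rel_sym rel_trans unfolding blk_def mem_Collect_eq by blast
      then show "(\<Sum>i\<in>blk N l. W m i * W' i l) * W l k = (if l = m then W m k else 0)" by (auto simp: WW')
    qed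
    finally show "(\<Sum>i\<in>blk N k. W m i * a i) = 0" using m by simp
  qed
  then show ?thesis by (simp add: a_def)
qed

section \<open>Riesz basis criterion by bounds on the matrix entries\<close>

lemma card_blk: "card (blk N j) \<le> 2 * N + 1"
proof (cases "\<bar>j\<bar> \<le> int N")
  case True
  then have "blk N j \<subseteq> {- int N..int N}" unfolding blk_def rel_def by auto
  from card_mono[OF _ this] show ?thesis by simp
next
  case False
  then have "blk N j \<subseteq> {j, -j}" unfolding blk_def rel_def by auto
  then have "card (blk N j) \<le> card {j, -j}" by (rule card_mono[rotated]) simp
  also have "\<dots> \<le> 2" by (simp add: card_insert_if)
  finally show ?thesis using N by simp
qed

text \<open>A matrix supported on the blocks has at most \<open>2 * N + 1\<close> nonzero entries in
  each row and column, so a bound on its entries suffices for Schur's test.\<close>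

lemma block_schur:
  assumes bd: "\<And>l k. cmod (a l k) \<le> R" and zero: "\<And>l k. \<not> rel N l k \<Longrightarrow> a l k = 0" and F: "finite F" and H: "finite H"
  shows "sqrt (\<Sum>l\<in>H. (cmod (\<Sum>k\<in>F. a l k * c k))\<^sup>2) \<le> (real (2 * N + 1) * R) * sqrt (\<Sum>k\<in>F. (cmod (c k))\<^sup>2)"
proof -
  have R: "R \<ge> 0" using bd norm_ge_zero order.trans by blast
  have row: "(\<Sum>k\<in>F. cmod (a l k)) \<le> real (2 * N + 1) * R" if "finite F" for F l
  proof -
    have "(\<Sum>k\<in>F. cmod (a l k)) \<le> (\<Sum>k\<in>blk N l. cmod (a l k))"
    proof -
      have "(\<Sum>k\<in>F. cmod (a l k)) = (\<Sum>k\<in>F \<inter> blk N l. cmod (a l k))"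
        by (rule sum.mono_neutral_right) (use that zero in \<open>auto simp: blk_def intro: rel_sym\<close>)
      also have "\<dots> \<le> (\<Sum>k\<in>blk N l. cmod (a l k))" by (rule sum_mono2) auto
      finally show ?thesis .
    qed
    also have "\<dots> \<le> real (card (blk N l)) * R" by (rule sum_bounded_above) (rule bd)
    also have "\<dots> \<le> real (2 * N + 1) * R" by (intro mult_right_mono R) (use card_blk of_nat_le_iff in blast)
    finally show ?thesis .
  qed
  have col: "(\<Sum>l\<in>H. cmod (a l k)) \<le> real (2 * N + 1) * R" if "finite H" for H k
  proof -
    have "(\<Sum>l\<in>H. cmod (a l k)) \<le> (\<Sum>l\<in>blk N k. cmod (a l k))"
    proof -
      have "(\<Sum>l\<in>H. cmod (a l k)) = (\<Sum>l\<in>H \<inter> blk N k. cmod (a l k))"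
        by (rule sum.mono_neutral_right) (use that zero in \<open>auto simp: blk_def\<close>)
      also have "\<dots> \<le> (\<Sum>l\<in>blk N k. cmod (a l k))" by (rule sum_mono2) auto
      finally show ?thesis .
    qed
    also have "\<dots> \<le> real (card (blk N k)) * R" by (rule sum_bounded_above) (rule bd)
    also have "\<dots> \<le> real (2 * N + 1) * R" by (intro mult_right_mono R) (use card_blk of_nat_le_iff in blast)
    finally show ?thesis .
  qed
  have R': "real (2 * N + 1) * R \<ge> 0" using R by simp
  have "sqrt (\<Sum>l\<in>H. (cmod (\<Sum>k\<in>F. a l k * c k))\<^sup>2) \<le> sqrt ((real (2 * N + 1) * R)\<^sup>2 * (\<Sum>k\<in>F. (cmod (c k))\<^sup>2))"
    by (intro real_sqrt_le_mono schur_test row col F H R')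
  also have "\<dots> = (real (2 * N + 1) * R) * sqrt (\<Sum>k\<in>F. (cmod (c k))\<^sup>2)"
    using R' by (simp add: real_sqrt_mult)
  finally show ?thesis .
qed

text \<open>A combination of the normal system with coefficients \<open>c\<close> is the combination
  of \<open>g\<close> whose coefficients are \<open>W\<close> applied to \<open>c\<close>; the
  bounds and the density of \<open>g\<close> are transferred through \<open>W\<close> and
  \<open>W'\<close>.\<close>

theorem riesz_of_bounds:
  assumes bW: "\<And>l k. cmod (W l k) \<le> R" and bW': "\<And>l k. cmod (W' l k) \<le> R" and R: "R > 0"
  shows "L2_Riesz_basis (SL_index q) u"
proof -
  define S where "S = real (2 * N + 1) * R"
  have S: "S > 0" using R by (simp add: S_def)
  have uL2: "u p \<in> L2" if "p \<in> SL_index q" for p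
    using index_J[OF that] root_L2 mlt(3) by (metis (no_types, lifting) E_def J_def case_prodE mem_Collect_eq)
  have usum: "AE x in \<mu>. (\<Sum>k\<in>F. c k * u (\<tau> k) x) = (\<Sum>l\<in>(\<Union>k\<in>F. blk N k). (\<Sum>k\<in>F. W l k * c k) * g l x)"
    if F: "finite F" for F c
  proof -
    have "AE x in \<mu>. \<forall>k\<in>F. u (\<tau> k) x = comb (blk N k) (\<lambda>l. W l k) x"
      by (rule eventually_ball_finite[OF F]) (use W_u in blast)
    then show ?thesis
    proof (rule AE_imp1)
      fix x assume h: "\<forall>k\<in>F. u (\<tau> k) x = comb (blk N k) (\<lambda>l. W l k) x"
      have "(\<Sum>k\<in>F. c k * u (\<tau> k) x) = (\<Sum>k\<in>F. \<Sum>l\<in>(\<Union>k\<in>F. blk N k). W l k * c k * g l x)"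
      proof (rule sum.cong[OF refl])
        fix k assume k: "k \<in> F"
        have "c k * u (\<tau> k) x = (\<Sum>l\<in>blk N k. W l k * c k * g l x)"
          using h k by (simp add: comb_def sum_distrib_left mult_ac)
        also have "\<dots> = (\<Sum>l\<in>(\<Union>k\<in>F. blk N k). W l k * c k * g l x)"
          by (rule sum.mono_neutral_left) (use F k W_block[of _ k] in \<open>auto simp: blk_def[of N k]\<close>)
        finally show "c k * u (\<tau> k) x = (\<Sum>l\<in>(\<Union>k\<in>F. blk N k). W l k * c k * g l x)" .
      qed
      also have "\<dots> = (\<Sum>l\<in>(\<Union>k\<in>F. blk N k). (\<Sum>k\<in>F. W l k * c k) * g l x)"
        by (subst sum.swap) (simp add: sum_distrib_right)
      finally show "(\<Sum>k\<in>F. c k * u (\<tau> k) x) = (\<Sum>l\<in>(\<Union>k\<in>F. blk N k). (\<Sum>k\<in>F. W l k * c k) * g l x)" .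
    qed
  qed
  have norm_eq: "L2_norm (\<lambda>x. \<Sum>k\<in>F. c k * u (\<tau> k) x) = L2_norm (\<lambda>x. \<Sum>l\<in>(\<Union>k\<in>F. blk N k). (\<Sum>k\<in>F. W l k * c k) * g l x)"
    if F: "finite F" for F c
    by (rule L2_norm_cong_AE[OF _ _ usum[OF F]]) (intro L2_measurable L2_lincomb uL2 \<tau> g_L2)+
  interpret V: riesz_family "\<lambda>k. u (\<tau> k)" "(1 - 1/8) / S" "(1 + 1/8) * S"
  proof
    show "u (\<tau> k) \<in> L2" for k by (rule uL2[OF \<tau>(2)])
    show "(1 - 1/8) / S > 0" using S by simp
    fix F :: "int set" and c :: "int \<Rightarrow> complex" assume F: "finite F"
    define H where "H = (\<Union>k\<in>F. blk N k)"
    define b where "b l = (\<Sum>k\<in>F. W l k * c k)" for l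
    have H: "finite H" using F by (simp add: H_def)
    have up: "sqrt (\<Sum>l\<in>H. (cmod (b l))\<^sup>2) \<le> S * sqrt (\<Sum>k\<in>F. (cmod (c k))\<^sup>2)"
      unfolding b_def S_def by (rule block_schur[OF bW W_block F H])
    have inv: "(\<Sum>l\<in>H. W' k l * b l) = c k" if k: "k \<in> F" for k
    proof -
      have "(\<Sum>l\<in>H. W' k l * b l) = (\<Sum>l\<in>H. \<Sum>k'\<in>F. W' k l * W l k' * c k')"
        unfolding b_def by (simp add: sum_distrib_left mult.assoc)
      also have "\<dots> = (\<Sum>k'\<in>F. (\<Sum>l\<in>H. W' k l * W l k') * c k')"
        by (subst sum.swap) (simp add: sum_distrib_right)
      also have "\<dots> = (\<Sum>k'\<in>F. if k' = k then c k else 0)"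
      proof (rule sum.cong[OF refl])
        fix k' assume k': "k' \<in> F"
        have "(\<Sum>l\<in>H. W' k l * W l k') = (\<Sum>l\<in>blk N k'. W' k l * W l k')"
          by (rule sum.mono_neutral_right[OF H]) (use k' W_block in \<open>auto simp: H_def blk_def\<close>)
        also have "\<dots> = (if k' = k then 1 else 0)"
        proof (cases "rel N k k'")
          case True then show ?thesis using W'W[OF True] by auto
        next
          case False
          have "W' k l = 0" if "l \<in> blk N k'" for l
            by (rule W'_block) (use that False rel_trans in \<open>auto simp: blk_def\<close>)
          then show ?thesis using False by auto
        qed
        finally show "(\<Sum>l\<in>H. W' k l * W l k') * c k' = (if k' = k then c k else 0)" by simp
      qed
      also have "\<dots> = c k" using F k by simp
      finally show ?thesis .
    qed
    have "sqrt (\<Sum>k\<in>F. (cmod (c k))\<^sup>2) = sqrt (\<Sum>k\<in>F. (cmod (\<Sum>l\<in>H. W' k l * b l))\<^sup>2)" by (simp add: inv)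
    also have "\<dots> \<le> S * sqrt (\<Sum>l\<in>H. (cmod (b l))\<^sup>2)"
      unfolding S_def by (rule block_schur[OF bW' W'_block H F])
    finally have lo: "sqrt (\<Sum>k\<in>F. (cmod (c k))\<^sup>2) \<le> S * sqrt (\<Sum>l\<in>H. (cmod (b l))\<^sup>2)" .
    have n: "L2_norm (\<lambda>x. \<Sum>k\<in>F. c k * u (\<tau> k) x) = L2_norm (\<lambda>x. \<Sum>l\<in>H. b l * g l x)"
      unfolding H_def b_def by (rule norm_eq[OF F])
    show "(1 - 1/8) / S * sqrt (\<Sum>k\<in>F. (cmod (c k))\<^sup>2) \<le> L2_norm (\<lambda>x. \<Sum>k\<in>F. c k * u (\<tau> k) x)"
    proof -
      have "(1 - 1/8) / S * sqrt (\<Sum>k\<in>F. (cmod (c k))\<^sup>2) \<le> (1 - 1/8) / S * (S * sqrt (\<Sum>l\<in>H. (cmod (b l))\<^sup>2))"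
        by (rule mult_left_mono[OF lo]) (use S in simp)
      also have "\<dots> = (1 - 1/8) * sqrt (\<Sum>l\<in>H. (cmod (b l))\<^sup>2)" using S by simp
      also have "\<dots> \<le> L2_norm (\<lambda>x. \<Sum>k\<in>F. c k * u (\<tau> k) x)" unfolding n by (rule G.lower[OF H])
      finally show ?thesis .
    qed
    show "L2_norm (\<lambda>x. \<Sum>k\<in>F. c k * u (\<tau> k) x) \<le> (1 + 1/8) * S * sqrt (\<Sum>k\<in>F. (cmod (c k))\<^sup>2)"
    proof -
      have "L2_norm (\<lambda>x. \<Sum>k\<in>F. c k * u (\<tau> k) x) \<le> (1 + 1/8) * sqrt (\<Sum>l\<in>H. (cmod (b l))\<^sup>2)" unfolding n by (rule G.upper[OF H])
      also have "\<dots> \<le> (1 + 1/8) * (S * sqrt (\<Sum>k\<in>F. (cmod (c k))\<^sup>2))" by (rule mult_left_mono[OF up]) simp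
      finally show ?thesis by (simp add: mult.assoc)
    qed
  next
    fix f and e :: real assume f: "f \<in> L2" and e: "e > 0"
    obtain F b where F: "finite F" "L2_norm (\<lambda>x. f x - (\<Sum>l\<in>F. b l * g l x)) < e" using G.dense[OF f e] by blast
    \<comment> \<open>\<open>H\<close> is the union of the blocks that meet \<open>F\<close>, so the
      coefficients \<open>c\<close> vanish outside it and \<open>W\<close> takes them back to those
      of the approximation by \<open>g\<close>.\<close>
    define H where "H = (\<Union>l\<in>F. blk N l)"
    define c where "c k = (\<Sum>l\<in>F. W' k l * b l)" for k
    have H: "finite H" using F(1) by (simp add: H_def)
    have HH: "(\<Union>k\<in>H. blk N k) = H" by (auto simp: H_def blk_eq')
    have sc: "(\<Sum>k\<in>H. W l k * c k) = (if l \<in> F then b l else 0)" if l: "l \<in> H" for l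
    proof -
      have "(\<Sum>k\<in>H. W l k * c k) = (\<Sum>l'\<in>F. (\<Sum>k\<in>H. W l k * W' k l') * b l')"
        unfolding c_def sum_distrib_left sum_distrib_right by (subst sum.swap) (simp add: mult.assoc)
      also have "\<dots> = (\<Sum>l'\<in>F. if l' = l then b l else 0)"
      proof (rule sum.cong[OF refl])
        fix l' assume l': "l' \<in> F"
        have "(\<Sum>k\<in>H. W l k * W' k l') = (\<Sum>k\<in>blk N l'. W l k * W' k l')"
          by (rule sum.mono_neutral_right[OF H]) (use l' W'_block in \<open>auto simp: H_def blk_def\<close>)
        also have "\<dots> = (if l' = l then 1 else 0)"
        proof (cases "rel N l l'")
          case True then show ?thesis using WW'[OF True] by auto
        next
          case False
          have "W l k = 0" if "k \<in> blk N l'" for k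
            by (rule W_block) (use that False rel_trans in \<open>auto simp: blk_def\<close>)
          then show ?thesis using False by auto
        qed
        finally show "(\<Sum>k\<in>H. W l k * W' k l') * b l' = (if l' = l then b l else 0)" by simp
      qed
      also have "\<dots> = (if l \<in> F then b l else 0)" using F(1) by simp
      finally show ?thesis .
    qed
    have eq: "(\<Sum>l\<in>H. (\<Sum>k\<in>H. W l k * c k) * g l x) = (\<Sum>l\<in>F. b l * g l x)" for x
    proof (rule sum.mono_neutral_cong_right[OF H])
      show FH: "F \<subseteq> H" using blk_self by (force simp: H_def)
      show "(\<Sum>k\<in>H. W l k * c k) * g l x = b l * g l x" if "l \<in> F" for l using sc[of l] that FH by auto
    qed (auto simp: sc)
    have ae: "AE x in \<mu>. (\<Sum>k\<in>H. c k * u (\<tau> k) x) = (\<Sum>l\<in>F. b l * g l x)"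
      using usum[OF H, of c] unfolding HH eq .
    have "L2_norm (\<lambda>x. f x - (\<Sum>k\<in>H. c k * u (\<tau> k) x)) = L2_norm (\<lambda>x. f x - (\<Sum>l\<in>F. b l * g l x))"
      by (rule L2_norm_cong_AE) (intro L2_measurable L2_diff f L2_lincomb uL2 \<tau> g_L2 | rule AE_imp1[OF ae], simp)+
    then show "\<exists>F c. finite F \<and> L2_norm (\<lambda>x. f x - (\<Sum>k\<in>F. c k * u (\<tau> k) x)) < e" using H F(2) by (intro exI[of _ H] exI[of _ c]) simp
  qed
  show ?thesis by (rule V.riesz_basis[OF \<sigma>_bij uL2]) (simp_all add: \<tau>)
qed

end

section \<open>The two-dimensional blocks\<close>

text \<open>Eliminating \<open>\<zeta>\<close> gives
  \<open>c * x1 * x1 = (a - d) * x1 * x2 + b * x2 * x2\<close>, which forces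
  \<open>cmod x1 \<le> 2 * cmod x2\<close>. Hence five times the square of \<open>cmod x2\<close> is
  at least \<open>64/81\<close>, and \<open>39/100\<close> lies just below the resulting
  bound.\<close>

lemma eigenvector_component_bound:
  fixes a b c d \<zeta> x1 x2 :: complex
  assumes c: "c \<noteq> 0" and bc: "cmod b \<le> 2 * cmod c" and ad: "cmod (a - d) \<le> cmod c / 4"
    and x: "a * x1 + b * x2 = \<zeta> * x1" "c * x1 + d * x2 = \<zeta> * x2"
    and n: "(8/9)\<^sup>2 \<le> (cmod x1)\<^sup>2 + (cmod x2)\<^sup>2"
  shows "39/100 \<le> cmod x2"
proof -
  have "c * x1 * x1 + d * x2 * x1 = a * x1 * x2 + b * x2 * x2"
    using x by (metis distrib_right mult.commute mult.left_commute)
  then have "c * x1 * x1 = (a - d) * (x1 * x2) + b * (x2 * x2)" by (simp add: algebra_simps)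
  then have "cmod c * (cmod x1 * cmod x1) \<le> cmod (a - d) * (cmod x1 * cmod x2) + cmod b * (cmod x2 * cmod x2)"
    by (metis norm_mult norm_triangle_ineq mult.assoc)
  also have "\<dots> \<le> cmod c / 4 * (cmod x1 * cmod x2) + 2 * cmod c * (cmod x2 * cmod x2)"
    by (intro add_mono mult_right_mono bc ad) auto
  also have "\<dots> = cmod c * (cmod x1 * cmod x2 / 4 + 2 * (cmod x2 * cmod x2))" by (simp add: algebra_simps)
  finally have q: "cmod x1 * cmod x1 \<le> cmod x1 * cmod x2 / 4 + 2 * (cmod x2 * cmod x2)" using c by simp
  have "cmod x1 \<le> 2 * cmod x2"
  proof (rule ccontr)
    assume "\<not> ?thesis"
    \<comment> \<open>In this case the right-hand side of \<open>q\<close> is at most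
      \<open>1/8 + 1/2\<close> of the square of \<open>cmod x1\<close>.\<close>
    then have g: "2 * cmod x2 < cmod x1" by simp
    have "cmod x1 * (2 * cmod x2) \<le> cmod x1 * cmod x1" using g by (intro mult_left_mono) auto
    moreover have "2 * cmod x2 * (2 * cmod x2) \<le> cmod x1 * cmod x1" using g by (intro mult_mono) auto
    moreover have "0 < cmod x1 * cmod x1" using g norm_ge_zero[of x2] by (intro mult_pos_pos) linarith+
    ultimately show False using q by linarith
  qed
  then have "(cmod x1)\<^sup>2 \<le> (2 * cmod x2)\<^sup>2" by (intro power_mono) auto
  then have "(39/100)\<^sup>2 \<le> (cmod x2)\<^sup>2" using n by (simp add: power2_eq_square)
  then show ?thesis by (rule power2_le_imp_le) simp
qed

text \<open>The discriminant formula
  \<open>(\<zeta> - \<eta>)\<^sup>2 = 4 * b * c + (a - d)\<^sup>2\<close> yields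
  \<open>cmod (\<zeta> - \<eta>) \<ge> cmod c\<close>, and the determinant times \<open>c\<close>
  equals \<open>(\<zeta> - \<eta>) * x2 * y2\<close>. The constant \<open>3/20\<close> lies just
  below the square of \<open>39/100\<close>.\<close>

lemma eigenvector_det_bound:
  fixes a b c d \<zeta> \<eta> x1 x2 y1 y2 :: complex
  assumes c: "c \<noteq> 0" and bc: "cmod b \<le> 2 * cmod c" "cmod c \<le> 2 * cmod b" and ad: "cmod (a - d) \<le> cmod c / 4"
    and x: "a * x1 + b * x2 = \<zeta> * x1" "c * x1 + d * x2 = \<zeta> * x2"
    and y: "a * y1 + b * y2 = \<eta> * y1" "c * y1 + d * y2 = \<eta> * y2"
    and nx: "(8/9)\<^sup>2 \<le> (cmod x1)\<^sup>2 + (cmod x2)\<^sup>2" and ny: "(8/9)\<^sup>2 \<le> (cmod y1)\<^sup>2 + (cmod y2)\<^sup>2"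
    and ne: "\<zeta> \<noteq> \<eta>"
  shows "3/20 \<le> cmod (x1 * y2 - x2 * y1)"
proof -
  have x2: "39/100 \<le> cmod x2" by (rule eigenvector_component_bound[OF c bc(1) ad x nx])
  have y2: "39/100 \<le> cmod y2" by (rule eigenvector_component_bound[OF c bc(1) ad y ny])
  have char: "(\<xi> - a) * (\<xi> - d) = b * c"
    if "a * z1 + b * z2 = \<xi> * z1" "c * z1 + d * z2 = \<xi> * z2" "39/100 \<le> cmod z2" for \<xi> z1 z2
  proof -
    have z: "(\<xi> - a) * z1 = b * z2" "c * z1 = (\<xi> - d) * z2" using that(1,2) by (simp_all add: algebra_simps)
    have "(\<xi> - a) * (\<xi> - d) * z2 = (\<xi> - a) * (c * z1)" by (simp add: z(2) mult.assoc)
    also have "\<dots> = b * c * z2" using z(1) by (simp add: mult_ac)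
    finally show ?thesis using that(3) by auto
  qed
  note cx = char[OF x x2] and cy = char[OF y y2]
  have "(\<zeta> - \<eta>) * (\<zeta> + \<eta> - (a + d)) = (\<zeta> - a) * (\<zeta> - d) - (\<eta> - a) * (\<eta> - d)" by (simp add: algebra_simps)
  then have "\<zeta> + \<eta> - (a + d) = 0" using ne unfolding cx cy by simp
  then have s: "\<eta> = a + d - \<zeta>" by (simp add: algebra_simps eq_diff_eq)
  have "(\<zeta> - \<eta>)\<^sup>2 = 4 * (b * c) + (a - d)\<^sup>2"
    unfolding cx[symmetric] s by (simp add: power2_eq_square algebra_simps)
  then have "4 * (b * c) = (\<zeta> - \<eta>)\<^sup>2 - (a - d)\<^sup>2" by simp
  then have "4 * (cmod b * cmod c) \<le> (cmod (\<zeta> - \<eta>))\<^sup>2 + (cmod (a - d))\<^sup>2"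
    by (metis norm_mult norm_numeral norm_power norm_triangle_ineq4)
  moreover have "(cmod (a - d))\<^sup>2 \<le> (cmod c / 4)\<^sup>2" by (intro power_mono ad) simp
  moreover have "cmod c * cmod c \<le> 2 * (cmod b * cmod c)"
    using mult_right_mono[OF bc(2), of "cmod c"] by simp
  moreover have "(cmod c / 4)\<^sup>2 = (cmod c)\<^sup>2 / 16" "cmod c * cmod c = (cmod c)\<^sup>2" by (simp_all add: power2_eq_square)
  ultimately have "(cmod c)\<^sup>2 \<le> (cmod (\<zeta> - \<eta>))\<^sup>2" using zero_le_power2[of "cmod c"] by linarith
  then have r: "cmod c \<le> cmod (\<zeta> - \<eta>)" by (rule power2_le_imp_le) simp
  have "c * (x1 * y2 - x2 * y1) = (c * x1) * y2 - x2 * (c * y1)" by (simp add: algebra_simps)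
  also have "\<dots> = (\<zeta> - \<eta>) * (x2 * y2)"
  proof -
    have e: "c * x1 = (\<zeta> - d) * x2" "c * y1 = (\<eta> - d) * y2" using x(2) y(2) by (simp_all add: algebra_simps)
    show ?thesis unfolding e by (simp add: algebra_simps)
  qed
  finally have "cmod c * cmod (x1 * y2 - x2 * y1) = cmod (\<zeta> - \<eta>) * (cmod x2 * cmod y2)"
    by (metis norm_mult)
  moreover have "cmod c * (3/20) \<le> cmod (\<zeta> - \<eta>) * (cmod x2 * cmod y2)"
  proof (rule mult_mono[OF r])
    have "3/20 \<le> 39/100 * (39/100::real)" by simp
    also have "\<dots> \<le> cmod x2 * cmod y2" by (intro mult_mono x2 y2) auto
    finally show "3/20 \<le> cmod x2 * cmod y2" .
  qed auto
  ultimately have "cmod c * (3/20) \<le> cmod c * cmod (x1 * y2 - x2 * y1)" by linarith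
  then show ?thesis using c mult_le_cancel_left_pos[of "cmod c"] by simp
qed

text \<open>Cramer's rule: the numerators are at most \<open>16/7\<close> and the determinant is at
  least \<open>3/20\<close>, with a quotient below \<open>16\<close>.\<close>

lemma inverse_entry_bound:
  fixes x1 x2 y1 y2 p m e1 e2 :: complex
  assumes det: "3/20 \<le> cmod (x1 * y2 - x2 * y1)"
    and e: "p * x1 + m * x2 = e1" "p * y1 + m * y2 = e2" "cmod e1 \<le> 1" "cmod e2 \<le> 1"
    and bd: "cmod x1 \<le> 8/7" "cmod x2 \<le> 8/7" "cmod y1 \<le> 8/7" "cmod y2 \<le> 8/7"
  shows "cmod p \<le> 16" "cmod m \<le> 16"
proof -
  have B: "cmod (e1 * s - e2 * t) \<le> 16/7" if "cmod s \<le> 8/7" "cmod t \<le> 8/7" for s t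
  proof -
    have "cmod (e1 * s - e2 * t) \<le> cmod e1 * cmod s + cmod e2 * cmod t" by (metis norm_mult norm_triangle_ineq4)
    also have "\<dots> \<le> 1 * (8/7) + 1 * (8/7)" by (intro add_mono mult_mono e that) auto
    finally show ?thesis by simp
  qed
  have D: "cmod z \<le> 16" if "cmod (z * (x1 * y2 - x2 * y1)) \<le> 16/7" for z
  proof -
    have "cmod z * (3/20) \<le> cmod z * cmod (x1 * y2 - x2 * y1)" by (intro mult_left_mono det) simp
    also have "\<dots> \<le> 16/7" using that by (simp add: norm_mult)
    finally show ?thesis by simp
  qed
  have "p * (x1 * y2 - x2 * y1) = e1 * y2 - e2 * x2" using e(1,2) by (auto simp: algebra_simps)
  then show "cmod p \<le> 16" using D B bd by simp
  have "m * (x1 * y2 - x2 * y1) = e2 * x1 - e1 * y1" using e(1,2) by (auto simp: algebra_simps)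
  then have "cmod (m * (x1 * y2 - x2 * y1)) = cmod (e1 * y1 - e2 * x1)" by (simp add: norm_minus_commute)
  then show "cmod m \<le> 16" using D B bd by simp
qed

context sl_family
begin

text \<open>
  The functions \<open>g n\<close> are close to exponentials, whose bilinear pairing is \<open>1\<close> for opposite and \<open>0\<close>
  for other pairs of frequencies.
\<close>

lemma Gm_eq:
  assumes r: "rel N i j"
  shows "Gm i j = (if i = - j then 1 else 0) + (\<Sum>\<^sub>\<infinity>k. K (- k) i * K k j)"
    "cmod (\<Sum>\<^sub>\<infinity>k. K (- k) i * K k j) \<le> C * C * \<gamma>"
proof -
  have bd: "cmod (K (- k) i * K k j) \<le> C * C * gapinv N k j" for k
  proof -
    have "cmod (K (- k) i) \<le> C * 1" 
      by (rule order.trans[OF K_bound1]) (use C gapinv_le_1 in \<open>simp add: mult_left_mono\<close>)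
    then have "cmod (K (- k) i * K k j) \<le> (C * 1) * (C * gapinv N k j)"
      unfolding norm_mult by (rule mult_mono[OF _ K_bound1]) (use C in auto)
    then show ?thesis by (simp add: mult.assoc)
  qed
  have gs: "(\<lambda>k. C * C * gapinv N k j) summable_on UNIV" by (rule summable_on_cmult_right[OF gapinv_summable[OF N]])
  have as: "(\<lambda>k. cmod (K (- k) i * K k j)) summable_on UNIV"
    by (rule summable_on_comparison_test[OF gs bd]) simp
  have s: "(\<lambda>k. K (- k) i * K k j) summable_on UNIV" by (rule abs_summable_summable[OF as])
  have "Gm i j = fc (\<lambda>x. g i x * abs_trig.f (\<lambda>k. U k j) x) 0"
    by (simp add: Gm_def bl_def g_def fc_def ex_def)
  also have "\<dots> = (\<Sum>\<^sub>\<infinity>k. U (- k) i * U k j)"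
    using abs_trig.fc_mult[OF U_abs_trig g_L2, of i j 0] by (simp add: fc_g)
  also have "\<dots> = (\<Sum>\<^sub>\<infinity>k. (if k = j \<and> i = - j then 1 else 0) + K (- k) i * K k j)"
  proof (rule infsum_cong)
    fix k
    \<comment> \<open>The mixed terms vanish because a block contains the opposite of each of its
      indices.\<close>
    have "K (- j) i = 0" "K (- i) j = 0" using r by (auto intro!: K_rel simp: rel_def)
    then show "U (- k) i * U k j = (if k = j \<and> i = - j then 1 else 0) + K (- k) i * K k j"
      by (auto simp: U_def algebra_simps)
  qed
  also have "\<dots> = (\<Sum>\<^sub>\<infinity>k. (if k = j \<and> i = - j then 1 else 0)) + (\<Sum>\<^sub>\<infinity>k. K (- k) i * K k j)"
    by (rule infsum_add[OF _ s])
      (rule summable_on_cong_neutral[THEN iffD1, OF _ _ _ summable_on_finite[of "{j}" "\<lambda>k. if i = - j then 1 else 0"]], auto)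
  also have "(\<Sum>\<^sub>\<infinity>k. (if k = j \<and> i = - j then 1 else 0)) = (\<Sum>\<^sub>\<infinity>k\<in>{j}. (if i = - j then 1 else (0::complex)))"
    by (rule infsum_cong_neutral) auto
  finally show "Gm i j = (if i = - j then 1 else 0) + (\<Sum>\<^sub>\<infinity>k. K (- k) i * K k j)" by simp
  have "cmod (\<Sum>\<^sub>\<infinity>k. K (- k) i * K k j) \<le> (\<Sum>\<^sub>\<infinity>k. cmod (K (- k) i * K k j))" by (rule norm_infsum_bound[OF as])
  also have "\<dots> \<le> (\<Sum>\<^sub>\<infinity>k. C * C * gapinv N k j)" by (rule infsum_mono[OF as gs bd])
  also have "\<dots> = C * C * infsum (\<lambda>k. gapinv N k j) UNIV" by (rule infsum_cmult_right')
  also have "\<dots> \<le> C * C * \<gamma>" using C gapinv_sum_N[OF N] by (intro mult_left_mono) auto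
  finally show "cmod (\<Sum>\<^sub>\<infinity>k. K (- k) i * K k j) \<le> C * C * \<gamma>" .
qed

lemma blk_tail: "\<bar>n\<bar> > int N \<Longrightarrow> blk N n = {n, - n}"
  by (auto simp: blk_def rel_def)

lemma A_tail:
  assumes n: "\<bar>n\<bar> > int N"
  shows "BO.A n \<zeta> v n = M n n * v n + B n (- n) * v (- n) - \<zeta> * v n"
    "BO.A n \<zeta> v (- n) = B (- n) n * v n + M (- n) (- n) * v (- n) - \<zeta> * v (- n)"
proof -
  have *: "BO.A n \<zeta> v k = M k n * v n + M k (- n) * v (- n) - \<zeta> * v k" if "k \<in> blk N n" for k
    unfolding BO.A_def if_P[OF that] unfolding blk_tail[OF n] using n by simp
  show "BO.A n \<zeta> v n = M n n * v n + B n (- n) * v (- n) - \<zeta> * v n"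
    "BO.A n \<zeta> v (- n) = B (- n) n * v n + M (- n) (- n) * v (- n) - \<zeta> * v (- n)"
    using *[of n] *[of "- n"] n by (simp_all add: blk_tail[OF n] M_def)
qed

text \<open>
  The operator is symmetric for the bilinear pairing, which controls the difference of the
  diagonal entries of a block by its off-diagonal entries.
\<close>

lemma diagonal_difference:
  assumes n: "\<bar>n\<bar> > int N" and sm: "C * C * \<gamma> \<le> 1/100" and bc: "cmod (B n (- n)) \<le> 2 * cmod (B (- n) n)"
  shows "cmod (M n n - M (- n) (- n)) \<le> cmod (B (- n) n) / 4"
proof -
  let ?b = "B n (- n)" and ?c = "B (- n) n"
  have n0: "n \<noteq> - n" using n by auto
  have G: "cmod (Gm i j - (if i = - j then 1 else 0)) \<le> 1/100" if "rel N i j" for i j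
    using Gm_eq(1)[OF that] order.trans[OF Gm_eq(2)[OF that] sm] by simp
  have r: "rel N n n" "rel N (- n) (- n)" "rel N (- n) n" by (simp_all add: rel_def)
  \<comment> \<open>One entry of \<open>Gm_relation\<close>; the factor on the left is close to
    \<open>1\<close>, the two Gram entries on the right are close to \<open>0\<close>.\<close>
  have "(M n n - M (- n) (- n)) * Gm (- n) n = ?b * Gm n n - ?c * Gm (- n) (- n)"
    using Gm_relation[of n "- n"] n n0 blk_tail[of n] blk_tail[of "- n"] by (simp add: M_def algebra_simps Gm_sym[of n "- n"])
  then have "cmod (M n n - M (- n) (- n)) * cmod (Gm (- n) n) \<le> cmod ?b * cmod (Gm n n) + cmod ?c * cmod (Gm (- n) (- n))"
    by (metis norm_mult norm_triangle_ineq4)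
  also have "\<dots> \<le> (2 * cmod ?c) * (1/100) + cmod ?c * (1/100)"
    by (intro add_mono mult_mono bc) (use G[OF r(1)] G[OF r(2)] n0 in auto)
  finally have 1: "cmod (M n n - M (- n) (- n)) * cmod (Gm (- n) n) \<le> 3/100 * cmod ?c" by simp
  have "99/100 \<le> cmod (Gm (- n) n)"
    using G[OF r(3)] norm_triangle_ineq3[of "1" "Gm (- n) n"] by (simp add: norm_minus_commute abs_le_iff)
  then have "cmod (M n n - M (- n) (- n)) * (99/100) \<le> cmod (M n n - M (- n) (- n)) * cmod (Gm (- n) n)"
    by (rule mult_left_mono) simp
  with 1 have "cmod (M n n - M (- n) (- n)) * (99/100) \<le> 3/100 * cmod ?c" by linarith
  then show ?thesis using norm_ge_zero[of ?c] by linarith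
qed

end

context sl_normal
begin

text \<open>The characteristic polynomial of the block has two distinct roots, and both are
  eigenvalues; since the block has two indices, they exhaust it and are simple.\<close>

lemma tail_simple:
  assumes n: "\<bar>n\<bar> > int N" and sm: "C * C * \<gamma> \<le> 1/100"
    and c: "B (- n) n \<noteq> 0" and bc: "cmod (B n (- n)) \<le> 2 * cmod (B (- n) n)" "cmod (B (- n) n) \<le> 2 * cmod (B n (- n))"
  obtains \<zeta> \<eta> where "\<zeta> \<noteq> \<eta>" "J n = {(\<zeta>, 0), (\<eta>, 0)}" "mlt \<zeta> = 1" "mlt \<eta> = 1"
proof -
  define a b c dd where "a = M n n" and "b = B n (- n)" and "c = B (- n) n" and "dd = M (- n) (- n)"
  have n0: "n \<noteq> - n" "n \<noteq> 0" using n by auto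
  note bt = blk_tail[OF n]
  have ad: "cmod (a - dd) \<le> cmod c / 4" unfolding a_def dd_def c_def by (rule diagonal_difference[OF n sm bc(1)])
  define s where "s = csqrt ((a - dd)\<^sup>2 + 4 * (b * c))"
  have s2: "s\<^sup>2 = (a - dd)\<^sup>2 + 4 * (b * c)" by (simp add: s_def)
  have c0: "c \<noteq> 0" using assms(3) by (simp add: c_def)
  have b0: "b \<noteq> 0" using bc(2) c0 by (auto simp: b_def c_def)
  \<comment> \<open>A vanishing discriminant would make \<open>4 * b * c\<close> as small as
    \<open>(a - d)\<^sup>2\<close>, at most a sixteenth of the square of \<open>cmod c\<close>,
    against \<open>cmod c \<le> 2 * cmod b\<close>.\<close>
  have "s \<noteq> 0"
  proof
    assume "s = 0"
    then have "4 * (b * c) = - (a - dd)\<^sup>2" using s2 by (simp add: eq_neg_iff_add_eq_0 add.commute)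
    then have "4 * (cmod b * cmod c) = (cmod (a - dd))\<^sup>2" by (metis norm_minus_cancel norm_mult norm_numeral norm_power)
    also have "\<dots> \<le> (cmod c / 4)\<^sup>2" by (intro power_mono ad) simp
    finally have "64 * (cmod b * cmod c) \<le> cmod c * cmod c" by (simp add: power2_eq_square)
    then have "64 * cmod b \<le> cmod c" using c0 by (simp add: mult_le_cancel_right flip: mult.assoc)
    moreover have "cmod c \<le> 2 * cmod b" "0 < cmod b" using bc(2) b0 by (simp_all add: b_def c_def)
    ultimately show False by linarith
  qed
  define \<zeta> \<eta> where "\<zeta> = (a + dd + s) / 2" and "\<eta> = (a + dd - s) / 2"
  have ne: "\<zeta> \<noteq> \<eta>" using \<open>s \<noteq> 0\<close> by (simp add: \<zeta>_def \<eta>_def)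
  have "(\<zeta> - a) * (\<zeta> - dd) = (s\<^sup>2 - (a - dd)\<^sup>2) / 4" "(\<eta> - a) * (\<eta> - dd) = (s\<^sup>2 - (a - dd)\<^sup>2) / 4"
    by (simp_all add: \<zeta>_def \<eta>_def power2_eq_square field_simps)
  then have char: "(\<zeta> - a) * (\<zeta> - dd) = b * c" "(\<eta> - a) * (\<eta> - dd) = b * c" by (simp_all add: s2)
  have ev: "\<xi> \<in> E n" if ch: "(\<xi> - a) * (\<xi> - dd) = b * c" for \<xi>
  proof (rule ccontr)
    assume "\<xi> \<notin> E n"
    then have sub: "BO.GE n \<xi> \<subseteq> {0}" by (rule far_GE)
    \<comment> \<open>An eigenvector read off from row \<open>n\<close> of the block; it is nonzero
      because of its entry \<open>b\<close>.\<close>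
    define v where "v k = (if k = n then b else if k = - n then \<xi> - a else 0)" for k
    have vs: "v \<in> BO.supp n" unfolding BO.supp_def unfolding bt by (auto simp: v_def)
    have "BO.A n \<xi> v k = 0" for k
    proof (cases "k \<in> blk N n")
      case True
      then consider "k = n" | "k = - n" using bt by auto
      then show ?thesis
      proof cases
        case 1
        then show ?thesis using n0 by (simp add: A_tail[OF n] v_def a_def b_def algebra_simps)
      next
        case 2
        have "c * b + dd * (\<xi> - a) - \<xi> * (\<xi> - a) = 0" using ch by (simp add: algebra_simps)
        then show ?thesis using 2 n0 by (simp add: A_tail[OF n] v_def c_def dd_def)
      qed
    qed (simp add: BO.A_def)
    then have "(BO.A n \<xi> ^^ 1) v = 0" by (simp add: fun_eq_iff)
    then have "v \<in> BO.GE n \<xi>" using vs unfolding BO.GE_def by blast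
    then have "v n = 0" using sub by auto
    then show False using b0 by (simp add: v_def)
  qed
  have E: "\<zeta> \<in> E n" "\<eta> \<in> E n" by (rule ev; rule char)+
  have m1: "1 \<le> mlt \<zeta>" "1 \<le> mlt \<eta>" using E mlt(2) by (auto simp: E_def)
  have in_J: "{(\<zeta>, 0), (\<eta>, 0)} \<subseteq> J n" using E m1 by (auto simp: J_def)
  have "card (J n) = 2" using block_basis(2)[of n] n0 by (simp add: bt)
  then have Jn: "J n = {(\<zeta>, 0), (\<eta>, 0)}" using card_subset_eq[OF block_basis(1) in_J] ne by simp
  have "mlt \<zeta> = 1" "mlt \<eta> = 1"
  proof -
    have "(\<zeta>, 1) \<notin> J n" "(\<eta>, 1) \<notin> J n" unfolding Jn by simp_all
    then have "\<not> 1 < mlt \<zeta>" "\<not> 1 < mlt \<eta>" using E by (simp_all add: J_def)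
    then show "mlt \<zeta> = 1" "mlt \<eta> = 1" using m1 by simp_all
  qed
  then show thesis using that ne Jn by blast
qed

text \<open>The Riesz bounds \<open>7/8\<close> and \<open>9/8\<close> of \<open>g\<close> turn the
  unit norm of the eigenfunction into the bounds \<open>8/7\<close> and \<open>8/9\<close> on its
  coordinates.\<close>

lemma tail_column:
  assumes n: "\<bar>n\<bar> > int N" and p: "(\<zeta>, 0) \<in> J n" "mlt \<zeta> = 1"
  defines "v \<equiv> cv n (\<zeta>, 0)"
  shows "M n n * v n + B n (- n) * v (- n) = \<zeta> * v n" "B (- n) n * v n + M (- n) (- n) * v (- n) = \<zeta> * v (- n)"
    "(8/9)\<^sup>2 \<le> (cmod (v n))\<^sup>2 + (cmod (v (- n)))\<^sup>2" "(cmod (v n))\<^sup>2 + (cmod (v (- n)))\<^sup>2 \<le> (8/7)\<^sup>2"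
proof -
  have n0: "n \<noteq> - n" "n \<noteq> 0" using n by auto
  note bt = blk_tail[OF n]
  have \<zeta>: "\<zeta> \<in> E n" "SL_eigenvalue q \<zeta>" using p(1) by (auto simp: J_def E_def)
  obtain k where k: "k \<in> blk N n" "near \<zeta> k" using \<zeta>(1) by (auto simp: E_def)
  have u1: "u (\<zeta>, 0) \<in> SL_eigenspace q \<zeta>" "L2_norm (u (\<zeta>, 0)) = 1" using mlt(5)[OF \<zeta>(2) p(2)] by auto
  have ae: "AE x in \<mu>. u (\<zeta>, 0) x = comb (blk N n) v x" unfolding v_def by (rule cv(2)[OF p(1)])
  have vs: "v \<in> BO.supp n" unfolding v_def by (rule cv_supp[OF p(1)])
  obtain v' where v': "v' \<in> BO.supp k" "BO.A k \<zeta> v' = 0" "AE x in \<mu>. u (\<zeta>, 0) x = comb (blk N k) v' x"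
    by (rule eigenspace_coord[OF u1(1) k(2)])
  note v' = v'[unfolded blk_eq'[OF k(1)]]
  have "AE x in \<mu>. comb (blk N n) v x = comb (blk N n) v' x" by (rule AE_imp2[OF ae v'(3)]) simp
  then have "v = v'" by (rule comb_inj[OF vs v'(1)])
  then have A: "BO.A n \<zeta> v k = 0" for k using v'(2) by simp
  show "M n n * v n + B n (- n) * v (- n) = \<zeta> * v n" "B (- n) n * v n + M (- n) (- n) * v (- n) = \<zeta> * v (- n)"
    using A[of n] A[of "- n"] by (simp_all add: A_tail[OF n])
  have uL: "u (\<zeta>, 0) \<in> L2" using u1(1) eigenspace_root root_L2 by blast
  have nu: "L2_norm (\<lambda>x. \<Sum>l\<in>{n, - n}. v l * g l x) = 1"
    unfolding u1(2)[symmetric] by (rule L2_norm_cong_AE[symmetric])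
      (intro L2_measurable uL L2_lincomb g_L2 | rule AE_imp1[OF ae], simp add: comb_def bt)+
  define s where "s = (cmod (v n))\<^sup>2 + (cmod (v (- n)))\<^sup>2"
  have s: "(\<Sum>l\<in>{n, - n}. (cmod (v l))\<^sup>2) = s" using n0 by (simp add: s_def)
  have fin: "finite {n, - n}" by simp
  have lo: "(1 - 1/8) * sqrt s \<le> 1" using G.lower[OF fin, of v] unfolding nu s .
  have up: "1 \<le> (1 + 1/8) * sqrt s" using G.upper[OF fin, of v] unfolding nu s .
  have s0: "s \<ge> 0" by (simp add: s_def)
  have "(8/9)\<^sup>2 \<le> (sqrt s)\<^sup>2" by (rule power_mono) (use up in auto)
  then show "(8/9)\<^sup>2 \<le> (cmod (v n))\<^sup>2 + (cmod (v (- n)))\<^sup>2" using s0 by (simp add: s_def)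
  have "(sqrt s)\<^sup>2 \<le> (8/7)\<^sup>2" by (rule power_mono) (use lo s0 in auto)
  then show "(cmod (v n))\<^sup>2 + (cmod (v (- n)))\<^sup>2 \<le> (8/7)\<^sup>2" using s0 by (simp add: s_def)
qed

text \<open>The two columns of \<open>W\<close> are coordinates of normalised eigenfunctions for
  different eigenvalues, so the determinant bound controls the inverse uniformly in
  \<open>n\<close>.\<close>

lemma tail_bound:
  assumes n: "\<bar>n\<bar> > int N" and sm: "C * C * \<gamma> \<le> 1/100"
    and c: "B (- n) n \<noteq> 0" and bc: "cmod (B n (- n)) \<le> 2 * cmod (B (- n) n)" "cmod (B (- n) n) \<le> 2 * cmod (B n (- n))"
    and lk: "l \<in> {n, - n}" "k \<in> {n, - n}"
  shows "cmod (W l k) \<le> 16" "cmod (W' l k) \<le> 16"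
proof -
  have n0: "n \<noteq> - n" using n by auto
  note bt = blk_tail[OF n]
  have r: "rel N (- n) n" "rel N n n" "rel N (- n) (- n)" "rel N n (- n)" by (simp_all add: rel_def)
  obtain \<zeta>' \<eta>' where Z: "\<zeta>' \<noteq> \<eta>'" "J n = {(\<zeta>', 0), (\<eta>', 0)}" "mlt \<zeta>' = 1" "mlt \<eta>' = 1"
    by (rule tail_simple[OF n sm c bc])
  have \<tau>n: "\<tau> n \<in> J n" "\<tau> (- n) \<in> J n" using \<tau>_J[of n] \<tau>_J[of "- n"] J_cong[OF r(1)] by auto
  have ne: "\<tau> n \<noteq> \<tau> (- n)" using \<tau>(1)[of n] \<tau>(1)[of "- n"] n0 by metis
  obtain \<zeta> where \<zeta>: "\<tau> n = (\<zeta>, 0)" "mlt \<zeta> = 1" using \<tau>n(1) Z by auto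
  obtain \<eta> where \<eta>: "\<tau> (- n) = (\<eta>, 0)" "mlt \<eta> = 1" using \<tau>n(2) Z by auto
  have Wx: "W m n = cv n (\<zeta>, 0) m" and Wy: "W m (- n) = cv n (\<eta>, 0) m" for m
    using cv_cong[OF r(1)] by (simp_all add: W_def \<zeta>(1) \<eta>(1))
  note X = tail_column[OF n \<tau>n(1)[unfolded \<zeta>(1)] \<zeta>(2), folded Wx]
  note Y = tail_column[OF n \<tau>n(2)[unfolded \<eta>(1)] \<eta>(2), folded Wy]
  have det: "3/20 \<le> cmod (W n n * W (- n) (- n) - W (- n) n * W n (- n))"
    by (rule eigenvector_det_bound[OF c bc diagonal_difference[OF n sm bc(1)] X(1,2) Y(1,2) X(3) Y(3)])
      (use ne \<zeta>(1) \<eta>(1) in auto)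
  have small: "cmod s \<le> 8/7" "cmod t \<le> 8/7" if "(cmod s)\<^sup>2 + (cmod t)\<^sup>2 \<le> (8/7)\<^sup>2" for s t
  proof -
    have "(cmod s)\<^sup>2 \<le> (8/7)\<^sup>2" "(cmod t)\<^sup>2 \<le> (8/7)\<^sup>2"
      using that zero_le_power2[of "cmod s"] zero_le_power2[of "cmod t"] by linarith+
    then show "cmod s \<le> 8/7" "cmod t \<le> 8/7" by (auto intro: power2_le_imp_le)
  qed
  note S = small[OF X(4)] small[OF Y(4)]
  have "cmod (W l k) \<le> 8/7" using lk S by auto
  then show "cmod (W l k) \<le> 16" by simp
  have rl: "rel N l n" "rel N l (- n)" using lk(1) r by auto
  have e: "W' l n * W n n + W' l (- n) * W (- n) n = (if l = n then 1 else 0)"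
    "W' l n * W n (- n) + W' l (- n) * W (- n) (- n) = (if l = - n then 1 else 0)"
    using W'W[OF rl(1)] W'W[OF rl(2)] n0 bt blk_eq[OF r(1)] by simp_all
  have "cmod (W' l n) \<le> 16" "cmod (W' l (- n)) \<le> 16"
    by (rule inverse_entry_bound[OF det e _ _ S]; simp)+
  then show "cmod (W' l k) \<le> 16" using lk(2) by auto
qed

text \<open>Only finitely many entries belong to the central block, and a maximum bounds them; the
  hypotheses make the bound of the tail blocks uniform.\<close>

theorem riesz_basis_of_tail:
  assumes sm: "C * C * \<gamma> \<le> 1/100"
    and c: "\<And>n. \<bar>n\<bar> > int N \<Longrightarrow> B (- n) n \<noteq> 0"
    and bc: "\<And>n. \<bar>n\<bar> > int N \<Longrightarrow> cmod (B n (- n)) \<le> 2 * cmod (B (- n) n)"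
  shows "L2_Riesz_basis (SL_index q) u"
proof -
  define S where "S = (\<lambda>(l,k). cmod (W l k) + cmod (W' l k)) ` (blk N 0 \<times> blk N 0)"
  have S: "finite S" by (simp add: S_def)
  define R where "R = 16 + Max S"
  have "Max S \<in> S" by (rule Max_in[OF S]) (use blk_self[of 0 N] in \<open>auto simp: S_def simp del: blk_self\<close>)
  then have M0: "Max S \<ge> 0" by (auto simp: S_def)
  have "cmod (W l k) \<le> R \<and> cmod (W' l k) \<le> R" for l k
  proof (cases "rel N l k")
    case False
    then show ?thesis using M0 by (simp add: W_block W'_block R_def)
  next
    case r: True
    show ?thesis
    proof (cases "\<bar>k\<bar> > int N")
      case True
      then have lk: "l \<in> {k, - k}" using r by (auto simp: rel_def)
      \<comment> \<open>The comparison is needed in both directions; the second one is the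
        hypothesis at \<open>- k\<close>.\<close>
      have bc2: "cmod (B (- k) k) \<le> 2 * cmod (B k (- k))" using bc[of "- k"] True by simp
      show ?thesis using tail_bound[OF True sm c[OF True] bc[OF True] bc2 lk, of k] M0 by (simp add: R_def)
    next
      case False
      then have "l \<in> blk N 0" "k \<in> blk N 0" using r by (auto simp: blk_def rel_def)
      then have "cmod (W l k) + cmod (W' l k) \<le> Max S" by (intro Max_ge[OF S]) (auto simp: S_def)
      then have "cmod (W l k) \<le> Max S" "cmod (W' l k) \<le> Max S"
        using norm_ge_zero[of "W l k"] norm_ge_zero[of "W' l k"] by linarith+
      then show ?thesis by (simp add: R_def)
    qed
  qed
  then show ?thesis using M0 by (intro riesz_of_bounds[of R]) (auto simp: R_def)
qed

end

section \<open>Asymptotics of the Fourier coefficients\<close>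

text \<open>The decay of the Fourier coefficients when the first jump occurs in the derivative of
  order \<open>r - 1\<close>. Adding \<open>1\<close> to the modulus makes the weight
  submultiplicative and defined at \<open>0\<close>.\<close>

definition wt :: "nat \<Rightarrow> int \<Rightarrow> real" where "wt r k = 1 / (1 + of_int \<bar>k\<bar>) ^ r"

lemma wt_pos: "wt r k > 0" and wt_le_1: "wt r k \<le> 1" and wt_minus: "wt r (- k) = wt r k"
  by (simp_all add: wt_def)

lemma wt_mult: "wt r a * wt r b \<le> wt r (a + b)"
proof -
  have "(1 + real_of_int \<bar>a + b\<bar>) ^ r \<le> ((1 + of_int \<bar>a\<bar>) * (1 + of_int \<bar>b\<bar>)) ^ r"
  proof (rule power_mono)
    have "\<bar>a + b\<bar> \<le> \<bar>a\<bar> + \<bar>b\<bar> + \<bar>a\<bar> * \<bar>b\<bar>" using abs_triangle_ineq[of a b] by (simp add: add_increasing2)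
    then have "real_of_int \<bar>a + b\<bar> \<le> of_int (\<bar>a\<bar> + \<bar>b\<bar> + \<bar>a\<bar> * \<bar>b\<bar>)" by (simp only: of_int_le_iff)
    then show "1 + real_of_int \<bar>a + b\<bar> \<le> (1 + of_int \<bar>a\<bar>) * (1 + of_int \<bar>b\<bar>)" by (simp add: algebra_simps)
  qed simp
  then show ?thesis unfolding wt_def power_mult_distrib times_divide_times_eq mult_1 
    by (intro divide_left_mono mult_pos_pos zero_less_power) auto
qed

lemma wt_small: "r \<ge> 1 \<Longrightarrow> wt r k \<le> 1 / (1 + of_int \<bar>k\<bar>)"
  unfolding wt_def by (intro divide_left_mono self_le_power) auto

lemma wt_ge: "k \<noteq> 0 \<Longrightarrow> 1 / (2 * pi * of_int \<bar>k\<bar>) ^ r \<le> wt r k"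
proof -
  assume "k \<noteq> 0"
  then have k: "1 \<le> real_of_int \<bar>k\<bar>" by linarith
  have "2 * real_of_int \<bar>k\<bar> \<le> 2 * pi * of_int \<bar>k\<bar>" using pi_ge_two k by (intro mult_right_mono) auto
  then have "(1 + real_of_int \<bar>k\<bar>) ^ r \<le> (2 * pi * of_int \<bar>k\<bar>) ^ r" using k by (intro power_mono) linarith+
  then show ?thesis unfolding wt_def using k by (intro divide_left_mono mult_pos_pos zero_less_power) auto
qed

lemma wt_le: "k \<noteq> 0 \<Longrightarrow> wt r k / (2 * pi) ^ r \<le> 1 / (2 * pi * of_int \<bar>k\<bar>) ^ r"
proof -
  assume k: "k \<noteq> 0"
  have "(2 * pi * of_int \<bar>k\<bar>) ^ r \<le> (2 * pi * (1 + of_int \<bar>k\<bar>)) ^ r" by (intro power_mono) auto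
  then have "1 / (2 * pi * (1 + of_int \<bar>k\<bar>)) ^ r \<le> 1 / (2 * pi * of_int \<bar>k\<bar>) ^ r"
    using k by (intro divide_left_mono mult_pos_pos zero_less_power) auto
  then show ?thesis by (simp add: wt_def power_mult_distrib mult.commute)
qed

text \<open>With \<open>m\<close> the lowest order at which a jump occurs, \<open>m + 1\<close>
  integrations by parts leave this jump and a coefficient that tends to zero; the latter is
  eventually below a tenth of the jump.\<close>

lemma fourier_coefficient_asymptotics:
  assumes W: "sobolev_W1 p q" and s: "s < p" and ne: "(deriv01 ^^ s) q 0 \<noteq> (deriv01 ^^ s) q 1"
  obtains r \<eta> N where "r \<ge> 1" "\<eta> > 0"
    "\<forall>k. \<bar>k\<bar> > int N \<longrightarrow> 9/10 * (\<eta> / (2 * pi * of_int \<bar>k\<bar>) ^ r) \<le> cmod (fc q k) \<and>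
      cmod (fc q k) \<le> 11/10 * (\<eta> / (2 * pi * of_int \<bar>k\<bar>) ^ r)"
proof -
  define m where "m = (LEAST s. (deriv01 ^^ s) q 0 \<noteq> (deriv01 ^^ s) q 1)"
  have m: "(deriv01 ^^ m) q 0 \<noteq> (deriv01 ^^ m) q 1" unfolding m_def by (rule LeastI) (rule ne)
  have per: "(deriv01 ^^ l) q 1 = (deriv01 ^^ l) q 0" if "l < m" for l
    using not_less_Least[OF that[unfolded m_def]] by simp
  have "m \<le> s" unfolding m_def by (rule Least_le) (rule ne)
  then have mp: "m < p" using s by simp
  have ac: "abs_cont ((deriv01 ^^ l) q)" if "l < p" for l using W that by (simp add: sobolev_W1_def derivs_abs_cont_def)
  have int: "integrable \<mu> ((deriv01 ^^ Suc m) q)"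
  proof (cases "Suc m = p")
    case True
    then show ?thesis using W unfolding sobolev_W1_def by blast
  next
    case False
    then have "abs_cont ((deriv01 ^^ Suc m) q)" using mp by (intro ac) simp
    then show ?thesis by (intro continuous_integrable_mu abs_cont_continuous)
  qed
  define \<delta> where "\<delta> = (deriv01 ^^ m) q 1 - (deriv01 ^^ m) q 0"
  have \<delta>: "cmod \<delta> > 0" using m by (simp add: \<delta>_def)
  obtain N where N: "\<And>k. \<bar>k\<bar> > int N \<Longrightarrow> cmod (fc ((deriv01 ^^ Suc m) q) k) < cmod \<delta> / 10"
    using riemann_lebesgue[OF int, of "cmod \<delta> / 10"] \<delta> by auto
  show thesis
  proof (rule that[of "Suc m" "cmod \<delta>" N], safe)
    fix k :: int assume k: "\<bar>k\<bar> > int N"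
    let ?a = "(2 * pi * of_int \<bar>k\<bar>) ^ Suc m :: real"
    have a: "?a > 0" using k by (intro zero_less_power) auto
    have "(2 * pi * \<i> * of_int k) ^ Suc m * fc q k = fc ((deriv01 ^^ Suc m) q) k - \<delta>"
      unfolding \<delta>_def by (rule fourier_jump) (use ac mp per int in auto)
    moreover have "cmod ((2 * pi * \<i> * of_int k) ^ Suc m) = ?a"
      by (simp only: norm_power norm_mult norm_of_int norm_of_real norm_ii) simp
    ultimately have e: "?a * cmod (fc q k) = cmod (fc ((deriv01 ^^ Suc m) q) k - \<delta>)" by (metis norm_mult)
    have "?a * cmod (fc q k) \<le> 11/10 * cmod \<delta>" "9/10 * cmod \<delta> \<le> ?a * cmod (fc q k)"
      unfolding e using N[OF k] norm_triangle_ineq4[of "fc ((deriv01 ^^ Suc m) q) k" \<delta>]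
        norm_triangle_ineq2[of \<delta> "fc ((deriv01 ^^ Suc m) q) k"] norm_minus_commute[of \<delta> "fc ((deriv01 ^^ Suc m) q) k"] by linarith+
    then show "9/10 * (cmod \<delta> / ?a) \<le> cmod (fc q k)" "cmod (fc q k) \<le> 11/10 * (cmod \<delta> / ?a)"
      using a by (simp_all add: field_simps)
  qed (use \<delta> in auto)
qed

lemma large_parameter:
  fixes C \<epsilon> :: real
  assumes C: "C > 0" and e: "\<epsilon> > 0"
  obtains N where "N > N0" "N > 0" "C * (Z32 / sqrt (real N)) \<le> 1/8"
    "2 * (2 * C * (2 + sqrt (2 * real N) * Z32)) < 4 * real N" "C * C * (Z32 / sqrt (real N)) \<le> \<epsilon>"
proof -
  \<comment> \<open>The summands collect the lower bounds on \<open>sqrt N\<close> that the separate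
    requirements ask for; \<open>N\<close> is then taken beyond the square of
    \<open>X\<close>.\<close>
  define X where "X = 1 + 8 * C * Z32 + (2 * C + 2 * C * Z32) + C * C * Z32 / \<epsilon>"
  have nn: "0 \<le> C * Z32" "0 \<le> C * C * Z32 / \<epsilon>" using C e Z32_nonneg by simp_all
  have X: "X \<ge> 1" "8 * C * Z32 \<le> X" "C * C * Z32 / \<epsilon> \<le> X" "1 + 2 * C + 2 * C * Z32 \<le> X"
    using nn C by (simp_all add: X_def)
  define N where "N = Suc N0 + nat \<lceil>X\<^sup>2\<rceil>"
  have "X\<^sup>2 \<le> real N" unfolding N_def by simp linarith
  then have x: "X \<le> sqrt (real N)" using real_le_rsqrt by blast
  then have x0: "sqrt (real N) > 0" using X(1) by linarith
  show thesis
  proof (rule that[of N])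
    show "C * (Z32 / sqrt (real N)) \<le> 1/8" using X(2) x x0 by (simp add: divide_le_eq)
    have "C * C * Z32 / \<epsilon> \<le> sqrt (real N)" using X(3) x by linarith
    then have "C * C * Z32 \<le> \<epsilon> * sqrt (real N)" using e by (simp add: divide_le_eq mult.commute)
    then show "C * C * (Z32 / sqrt (real N)) \<le> \<epsilon>" using x0 by (simp add: divide_le_eq)
    let ?x = "sqrt (real N)"
    have "sqrt 2 \<le> sqrt (2\<^sup>2)" by (intro real_sqrt_le_mono) simp
    then have "sqrt (2 * real N) \<le> 2 * ?x" unfolding real_sqrt_mult by (intro mult_right_mono) auto
    then have "C * (2 + sqrt (2 * real N) * Z32) \<le> C * (2 + 2 * ?x * Z32)"
      using C Z32_nonneg by (intro mult_left_mono add_left_mono mult_right_mono) auto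
    also have "\<dots> = (2 * C) * 1 + (2 * C * Z32) * ?x" by (simp add: algebra_simps)
    also have "\<dots> \<le> (2 * C) * ?x + (2 * C * Z32) * ?x"
      by (intro add_right_mono mult_left_mono order.trans[OF X(1) x]) (use C in simp)
    also have "\<dots> < (1 + 2 * C + 2 * C * Z32) * ?x" using x0 by (simp add: algebra_simps)
    also have "\<dots> \<le> ?x * ?x" using X(4) x x0 by (intro mult_right_mono) auto
    finally show "2 * (2 * C * (2 + sqrt (2 * real N) * Z32)) < 4 * real N" by simp
  qed (simp_all add: N_def)
qed

theorem corollary2:
  fixes q :: "real \<Rightarrow> complex" and p s :: nat
    and u :: "complex \<times> nat \<Rightarrow> real \<Rightarrow> complex"
  assumes "p \<ge> 1"
    and "sobolev_W1 p q"
    and "(LINT x|lebesgue_on {0..1}. q x) = 0"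
    and "s \<le> p - 1"
    and "(deriv01 ^^ s) q 0 \<noteq> (deriv01 ^^ s) q 1"
    and "\<And>\<zeta>. SL_eigenvalue q \<zeta> \<Longrightarrow> SL_alg_mult q \<zeta> \<le> 2"
    and "SL_normal_system q u"
  shows "L2_Riesz_basis (SL_index q) u"
proof -
  have sp: "s < p" using assms(1,4) by simp
  obtain r \<eta> N1 where r: "r \<ge> 1" and \<eta>: "\<eta> > 0" and
    as': "\<forall>k. \<bar>k\<bar> > int N1 \<longrightarrow> 9/10 * (\<eta> / (2 * pi * of_int \<bar>k\<bar>) ^ r) \<le> cmod (fc q k) \<and>
      cmod (fc q k) \<le> 11/10 * (\<eta> / (2 * pi * of_int \<bar>k\<bar>) ^ r)"
    by (rule fourier_coefficient_asymptotics[OF assms(2) sp assms(5)])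
  note as = as'[rule_format]
  have "\<forall>l<p. abs_cont ((deriv01 ^^ l) q)" using assms(2) unfolding sobolev_W1_def derivs_abs_cont_def by blast
  then have "abs_cont ((deriv01 ^^ 0) q)" using assms(1) by fastforce
  then have qc: "continuous_on {0..1} q" by (simp add: abs_cont_continuous)
  have qL: "q \<in> L2" by (rule L2_continuous[OF qc])
  have n0: "L2_norm q \<ge> 0" by (simp add: L2_norm_def)
  \<comment> \<open>The first term serves the frequencies where the asymptotics hold, the second one
    the finitely many others, through the trivial bound by \<open>L2_norm q\<close>.\<close>
  define C where "C = 11/10 * \<eta> + L2_norm q * (1 + real N1) ^ r"
  have C: "C > 0" unfolding C_def using \<eta> n0 by (intro add_pos_nonneg) auto
  have bd: "cmod (fc q k) \<le> C * wt r k" for k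
  proof (cases "\<bar>k\<bar> > int N1")
    case True
    then have k0: "k \<noteq> 0" by auto
    have "cmod (fc q k) \<le> 11/10 * \<eta> * (1 / (2 * pi * of_int \<bar>k\<bar>) ^ r)" using as[OF True] by simp
    also have "\<dots> \<le> 11/10 * \<eta> * wt r k" by (rule mult_left_mono[OF wt_ge[OF k0]]) (use \<eta> in simp)
    also have "\<dots> \<le> C * wt r k" by (rule mult_right_mono) (use n0 wt_pos[of r k] in \<open>auto simp: C_def\<close>)
    finally show ?thesis .
  next
    case False
    have "1 \<le> (1 + real N1) ^ r * wt r k"
      unfolding wt_def using False by (simp add: power_mono)
    then have "L2_norm q * 1 \<le> L2_norm q * ((1 + real N1) ^ r * wt r k)" by (rule mult_left_mono) (rule n0)
    also have "\<dots> \<le> C * wt r k" unfolding mult.assoc[symmetric]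
      by (rule mult_right_mono) (use \<eta> wt_pos[of r k] in \<open>auto simp: C_def\<close>)
    finally show ?thesis using fc_bound[OF qL, of k] by simp
  qed
  \<comment> \<open>The bound \<open>1/100\<close> keeps the Gram matrix close to that of the
    exponentials, as \<open>diagonal_difference\<close> requires; the other one makes the correction
    in \<open>B_asymp\<close> at most a tenth of the leading term.\<close>
  define \<epsilon> where "\<epsilon> = min (1/100) (\<eta> / (2 * pi) ^ r / 10)"
  have \<epsilon>: "\<epsilon> > 0" using \<eta> by (simp add: \<epsilon>_def)
  obtain N where large: "N > N1" "N > 0" "C * (Z32 / sqrt (real N)) \<le> 1/8"
    "2 * (2 * C * (2 + sqrt (2 * real N) * Z32)) < 4 * real N" "C * C * (Z32 / sqrt (real N)) \<le> \<epsilon>"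
    by (rule large_parameter[OF C \<epsilon>, of N1])
  interpret sl_normal q "wt r" C N u
    by unfold_locales (use wt_pos wt_le_1 wt_mult bd C large qc wt_small[OF r] assms(6,7) in auto)
  \<comment> \<open>One tenth is lost in the Fourier asymptotics and one tenth in the correction, so
    two such entries have a ratio of at most \<open>3/2\<close>, within the admissible factor
    \<open>2\<close>.\<close>
  have B: "8/10 * t \<le> cmod (B n (- n)) \<and> cmod (B n (- n)) \<le> 12/10 * t"
    if n: "\<bar>n\<bar> > int N" and t: "t = \<eta> / (2 * pi * of_int \<bar>2 * n\<bar>) ^ r" for n t
  proof -
    have "2 * n \<noteq> 0" and big: "\<bar>2 * n\<bar> > int N1" using n large(1) by auto
    have "cmod (B n (- n) - fc q (2 * n)) \<le> C * C * wt r (2 * n) * infsum (\<lambda>i. gapinv N i (- n)) UNIV"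
      using B_asymp[of n "- n"] by (simp add: rel_def)
    also have "\<dots> \<le> C * C * wt r (2 * n) * \<gamma>"
      by (rule mult_left_mono[OF gapinv_sum_N[OF large(2)]]) (use C wt_pos[of r "2 * n"] in simp)
    also have "\<dots> = C * C * \<gamma> * wt r (2 * n)" by simp
    also have "\<dots> \<le> \<eta> / (2 * pi) ^ r / 10 * wt r (2 * n)"
      by (rule mult_right_mono[OF order.trans[OF large(5)]]) (use wt_pos[of r "2 * n"] in \<open>auto simp: \<epsilon>_def\<close>)
    also have "\<dots> = \<eta> / 10 * (wt r (2 * n) / (2 * pi) ^ r)" by simp
    also have "\<dots> \<le> \<eta> / 10 * (1 / (2 * pi * of_int \<bar>2 * n\<bar>) ^ r)"
      by (rule mult_left_mono[OF wt_le[OF \<open>2 * n \<noteq> 0\<close>]]) (use \<eta> in simp)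
    also have "\<dots> = t / 10" by (simp add: t)
    finally have "cmod (B n (- n) - fc q (2 * n)) \<le> t / 10" .
    moreover have "9/10 * t \<le> cmod (fc q (2 * n))" "cmod (fc q (2 * n)) \<le> 11/10 * t" using as[OF big] by (auto simp: t)
    ultimately show ?thesis
      using norm_triangle_ineq2[of "B n (- n)" "fc q (2 * n)"] norm_triangle_ineq2[of "fc q (2 * n)" "B n (- n)"]
        norm_minus_commute[of "B n (- n)" "fc q (2 * n)"] by linarith
  qed
  have BB: "B (- n) n \<noteq> 0 \<and> cmod (B n (- n)) \<le> 2 * cmod (B (- n) n)" if n: "\<bar>n\<bar> > int N" for n
  proof -
    define t where "t = \<eta> / (2 * pi * of_int \<bar>2 * n\<bar>) ^ r"
    have t0: "t > 0" unfolding t_def by (intro divide_pos_pos \<eta> zero_less_power mult_pos_pos) (use n in auto)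
    have "8/10 * t \<le> cmod (B (- n) n)" "cmod (B n (- n)) \<le> 12/10 * t"
      using B[OF n t_def] B[of "- n" t] n by (simp_all add: t_def)
    then show ?thesis using t0 by auto
  qed
  show ?thesis by (rule riesz_basis_of_tail) (use BB large(5) in \<open>auto simp: \<epsilon>_def\<close>)
qed

end
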